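(* Let $(k,n,A,L)$ be a type. (i) The set of $k$-proportionality classes of Jacobi matrices of type $(k,n,A,L)$ forms a projective algebraic variety over $k$. (ii) The abstract Abel map takes values in the set of Jacobi matrices of type $(k,n,A,L)$. (iii) The abstract Abel map puts the $k$-equivalence classes of Segre matrices of type $(k,n,A,L)$ into bijective correspondence with the $k$-proportionality classes of Jacobi matrices of type $(k,n,A,L)$.
   Context: A type $(k,n,A,L)$ consists of an algebraically closed field $k$, an integer $n\geq2$, a finitely generated commutative $k$-algebra $A$ with unit and without zero divisors, and a finite-dimensional $k$-subspace $L\subset A$. All rings are commutative with unit. Matrix terminology: a matrix with entries in a $k$-algebra is of rank $\leq 1$ if every $2\times 2$ submatrix has zero determinant; it is $k$-general if some row has $k$-linearly independent entries and some column has $k$-linearly independent entries. Matrices $X,Y$ are $k$-equivalent if $Y=\Phi X\Psi$ with $\Phi,\Psi$ square matrices over $k$ of nonzero determinant; vectors are $k$-proportional if one is a nonzero scalar multiple of the other. A Segre matrix (of type $(k,n,A,L)$) is an $n\times n$ matrix with entries in $L$ of rank $\leq1$ that is $k$-general. Abeliant: for an $n\times n$ matrix $X$ over a ring $R$, $X^\star$ is its adjugate. For $n\times n$ matrices $X^{(0)},\dots,X^{(n+1)}$ over $R$, $\mathrm{abel}_{\ell=0}^{n+1}X^{(\ell)}=\mathrm{abel}(X^{(0)},\dots,X^{(n+1)})$ is the $n\times n$ matrix whose $(i,j)$ entry is the coefficient of $s_1\cdots\widehat{s_i}\cdots s_nt_1\cdots\widehat{t_j}\cdots t_n$ in $\mathrm{trace}\big(X^{(0)}(\sum_{b=1}^n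 t_bX^{(b)})^\star X^{(n+1)}(\sum_{a=1}^n s_aX^{(a)})^\star\big)\in R[s_1,\dots,s_n,t_1,\dots,t_n]$. Tensor formalism: $A^{\otimes\mathbb{Z}}$ is the tensor product over $k$ of copies of $A$ indexed by $\mathbb{Z}$ (generated by $\bigotimes_i a_i$ with $a_i=1$ for almost all $i$); it has no zero divisors. $a^{(\ell)}$ is the pure tensor with $a\in A$ in slot $\ell$ and $1$ elsewhere; $X^{(\ell)}$ is defined entrywise for matrices over $A$; $V^{(\ell)}=\{a^{(\ell)}:a\in V\}$ for $V\subseteq A$; $A^{\otimes I}$ is the subalgebra generated by $a^{(\ell)}$, $\ell\in I$; we identify $a=a^{(0)}$. A derangement is any map $\sigma:\mathbb{Z}\to\mathbb{Z}$ (support $\{\ell:\sigma\ell\neq\ell\}$); $\sigma_*$ is the $k$-algebra endomorphism with $\sigma_*(a^{(\ell)})=a^{(\sigma\ell)}$, applied entrywise. $\langle i\mid j\rangle$ is the transposition of distinct $i,j$; $[i\mapsto j]$ sends $i$ to $j$ and fixes all else. The bar operation is the automorphism with $\overline{a^{(\ell)}}=a^{(-\ell)}$, applied entrywise. Abstract Abel map: a Segre matrix $X\mapsto \mathrm{abel}_{\ell=0}^{n+1}X^{(\ell)}$ (entries in $A^{\otimes\{0,\dots,n+1\}}$). Jacobi matrix (of type $(k,n,A,L)$): an $n\times n$ matrix $Z$ with entries in $A^{\otimes\{0,\dots,n+1\}}$ such that $Z\neq0$; $Z_{12}$ lies in the $k$-span of $L\cdot L^{(1)}\cdot L^{(2)}\cdot(L^{(3)})^2\cdots(L^{(n)})^2\cdot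 L^{(n+1)}$; $Z_{11}=[1\mapsto2]_*Z_{12}$; $\pi_*Z_{ij}=Z_{\pi i,\pi j}$ for every bijective derangement $\pi$ supported in $\{1,\dots,n\}$; $Z_{11}Z_{22}-Z_{12}Z_{21}=0$; and $\mathrm{abel}_{\ell=0}^{n+1}[0\mapsto-\ell]_*Z=\Delta\cdot\overline{Z}$ where $\Delta=\langle2\mid n+1\rangle_*\langle0\mid1\rangle_*Z_{11}\cdot\langle0\mid1\rangle_*Z_{11}\cdot\langle0\mid2\rangle_*Z_{22}\cdot\prod_{\ell=3}^n(\langle0\mid\ell\rangle_*Z_{\ell\ell})^2$. *)

theory Defs
  imports
    "Jordan_Normal_Form.Determinant"
    "HOL-Library.Poly_Mapping"
    "HOL-Library.Set_Algebras"
    "HOL-Combinatorics.Permutations"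
begin

section \<open>Domains over an algebraically closed field\<close>

text \<open>
  A commutative algebra without zero divisors over an algebraically closed field \<open>k\<close> is an
  integral domain type with a distinguished algebraically closed subfield, the image of \<open>k\<close>
  (the structure map \<open>k \<rightarrow> A\<close> is injective because \<open>A\<close> is not the zero ring).  The field \<open>k\<close>
  itself is the type \<open>'a base\<close> below, and \<open>of_base\<close> is the structure map.
\<close>

class k_domain = idom +
  fixes base_field :: "'a set"
  assumes base_field_1: "1 \<in> base_field"
    and base_field_diff: "x \<in> base_field \<Longrightarrow> y \<in> base_field \<Longrightarrow> x - y \<in> base_field"
    and base_field_mult: "x \<in> base_field \<Longrightarrow> y \<in> base_field \<Longrightarrow> x * y \<in> base_field"
    and base_field_inverse: "x \<in> base_field \<Longrightarrow> x \<noteq> 0 \<Longrightarrow> \<exists>y\<in>base_field. x * y = 1"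
    and base_field_alg_closed:
      "n > 0 \<Longrightarrow> (\<And>i. f i \<in> base_field) \<Longrightarrow> f n \<noteq> 0
        \<Longrightarrow> \<exists>x\<in>base_field. (\<Sum>i\<le>n. f i * x ^ i) = 0"
begin

lemma base_field_0: "0 \<in> base_field"
  using base_field_diff[OF base_field_1 base_field_1] by simp

lemma base_field_uminus: "x \<in> base_field \<Longrightarrow> - x \<in> base_field"
  using base_field_diff[OF base_field_0, of x] by simp

lemma base_field_add: "x \<in> base_field \<Longrightarrow> y \<in> base_field \<Longrightarrow> x + y \<in> base_field"
  using base_field_diff[of x "- y"] base_field_uminus[of y] by simp

end

typedef (overloaded) 'a base = "base_field :: 'a::k_domain set"
  morphisms of_base to_base
  using base_field_1 by blast

setup_lifting type_definition_base

instantiation base :: (k_domain) field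
begin

lift_definition zero_base :: "'a base" is 0 by (rule base_field_0)
lift_definition one_base :: "'a base" is 1 by (rule base_field_1)
lift_definition plus_base :: "'a base \<Rightarrow> 'a base \<Rightarrow> 'a base" is "(+)" by (rule base_field_add)
lift_definition minus_base :: "'a base \<Rightarrow> 'a base \<Rightarrow> 'a base" is "(-)" by (rule base_field_diff)
lift_definition uminus_base :: "'a base \<Rightarrow> 'a base" is uminus by (rule base_field_uminus)
lift_definition times_base :: "'a base \<Rightarrow> 'a base \<Rightarrow> 'a base" is "(*)" by (rule base_field_mult)

definition inverse_base_def:
  "inverse (x :: 'a base) = (if x = 0 then 0 else SOME y. x * y = 1)"

definition divide_base_def: "(x :: 'a base) div y = x * inverse y"

instance
proof
  fix x y z :: "'a base"
  show "x + y + z = x + (y + z)" by transfer (simp add: algebra_simps)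
  show "x + y = y + x" by transfer (simp add: algebra_simps)
  show "0 + x = x" by transfer simp
  show "- x + x = 0" by transfer simp
  show "x - y = x + - y" by transfer simp
  show "x * y * z = x * (y * z)" by transfer (simp add: algebra_simps)
  show "x * y = y * x" by transfer (simp add: algebra_simps)
  show "1 * x = x" by transfer simp
  show "(x + y) * z = x * z + y * z" by transfer (simp add: algebra_simps)
  show "(0::'a base) \<noteq> 1" by transfer simp
  show "inverse (0::'a base) = 0" by (simp add: inverse_base_def)
  show "x div y = x * inverse y" by (rule divide_base_def)
  have *: "x * y = y * x" for x y :: "'a base" by transfer (simp add: algebra_simps)
  assume nz: "x \<noteq> 0"
  then have "\<exists>y. x * y = 1"
    by transfer (use base_field_inverse in blast)
  then have "x * inverse x = 1"
    using nz unfolding inverse_base_def by (auto intro: someI_ex)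
  then show "inverse x * x = 1" by (simp only: *)
qed

end

lemma of_base_simps [simp]:
  "of_base 0 = 0" "of_base 1 = 1" "of_base (x + y) = of_base x + of_base y"
  "of_base (x - y) = of_base x - of_base y" "of_base (- x) = - of_base x"
  "of_base (x * y) = of_base x * of_base y"
  by (transfer, rule refl)+

lemma of_base_eq_iff [simp]: "of_base x = of_base y \<longleftrightarrow> x = y"
  by (rule of_base_inject)

lemma of_base_power [simp]: "of_base (x ^ n) = of_base x ^ n"
  by (induction n) simp_all

lemma of_base_sum [simp]: "of_base (sum f S) = (\<Sum>x\<in>S. of_base (f x))"
  by (induction S rule: infinite_finite_induct) simp_all

instance base :: (k_domain) alg_closed_field
proof intro_classes
  fix n :: nat and f :: "nat \<Rightarrow> 'a::k_domain base"
  assume "n > 0" "f n \<noteq> 0"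
  then have "\<exists>x\<in>base_field. (\<Sum>i\<le>n. of_base (f i) * x ^ i) = 0"
    using of_base_eq_iff[of "f n" 0]
    by (intro base_field_alg_closed) (auto simp: of_base simp del: of_base_eq_iff)
  then obtain x where x: "x \<in> base_field" "(\<Sum>i\<le>n. of_base (f i) * x ^ i) = 0" by blast
  define y where "y = to_base x"
  have y: "of_base y = x" using x(1) by (simp add: y_def to_base_inverse)
  have "of_base (\<Sum>i\<le>n. f i * y ^ i) = of_base 0" using x(2) by (simp add: y)
  then have "(\<Sum>i\<le>n. f i * y ^ i) = 0" by (simp only: of_base_eq_iff)
  then show "\<exists>x. (\<Sum>k\<le>n. f k * x ^ k) = 0" by blast
qed

abbreviation base_scale :: "'a::k_domain base \<Rightarrow> 'a \<Rightarrow> 'a"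
  where "base_scale c a \<equiv> of_base c * a"

lemma vector_space_base_scale: "vector_space (base_scale :: 'a::k_domain base \<Rightarrow> 'a \<Rightarrow> 'a)"
  by standard (simp_all add: algebra_simps)


section \<open>The tensor power of \<open>A\<close> indexed by the integers\<close>

text \<open>
  The index monoid: families \<open>(a\<^sub>i)\<close> in \<open>A\<close> with \<open>a\<^sub>i = 1\<close> for almost all \<open>i\<close>, multiplied
  componentwise.  The monoid operation is written additively only because the product on
  \<open>_ \<Rightarrow>\<^sub>0 _\<close> is convolution with respect to \<open>+\<close>.
\<close>

typedef (overloaded) 'a family = "{f :: int \<Rightarrow> 'a::comm_monoid_mult. finite {i. f i \<noteq> 1}}"
  morphisms component Family
  by (rule exI[of _ "\<lambda>_. 1"]) simp

setup_lifting type_definition_family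

instantiation family :: (comm_monoid_mult) comm_monoid_add
begin

lift_definition zero_family :: "'a family" is "\<lambda>_. 1" by simp

lift_definition plus_family :: "'a family \<Rightarrow> 'a family \<Rightarrow> 'a family" is "\<lambda>f g i. f i * g i"
proof -
  fix f g :: "int \<Rightarrow> 'a"
  assume "finite {i. f i \<noteq> 1}" "finite {i. g i \<noteq> 1}"
  then have "finite ({i. f i \<noteq> 1} \<union> {i. g i \<noteq> 1})" by simp
  then show "finite {i. f i * g i \<noteq> 1}" by (rule rev_finite_subset) auto
qed

instance
  by standard (transfer; simp add: fun_eq_iff mult_ac)+

end

lift_definition family_upd :: "'a::comm_monoid_mult family \<Rightarrow> int \<Rightarrow> 'a \<Rightarrow> 'a family"
  is "\<lambda>f i a. f(i := a)"
proof -
  fix f :: "int \<Rightarrow> 'a" and i a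
  assume "finite {j. f j \<noteq> 1}"
  then have "finite (insert i {j. f j \<noteq> 1})" by simp
  then show "finite {j. (f(i := a)) j \<noteq> 1}" by (rule rev_finite_subset) auto
qed

text \<open>
  The monoid algebra over \<open>k\<close> of the families, modulo the relations saying that the class of
  \<open>(a\<^sub>i)\<close> is \<open>k\<close>-linear in each component.
\<close>

inductive_set tensor_relations :: "('a::k_domain family \<Rightarrow>\<^sub>0 'a base) set" where
  zero: "0 \<in> tensor_relations"
| add: "x \<in> tensor_relations \<Longrightarrow> y \<in> tensor_relations \<Longrightarrow> x + y \<in> tensor_relations"
| mult: "x \<in> tensor_relations \<Longrightarrow> r * x \<in> tensor_relations"
| additive: "Poly_Mapping.single (family_upd f i (a + b)) 1
    - Poly_Mapping.single (family_upd f i a) 1 - Poly_Mapping.single (family_upd f i b) 1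
    \<in> tensor_relations"
| homogeneous: "Poly_Mapping.single (family_upd f i (base_scale c a)) 1
    - Poly_Mapping.single (family_upd f i a) c \<in> tensor_relations"

definition tensor_rel ::
    "('a::k_domain family \<Rightarrow>\<^sub>0 'a base) \<Rightarrow> ('a family \<Rightarrow>\<^sub>0 'a base) \<Rightarrow> bool"
  where "tensor_rel x y \<longleftrightarrow> x - y \<in> tensor_relations"

lemma tensor_relations_uminus: "x \<in> tensor_relations \<Longrightarrow> - x \<in> tensor_relations"
  using tensor_relations.mult[of x "- 1"] by simp

lemma equivp_tensor_rel:
  "equivp (tensor_rel :: ('a::k_domain family \<Rightarrow>\<^sub>0 'a base) \<Rightarrow> _ \<Rightarrow> _)" (is "equivp ?R")
proof (rule equivpI)
  show "reflp ?R"
    by (rule reflpI) (simp add: tensor_rel_def tensor_relations.zero)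
  show "symp ?R"
    by (rule sympI) (use tensor_relations_uminus in \<open>force simp: tensor_rel_def\<close>)
  show "transp ?R"
  proof (rule transpI)
    fix x y z :: "'a family \<Rightarrow>\<^sub>0 'a base"
    assume "tensor_rel x y" "tensor_rel y z"
    then have "(x - y) + (y - z) \<in> tensor_relations"
      unfolding tensor_rel_def by (rule tensor_relations.add)
    then show "tensor_rel x z" by (simp add: tensor_rel_def)
  qed
qed

quotient_type (overloaded) 'a tensor_power = "'a::k_domain family \<Rightarrow>\<^sub>0 'a base" / tensor_rel
  by (rule equivp_tensor_rel)


text \<open>
  A family \<open>h\<^sub>\<ell>\<close> of \<open>k\<close>-algebra homomorphisms from \<open>A\<close> to a commutative ring; the common
  restriction of the \<open>h\<^sub>\<ell>\<close> to \<open>k\<close> is the \<open>k\<close>-algebra structure of the target.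
\<close>

definition alg_hom_family :: "(int \<Rightarrow> 'a::k_domain \<Rightarrow> 'r::comm_ring_1) \<Rightarrow> bool"
  where "alg_hom_family h \<longleftrightarrow>
    (\<forall>i a b. h i (a + b) = h i a + h i b) \<and> (\<forall>i a b. h i (a * b) = h i a * h i b) \<and>
    (\<forall>i. h i 1 = 1) \<and> (\<forall>i j c. h i (of_base c) = h j (of_base c))"

definition family_eval :: "(int \<Rightarrow> 'a::comm_monoid_mult \<Rightarrow> 'r::comm_ring_1) \<Rightarrow> 'a family \<Rightarrow> 'r"
  where "family_eval h f = (\<Prod>i\<in>{i. component f i \<noteq> 1}. h i (component f i))"

definition formal_eval ::
    "(int \<Rightarrow> 'a::k_domain \<Rightarrow> 'r::comm_ring_1) \<Rightarrow> ('a family \<Rightarrow>\<^sub>0 'a base) \<Rightarrow> 'r"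
  where "formal_eval h p =
    (\<Sum>f\<in>Poly_Mapping.keys p. h 0 (of_base (Poly_Mapping.lookup p f)) * family_eval h f)"

lemma finite_component: "finite {i. component f i \<noteq> 1}"
  using component[of f] by simp

context
  fixes h :: "int \<Rightarrow> 'a::k_domain \<Rightarrow> 'r::comm_ring_1"
  assumes h: "alg_hom_family h"
begin

lemma h_simps: "h i (a + b) = h i a + h i b" "h i (a * b) = h i a * h i b" "h i 1 = 1"
  using h by (auto simp: alg_hom_family_def)

lemma h_scalar: "h i (of_base c) = h 0 (of_base c)"
  using h by (auto simp: alg_hom_family_def)

lemma h_0: "h i 0 = 0"
  using h_simps(1)[of i 0 0] by simp

lemma family_eval_superset:
  assumes "finite S" "{i. component f i \<noteq> 1} \<subseteq> S"
  shows "family_eval h f = (\<Prod>i\<in>S. h i (component f i))"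
  unfolding family_eval_def
  by (rule prod.mono_neutral_left) (use assms h_simps(3) in auto)

lemma family_eval_0: "family_eval h 0 = 1"
  by (simp add: family_eval_def zero_family.rep_eq)

lemma family_eval_add: "family_eval h (f + g) = family_eval h f * family_eval h g"
proof -
  let ?S = "{i. component f i \<noteq> 1} \<union> {i. component g i \<noteq> 1}"
  have fin: "finite ?S" by (simp add: finite_component)
  have "family_eval h (f + g) = (\<Prod>i\<in>?S. h i (component (f + g) i))"
    by (rule family_eval_superset[OF fin]) (auto simp: plus_family.rep_eq)
  also have "\<dots> = (\<Prod>i\<in>?S. h i (component f i)) * (\<Prod>i\<in>?S. h i (component g i))"
    by (simp add: plus_family.rep_eq h_simps prod.distrib)
  also have "\<dots> = family_eval h f * family_eval h g"
    by (subst (1 2) family_eval_superset[OF fin]) auto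
  finally show ?thesis .
qed

lemma family_eval_upd:
  "family_eval h (family_upd f i a) = h i a * family_eval h (family_upd f i 1)"
proof -
  let ?S = "insert i {i. component f i \<noteq> 1}"
  have fin: "finite ?S" by (simp add: finite_component)
  have upd: "component (family_upd f i b) j = (if j = i then b else component f j)" for b j
    by (simp add: family_upd.rep_eq)
  have *: "family_eval h (family_upd f i b) = h i b * (\<Prod>j\<in>?S - {i}. h j (component f j))" for b
  proof -
    have "family_eval h (family_upd f i b) = (\<Prod>j\<in>?S. h j (component (family_upd f i b) j))"
      by (rule family_eval_superset[OF fin]) (auto simp: upd split: if_splits)
    also have "\<dots> = h i b * (\<Prod>j\<in>?S - {i}. h j (component (family_upd f i b) j))"
      using fin by (subst prod.remove[of _ i]) (auto simp: upd)
    also have "(\<Prod>j\<in>?S - {i}. h j (component (family_upd f i b) j))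
        = (\<Prod>j\<in>?S - {i}. h j (component f j))"
      by (rule prod.cong) (auto simp: upd)
    finally show ?thesis .
  qed
  show ?thesis by (simp add: * h_simps)
qed

lemma formal_eval_superset:
  assumes "finite S" "Poly_Mapping.keys p \<subseteq> S"
  shows "formal_eval h p = (\<Sum>f\<in>S. h 0 (of_base (Poly_Mapping.lookup p f)) * family_eval h f)"
  unfolding formal_eval_def
  by (rule sum.mono_neutral_left) (use assms h_0 in \<open>auto simp: in_keys_iff\<close>)

lemma formal_eval_0: "formal_eval h 0 = 0"
  by (simp add: formal_eval_def)

lemma formal_eval_single:
  "formal_eval h (Poly_Mapping.single f c) = h 0 (of_base c) * family_eval h f"
  by (subst formal_eval_superset[of "{f}"]) auto

lemma formal_eval_1: "formal_eval h 1 = 1"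
  using formal_eval_single[of 0 1] by (simp add: family_eval_0 h_simps)

lemma formal_eval_add: "formal_eval h (p + q) = formal_eval h p + formal_eval h q"
proof -
  let ?S = "Poly_Mapping.keys p \<union> Poly_Mapping.keys q"
  have "Poly_Mapping.keys (p + q) \<subseteq> ?S" by (rule Poly_Mapping.keys_add)
  then show ?thesis
    by (subst (1 2 3) formal_eval_superset[of ?S])
      (auto simp: lookup_add h_simps algebra_simps sum.distrib)
qed

lemma formal_eval_uminus: "formal_eval h (- p) = - formal_eval h p"
  using formal_eval_add[of p "- p"] by (simp add: formal_eval_0 add_eq_0_iff)

lemma formal_eval_diff: "formal_eval h (p - q) = formal_eval h p - formal_eval h q"
  using formal_eval_add[of p "- q"] by (simp add: formal_eval_uminus)

lemma formal_eval_sum: "formal_eval h (sum p S) = (\<Sum>x\<in>S. formal_eval h (p x))"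
  by (induction S rule: infinite_finite_induct) (simp_all add: formal_eval_0 formal_eval_add)

lemma formal_eval_mult: "formal_eval h (p * q) = formal_eval h p * formal_eval h q"
proof -
  have sum: "p = (\<Sum>f\<in>Poly_Mapping.keys p. Poly_Mapping.single f (Poly_Mapping.lookup p f))"
    for p :: "'a family \<Rightarrow>\<^sub>0 'a base"
    by (rule poly_mapping_eqI)
      (simp add: lookup_sum lookup_single when_def in_keys_iff sum.delta[OF finite_keys] cong: if_cong)
  have "formal_eval h (p * q) = formal_eval h
      ((\<Sum>f\<in>Poly_Mapping.keys p. Poly_Mapping.single f (Poly_Mapping.lookup p f)) *
       (\<Sum>f\<in>Poly_Mapping.keys q. Poly_Mapping.single f (Poly_Mapping.lookup q f)))"
    using sum[of p] sum[of q] by simp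
  also have "\<dots> = formal_eval h p * formal_eval h q"
    by (simp add: sum_product formal_eval_sum mult_single formal_eval_single family_eval_add h_simps)
      (simp add: formal_eval_def sum_product mult_ac)
  finally show ?thesis .
qed

lemma formal_eval_relations: "p \<in> tensor_relations \<Longrightarrow> formal_eval h p = 0"
proof (induction rule: tensor_relations.induct)
  case (additive f i a b)
  have "family_eval h (family_upd f i (a + b)) =
      family_eval h (family_upd f i a) + family_eval h (family_upd f i b)"
    by (subst (1 2 3) family_eval_upd) (simp add: h_simps algebra_simps)
  then show ?case
    by (simp add: formal_eval_diff formal_eval_single h_simps)
next
  case (homogeneous f i c a)
  have "family_eval h (family_upd f i (base_scale c a)) =
      h 0 (of_base c) * family_eval h (family_upd f i a)"
    by (subst (1 2) family_eval_upd) (simp add: h_simps h_scalar[of i] mult.assoc)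
  then show ?case
    by (simp add: formal_eval_diff formal_eval_single h_simps)
qed (simp_all add: formal_eval_0 formal_eval_add formal_eval_mult)

lemma formal_eval_rel: "tensor_rel p q \<Longrightarrow> formal_eval h p = formal_eval h q"
  using formal_eval_relations[of "p - q"] by (simp add: tensor_rel_def formal_eval_diff)

end


instantiation tensor_power :: (k_domain) comm_ring_1
begin

lift_definition zero_tensor_power :: "'a tensor_power" is 0 .
lift_definition one_tensor_power :: "'a tensor_power" is 1 .

lift_definition plus_tensor_power :: "'a tensor_power \<Rightarrow> 'a tensor_power \<Rightarrow> 'a tensor_power"
  is "(+)"
  unfolding tensor_rel_def by (metis tensor_relations.add add_diff_add)

lift_definition uminus_tensor_power :: "'a tensor_power \<Rightarrow> 'a tensor_power" is uminus
  unfolding tensor_rel_def by (metis tensor_relations_uminus minus_diff_minus)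

lift_definition minus_tensor_power :: "'a tensor_power \<Rightarrow> 'a tensor_power \<Rightarrow> 'a tensor_power"
  is "(-)"
proof -
  fix p p' q q' :: "'a family \<Rightarrow>\<^sub>0 'a base"
  assume "tensor_rel p p'" "tensor_rel q q'"
  then have "(p - p') + - (q - q') \<in> tensor_relations"
    unfolding tensor_rel_def by (intro tensor_relations.add tensor_relations_uminus)
  then show "tensor_rel (p - q) (p' - q')"
    by (simp add: tensor_rel_def algebra_simps)
qed

lift_definition times_tensor_power :: "'a tensor_power \<Rightarrow> 'a tensor_power \<Rightarrow> 'a tensor_power"
  is "(*)"
proof -
  fix p p' q q' :: "'a family \<Rightarrow>\<^sub>0 'a base"
  assume "tensor_rel p p'" "tensor_rel q q'"
  then have "q * (p - p') + p' * (q - q') \<in> tensor_relations"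
    unfolding tensor_rel_def by (intro tensor_relations.add tensor_relations.mult)
  then show "tensor_rel (p * q) (p' * q')"
    by (simp add: tensor_rel_def algebra_simps)
qed

instance
proof
  fix x y z :: "'a tensor_power"
  have refl: "tensor_rel p p" for p :: "'a family \<Rightarrow>\<^sub>0 'a base"
    by (rule equivp_reflp[OF equivp_tensor_rel])
  show "x + y + z = x + (y + z)" by transfer (simp add: add.assoc refl)
  show "x + y = y + x" by transfer (simp add: add.commute refl)
  show "0 + x = x" by transfer (simp add: refl)
  show "- x + x = 0" by transfer (simp add: refl)
  show "x - y = x + - y" by transfer (simp add: refl)
  show "x * y * z = x * (y * z)" by transfer (simp add: mult.assoc refl)
  show "x * y = y * x" by transfer (simp add: mult.commute refl)
  show "1 * x = x" by transfer (simp add: refl)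
  show "(x + y) * z = x * z + y * z" by transfer (simp add: distrib_right refl)
  have id: "alg_hom_family (\<lambda>_ a::'a. a)" by (simp add: alg_hom_family_def)
  show "(0::'a tensor_power) \<noteq> 1"
    by transfer (use formal_eval_rel[OF id, of 0 1] in
        \<open>auto simp: formal_eval_0[OF id] formal_eval_1[OF id]\<close>)
qed

end

text \<open>The element \<open>a\<^bsup>(\<ell>)\<^esup>\<close>, with \<open>a\<close> in position \<open>\<ell>\<close> and \<open>1\<close> elsewhere.\<close>

lift_definition slot :: "int \<Rightarrow> 'a::k_domain \<Rightarrow> 'a tensor_power"
  is "\<lambda>l a. Poly_Mapping.single (family_upd 0 l a) 1" .

definition tensor_scalar :: "'a::k_domain base \<Rightarrow> 'a tensor_power"
  where "tensor_scalar c = abs_tensor_power (Poly_Mapping.single 0 c)"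

abbreviation tensor_scale :: "'a::k_domain base \<Rightarrow> 'a tensor_power \<Rightarrow> 'a tensor_power"
  where "tensor_scale c x \<equiv> tensor_scalar c * x"

lemma family_upd_0_1 [simp]: "family_upd 0 l 1 = 0"
  by transfer auto

lemma slot_simps:
  "slot l (a + b) = slot l a + slot l b" "slot l (a * b) = slot l a * slot l b" "slot l 1 = 1"
  "slot l (of_base c) = tensor_scalar c"
proof -
  show "slot l (a + b) = slot l a + slot l b"
    using tensor_relations.additive[of 0 l a b]
    by (simp only: slot.abs_eq plus_tensor_power.abs_eq tensor_power.abs_eq_iff tensor_rel_def
        diff_diff_eq)
  have "family_upd 0 l (a * b) = family_upd 0 l a + family_upd 0 l b"
    by transfer auto
  then show "slot l (a * b) = slot l a * slot l b"
    by (simp add: slot.abs_eq times_tensor_power.abs_eq mult_single)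
  show "slot l 1 = 1"
    by (simp add: slot.abs_eq one_tensor_power.abs_eq)
  show "slot l (of_base c) = tensor_scalar c"
    using tensor_relations.homogeneous[of 0 l c 1]
    by (simp add: slot.abs_eq tensor_scalar_def tensor_power.abs_eq_iff tensor_rel_def)
qed

lemma alg_hom_family_slot: "alg_hom_family (\<lambda>l. slot (\<sigma> l))"
  by (simp add: alg_hom_family_def slot_simps)

lemma tensor_scalar_simps:
  "tensor_scalar (c + d) = tensor_scalar c + tensor_scalar d"
  "tensor_scalar (c * d) = tensor_scalar c * tensor_scalar d" "tensor_scalar 1 = 1"
  by (simp_all only: slot_simps(4)[of 0, symmetric] of_base_simps slot_simps(1-3))

lemma vector_space_tensor_scale:
  "vector_space (tensor_scale :: 'a::k_domain base \<Rightarrow> 'a tensor_power \<Rightarrow> 'a tensor_power)"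
  by standard (simp_all add: tensor_scalar_simps algebra_simps)


text \<open>
  \<open>\<sigma>\<^sub>*\<close>; by \<open>is_alg_endo_derange\<close>, \<open>derange_slot\<close> and \<open>derange_unique\<close> below it is the unique
  \<open>k\<close>-algebra endomorphism with \<open>\<sigma>\<^sub>*(a\<^bsup>(\<ell>)\<^esup>) = a\<^bsup>(\<sigma> \<ell>)\<^esup>\<close>.
\<close>

definition derange :: "(int \<Rightarrow> int) \<Rightarrow> 'a::k_domain tensor_power \<Rightarrow> 'a tensor_power"
  where "derange \<sigma> x = formal_eval (\<lambda>l. slot (\<sigma> l)) (rep_tensor_power x)"

lemma derange_abs: "derange \<sigma> (abs_tensor_power p) = formal_eval (\<lambda>l. slot (\<sigma> l)) p"
  unfolding derange_def
  by (rule formal_eval_rel[OF alg_hom_family_slot])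
    (rule Quotient_rep_abs[OF Quotient_tensor_power equivp_reflp[OF equivp_tensor_rel]])

definition is_alg_endo :: "('a::k_domain tensor_power \<Rightarrow> 'a tensor_power) \<Rightarrow> bool"
  where "is_alg_endo \<phi> \<longleftrightarrow> (\<forall>x y. \<phi> (x + y) = \<phi> x + \<phi> y) \<and> (\<forall>x y. \<phi> (x * y) = \<phi> x * \<phi> y) \<and>
    (\<forall>c. \<phi> (tensor_scalar c) = tensor_scalar c)"

lemma is_alg_endo_derange: "is_alg_endo (derange \<sigma> :: 'a::k_domain tensor_power \<Rightarrow> _)"
proof -
  note H = alg_hom_family_slot[of \<sigma>]
  have abs: "\<exists>p. x = abs_tensor_power p" for x :: "'a tensor_power"
    by (induction x) blast
  have "derange \<sigma> (x + y) = derange \<sigma> x + derange \<sigma> y \<and> derange \<sigma> (x * y) = derange \<sigma> x * derange \<sigma> y"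
    for x y :: "'a tensor_power"
  proof -
    obtain p q where [simp]: "x = abs_tensor_power p" "y = abs_tensor_power q"
      using abs[of x] abs[of y] by blast
    show ?thesis
      by (simp only: plus_tensor_power.abs_eq times_tensor_power.abs_eq derange_abs
          formal_eval_add[OF H] formal_eval_mult[OF H] simp_thms \<open>x = _\<close> \<open>y = _\<close>)
  qed
  moreover have "derange \<sigma> (tensor_scalar c) = tensor_scalar c" for c :: "'a base"
  proof -
    have "derange \<sigma> (tensor_scalar c) = slot (\<sigma> 0) (of_base c) * 1"
      by (simp only: tensor_scalar_def derange_abs formal_eval_single[OF H] family_eval_0[OF H])
    then show ?thesis by (simp add: slot_simps)
  qed
  ultimately show ?thesis by (simp add: is_alg_endo_def)
qed

lemma derange_slot: "derange \<sigma> (slot l a) = slot (\<sigma> l) a"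
proof -
  note H = alg_hom_family_slot[of \<sigma>]
  have "derange \<sigma> (slot l a) = slot (\<sigma> 0) (of_base 1) * family_eval (\<lambda>l. slot (\<sigma> l)) (family_upd 0 l a)"
    by (simp only: slot.abs_eq derange_abs formal_eval_single[OF H])
  also have "\<dots> = slot (\<sigma> l) a"
    by (subst family_eval_upd[OF H]) (simp add: family_eval_0[OF H] slot_simps(3))
  finally show ?thesis .
qed

lemma family_eq_sum:
  fixes f :: "'a::comm_monoid_mult family"
  shows "f = (\<Sum>i\<in>{i. component f i \<noteq> 1}. family_upd 0 i (component f i))"
proof -
  have sum: "component (sum g S) j = (\<Prod>i\<in>S. component (g i) j)"
    for g :: "int \<Rightarrow> 'a family" and S j
    by (induction S rule: infinite_finite_induct) (simp_all add: zero_family.rep_eq plus_family.rep_eq)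
  have "component (\<Sum>i\<in>{i. component f i \<noteq> 1}. family_upd 0 i (component f i)) j = component f j" for j
  proof -
    have "component (\<Sum>i\<in>{i. component f i \<noteq> 1}. family_upd 0 i (component f i)) j =
        (\<Prod>i\<in>{i. component f i \<noteq> 1}. if i = j then component f j else 1)"
      by (simp only: sum) (rule prod.cong, auto simp: family_upd.rep_eq zero_family.rep_eq)
    then show ?thesis by (simp add: finite_component)
  qed
  then have "component (\<Sum>i\<in>{i. component f i \<noteq> 1}. family_upd 0 i (component f i)) = component f"
    by (rule ext)
  then show ?thesis by (simp only: component_inject)
qed

lemma abs_tensor_power_single:
  fixes f :: "'a::k_domain family"
  shows "abs_tensor_power (Poly_Mapping.single f c) =
    tensor_scalar c * (\<Prod>i\<in>{i. component f i \<noteq> 1}. slot i (component f i))"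
proof -
  have prod: "(\<Prod>i\<in>S. slot i (g i)) =
      abs_tensor_power (Poly_Mapping.single (\<Sum>i\<in>S. family_upd 0 i (g i)) 1)"
    if "finite S" for S and g :: "int \<Rightarrow> 'a"
    using that
    by (induction S rule: finite_induct)
      (simp_all add: one_tensor_power.abs_eq slot.abs_eq times_tensor_power.abs_eq mult_single)
  have "tensor_scalar c * (\<Prod>i\<in>{i. component f i \<noteq> 1}. slot i (component f i)) =
      tensor_scalar c * abs_tensor_power (Poly_Mapping.single f 1)"
    by (subst prod[OF finite_component], subst family_eq_sum[of f, symmetric]) (rule refl)
  also have "\<dots> = abs_tensor_power (Poly_Mapping.single f c)"
    by (simp add: tensor_scalar_def times_tensor_power.abs_eq mult_single)
  finally show ?thesis by (rule sym)
qed

lemma is_alg_endoD: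
  assumes "is_alg_endo \<phi>"
  shows "\<phi> (x + y) = \<phi> x + \<phi> y" "\<phi> (x * y) = \<phi> x * \<phi> y"
    "\<phi> (tensor_scalar c) = tensor_scalar c" "\<phi> 0 = 0" "\<phi> 1 = 1"
    "\<phi> (\<Prod>i\<in>S. f i) = (\<Prod>i\<in>S. \<phi> (f i))"
proof -
  show 1: "\<phi> (x + y) = \<phi> x + \<phi> y" "\<phi> (x * y) = \<phi> x * \<phi> y"
    "\<phi> (tensor_scalar c) = tensor_scalar c" for x y c
    using assms by (simp_all add: is_alg_endo_def)
  show "\<phi> 0 = 0" using 1(1)[of 0 0] by simp
  show one: "\<phi> 1 = 1" using 1(3)[of 1] by (simp add: tensor_scalar_simps)
  show "\<phi> (\<Prod>i\<in>S. f i) = (\<Prod>i\<in>S. \<phi> (f i))"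
    by (induction S rule: infinite_finite_induct) (simp_all add: one 1)
qed

lemma derange_unique:
  fixes \<phi> :: "'a::k_domain tensor_power \<Rightarrow> 'a tensor_power"
  assumes \<phi>: "is_alg_endo \<phi>" and slot: "\<And>l a. \<phi> (slot l a) = slot (\<sigma> l) a"
  shows "\<phi> = derange \<sigma>"
proof -
  note \<sigma> = is_alg_endo_derange[of \<sigma>]
  have single: "\<phi> (abs_tensor_power (Poly_Mapping.single f c)) =
      derange \<sigma> (abs_tensor_power (Poly_Mapping.single f c))" for f c
    unfolding abs_tensor_power_single is_alg_endoD(2,3,6)[OF \<phi>] is_alg_endoD(2,3,6)[OF \<sigma>]
      slot derange_slot ..
  have "\<phi> (abs_tensor_power p) = derange \<sigma> (abs_tensor_power p)" for p
  proof (induction p rule: update_induct)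
    case const
    then show ?case
      using is_alg_endoD(4)[OF \<phi>] is_alg_endoD(4)[OF \<sigma>]
      by (metis zero_tensor_power.abs_eq)
  next
    case (update f a b)
    have "Poly_Mapping.update a b f = f + Poly_Mapping.single a b"
      using update(1) by (intro poly_mapping_eqI)
        (auto simp: lookup_update lookup_add lookup_single in_keys_iff when_def)
    then have "abs_tensor_power (Poly_Mapping.update a b f) =
        abs_tensor_power f + abs_tensor_power (Poly_Mapping.single a b)"
      by (simp add: plus_tensor_power.abs_eq)
    then show ?case
      by (simp only: is_alg_endoD(1)[OF \<phi>] is_alg_endoD(1)[OF \<sigma>] update(3) single)
  qed
  moreover have "\<exists>p. x = abs_tensor_power p" for x :: "'a tensor_power"
    by (induction x) blast
  ultimately show ?thesis by (metis ext)
qed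

definition bar_mat :: "'a::k_domain tensor_power mat \<Rightarrow> 'a tensor_power mat"
  where "bar_mat = map_mat (derange (\<lambda>l. - l))"


section \<open>Types \<open>(k, n, A, L)\<close>\<close>

inductive_set subring_generated :: "'r::comm_ring_1 set \<Rightarrow> 'r set" for S where
  incl: "x \<in> S \<Longrightarrow> x \<in> subring_generated S"
| one: "1 \<in> subring_generated S"
| diff: "x \<in> subring_generated S \<Longrightarrow> y \<in> subring_generated S \<Longrightarrow> x - y \<in> subring_generated S"
| mult: "x \<in> subring_generated S \<Longrightarrow> y \<in> subring_generated S \<Longrightarrow> x * y \<in> subring_generated S"

definition is_type :: "nat \<Rightarrow> 'a::k_domain set \<Rightarrow> bool"
  where "is_type n L \<longleftrightarrow> n \<ge> 2 \<and>
    (\<exists>S::'a set. finite S \<and> subring_generated (base_field \<union> S) = UNIV) \<and>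
    module.subspace base_scale L \<and> (\<exists>B. finite B \<and> module.span base_scale B = L)"

definition tensor_sub :: "int set \<Rightarrow> 'a::k_domain tensor_power set"
  where "tensor_sub I = subring_generated (range tensor_scalar \<union> {slot l a |l a. l \<in> I})"


section \<open>Matrices\<close>

text \<open>
  The library counts the rows and columns of matrices from 0; \<open>ent\<close> counts them from 1, so that
  they match positions in the tensor power.
\<close>

definition ent :: "'r mat \<Rightarrow> int \<Rightarrow> int \<Rightarrow> 'r"
  where "ent Z i j = Z $$ (nat (i - 1), nat (j - 1))"

definition trace_mat :: "'r::comm_ring_1 mat \<Rightarrow> 'r"
  where "trace_mat X = (\<Sum>i<dim_row X. X $$ (i, i))"

definition rank_le_1 :: "'r::comm_ring_1 mat \<Rightarrow> bool"
  where "rank_le_1 X \<longleftrightarrow>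
    (\<forall>i i' j j'. i < i' \<longrightarrow> i' < dim_row X \<longrightarrow> j < j' \<longrightarrow> j' < dim_col X \<longrightarrow>
      X $$ (i, j) * X $$ (i', j') - X $$ (i, j') * X $$ (i', j) = 0)"

definition k_independent :: "nat \<Rightarrow> (nat \<Rightarrow> 'a::k_domain) \<Rightarrow> bool"
  where "k_independent m x \<longleftrightarrow>
    (\<forall>c. (\<Sum>i<m. base_scale (c i) (x i)) = 0 \<longrightarrow> (\<forall>i<m. c i = 0))"

definition k_general :: "'a::k_domain mat \<Rightarrow> bool"
  where "k_general X \<longleftrightarrow>
    (\<exists>i<dim_row X. k_independent (dim_col X) (\<lambda>j. X $$ (i, j))) \<and>
    (\<exists>j<dim_col X. k_independent (dim_row X) (\<lambda>i. X $$ (i, j)))"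

definition Segre_matrices :: "nat \<Rightarrow> 'a::k_domain set \<Rightarrow> 'a mat set"
  where "Segre_matrices n L =
    {X \<in> carrier_mat n n. (\<forall>i<n. \<forall>j<n. X $$ (i, j) \<in> L) \<and> rank_le_1 X \<and> k_general X}"

definition k_equivalent :: "nat \<Rightarrow> 'a::k_domain mat \<Rightarrow> 'a mat \<Rightarrow> bool"
  where "k_equivalent n X Y \<longleftrightarrow>
    (\<exists>\<Phi>\<in>carrier_mat n n. \<exists>\<Psi>\<in>carrier_mat n n. det \<Phi> \<noteq> 0 \<and> det \<Psi> \<noteq> 0 \<and>
      Y = map_mat of_base \<Phi> * X * map_mat of_base \<Psi>)"

definition Segre_equivalence :: "nat \<Rightarrow> 'a::k_domain set \<Rightarrow> ('a mat \<times> 'a mat) set"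
  where "Segre_equivalence n L =
    {(X, Y). X \<in> Segre_matrices n L \<and> Y \<in> Segre_matrices n L \<and> k_equivalent n X Y}"

definition k_proportionality :: "nat \<Rightarrow> ('a::k_domain tensor_power mat \<times> 'a tensor_power mat) set"
  where "k_proportionality n =
    {(X, Y). X \<in> carrier_mat n n \<and> Y \<in> carrier_mat n n \<and> (\<exists>c. c \<noteq> 0 \<and> Y = tensor_scalar c \<cdot>\<^sub>m X)}"


section \<open>The abeliant\<close>

text \<open>Polynomials in \<open>s\<^sub>1, s\<^sub>2, \<dots>\<close> (indexed by \<open>Inl\<close>) and \<open>t\<^sub>1, t\<^sub>2, \<dots>\<close> (indexed by \<open>Inr\<close>).\<close>

type_synonym 'r st_poly = "((nat + nat) \<Rightarrow>\<^sub>0 nat) \<Rightarrow>\<^sub>0 'r"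

definition st_const :: "'r::comm_ring_1 \<Rightarrow> 'r st_poly"
  where "st_const r = Poly_Mapping.single 0 r"

definition st_var :: "nat + nat \<Rightarrow> 'r::comm_ring_1 st_poly"
  where "st_var v = Poly_Mapping.single (Poly_Mapping.single v 1) 1"

definition generic_sum ::
    "nat \<Rightarrow> (nat \<Rightarrow> nat + nat) \<Rightarrow> (nat \<Rightarrow> 'r::comm_ring_1 mat) \<Rightarrow> 'r st_poly mat"
  where "generic_sum n v X =
    mat n n (\<lambda>(i, j). \<Sum>b = 1..n. st_var (v b) * st_const (X b $$ (i, j)))"

text \<open>The exponent of \<open>s\<^sub>1 \<cdots> s\<^sub>n t\<^sub>1 \<cdots> t\<^sub>n\<close> with \<open>s\<^sub>i\<close> and \<open>t\<^sub>j\<close> omitted.\<close>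

definition abel_exponent :: "nat \<Rightarrow> nat \<Rightarrow> nat \<Rightarrow> (nat + nat) \<Rightarrow>\<^sub>0 nat"
  where "abel_exponent n i j =
    (\<Sum>a\<in>{1..n} - {i}. Poly_Mapping.single (Inl a) 1) +
    (\<Sum>b\<in>{1..n} - {j}. Poly_Mapping.single (Inr b) 1)"

definition abel :: "nat \<Rightarrow> (nat \<Rightarrow> 'r::comm_ring_1 mat) \<Rightarrow> 'r mat"
  where "abel n X = mat n n (\<lambda>(i, j). Poly_Mapping.lookup
    (trace_mat (map_mat st_const (X 0) * adj_mat (generic_sum n Inr X) *
      map_mat st_const (X (n + 1)) * adj_mat (generic_sum n Inl X)))
    (abel_exponent n (i + 1) (j + 1)))"

definition abel_map :: "nat \<Rightarrow> 'a::k_domain mat \<Rightarrow> 'a tensor_power mat"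
  where "abel_map n X = abel n (\<lambda>l. map_mat (slot (int l)) X)"


section \<open>Jacobi matrices\<close>

text \<open>Products and powers of the sets \<open>L\<^bsup>(\<ell>)\<^esup>\<close> are elementwise.\<close>

definition Jacobi_space :: "nat \<Rightarrow> 'a::k_domain set \<Rightarrow> 'a tensor_power set"
  where "Jacobi_space n L = module.span tensor_scale
    (slot 0 ` L * slot 1 ` L * slot 2 ` L * (\<Prod>l = 3..int n. (slot l ` L)\<^sup>2) * slot (int n + 1) ` L)"

definition Jacobi_factor :: "nat \<Rightarrow> 'a::k_domain tensor_power mat \<Rightarrow> 'a tensor_power"
  where "Jacobi_factor n Z =
    derange (transpose 2 (int n + 1)) (derange (transpose 0 1) (ent Z 1 1)) *
    derange (transpose 0 1) (ent Z 1 1) * derange (transpose 0 2) (ent Z 2 2) *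
    (\<Prod>l = 3..int n. (derange (transpose 0 l) (ent Z l l))\<^sup>2)"

definition Jacobi_matrices :: "nat \<Rightarrow> 'a::k_domain set \<Rightarrow> 'a tensor_power mat set"
  where "Jacobi_matrices n L = {Z \<in> carrier_mat n n.
    (\<forall>i\<in>{1..int n}. \<forall>j\<in>{1..int n}. ent Z i j \<in> tensor_sub {0..int n + 1}) \<and>
    Z \<noteq> 0\<^sub>m n n \<and>
    ent Z 1 2 \<in> Jacobi_space n L \<and>
    ent Z 1 1 = derange (id(1 := 2)) (ent Z 1 2) \<and>
    (\<forall>\<pi>. \<pi> permutes {1..int n} \<longrightarrow>
      (\<forall>i\<in>{1..int n}. \<forall>j\<in>{1..int n}. derange \<pi> (ent Z i j) = ent Z (\<pi> i) (\<pi> j))) \<and>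
    ent Z 1 1 * ent Z 2 2 - ent Z 1 2 * ent Z 2 1 = 0 \<and>
    abel n (\<lambda>l. map_mat (derange (id(0 := - int l))) Z) = Jacobi_factor n Z \<cdot>\<^sub>m bar_mat Z}"


section \<open>Projective varieties of proportionality classes\<close>

definition mpoly_eval :: "(nat \<Rightarrow> 'k::comm_ring_1) \<Rightarrow> ((nat \<Rightarrow>\<^sub>0 nat) \<Rightarrow>\<^sub>0 'k) \<Rightarrow> 'k"
  where "mpoly_eval c f = (\<Sum>m\<in>Poly_Mapping.keys f. Poly_Mapping.lookup f m *
    (\<Prod>i\<in>Poly_Mapping.keys m. c i ^ Poly_Mapping.lookup m i))"

text \<open>Homogeneous polynomials in the variables numbered \<open>0, \<dots>, N\<close>.\<close>

definition homogeneous_mpoly :: "nat \<Rightarrow> ((nat \<Rightarrow>\<^sub>0 nat) \<Rightarrow>\<^sub>0 'k::zero) \<Rightarrow> bool"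
  where "homogeneous_mpoly N f \<longleftrightarrow> (\<exists>d. \<forall>m\<in>Poly_Mapping.keys f.
    Poly_Mapping.keys m \<subseteq> {..N} \<and> (\<Sum>i\<in>Poly_Mapping.keys m. Poly_Mapping.lookup m i) = d)"

definition mat_combination ::
    "nat \<Rightarrow> nat \<Rightarrow> (nat \<Rightarrow> 'a::k_domain tensor_power mat) \<Rightarrow> (nat \<Rightarrow> 'a base) \<Rightarrow> 'a tensor_power mat"
  where "mat_combination n N B c = mat n n (\<lambda>(i, j). \<Sum>l\<le>N. tensor_scale (c l) (B l $$ (i, j)))"

text \<open>
  A set of \<open>k\<close>-proportionality classes of nonzero \<open>n \<times> n\<close> matrices is a projective variety if,
  in the projective space \<open>\<P>\<^sup>N(k)\<close> of some finite-dimensional \<open>k\<close>-space of matrices with basis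
  \<open>B 0, \<dots>, B N\<close>, it is the locus of common zeros of a set of homogeneous polynomials over \<open>k\<close>.
  Neither irreducibility nor nonemptiness is part of the notion.
\<close>

definition is_projective_variety :: "nat \<Rightarrow> 'a::k_domain tensor_power mat set set \<Rightarrow> bool"
  where "is_projective_variety n W \<longleftrightarrow>
    (\<exists>N B F. (\<forall>l\<le>N. B l \<in> carrier_mat n n) \<and>
      (\<forall>c. mat_combination n N B c = 0\<^sub>m n n \<longrightarrow> (\<forall>l\<le>N. c l = 0)) \<and>
      (\<forall>f\<in>F. homogeneous_mpoly N f) \<and>
      W = {k_proportionality n `` {mat_combination n N B c} |c.
        (\<exists>l\<le>N. c l \<noteq> 0) \<and> (\<forall>f\<in>F. mpoly_eval c f = 0)})"

end

theory Submission imports Defs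
begin

text \<open>
  All identities are checked at points: by the Nullstellensatz the \<open>k\<close>-algebra homomorphisms
  \<open>A \<rightarrow> k\<close> separate the elements of \<open>A\<close>, and families \<open>(\<Phi>\<^sub>l)\<close> of such homomorphisms separate the
  elements of the tensor power.  At a point a matrix of rank one is a product \<open>u v\<^sup>T\<close>, and each
  entry of its Abel matrix is a product of four determinants in the vectors \<open>u\<close> and \<open>v\<close> at
  the various positions; the Jacobi identities then follow from Cramer's rule.

  Conversely, a Jacobi matrix \<open>Z\<close> has rank one: if \<open>n \<ge> 3\<close>, merging position \<open>0\<close> with position \<open>l\<close> kills
  all entries of \<open>Z\<close> except \<open>Z\<^sub>l\<^sub>l\<close>, so that after such mergers the abeliant in the Abel identity
  collapses to the four terms of a minor, and the vanishing of the principal minors forces that of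
  the others.  Evaluating all positions of \<open>Z\<close> except \<open>0\<close> at a point where \<open>\<Delta>\<close> does not vanish
  yields a matrix \<open>X\<close> over \<open>A\<close>, and the Abel identity says that the Abel map sends \<open>X\<close> to a
  multiple of \<open>Z\<close>.  When \<open>Z\<close> is the image of a Segre matrix, that matrix is recovered up to
  \<open>k\<close>-equivalence, which gives the bijection.

  The linear Jacobi conditions determine \<open>Z\<close> from \<open>Z\<^sub>1\<^sub>2\<close>, which ranges over a finite-dimensional
  space; the remaining two conditions are homogeneous in the coordinates of \<open>Z\<^sub>1\<^sub>2\<close>.
\<close>

section \<open>Determinants and the abeliant\<close>

text \<open>The shape of \<Delta> comes from Cramer's rule. At a point let \<open>f\<close>,
  \<open>h\<close> be the determinants of the left and right vectors at positions 1..n, and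
  \<open>fl l\<close>, \<open>hl l\<close> the same with the position of index \<open>l\<close>
  replaced by n+1. The abeliant of the matrices with position 0 moved to \<open>-l\<close> is a
  product of four determinants of Cramer coordinates; besides the barred entry it contains
  \<open>(f h)^(2n-2)\<close> and the squares of all \<open>fl l\<close> and \<open>hl l\<close>.
  The factor of \<Delta> attached to \<open>l\<close> has the value
  \<open>f h (fl l) (hl l)\<close>, so the product of all their squares has two powers of
  \<open>f h\<close> too many. One copy of the factors for indices 0 and 1 is therefore replaced by
  a twisted factor with value \<open>(fl 0) (hl 0) (fl 1) (hl 1)\<close>.

  The price is a formula without visible symmetry in positions 1..n, and this is what drives the
  converse: the Abel identity forces \<Delta> to be invariant under \<open>transpose 2 3\<close> and
  to vanish when positions 1 and 2 merge, and the two together give the vanishing of entries under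
  mergers with position 0. For n = 2 the one prescribed minor is already the whole rank one
  condition.\<close>

definition dt :: "nat \<Rightarrow> (nat \<Rightarrow> nat \<Rightarrow> 'r::comm_ring_1) \<Rightarrow> 'r"
  where "dt n w = det (mat n n (\<lambda>(b, c). w b c))"

text \<open>The unnormalized mixed discriminant, that is the full polarization of the determinant:
  the coefficient of \<open>t_1 ... t_n\<close> in the determinant of the sum of the matrices
  \<open>t_b Y b\<close>. Row \<open>r\<close> is taken from the matrix numbered
  \<open>\<tau> r\<close>.\<close>

definition mixed_det :: "nat \<Rightarrow> (nat \<Rightarrow> nat \<Rightarrow> nat \<Rightarrow> 'r::comm_ring_1) \<Rightarrow> 'r"
  where "mixed_det n Y = (\<Sum>\<tau> | \<tau> permutes {0..<n}. \<Sum>\<sigma> | \<sigma> permutes {0..<n}.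
    signof \<sigma> * (\<Prod>r = 0..<n. Y (\<tau> r) r (\<sigma> r)))"

definition unit_row :: "nat \<Rightarrow> (nat \<Rightarrow> 'r::comm_ring_1) \<Rightarrow> nat \<Rightarrow> nat \<Rightarrow> 'r"
  where "unit_row r \<rho> = (\<lambda>p c. if p = r then \<rho> c else 0)"

text \<open>The entry of the abeliant after the coefficient has been extracted. \<open>Y b\<close>
  is the matrix numbered \<open>b + 1\<close>, and \<open>P\<close>, \<open>Q\<close> are those
  numbered 0 and n+1. The two mixed determinants come from the entries \<open>(a, r)\<close> and
  \<open>(r, a)\<close> of the products of \<open>P\<close> and \<open>Q\<close> with the adjugates
  of the generic sums in t and in s. In this form compatibility with ring homomorphisms is
  immediate.\<close>

definition abelf :: "nat \<Rightarrow> (nat \<Rightarrow> nat \<Rightarrow> nat \<Rightarrow> 'r::comm_ring_1) \<Rightarrow> (nat \<Rightarrow> nat \<Rightarrow> 'r) \<Rightarrow>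
    (nat \<Rightarrow> nat \<Rightarrow> 'r) \<Rightarrow> nat \<Rightarrow> nat \<Rightarrow> 'r"
  where "abelf n Y P Q i j = (\<Sum>a<n. \<Sum>r<n.
    mixed_det n (Y(j := unit_row r (P a))) * mixed_det n (Y(i := unit_row a (Q r))))"

lemma permutes_lt: "\<sigma> permutes {0..<n::nat} \<Longrightarrow> i < n \<Longrightarrow> \<sigma> i < n"
  using permutes_in_image[of \<sigma> "{0..<n}" i] by (metis atLeastLessThan_iff zero_le)

lemma sum_swap4:
  "(\<Sum>x\<in>A. \<Sum>y\<in>B. \<Sum>r\<in>C. \<Sum>c\<in>D. f x y r c) = (\<Sum>r\<in>C. \<Sum>c\<in>D. \<Sum>x\<in>A. \<Sum>y\<in>B. f x y r c)"
proof -
  have "(\<Sum>x\<in>A. \<Sum>y\<in>B. \<Sum>r\<in>C. \<Sum>c\<in>D. f x y r c) = (\<Sum>x\<in>A. \<Sum>r\<in>C. \<Sum>c\<in>D. \<Sum>y\<in>B. f x y r c)"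
    by (rule sum.cong[OF refl], rule trans[OF sum.swap], rule sum.cong[OF refl], rule sum.swap)
  also have "\<dots> = (\<Sum>r\<in>C. \<Sum>c\<in>D. \<Sum>x\<in>A. \<Sum>y\<in>B. f x y r c)"
    by (rule trans[OF sum.swap], rule sum.cong[OF refl], rule sum.swap)
  finally show ?thesis .
qed

lemma dt_Leibniz: "dt n w = (\<Sum>\<sigma> | \<sigma> permutes {0..<n}. signof \<sigma> * (\<Prod>b = 0..<n. w b (\<sigma> b)))"
  unfolding dt_def
  by (subst det_def'[of _ n], simp, rule sum.cong[OF refl])
    (auto intro!: prod.cong arg_cong2[where f = "(*)"] simp: permutes_lt)

lemma dt_Leibniz': "dt n w = (\<Sum>\<sigma> | \<sigma> permutes {0..<n}. signof \<sigma> * (\<Prod>b = 0..<n. w (\<sigma> b) b))"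
proof -
  have "dt n w = det (mat n n (\<lambda>(b, c). w b c))\<^sup>T"
    unfolding dt_def by (subst det_transpose[of _ n]) auto
  also have "(mat n n (\<lambda>(b, c). w b c))\<^sup>T = mat n n (\<lambda>(b, c). w c b)" by (rule eq_matI) auto
  also have "det \<dots> = dt n (\<lambda>b c. w c b)" by (simp add: dt_def)
  finally show ?thesis by (simp add: dt_Leibniz)
qed

lemma dt_cong: "(\<And>b c. b < n \<Longrightarrow> c < n \<Longrightarrow> w b c = w' b c) \<Longrightarrow> dt n w = dt n w'"
  unfolding dt_def by (rule arg_cong[of _ _ det], rule eq_matI) auto

lemma dt_permute: "\<tau> permutes {0..<n} \<Longrightarrow> dt n (\<lambda>b. w (\<tau> b)) = signof \<tau> * dt n w"
proof -
  assume \<tau>: "\<tau> permutes {0..<n}"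
  have "mat n n (\<lambda>(b, c). w (\<tau> b) c) = mat n n (\<lambda>(i,j). mat n n (\<lambda>(b, c). w b c) $$ (\<tau> i, j))"
    by (rule eq_matI) (use \<tau> in \<open>auto simp: permutes_lt\<close>)
  then show ?thesis unfolding dt_def by (simp only: det_permute_rows[OF _ \<tau>] mat_carrier)
qed

lemma dt_equal: "a < n \<Longrightarrow> b < n \<Longrightarrow> a \<noteq> b \<Longrightarrow> (\<And>c. c < n \<Longrightarrow> w a c = w b c) \<Longrightarrow> dt n w = 0"
  unfolding dt_def
  by (rule det_identical_rows[of _ n a b]) (auto intro!: eq_vecI)

lemma mixed_det_cong:
  assumes "\<And>b r c. b < n \<Longrightarrow> r < n \<Longrightarrow> c < n \<Longrightarrow> Y b r c = Y' b r c"
  shows "mixed_det n Y = mixed_det n Y'"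
  unfolding mixed_det_def
  by (intro sum.cong refl arg_cong2[where f = "(*)"] prod.cong) (use assms in \<open>auto simp: permutes_lt\<close>)

lemma mixed_det_dt: "mixed_det n Y = (\<Sum>\<tau> | \<tau> permutes {0..<n}. dt n (\<lambda>r. Y (\<tau> r) r))"
  by (simp add: mixed_det_def dt_Leibniz)

text \<open>Row \<open>r\<close> of the matrix numbered \<open>\<tau> r\<close> is the multiple
  \<open>u (\<tau> r) r\<close> of the vector \<open>v (\<tau> r)\<close>. Pulling out the scalars
  leaves a row permutation of \<open>dt n v\<close> with sign \<open>signof \<tau>\<close>, and the
  sum over \<tau> is the Leibniz formula for \<open>u\<close>.\<close>

lemma mixed_det_rank_one: "mixed_det n (\<lambda>b p c. u b p * v b c) = dt n u * dt n v"
proof -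
  have "mixed_det n (\<lambda>b p c. u b p * v b c) =
      (\<Sum>\<tau> | \<tau> permutes {0..<n}. (\<Prod>r = 0..<n. u (\<tau> r) r) * dt n (\<lambda>r. v (\<tau> r)))"
    by (simp add: mixed_det_def dt_Leibniz prod.distrib sum_distrib_left mult_ac)
  also have "\<dots> = (\<Sum>\<tau> | \<tau> permutes {0..<n}. signof \<tau> * (\<Prod>r = 0..<n. u (\<tau> r) r) * dt n v)"
    by (rule sum.cong[OF refl]) (simp add: dt_permute mult_ac)
  finally show ?thesis by (simp add: dt_Leibniz'[of n u] sum_distrib_right)
qed

lemma mixed_det_equal_columns:
  assumes "c < n" "c' < n" "c \<noteq> c'" "\<And>b r. b < n \<Longrightarrow> r < n \<Longrightarrow> Y b r c = Y b r c'"
  shows "mixed_det n Y = 0"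
proof -
  have "dt n (\<lambda>r. Y (\<tau> r) r) = 0" if "\<tau> permutes {0..<n}" for \<tau>
    unfolding dt_def
    by (rule det_identical_columns[of _ n c c']) (use assms that in \<open>auto intro!: eq_vecI simp: permutes_lt\<close>)
  then show ?thesis by (simp add: mixed_det_dt)
qed

text \<open>The coefficient of the entry \<open>(r, c)\<close> of the matrix numbered
  \<open>j\<close> in \<open>mixed_det\<close>, which is linear in each of its matrices. The matrix
  \<open>Y j\<close> itself does not enter, since \<tau> takes the value \<open>j\<close> only at
  \<open>r\<close>.\<close>

definition mixed_cof :: "nat \<Rightarrow> (nat \<Rightarrow> nat \<Rightarrow> nat \<Rightarrow> 'r::comm_ring_1) \<Rightarrow> nat \<Rightarrow> nat \<Rightarrow> nat \<Rightarrow> 'r"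
  where "mixed_cof n Y j r c = (\<Sum>\<tau> | \<tau> permutes {0..<n} \<and> \<tau> r = j.
    \<Sum>\<sigma> | \<sigma> permutes {0..<n} \<and> \<sigma> r = c. signof \<sigma> * (\<Prod>p\<in>{0..<n} - {r}. Y (\<tau> p) p (\<sigma> p)))"

lemma mixed_det_expand:
  assumes j: "j < n"
  shows "mixed_det n (Y(j := R)) = (\<Sum>r<n. \<Sum>c<n. R r c * mixed_cof n Y j r c)"
proof -
  let ?P = "{\<tau>. \<tau> permutes {0..<n}}"
  have fin: "finite ?P" by (simp add: finite_permutations)
  have trm: "(\<Prod>p = 0..<n. (Y(j := R)) (\<tau> p) p (\<sigma> p)) =
      (\<Sum>r<n. \<Sum>c<n. if \<tau> r = j \<and> \<sigma> r = c then R r c * (\<Prod>p\<in>{0..<n} - {r}. Y (\<tau> p) p (\<sigma> p)) else 0)"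
    if t: "\<tau> permutes {0..<n}" and s: "\<sigma> permutes {0..<n}" for \<tau> \<sigma>
  proof -
    \<comment> \<open>Each \<tau> takes exactly one row from the matrix \<open>R\<close>, so the
      double sum has a single nonzero term.\<close>
    obtain r0 where r0: "r0 < n" "\<tau> r0 = j" using j t permutes_image[OF t] by (metis atLeastLessThan_iff imageE le0)
    have inj: "\<tau> r = j \<longleftrightarrow> r = r0" for r using permutes_inj[OF t] r0(2) by (auto dest: injD)
    have s0: "\<sigma> r0 < n" using s r0(1) by (simp add: permutes_lt)
    have "(\<Prod>p = 0..<n. (Y(j := R)) (\<tau> p) p (\<sigma> p)) =
        R r0 (\<sigma> r0) * (\<Prod>p\<in>{0..<n} - {r0}. Y (\<tau> p) p (\<sigma> p))"
      using r0 inj by (subst prod.remove[of _ r0]) (auto intro!: prod.cong arg_cong2[where f = "(*)"])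
    also have "\<dots> = (\<Sum>r<n. \<Sum>c<n. if r = r0 \<and> c = \<sigma> r0 then R r c * (\<Prod>p\<in>{0..<n} - {r}. Y (\<tau> p) p (\<sigma> p)) else 0)"
    proof -
      have "(\<Sum>r<n. \<Sum>c<n. if r = r0 \<and> c = \<sigma> r0 then R r c * (\<Prod>p\<in>{0..<n} - {r}. Y (\<tau> p) p (\<sigma> p)) else 0)
        = (\<Sum>r<n. if r = r0 then (\<Sum>c<n. if c = \<sigma> r0 then R r c * (\<Prod>p\<in>{0..<n} - {r}. Y (\<tau> p) p (\<sigma> p)) else 0) else 0)"
        by (intro sum.cong refl) auto
      then show ?thesis using r0(1) s0 by simp
    qed
    finally show ?thesis using inj by (auto intro!: sum.cong)
  qed
  have "mixed_det n (Y(j := R)) = (\<Sum>\<tau>\<in>?P. \<Sum>\<sigma>\<in>?P. signof \<sigma> *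
      (\<Sum>r<n. \<Sum>c<n. if \<tau> r = j \<and> \<sigma> r = c then R r c * (\<Prod>p\<in>{0..<n} - {r}. Y (\<tau> p) p (\<sigma> p)) else 0))"
    unfolding mixed_det_def by (intro sum.cong refl arg_cong2[where f = "(*)"]) (use trm in auto)
  also have "\<dots> = (\<Sum>\<tau>\<in>?P. \<Sum>\<sigma>\<in>?P. \<Sum>r<n. \<Sum>c<n. if \<tau> r = j \<and> \<sigma> r = c then
      R r c * (signof \<sigma> * (\<Prod>p\<in>{0..<n} - {r}. Y (\<tau> p) p (\<sigma> p))) else 0)"
    by (simp add: sum_distrib_left if_distrib mult_ac cong: if_cong)
  also have "\<dots> = (\<Sum>r<n. \<Sum>c<n. \<Sum>\<tau>\<in>?P. \<Sum>\<sigma>\<in>?P. if \<tau> r = j \<and> \<sigma> r = c then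
      R r c * (signof \<sigma> * (\<Prod>p\<in>{0..<n} - {r}. Y (\<tau> p) p (\<sigma> p))) else 0)"
    by (rule sum_swap4)
  also have "\<dots> = (\<Sum>r<n. \<Sum>c<n. R r c * mixed_cof n Y j r c)"
  proof (intro sum.cong refl)
    fix r c
    have "(\<Sum>\<tau>\<in>?P. \<Sum>\<sigma>\<in>?P. if \<tau> r = j \<and> \<sigma> r = c then
        R r c * (signof \<sigma> * (\<Prod>p\<in>{0..<n} - {r}. Y (\<tau> p) p (\<sigma> p))) else 0) =
      (\<Sum>\<tau>\<in>?P. if \<tau> r = j then \<Sum>\<sigma>\<in>?P. if \<sigma> r = c then
        R r c * (signof \<sigma> * (\<Prod>p\<in>{0..<n} - {r}. Y (\<tau> p) p (\<sigma> p))) else 0 else 0)"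
      by (intro sum.cong refl) auto
    also have "\<dots> = (\<Sum>\<tau>\<in>?P \<inter> {\<tau>. \<tau> r = j}. \<Sum>\<sigma>\<in>?P \<inter> {\<sigma>. \<sigma> r = c}.
        R r c * (signof \<sigma> * (\<Prod>p\<in>{0..<n} - {r}. Y (\<tau> p) p (\<sigma> p))))"
      by (simp add: sum.If_cases[OF fin])
    also have "\<dots> = R r c * mixed_cof n Y j r c"
      unfolding mixed_cof_def sum_distrib_left
      by (intro sum.cong) auto
    finally show "(\<Sum>\<tau>\<in>?P. \<Sum>\<sigma>\<in>?P. if \<tau> r = j \<and> \<sigma> r = c then
        R r c * (signof \<sigma> * (\<Prod>p\<in>{0..<n} - {r}. Y (\<tau> p) p (\<sigma> p))) else 0) = R r c * mixed_cof n Y j r c" .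
  qed
  finally show ?thesis .
qed

lemma mixed_det_unit_row:
  "j < n \<Longrightarrow> r < n \<Longrightarrow> mixed_det n (Y(j := unit_row r \<rho>)) = (\<Sum>c<n. \<rho> c * mixed_cof n Y j r c)"
proof -
  assume "j < n" "r < n"
  have "mixed_det n (Y(j := unit_row r \<rho>)) = (\<Sum>p<n. if p = r then \<Sum>c<n. \<rho> c * mixed_cof n Y j p c else 0)"
    unfolding mixed_det_expand[OF \<open>j < n\<close>]
    by (intro sum.cong refl) (simp add: unit_row_def)
  then show ?thesis using \<open>r < n\<close> by simp
qed

lemma dt_linear:
  assumes "j < n" "\<And>c. c < n \<Longrightarrow> R c = (\<Sum>s\<in>S. k s * R' s c)"
  shows "dt n (w(j := R)) = (\<Sum>s\<in>S. k s * dt n (w(j := R' s)))"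
proof -
  define cf where "cf \<sigma> = signof \<sigma> * (\<Prod>b\<in>{0..<n} - {j}. w b (\<sigma> b))" for \<sigma>
  have *: "dt n (w(j := R)) = (\<Sum>\<sigma> | \<sigma> permutes {0..<n}. R (\<sigma> j) * cf \<sigma>)" for R
    unfolding dt_Leibniz
  proof (intro sum.cong refl)
    fix \<sigma>
    have "(\<Prod>b\<in>{0..<n} - {j}. (w(j := R)) b (\<sigma> b)) = (\<Prod>b\<in>{0..<n} - {j}. w b (\<sigma> b))"
      by (intro prod.cong refl) auto
    then show "signof \<sigma> * (\<Prod>b = 0..<n. (w(j := R)) b (\<sigma> b)) = R (\<sigma> j) * cf \<sigma>"
      using assms(1) by (subst prod.remove[of _ j]) (auto simp: cf_def mult_ac)
  qed
  have "dt n (w(j := R)) = (\<Sum>\<sigma> | \<sigma> permutes {0..<n}. \<Sum>s\<in>S. k s * (R' s (\<sigma> j) * cf \<sigma>))"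
    unfolding * by (intro sum.cong refl) (simp add: assms permutes_lt sum_distrib_left sum_distrib_right mult_ac)
  also have "\<dots> = (\<Sum>s\<in>S. \<Sum>\<sigma> | \<sigma> permutes {0..<n}. k s * (R' s (\<sigma> j) * cf \<sigma>))" by (rule sum.swap)
  finally show ?thesis by (simp add: * sum_distrib_left)
qed

text \<open>Conjugation by a permutation matrix: \<tau> is composed with the inverse of \<pi>, and
  \<sigma> is replaced by its conjugate under \<pi>, which has the same sign.\<close>

lemma mixed_det_conj:
  assumes \<pi>: "\<pi> permutes {0..<n}"
  shows "mixed_det n (\<lambda>b r c. Y b (\<pi> r) (\<pi> c)) = mixed_det n Y"
proof -
  let ?P = "{\<tau>. \<tau> permutes {0..<n}}"
  have ip: "inv_into UNIV \<pi> permutes {0..<n}" by (rule permutes_inv[OF \<pi>])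
  have inner: "(\<Sum>\<sigma>\<in>?P. signof \<sigma> * (\<Prod>r = 0..<n. Y (\<tau> r) (\<pi> r) (\<pi> (\<sigma> r)))) =
      (\<Sum>\<sigma>\<in>?P. signof \<sigma> * (\<Prod>r = 0..<n. Y ((\<tau> \<circ> inv_into UNIV \<pi>) r) r (\<sigma> r)))" for \<tau> :: "nat \<Rightarrow> nat"
  proof -
    have "(\<Sum>\<sigma>\<in>?P. signof \<sigma> * (\<Prod>r = 0..<n. Y ((\<tau> \<circ> inv_into UNIV \<pi>) r) r (\<sigma> r))) =
        (\<Sum>\<sigma>\<in>?P. signof (\<pi> \<circ> \<sigma>) * (\<Prod>r = 0..<n. Y ((\<tau> \<circ> inv_into UNIV \<pi>) r) r ((\<pi> \<circ> \<sigma>) r)))"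
      by (rule setum_permutations_compose_left[OF \<pi>])
    also have "\<dots> = (\<Sum>\<sigma>\<in>?P. signof (\<pi> \<circ> (\<sigma> \<circ> inv_into UNIV \<pi>)) *
        (\<Prod>r = 0..<n. Y ((\<tau> \<circ> inv_into UNIV \<pi>) r) r ((\<pi> \<circ> (\<sigma> \<circ> inv_into UNIV \<pi>)) r)))"
      by (rule sum_permutations_compose_right[OF ip])
    also have "\<dots> = (\<Sum>\<sigma>\<in>?P. signof \<sigma> * (\<Prod>r = 0..<n. Y (\<tau> r) (\<pi> r) (\<pi> (\<sigma> r))))"
    proof (rule sum.cong[OF refl])
      fix \<sigma> assume "\<sigma> \<in> ?P"
      then have s: "\<sigma> permutes {0..<n}" by simp
      have perm: "permutation \<pi>" "permutation \<sigma>" "permutation (inv_into UNIV \<pi>)"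
        using \<pi> s ip permutation_permutes by blast+
      have sg: "sign (\<pi> \<circ> (\<sigma> \<circ> inv_into UNIV \<pi>)) = sign \<sigma>"
        using perm by (simp add: sign_compose sign_inverse permutation_compose)
      have "(\<Prod>r = 0..<n. Y ((\<tau> \<circ> inv_into UNIV \<pi>) r) r ((\<pi> \<circ> (\<sigma> \<circ> inv_into UNIV \<pi>)) r)) =
          (\<Prod>r = 0..<n. Y ((\<tau> \<circ> inv_into UNIV \<pi>) (\<pi> r)) (\<pi> r) ((\<pi> \<circ> (\<sigma> \<circ> inv_into UNIV \<pi>)) (\<pi> r)))"
        by (rule prod.permute[OF \<pi>, unfolded o_def])
      then show "signof (\<pi> \<circ> (\<sigma> \<circ> inv_into UNIV \<pi>)) *
          (\<Prod>r = 0..<n. Y ((\<tau> \<circ> inv_into UNIV \<pi>) r) r ((\<pi> \<circ> (\<sigma> \<circ> inv_into UNIV \<pi>)) r)) =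
        signof \<sigma> * (\<Prod>r = 0..<n. Y (\<tau> r) (\<pi> r) (\<pi> (\<sigma> r)))"
        by (simp add: sg permutes_inverses[OF \<pi>])
    qed
    finally show ?thesis by (rule sym)
  qed
  show ?thesis unfolding mixed_det_def inner
    by (rule sum_permutations_compose_right[OF ip, symmetric])
qed

text \<open>The source of the invariance of \<Delta>: a derangement whose effect on all matrices is
  a simultaneous permutation of rows and columns leaves the abeliant unchanged.\<close>

lemma abelf_conj:
  fixes Y :: "nat \<Rightarrow> nat \<Rightarrow> nat \<Rightarrow> 'r::comm_ring_1"
  assumes \<pi>: "\<pi> permutes {0..<n}"
  shows "abelf n (\<lambda>b p c. Y b (\<pi> p) (\<pi> c)) (\<lambda>p c. P (\<pi> p) (\<pi> c)) (\<lambda>p c. Q (\<pi> p) (\<pi> c)) i j =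
    abelf n Y P Q i j"
proof -
  have *: "mixed_det n ((\<lambda>b p c. Y b (\<pi> p) (\<pi> c))(j := unit_row r (\<lambda>c. \<rho> (\<pi> c)))) =
      mixed_det n (Y(j := unit_row (\<pi> r) \<rho>))" for j r \<rho>
  proof -
    have "(\<lambda>b p c. Y b (\<pi> p) (\<pi> c))(j := unit_row r (\<lambda>c. \<rho> (\<pi> c))) =
        (\<lambda>b p c. (Y(j := unit_row (\<pi> r) \<rho>)) b (\<pi> p) (\<pi> c))"
      using permutes_inj[OF \<pi>] by (intro ext) (auto simp: unit_row_def dest: injD)
    then show ?thesis by (simp only: mixed_det_conj[OF \<pi>])
  qed
  have re: "(\<Sum>a<n. f (\<pi> a)) = (\<Sum>a<n. f a)" for f :: "nat \<Rightarrow> 'r"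
    using sum.permute[OF \<pi>, of f] by (simp add: o_def atLeast0LessThan)
  have "abelf n (\<lambda>b p c. Y b (\<pi> p) (\<pi> c)) (\<lambda>p c. P (\<pi> p) (\<pi> c)) (\<lambda>p c. Q (\<pi> p) (\<pi> c)) i j =
      (\<Sum>a<n. \<Sum>r<n. mixed_det n (Y(j := unit_row (\<pi> r) (P (\<pi> a)))) *
        mixed_det n (Y(i := unit_row (\<pi> a) (Q (\<pi> r)))))"
    by (simp add: abelf_def *)
  also have "\<dots> = (\<Sum>a<n. \<Sum>r<n. mixed_det n (Y(j := unit_row r (P (\<pi> a)))) *
        mixed_det n (Y(i := unit_row (\<pi> a) (Q r))))"
    by (intro sum.cong refl re)
  also have "\<dots> = abelf n Y P Q i j" unfolding abelf_def
    by (rule re[of "\<lambda>a. \<Sum>r<n. mixed_det n (Y(j := unit_row r (P a))) * mixed_det n (Y(i := unit_row a (Q r)))"])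
  finally show ?thesis .
qed

text \<open>Every summand contains a mixed determinant formed from \<open>Y\<close> and a row of
  \<open>P\<close>, and this one has two equal columns.\<close>

lemma abelf_equal_columns:
  assumes "c < n" "c' < n" "c \<noteq> c'"
    and "\<And>b r. b < n \<Longrightarrow> r < n \<Longrightarrow> Y b r c = Y b r c'" "\<And>r. r < n \<Longrightarrow> P r c = P r c'"
  shows "abelf n Y P Q i j = 0"
proof -
  have "mixed_det n (Y(j := unit_row r (P a))) = 0" if "a < n" for a r
    by (rule mixed_det_equal_columns[OF assms(1-3)]) (use assms(4,5) that in \<open>auto simp: unit_row_def\<close>)
  then show ?thesis by (simp add: abelf_def)
qed

text \<open>\<open>unit_row r \<rho>\<close> is itself of rank one, the product of a unit vector and
  \<rho>, so both mixed determinants factor. The outer matrices stay arbitrary because the formula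
  is also applied with a \<open>Q\<close> of which nothing is known.\<close>

lemma abelf_rank_one_inner:
  assumes "i < n" "j < n"
  shows "abelf n (\<lambda>b p c. u b p * v b c) P Q i j = (\<Sum>a<n. \<Sum>r<n.
    dt n (u(j := \<lambda>p. if p = r then 1 else 0)) * dt n (v(j := P a)) *
    (dt n (u(i := \<lambda>p. if p = a then 1 else 0)) * dt n (v(i := Q r))))"
proof -
  have "mixed_det n ((\<lambda>b p c. u b p * v b c)(j := unit_row r \<rho>)) =
      dt n (u(j := \<lambda>p. if p = r then 1 else 0)) * dt n (v(j := \<rho>))" for j r \<rho>
    unfolding mixed_det_rank_one[symmetric]
    by (rule arg_cong[of _ _ "mixed_det n"]) (auto simp: fun_eq_iff unit_row_def)
  then show ?thesis by (simp add: abelf_def)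
qed

lemma dt_unit_expand:
  assumes "j < n"
  shows "dt n (w(j := \<rho>)) = (\<Sum>r<n. \<rho> r * dt n (w(j := \<lambda>p. if p = r then 1 else 0)))"
  by (rule dt_linear[OF assms]) (simp add: if_distrib cong: if_cong)

lemma dt_scale: "j < n \<Longrightarrow> dt n (w(j := \<lambda>c. k * \<rho> c)) = k * dt n (w(j := \<rho>))"
  using dt_linear[where j = j and n = n and R = "\<lambda>c. k * \<rho> c" and S = "{0::nat}" and k = "\<lambda>_. k"
      and R' = "\<lambda>_. \<rho>" and w = w] by simp

text \<open>Expanding along the unit vectors turns the sums over \<open>a\<close> and
  \<open>r\<close> into row replacements by \<open>u0\<close> and \<open>u'\<close>. The index
  \<open>i\<close> enters only the first two determinants and \<open>j\<close> only the last two, so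
  the abeliant is again of rank one.\<close>

lemma abelf_rank_one:
  assumes "i < n" "j < n"
  shows "abelf n (\<lambda>b p c. u b p * v b c) (\<lambda>p c. u0 p * v0 c) (\<lambda>p c. u' p * v' c) i j =
    dt n (u(i := u0)) * dt n (v(i := v')) * dt n (u(j := u')) * dt n (v(j := v0))"
  unfolding abelf_rank_one_inner[OF assms] dt_scale[OF assms(1)] dt_scale[OF assms(2)]
    dt_unit_expand[OF assms(1), of u u0] dt_unit_expand[OF assms(2), of u u']
  by (simp add: sum_distrib_left sum_distrib_right mult_ac)

section \<open>The coefficient of the trace polynomial\<close>

lemma st_const_simps:
  "st_const (a + b) = st_const a + st_const b" "st_const (a * b) = st_const a * st_const b"
  "st_const 0 = 0" "st_const 1 = 1" "st_const (- a) = - st_const a"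
  by (simp_all add: st_const_def single_add mult_single single_uminus)

lemma st_const_sum: "st_const (sum f S) = (\<Sum>x\<in>S. st_const (f x))"
  by (induction S rule: infinite_finite_induct) (simp_all add: st_const_simps)

lemma st_const_prod: "st_const (prod f S) = (\<Prod>x\<in>S. st_const (f x))"
  by (induction S rule: infinite_finite_induct) (simp_all add: st_const_simps)

lemma st_const_signof: "st_const (signof \<sigma>) = signof \<sigma>"
  by (simp add: sign_def st_const_simps)

lemma st_var_prod:
  "(\<Prod>x\<in>S. st_var (f x)) = Poly_Mapping.single (\<Sum>x\<in>S. Poly_Mapping.single (f x) 1) 1"
  by (induction S rule: infinite_finite_induct) (simp_all add: st_var_def mult_single)

lemma permutes_ex: "\<tau> permutes {0..<n::nat} \<Longrightarrow> j < n \<Longrightarrow> \<exists>p<n. \<tau> p = j"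
  using permutes_image[of \<tau> "{0..<n}"] by (metis atLeastLessThan_iff imageE zero_le)

text \<open>The determinant with row \<open>r\<close> equal to \<rho> and row \<open>p\<close> taken
  from the matrix numbered \<open>\<beta> p\<close>: one selection of a summand in every generic
  row.\<close>

definition row_coeff :: "nat \<Rightarrow> (nat \<Rightarrow> 'r::comm_ring_1 mat) \<Rightarrow> nat \<Rightarrow> (nat \<Rightarrow> 'r) \<Rightarrow> (nat \<Rightarrow> nat) \<Rightarrow> 'r"
  where "row_coeff n X r \<rho> \<beta> = (\<Sum>\<sigma> | \<sigma> permutes {0..<n}. signof \<sigma> *
    (\<rho> (\<sigma> r) * (\<Prod>p\<in>{0..<n} - {r}. X (\<beta> p) $$ (p, \<sigma> p))))"

text \<open>Replacing row \<open>r\<close> leaves the cofactors along that row unchanged, so the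
  Laplace expansion along it is a scalar product with column \<open>r\<close> of the
  adjugate.\<close>

lemma adj_mat_row:
  fixes A :: "'s::comm_ring_1 mat"
  assumes A: "A \<in> carrier_mat n n" and M: "M \<in> carrier_mat n n" and pr: "p < n" "r < n"
  shows "(M * adj_mat A) $$ (p, r) = det (mat n n (\<lambda>(i, j). if i = r then M $$ (p, j) else A $$ (i, j)))"
proof -
  let ?B = "mat n n (\<lambda>(i, j). if i = r then M $$ (p, j) else A $$ (i, j))"
  have "mat_delete ?B r q = mat_delete A r q" for q
    using A by (intro eq_matI) (auto simp: mat_delete_def)
  then have cof: "cofactor ?B r q = cofactor A r q" for q by (simp add: cofactor_def)
  have "det ?B = (\<Sum>q<n. ?B $$ (r, q) * cofactor ?B r q)"
    by (rule laplace_expansion_row[OF _ pr(2)]) simp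
  also have "\<dots> = (\<Sum>q<n. M $$ (p, q) * cofactor A r q)"
    unfolding cof using pr by (intro sum.cong) auto
  also have "\<dots> = (M * adj_mat A) $$ (p, r)"
    using A M pr adj_mat(1)[OF A] by (simp add: scalar_prod_def adj_mat_def atLeast0LessThan)
  finally show ?thesis by (rule sym)
qed

text \<open>Multilinearity in the rows: \<beta> selects one of the \<open>n\<close> summands for
  each row other than \<open>r\<close>, and the selected variables form the monomial.\<close>

lemma generic_row_det:
  assumes r: "r < n"
  shows "det (mat n n (\<lambda>(i, j). if i = r then st_const (\<rho> j) else generic_sum n v X $$ (i, j))) =
    (\<Sum>\<beta>\<in>PiE ({0..<n} - {r}) (\<lambda>_. {1..n}).
      Poly_Mapping.single (\<Sum>p\<in>{0..<n} - {r}. Poly_Mapping.single (v (\<beta> p)) 1) (row_coeff n X r \<rho> \<beta>))"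
proof -
  let ?I = "{0..<n} - {r}" and ?F = "PiE ({0..<n} - {r}) (\<lambda>_. {1..n})"
  let ?P = "{\<sigma>. \<sigma> permutes {0..<n}}"
  let ?m = "\<lambda>\<beta>. Poly_Mapping.single (\<Sum>p\<in>?I. Poly_Mapping.single (v (\<beta> p)) 1) 1"
  have row: "(\<Prod>p = 0..<n. (\<lambda>(i, j). if i = r then st_const (\<rho> j) else generic_sum n v X $$ (i, j)) (p, \<sigma> p)) =
      (\<Sum>\<beta>\<in>?F. ?m \<beta> * st_const (\<rho> (\<sigma> r) * (\<Prod>p\<in>?I. X (\<beta> p) $$ (p, \<sigma> p))))"
    if \<sigma>: "\<sigma> permutes {0..<n}" for \<sigma>
  proof -
    have "(\<Prod>p = 0..<n. (\<lambda>(i, j). if i = r then st_const (\<rho> j) else generic_sum n v X $$ (i, j)) (p, \<sigma> p)) =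
        st_const (\<rho> (\<sigma> r)) * (\<Prod>p\<in>?I. generic_sum n v X $$ (p, \<sigma> p))"
      using r by (subst prod.remove[of _ r]) (auto intro!: arg_cong2[where f = "(*)"] prod.cong)
    also have "(\<Prod>p\<in>?I. generic_sum n v X $$ (p, \<sigma> p)) =
        (\<Prod>p\<in>?I. \<Sum>b = 1..n. st_var (v b) * st_const (X b $$ (p, \<sigma> p)))"
      by (rule prod.cong) (auto simp: generic_sum_def permutes_lt[OF \<sigma>])
    also have "\<dots> = (\<Sum>\<beta>\<in>?F. \<Prod>p\<in>?I. st_var (v (\<beta> p)) * st_const (X (\<beta> p) $$ (p, \<sigma> p)))"
      by (rule prod_sum_PiE) auto
    also have "\<dots> = (\<Sum>\<beta>\<in>?F. ?m \<beta> * st_const (\<Prod>p\<in>?I. X (\<beta> p) $$ (p, \<sigma> p)))"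
      by (simp add: prod.distrib st_const_prod st_var_prod)
    finally show ?thesis by (simp add: sum_distrib_left st_const_simps mult_ac)
  qed
  have "det (mat n n (\<lambda>(i, j). if i = r then st_const (\<rho> j) else generic_sum n v X $$ (i, j))) =
      (\<Sum>\<sigma>\<in>?P. signof \<sigma> * (\<Sum>\<beta>\<in>?F. ?m \<beta> * st_const (\<rho> (\<sigma> r) * (\<Prod>p\<in>?I. X (\<beta> p) $$ (p, \<sigma> p)))))"
  proof (subst det_def'[of _ n], simp, rule sum.cong[OF refl])
    fix \<sigma> assume "\<sigma> \<in> ?P"
    then have \<sigma>: "\<sigma> permutes {0..<n}" by simp
    have "(\<Prod>i = 0..<n. mat n n (\<lambda>(i, j). if i = r then st_const (\<rho> j) else generic_sum n v X $$ (i, j)) $$ (i, \<sigma> i)) =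
        (\<Prod>p = 0..<n. (\<lambda>(i, j). if i = r then st_const (\<rho> j) else generic_sum n v X $$ (i, j)) (p, \<sigma> p))"
      by (rule prod.cong) (auto simp: permutes_lt[OF \<sigma>])
    then show "signof \<sigma> * (\<Prod>i = 0..<n. mat n n (\<lambda>(i, j). if i = r then st_const (\<rho> j) else generic_sum n v X $$ (i, j)) $$ (i, \<sigma> i)) =
        signof \<sigma> * (\<Sum>\<beta>\<in>?F. ?m \<beta> * st_const (\<rho> (\<sigma> r) * (\<Prod>p\<in>?I. X (\<beta> p) $$ (p, \<sigma> p))))"
      by (simp only: row[OF \<sigma>])
  qed
  also have "\<dots> = (\<Sum>\<beta>\<in>?F. ?m \<beta> * (\<Sum>\<sigma>\<in>?P. st_const (signof \<sigma> * (\<rho> (\<sigma> r) * (\<Prod>p\<in>?I. X (\<beta> p) $$ (p, \<sigma> p))))))"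
    unfolding sum_distrib_left by (subst sum.swap) (simp add: st_const_simps(2) st_const_signof mult_ac)
  also have "\<dots> = (\<Sum>\<beta>\<in>?F. ?m \<beta> * st_const (row_coeff n X r \<rho> \<beta>))"
    by (simp only: row_coeff_def st_const_sum)
  also have "\<dots> = (\<Sum>\<beta>\<in>?F. Poly_Mapping.single (\<Sum>p\<in>?I. Poly_Mapping.single (v (\<beta> p)) 1) (row_coeff n X r \<rho> \<beta>))"
    by (simp add: st_const_def mult_single)
  finally show ?thesis .
qed

text \<open>The condition for the monomial of the selection \<beta> to be the product of all
  variables but the \<open>j\<close>-th: each of the others is selected exactly once. Here
  \<open>j\<close> and the values of \<beta> count from 1, while rows count from 0.\<close>

definition hits_once :: "nat \<Rightarrow> nat \<Rightarrow> nat \<Rightarrow> (nat \<Rightarrow> nat) \<Rightarrow> bool"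
  where "hits_once n r j \<beta> \<longleftrightarrow> (\<forall>b. card {p \<in> {0..<n} - {r}. \<beta> p = b} = (if b \<in> {1..n} - {j} then 1 else 0))"

text \<open>The selections singled out by \<open>hits_once\<close> are the permutations \<tau> with
  \<open>\<tau> r = j\<close>, shifted by one and restricted to the other rows. A permutation with
  another value at \<open>r\<close> contributes zero to the mixed determinant, because it takes a
  zero row from \<open>unit_row r \<rho>\<close>.\<close>

lemma row_coeff_sum:
  assumes r: "r < n" and j: "j < n"
  shows "(\<Sum>\<beta> | \<beta> \<in> PiE ({0..<n} - {r}) (\<lambda>_. {1..n}) \<and> hits_once n r (Suc j) \<beta>. row_coeff n X r \<rho> \<beta>) =
    mixed_det n ((\<lambda>b p c. X (Suc b) $$ (p, c))(j := unit_row r \<rho>))"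
proof -
  let ?I = "{0..<n} - {r}"
  let ?P = "{\<tau>. \<tau> permutes {0..<n}}"
  let ?G = "{\<beta>. \<beta> \<in> PiE ?I (\<lambda>_. {1..n}) \<and> hits_once n r (Suc j) \<beta>}"
  let ?Y = "(\<lambda>b p c. X (Suc b) $$ (p, c))(j := unit_row r \<rho>)"
  have zero: "(\<Prod>p = 0..<n. ?Y (\<tau> p) p (\<sigma> p)) = 0" if t: "\<tau> permutes {0..<n}" "\<tau> r \<noteq> j" for \<tau> \<sigma>
  proof -
    obtain p where p: "p < n" "\<tau> p = j" using j permutes_ex[OF t(1)] by blast
    then have "?Y (\<tau> p) p (\<sigma> p) = 0" using t(2) by (auto simp: unit_row_def)
    then show ?thesis using p(1) by (intro prod_zero bexI[of _ p]) simp_all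
  qed
  have nonzero: "(\<Prod>p = 0..<n. ?Y (\<tau> p) p (\<sigma> p)) =
      \<rho> (\<sigma> r) * (\<Prod>p\<in>?I. X (restrict (\<lambda>p. Suc (\<tau> p)) ?I p) $$ (p, \<sigma> p))"
    if t: "\<tau> permutes {0..<n}" "\<tau> r = j" for \<tau> \<sigma>
  proof -
    have "\<tau> p \<noteq> j" if "p \<noteq> r" for p using permutes_inj[OF t(1)] t(2) that by (auto dest: injD)
    then show ?thesis
      using r t(2) by (subst prod.remove[of _ r]) (auto simp: unit_row_def intro!: arg_cong2[where f = "(*)"] prod.cong)
  qed
  have "mixed_det n ?Y = (\<Sum>\<tau>\<in>?P. if \<tau> r = j then row_coeff n X r \<rho> (restrict (\<lambda>p. Suc (\<tau> p)) ?I) else 0)"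
    unfolding mixed_det_def
  proof (rule sum.cong[OF refl])
    fix \<tau> assume "\<tau> \<in> ?P"
    then have t: "\<tau> permutes {0..<n}" by simp
    show "(\<Sum>\<sigma>\<in>?P. signof \<sigma> * (\<Prod>p = 0..<n. ?Y (\<tau> p) p (\<sigma> p))) =
        (if \<tau> r = j then row_coeff n X r \<rho> (restrict (\<lambda>p. Suc (\<tau> p)) ?I) else 0)"
    proof (cases "\<tau> r = j")
      case True
      show ?thesis by (simp add: nonzero[OF t True] True row_coeff_def del: fun_upd_apply)
    next
      case False
      show ?thesis by (simp only: zero[OF t False] False if_False) simp
    qed
  qed
  also have "\<dots> = (\<Sum>\<tau>\<in>?P \<inter> {\<tau>. \<tau> r = j}. row_coeff n X r \<rho> (restrict (\<lambda>p. Suc (\<tau> p)) ?I))"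
    by (subst sum.If_cases) (simp_all add: finite_permutations)
  also have "\<dots> = (\<Sum>\<beta>\<in>?G. row_coeff n X r \<rho> \<beta>)"
  proof (rule sum.reindex_bij_witness[where j = "\<lambda>\<tau>. restrict (\<lambda>p. Suc (\<tau> p)) ?I"
        and i = "\<lambda>\<beta> p. if p = r then j else if p < n then \<beta> p - 1 else p"], goal_cases)
    case (1 \<tau>)
    then have t: "\<tau> permutes {0..<n}" "\<tau> r = j" by auto
    show ?case
    proof
      fix p show "(if p = r then j else if p < n then restrict (\<lambda>p. Suc (\<tau> p)) ?I p - 1 else p) = \<tau> p"
        using t permutes_not_in[OF t(1), of p] by auto
    qed
  next
    case (2 \<tau>)
    then have t: "\<tau> permutes {0..<n}" "\<tau> r = j" by auto
    have te: "\<tau> p = \<tau> q \<longleftrightarrow> p = q" for p q by (rule inj_eq[OF permutes_inj[OF t(1)]])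
    have "card {p \<in> ?I. restrict (\<lambda>p. Suc (\<tau> p)) ?I p = b} = (if b \<in> {1..n} - {Suc j} then 1 else 0)" for b
    proof (cases "b \<in> {1..n} - {Suc j}")
      case True
      then have "b - 1 < n" "b - 1 \<noteq> j" by auto
      then obtain p where p: "p < n" "\<tau> p = b - 1"
        using permutes_ex[OF t(1)] by blast
      have "{p \<in> ?I. restrict (\<lambda>p. Suc (\<tau> p)) ?I p = b} = {p}"
      proof (intro subset_antisym subsetI)
        fix q assume "q \<in> {p \<in> ?I. restrict (\<lambda>p. Suc (\<tau> p)) ?I p = b}"
        then have "\<tau> q = \<tau> p" using p by auto
        then show "q \<in> {p}" using te by simp
      next
        fix q assume "q \<in> {p}"
        then show "q \<in> {p \<in> ?I. restrict (\<lambda>p. Suc (\<tau> p)) ?I p = b}"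
          using p True t(2) \<open>b - 1 \<noteq> j\<close> by auto
      qed
      then show ?thesis using True by simp
    next
      case False
      have "Suc (\<tau> p) \<noteq> b" if "p < n" "p \<noteq> r" for p
        using False permutes_lt[OF t(1) that(1)] te[of p r] t(2) that(2) by auto
      then have "{p \<in> ?I. restrict (\<lambda>p. Suc (\<tau> p)) ?I p = b} = {}" by auto
      then show ?thesis using False by (simp only: card.empty) simp
    qed
    moreover have "restrict (\<lambda>p. Suc (\<tau> p)) ?I \<in> PiE ?I (\<lambda>_. {1..n})"
      by (intro restrict_PiE_iff[THEN iffD2] ballI) (simp add: Suc_le_eq permutes_lt[OF t(1)])
    ultimately show ?case by (simp add: hits_once_def)
  next
    case (3 \<beta>)
    then have \<beta>: "\<beta> \<in> PiE ?I (\<lambda>_. {1..n})" by simp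
    then have ge: "\<beta> p \<ge> 1" if "p < n" "p \<noteq> r" for p using PiE_mem[OF \<beta>, of p] that by simp
    show ?case
    proof
      fix p show "restrict (\<lambda>p. Suc (if p = r then j else if p < n then \<beta> p - 1 else p)) ?I p = \<beta> p"
        using ge[of p] PiE_arb[OF \<beta>, of p] by (cases "p \<in> ?I") auto
    qed
  next
    \<comment> \<open>\<open>hits_once\<close> makes \<beta> injective and keeps it away from
      \<open>Suc j\<close>, so sending \<open>r\<close> to \<open>j\<close> completes it to a
      permutation.\<close>
    case (4 \<beta>)
    then have b: "\<beta> \<in> PiE ?I (\<lambda>_. {1..n})" and h: "hits_once n r (Suc j) \<beta>" by simp_all
    have mem: "\<beta> p \<in> {1..n}" if "p \<in> ?I" for p using PiE_mem[OF b that] .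
    have ne: "\<beta> p \<noteq> Suc j" if "p \<in> ?I" for p
    proof
      assume "\<beta> p = Suc j"
      then have "p \<in> {p \<in> ?I. \<beta> p = Suc j}" using that by simp
      moreover have "card {p \<in> ?I. \<beta> p = Suc j} = 0" using h by (simp add: hits_once_def)
      moreover have "finite {p \<in> ?I. \<beta> p = Suc j}" by simp
      ultimately show False by (metis (no_types, lifting) card_0_eq empty_iff)
    qed
    have inj: "p = q" if "p \<in> ?I" "q \<in> ?I" "\<beta> p = \<beta> q" for p q
    proof -
      have "card {q \<in> ?I. \<beta> q = \<beta> p} = 1" using h mem[OF that(1)] ne[OF that(1)] by (simp add: hits_once_def)
      then obtain z where "{q \<in> ?I. \<beta> q = \<beta> p} = {z}" by (auto simp: card_1_singleton_iff)
      then show ?thesis using that by (metis (mono_tags, lifting) mem_Collect_eq singletonD)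
    qed
    let ?\<tau> = "\<lambda>p. if p = r then j else if p < n then \<beta> p - 1 else p"
    have "inj_on ?\<tau> {0..<n}"
    proof (rule inj_onI)
      fix p q assume pq: "p \<in> {0..<n}" "q \<in> {0..<n}" "?\<tau> p = ?\<tau> q"
      show "p = q"
      proof (cases "p = r \<or> q = r")
        case True
        then show ?thesis using pq mem[of p] mem[of q] ne[of p] ne[of q] by (auto split: if_splits)
      next
        case False
        then show ?thesis using pq mem[of p] mem[of q] inj[of p q] by (auto split: if_splits)
      qed
    qed
    moreover have "?\<tau> ` {0..<n} \<subseteq> {0..<n}"
      using mem j by (auto split: if_splits) (metis DiffI One_nat_def Suc_pred' atLeastAtMost_iff
        atLeastLessThan_iff le0 less_eq_Suc_le singletonD)
    ultimately have "bij_betw ?\<tau> {0..<n} {0..<n}"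
      unfolding bij_betw_def using endo_inj_surj[OF finite_atLeastLessThan] by blast
    then have "?\<tau> permutes {0..<n}" by (rule bij_imp_permutes) (use r in auto)
    then show ?case by simp
  qed (rule refl)
  finally show ?thesis by (rule sym)
qed

lemma exponent_eq_iff:
  fixes \<beta> \<gamma> :: "nat \<Rightarrow> nat"
  shows "(\<Sum>p\<in>{0..<n} - {r}. Poly_Mapping.single (Inr (\<beta> p) :: nat + nat) (1::nat)) +
      (\<Sum>p\<in>{0..<n} - {a}. Poly_Mapping.single (Inl (\<gamma> p)) 1) = abel_exponent n i j \<longleftrightarrow>
    hits_once n r j \<beta> \<and> hits_once n a i \<gamma>"
proof -
  have sum: "Poly_Mapping.lookup (\<Sum>p\<in>S. Poly_Mapping.single (f p) (1::nat)) x = card {p \<in> S. f p = x}"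
    if "finite S" for S :: "nat set" and f :: "nat \<Rightarrow> nat + nat" and x
    using that by (simp add: lookup_sum lookup_single when_def) (simp add: sum.If_cases Int_def conj_commute)
  let ?L = "(\<Sum>p\<in>{0..<n} - {r}. Poly_Mapping.single (Inr (\<beta> p) :: nat + nat) (1::nat)) +
      (\<Sum>p\<in>{0..<n} - {a}. Poly_Mapping.single (Inl (\<gamma> p)) 1)"
  have L: "Poly_Mapping.lookup ?L (Inl b) = card {p \<in> {0..<n} - {a}. \<gamma> p = b}"
    "Poly_Mapping.lookup ?L (Inr b) = card {p \<in> {0..<n} - {r}. \<beta> p = b}" for b
    by (simp_all add: lookup_add sum sum[unfolded One_nat_def])
  have R: "Poly_Mapping.lookup (abel_exponent n i j) (Inl b) = (if b \<in> {1..n} - {i} then 1 else 0)"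
    "Poly_Mapping.lookup (abel_exponent n i j) (Inr b) = (if b \<in> {1..n} - {j} then 1 else 0)" for b
    by (auto simp: abel_exponent_def lookup_add sum sum[unfolded One_nat_def] conj_commute cong: conj_cong)
  have "?L = abel_exponent n i j \<longleftrightarrow>
      (\<forall>b. Poly_Mapping.lookup ?L (Inl b) = Poly_Mapping.lookup (abel_exponent n i j) (Inl b)) \<and>
      (\<forall>b. Poly_Mapping.lookup ?L (Inr b) = Poly_Mapping.lookup (abel_exponent n i j) (Inr b))"
  proof (intro iffI poly_mapping_eqI)
    fix x
    assume "(\<forall>b. Poly_Mapping.lookup ?L (Inl b) = Poly_Mapping.lookup (abel_exponent n i j) (Inl b)) \<and>
      (\<forall>b. Poly_Mapping.lookup ?L (Inr b) = Poly_Mapping.lookup (abel_exponent n i j) (Inr b))"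
    then show "Poly_Mapping.lookup ?L x = Poly_Mapping.lookup (abel_exponent n i j) x"
      by (cases x) simp_all
  qed simp
  also have "\<dots> \<longleftrightarrow> hits_once n r j \<beta> \<and> hits_once n a i \<gamma>"
    unfolding L R hits_once_def by blast
  finally show ?thesis .
qed

text \<open>The product of the two expansions is a double sum over selections \<beta> for the
  variables t and \<gamma> for the variables s. These variables are disjoint, so the conditions on
  the exponent separate and the double sum factors into two mixed determinants.\<close>

theorem abel_entry:
  fixes X :: "nat \<Rightarrow> 'a::comm_ring_1 mat"
  assumes X: "\<And>l. X l \<in> carrier_mat n n" and ij: "i < n" "j < n"
  shows "abel n X $$ (i, j) = abelf n (\<lambda>b p c. X (Suc b) $$ (p, c)) (\<lambda>p c. X 0 $$ (p, c))
    (\<lambda>p c. X (Suc n) $$ (p, c)) i j"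
proof -
  let ?e = "abel_exponent n (i + 1) (j + 1)"
  let ?T = "generic_sum n Inr X" and ?S = "generic_sum n Inl X"
  let ?A = "map_mat st_const (X 0)" and ?B = "map_mat st_const (X (n + 1))"
  have c: "?T \<in> carrier_mat n n" "?S \<in> carrier_mat n n" "?A \<in> carrier_mat n n" "?B \<in> carrier_mat n n"
    using X by (auto simp: generic_sum_def)
  note a = adj_mat(1)[OF c(1)] adj_mat(1)[OF c(2)]
  have AT: "(?A * adj_mat ?T) $$ (p, r) =
      det (mat n n (\<lambda>(i, j). if i = r then st_const (X 0 $$ (p, j)) else ?T $$ (i, j)))" if "p < n" "r < n" for p r
    unfolding adj_mat_row[OF c(1,3) that]
    by (rule arg_cong[of _ _ det], rule eq_matI) (use X[of 0] that in auto)
  have BS: "(?B * adj_mat ?S) $$ (r, p) =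
      det (mat n n (\<lambda>(i, j). if i = p then st_const (X (n + 1) $$ (r, j)) else ?S $$ (i, j)))" if "p < n" "r < n" for p r
    unfolding adj_mat_row[OF c(2,4) that(2,1)]
    by (rule arg_cong[of _ _ det], rule eq_matI) (use X[of "n + 1"] that in auto)
  have "trace_mat (?A * adj_mat ?T * ?B * adj_mat ?S) = trace_mat ((?A * adj_mat ?T) * (?B * adj_mat ?S))"
    using c a by (subst assoc_mult_mat[of _ n n _ n _ n]) auto
  also have "\<dots> = (\<Sum>p<n. \<Sum>r<n. (?A * adj_mat ?T) $$ (p, r) * (?B * adj_mat ?S) $$ (r, p))"
  proof -
    have trm: "trace_mat (M * N) = (\<Sum>p<n. \<Sum>r<n. M $$ (p, r) * N $$ (r, p))"
      if "M \<in> carrier_mat n n" "N \<in> carrier_mat n n" for M N :: "'a st_poly mat"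
      using that by (simp add: trace_mat_def scalar_prod_def atLeast0LessThan)
    show ?thesis
      by (rule trm; rule mult_carrier_mat) (use c a in auto)
  qed
  finally have tr: "trace_mat (?A * adj_mat ?T * ?B * adj_mat ?S) =
      (\<Sum>p<n. \<Sum>r<n. (?A * adj_mat ?T) $$ (p, r) * (?B * adj_mat ?S) $$ (r, p))" .
  have entry: "Poly_Mapping.lookup ((?A * adj_mat ?T) $$ (p, r) * (?B * adj_mat ?S) $$ (r, p)) ?e =
      mixed_det n ((\<lambda>b p c. X (Suc b) $$ (p, c))(j := unit_row r (\<lambda>c. X 0 $$ (p, c)))) *
      mixed_det n ((\<lambda>b p c. X (Suc b) $$ (p, c))(i := unit_row p (\<lambda>c. X (Suc n) $$ (r, c))))"
    if pr: "p < n" "r < n" for p r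
  proof -
    let ?F = "\<lambda>r. PiE ({0..<n} - {r}) (\<lambda>_. {1..n})"
    have fin: "finite (?F r)" for r by (intro finite_PiE) auto
    have "Poly_Mapping.lookup ((?A * adj_mat ?T) $$ (p, r) * (?B * adj_mat ?S) $$ (r, p)) ?e =
        (\<Sum>\<beta>\<in>?F r. \<Sum>\<gamma>\<in>?F p. if hits_once n r (Suc j) \<beta> \<and> hits_once n p (Suc i) \<gamma> then
          row_coeff n X r (\<lambda>c. X 0 $$ (p, c)) \<beta> * row_coeff n X p (\<lambda>c. X (Suc n) $$ (r, c)) \<gamma> else 0)"
      unfolding AT[OF pr] BS[OF pr] generic_row_det[OF pr(1)] generic_row_det[OF pr(2)]
      by (simp add: sum_product mult_single lookup_sum lookup_single when_def exponent_eq_iff[unfolded One_nat_def])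
    also have "\<dots> = (\<Sum>\<beta>\<in>?F r. \<Sum>\<gamma>\<in>?F p.
        (if hits_once n r (Suc j) \<beta> then row_coeff n X r (\<lambda>c. X 0 $$ (p, c)) \<beta> else 0) *
        (if hits_once n p (Suc i) \<gamma> then row_coeff n X p (\<lambda>c. X (Suc n) $$ (r, c)) \<gamma> else 0))"
      by (intro sum.cong refl) auto
    also have "\<dots> = (\<Sum>\<beta>\<in>?F r. if hits_once n r (Suc j) \<beta> then row_coeff n X r (\<lambda>c. X 0 $$ (p, c)) \<beta> else 0) *
        (\<Sum>\<gamma>\<in>?F p. if hits_once n p (Suc i) \<gamma> then row_coeff n X p (\<lambda>c. X (Suc n) $$ (r, c)) \<gamma> else 0)"
      by (simp only: sum_product)
    finally show ?thesis
      unfolding row_coeff_sum[OF pr(2) ij(2), symmetric] row_coeff_sum[OF pr(1) ij(1), symmetric]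
        sum.inter_filter[OF fin] .
  qed
  have "abel n X $$ (i, j) = Poly_Mapping.lookup (trace_mat (?A * adj_mat ?T * ?B * adj_mat ?S)) ?e"
    unfolding abel_def by (simp only: index_mat(1)[OF ij] case_prod_conv)
  also have "\<dots> = (\<Sum>p<n. \<Sum>r<n. Poly_Mapping.lookup ((?A * adj_mat ?T) $$ (p, r) * (?B * adj_mat ?S) $$ (r, p)) ?e)"
    by (simp only: tr lookup_sum)
  also have "\<dots> = abelf n (\<lambda>b p c. X (Suc b) $$ (p, c)) (\<lambda>p c. X 0 $$ (p, c)) (\<lambda>p c. X (Suc n) $$ (p, c)) i j"
    unfolding abelf_def by (intro sum.cong refl entry) simp_all
  finally show ?thesis .
qed

section \<open>Points of a finitely generated domain\<close>

text \<open>Over a finite field the product of all \<open>x - a\<close>, increased by 1, has no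
  root.\<close>

lemma infinite_alg_closed_field: "infinite (UNIV :: 'k::alg_closed_field set)"
proof
  assume fin: "finite (UNIV :: 'k set)"
  define p :: "'k poly" where "p = (\<Prod>a\<in>UNIV. [:- a, 1:])"
  have "degree p = card (UNIV :: 'k set)"
    unfolding p_def by (subst degree_prod_sum_eq) auto
  then have "degree p > 0" using fin by (simp add: finite_UNIV_card_ge_0)
  then have "degree (p + 1) > 0" using degree_add_eq_left[of 1 p] by simp
  then obtain x where x: "poly (p + 1) x = 0" using alg_closed_imp_poly_has_root by blast
  have "poly p x = 0" unfolding p_def poly_prod using fin by (intro prod_zero) auto
  then show False using x by simp
qed

text \<open>Polynomials over a subring are represented inside the polynomials over the ambient ring,
  because \<open>R\<close> is only a set.\<close>

definition coeffs_in :: "'a::comm_ring_1 set \<Rightarrow> 'a poly set"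
  where "coeffs_in R = {p. \<forall>i. coeff p i \<in> R}"

definition alg_subring :: "'a::k_domain set \<Rightarrow> bool"
  where "alg_subring R \<longleftrightarrow> base_field \<subseteq> R \<and> (\<forall>x\<in>R. \<forall>y\<in>R. x - y \<in> R \<and> x * y \<in> R)"

text \<open>A \<open>k\<close>-algebra homomorphism from \<open>R\<close> to \<open>k\<close>, given
  by a total function of which only the values on \<open>R\<close> matter.\<close>

definition point_on :: "'a::k_domain set \<Rightarrow> ('a \<Rightarrow> 'a base) \<Rightarrow> bool"
  where "point_on R \<chi> \<longleftrightarrow> (\<forall>x\<in>R. \<forall>y\<in>R. \<chi> (x + y) = \<chi> x + \<chi> y \<and> \<chi> (x * y) = \<chi> x * \<chi> y) \<and>
    (\<forall>c. \<chi> (of_base c) = c)"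

context
  fixes R :: "'a::k_domain set"
  assumes R: "alg_subring R"
begin

lemma R_base: "of_base c \<in> R" using R of_base[of c] by (auto simp: alg_subring_def)
lemma R_0: "0 \<in> R" using R_base[of 0] by simp
lemma R_1: "1 \<in> R" using R_base[of 1] by simp
lemma R_diff: "x \<in> R \<Longrightarrow> y \<in> R \<Longrightarrow> x - y \<in> R" using R by (auto simp: alg_subring_def)
lemma R_mult: "x \<in> R \<Longrightarrow> y \<in> R \<Longrightarrow> x * y \<in> R" using R by (auto simp: alg_subring_def)
lemma R_uminus: "x \<in> R \<Longrightarrow> - x \<in> R" using R_diff[OF R_0] by fastforce
lemma R_add: "x \<in> R \<Longrightarrow> y \<in> R \<Longrightarrow> x + y \<in> R" using R_diff[of x "- y"] R_uminus by fastforce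
lemma R_sum: "(\<And>i. i \<in> S \<Longrightarrow> f i \<in> R) \<Longrightarrow> sum f S \<in> R"
  by (induction S rule: infinite_finite_induct) (auto intro: R_add R_0)
lemma R_power: "x \<in> R \<Longrightarrow> x ^ m \<in> R" by (induction m) (auto intro: R_mult R_1)

lemma coeffs_in_diff: "p \<in> coeffs_in R \<Longrightarrow> q \<in> coeffs_in R \<Longrightarrow> p - q \<in> coeffs_in R"
  by (simp add: coeffs_in_def R_diff)
lemma coeffs_in_add: "p \<in> coeffs_in R \<Longrightarrow> q \<in> coeffs_in R \<Longrightarrow> p + q \<in> coeffs_in R"
  by (simp add: coeffs_in_def R_add)
lemma coeffs_in_mult: "p \<in> coeffs_in R \<Longrightarrow> q \<in> coeffs_in R \<Longrightarrow> p * q \<in> coeffs_in R"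
  by (simp add: coeffs_in_def coeff_mult R_sum R_mult)
lemma coeffs_in_monom: "a \<in> R \<Longrightarrow> monom a m \<in> coeffs_in R"
  by (simp add: coeffs_in_def R_0)
lemma coeffs_in_const: "a \<in> R \<Longrightarrow> [:a:] \<in> coeffs_in R"
  using coeffs_in_monom[of a 0] by (simp add: monom_0)
lemma coeffs_in_0: "0 \<in> coeffs_in R" by (simp add: coeffs_in_def R_0)

text \<open>The leading coefficient of \<open>g\<close> need not be invertible in \<open>R\<close>,
  so each reduction step costs one multiplication by it. The induction measure separates the zero
  polynomial from the nonzero constants.\<close>

lemma pseudo_division:
  assumes g: "g \<in> coeffs_in R" "g \<noteq> 0" and p: "p \<in> coeffs_in R"
  shows "\<exists>m. \<exists>q\<in>coeffs_in R. \<exists>r\<in>coeffs_in R.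
    [:lead_coeff g ^ m:] * p = q * g + r \<and> (r = 0 \<or> degree r < degree g)"
  using p
proof (induction "if p = 0 then 0 else Suc (degree p)" arbitrary: p rule: less_induct)
  case less
  show ?case
  proof (cases "p = 0 \<or> degree p < degree g")
    case True
    then have "[:lead_coeff g ^ 0:] * p = 0 * g + p" by simp
    then show ?thesis using True less.prems coeffs_in_0 by blast
  next
    case False
    then have p0: "p \<noteq> 0" and dg: "degree g \<le> degree p" by auto
    define s where "s = monom (lead_coeff p) (degree p - degree g)"
    define p' where "p' = [:lead_coeff g:] * p - s * g"
    have lg: "lead_coeff g \<in> R" and lp: "lead_coeff p \<in> R"
      using g(1) less.prems by (auto simp: coeffs_in_def)
    have sR: "s \<in> coeffs_in R" unfolding s_def by (rule coeffs_in_monom[OF lp])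
    have p'R: "p' \<in> coeffs_in R" unfolding p'_def
      by (intro coeffs_in_diff coeffs_in_mult coeffs_in_const lg less.prems sR g(1))
    have sg: "degree (s * g) = degree p" "lead_coeff (s * g) = lead_coeff p * lead_coeff g"
      using p0 g(2) dg lead_coeff_mult[of s g] unfolding s_def
      by (auto simp: degree_mult_eq degree_monom_eq)
    have lt: "(if p' = 0 then 0 else Suc (degree p')) < (if p = 0 then 0 else Suc (degree p))"
    proof (cases "p' = 0")
      case False
      have "degree p' \<le> degree p" unfolding p'_def
        by (rule degree_diff_le) (use sg(1) in \<open>auto intro: order_trans[OF degree_smult_le]\<close>)
      moreover have "coeff p' (degree p) = 0"
        using sg unfolding p'_def by (simp add: mult.commute)
      ultimately have "degree p' < degree p"
        using False by (metis le_neq_implies_less leading_coeff_0_iff)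
      then show ?thesis using p0 False by simp
    qed (simp add: p0)
    obtain m q r where qr: "q \<in> coeffs_in R" "r \<in> coeffs_in R"
      "[:lead_coeff g ^ m:] * p' = q * g + r" "r = 0 \<or> degree r < degree g"
      using less.hyps[OF lt p'R] by blast
    have "[:lead_coeff g ^ Suc m:] * p = [:lead_coeff g ^ m:] * ([:lead_coeff g:] * p)" by (simp add: mult.commute)
    also have "\<dots> = [:lead_coeff g ^ m:] * (p' + s * g)" by (simp add: p'_def)
    also have "\<dots> = [:lead_coeff g ^ m:] * p' + [:lead_coeff g ^ m:] * (s * g)" by (rule distrib_left)
    also have "\<dots> = (q + [:lead_coeff g ^ m:] * s) * g + r" unfolding qr(3) by (simp add: algebra_simps)
    finally have "[:lead_coeff g ^ Suc m:] * p = (q + [:lead_coeff g ^ m:] * s) * g + r" .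
    moreover have "q + [:lead_coeff g ^ m:] * s \<in> coeffs_in R"
      by (intro coeffs_in_add coeffs_in_mult coeffs_in_const R_power lg sR qr)
    ultimately show ?thesis using qr by blast
  qed
qed

context
  fixes \<chi> :: "'a \<Rightarrow> 'a base"
  assumes \<chi>: "point_on R \<chi>"
begin

lemma point_simps:
  "x \<in> R \<Longrightarrow> y \<in> R \<Longrightarrow> \<chi> (x + y) = \<chi> x + \<chi> y" "x \<in> R \<Longrightarrow> y \<in> R \<Longrightarrow> \<chi> (x * y) = \<chi> x * \<chi> y"
  "\<chi> (of_base c) = c"
  using \<chi> by (auto simp: point_on_def)

lemma point_0: "\<chi> 0 = 0" and point_1: "\<chi> 1 = 1"
  using point_simps(3)[of 0] point_simps(3)[of 1] by simp_all

lemma point_sum: "(\<And>i. i \<in> S \<Longrightarrow> f i \<in> R) \<Longrightarrow> \<chi> (sum f S) = (\<Sum>i\<in>S. \<chi> (f i))"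
  by (induction S rule: infinite_finite_induct) (auto simp: point_0 point_simps R_sum)

lemma map_poly_add: "p \<in> coeffs_in R \<Longrightarrow> q \<in> coeffs_in R \<Longrightarrow>
    map_poly \<chi> (p + q) = map_poly \<chi> p + map_poly \<chi> q"
  by (rule poly_eqI) (auto simp: coeff_map_poly point_0 point_simps coeffs_in_def)

lemma map_poly_mult: "p \<in> coeffs_in R \<Longrightarrow> q \<in> coeffs_in R \<Longrightarrow>
    map_poly \<chi> (p * q) = map_poly \<chi> p * map_poly \<chi> q"
  by (rule poly_eqI)
    (auto simp: coeff_map_poly point_0 point_simps coeffs_in_def coeff_mult point_sum R_mult)

lemma map_poly_const: "map_poly \<chi> [:a:] = [:\<chi> a:]"
  by (rule poly_eqI) (auto simp: coeff_map_poly point_0 coeff_pCons split: nat.split)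

text \<open>Evaluation at \<open>x\<close> maps the polynomials over \<open>R\<close> onto
  \<open>R[x]\<close>, and the homomorphism sending the variable to \<xi> descends along it as soon
  as all relations of \<open>x\<close> hold at \<xi>.\<close>

lemma point_extend:
  assumes wd: "\<And>p. p \<in> coeffs_in R \<Longrightarrow> poly p x = 0 \<Longrightarrow> poly (map_poly \<chi> p) \<xi> = 0"
  shows "\<exists>\<psi>. point_on {poly p x |p. p \<in> coeffs_in R} \<psi> \<and>
    (\<forall>p\<in>coeffs_in R. \<psi> (poly p x) = poly (map_poly \<chi> p) \<xi>)"
proof -
  define \<psi> where "\<psi> y = poly (map_poly \<chi> (SOME p. p \<in> coeffs_in R \<and> poly p x = y)) \<xi>" for y
  have \<psi>: "\<psi> (poly p x) = poly (map_poly \<chi> p) \<xi>" if p: "p \<in> coeffs_in R" for p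
  proof -
    define q where "q = (SOME q. q \<in> coeffs_in R \<and> poly q x = poly p x)"
    have q: "q \<in> coeffs_in R \<and> poly q x = poly p x"
      unfolding q_def by (rule someI[of _ p]) (use p in auto)
    have "poly (map_poly \<chi> (q - p)) \<xi> = 0" by (rule wd) (use q p coeffs_in_diff in auto)
    moreover have "map_poly \<chi> q = map_poly \<chi> (q - p) + map_poly \<chi> p"
      using map_poly_add[of "q - p" p] q p coeffs_in_diff by simp
    ultimately show ?thesis unfolding \<psi>_def q_def[symmetric] by simp
  qed
  have "point_on {poly p x |p. p \<in> coeffs_in R} \<psi>"
    unfolding point_on_def
  proof (intro conjI ballI allI)
    fix y z assume "y \<in> {poly p x |p. p \<in> coeffs_in R}" "z \<in> {poly p x |p. p \<in> coeffs_in R}"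
    then obtain p q where pq: "p \<in> coeffs_in R" "q \<in> coeffs_in R" "y = poly p x" "z = poly q x" by blast
    show "\<psi> (y + z) = \<psi> y + \<psi> z"
      using \<psi>[OF coeffs_in_add[OF pq(1,2)]] by (simp add: pq \<psi> map_poly_add)
    show "\<psi> (y * z) = \<psi> y * \<psi> z"
      using \<psi>[OF coeffs_in_mult[OF pq(1,2)]] by (simp add: pq \<psi> map_poly_mult)
  next
    fix c :: "'a base"
    show "\<psi> (of_base c) = c"
      using \<psi>[OF coeffs_in_const[OF R_base[of c]]] by (simp add: map_poly_const point_simps)
  qed
  then show ?thesis using \<psi> by blast
qed

end

text \<open>The weak Nullstellensatz is proved by adjoining one generator \<open>x\<close> at a time.\<close>

lemma points_adjoin:
  assumes good: "\<And>b. b \<in> R \<Longrightarrow> b \<noteq> 0 \<Longrightarrow> \<exists>\<chi>. point_on R \<chi> \<and> \<chi> b \<noteq> 0"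
    and b: "b \<in> {poly p x |p. p \<in> coeffs_in R}" "b \<noteq> 0"
  shows "\<exists>\<psi>. point_on {poly p x |p. p \<in> coeffs_in R} \<psi> \<and> \<psi> b \<noteq> 0"
proof (cases "\<exists>p\<in>coeffs_in R. p \<noteq> 0 \<and> poly p x = 0")
  \<comment> \<open>\<open>x\<close> is transcendental over \<open>R\<close>, so every value \<xi>
    extends \<chi>; only the finitely many zeros of the image of \<open>p\<close> are
    excluded.\<close>
  case False
  obtain p where p: "p \<in> coeffs_in R" "b = poly p x" using b(1) by blast
  then have "p \<noteq> 0" using b(2) by auto
  then have "lead_coeff p \<noteq> 0" "lead_coeff p \<in> R" using p(1) by (auto simp: coeffs_in_def)
  then obtain \<chi> where \<chi>: "point_on R \<chi>" "\<chi> (lead_coeff p) \<noteq> 0" using good by blast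
  have "map_poly \<chi> p \<noteq> 0"
    using \<chi>(2) coeff_map_poly[of \<chi> p "degree p"] point_0[OF \<chi>(1)] by auto
  then have "finite {\<xi>. poly (map_poly \<chi> p) \<xi> = 0}" by (rule poly_roots_finite)
  moreover have "infinite (UNIV :: 'a base set)" by (rule infinite_alg_closed_field)
  ultimately obtain \<xi> where \<xi>: "poly (map_poly \<chi> p) \<xi> \<noteq> 0"
    by (metis (mono_tags, lifting) ex_new_if_finite mem_Collect_eq)
  have "poly (map_poly \<chi> q) \<xi> = 0" if "q \<in> coeffs_in R" "poly q x = 0" for q
    using False that by auto
  then obtain \<psi> where \<psi>: "point_on {poly p x |p. p \<in> coeffs_in R} \<psi>"
    "\<And>p. p \<in> coeffs_in R \<Longrightarrow> \<psi> (poly p x) = poly (map_poly \<chi> p) \<xi>"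
    using point_extend[OF \<chi>(1), of x \<xi>] by blast
  have "\<psi> b \<noteq> 0" using \<psi>(2)[OF p(1)] p(2) \<xi> by simp
  then show ?thesis using \<psi>(1) by blast
next
  case True
  let ?Z = "\<lambda>p. p \<in> coeffs_in R \<and> p \<noteq> 0 \<and> poly p x = 0"
  obtain p0 where "?Z p0" using True by blast
  define f where "f = arg_min degree ?Z"
  have "?Z f" unfolding f_def by (rule arg_min_natI[of ?Z, OF \<open>?Z p0\<close>])
  then have f: "f \<in> coeffs_in R" "f \<noteq> 0" "poly f x = 0" by auto
  have f_min: "degree f \<le> degree p" if "p \<in> coeffs_in R" "p \<noteq> 0" "poly p x = 0" for p
    unfolding f_def by (rule arg_min_nat_le[of ?Z]) (use that in simp)
  have df: "degree f > 0"
  proof (rule ccontr)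
    assume "\<not> degree f > 0"
    then obtain a where "f = [:a:]" using degree_eq_zeroE by blast
    then show False using f by auto
  qed
  \<comment> \<open>These polynomials represent the nonzero multiples of \<open>b\<close> in
    \<open>R[x]\<close>. One of least degree turns out to be a constant \<open>c\<close>, and a
    point that does not kill \<open>c\<close> cannot kill \<open>b\<close>.\<close>
  let ?J = "\<lambda>q. q \<in> coeffs_in R \<and> poly q x \<noteq> 0 \<and> (\<exists>v\<in>coeffs_in R. poly q x = poly v x * b)"
  obtain p where p: "p \<in> coeffs_in R" "b = poly p x" using b(1) by blast
  have "?J p" using p b(2) coeffs_in_const[OF R_1] by (auto intro!: bexI[of _ "[:1:]"])
  define g where "g = arg_min degree ?J"
  have g: "?J g" unfolding g_def by (rule arg_min_natI[of ?J, OF \<open>?J p\<close>])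
  have g_min: "degree g \<le> degree q" if "?J q" for q
    unfolding g_def by (rule arg_min_nat_le[of ?J, OF that])
  have g0: "g \<noteq> 0" using g by auto
  have lgR: "lead_coeff g \<in> R" and lfR: "lead_coeff f \<in> R" using f g by (auto simp: coeffs_in_def)
  have "degree g = 0"
  proof (rule ccontr)
    assume dg: "degree g \<noteq> 0"
    \<comment> \<open>The pseudo-remainder of \<open>g\<close> modulo \<open>f\<close> lies again in
      the class \<open>?J\<close>.\<close>
    have dgf: "degree g \<le> degree f"
    proof -
      obtain m q r where qr: "q \<in> coeffs_in R" "r \<in> coeffs_in R"
        "[:lead_coeff f ^ m:] * g = q * f + r" "r = 0 \<or> degree r < degree f"
        using pseudo_division[of f g] f g by blast
      have "poly ([:lead_coeff f ^ m:] * g) x = poly (q * f + r) x" by (simp only: qr(3))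
      then have e: "lead_coeff f ^ m * poly g x = poly r x" using f(3) by simp
      obtain v where v: "v \<in> coeffs_in R" "poly g x = poly v x * b" using g by blast
      have "poly r x = poly ([:lead_coeff f ^ m:] * v) x * b" using e v by (simp add: mult.assoc)
      moreover have "[:lead_coeff f ^ m:] * v \<in> coeffs_in R"
        by (intro coeffs_in_mult coeffs_in_const R_power lfR v(1))
      moreover have "poly r x \<noteq> 0" using e g f(2) by (metis leading_coeff_0_iff mult_eq_0_iff power_not_zero)
      ultimately have "degree g \<le> degree r" using g_min qr(2) by blast
      moreover have "r \<noteq> 0" using \<open>poly r x \<noteq> 0\<close> by auto
      ultimately show ?thesis using qr(4) by simp
    qed
    obtain m s r where sr: "s \<in> coeffs_in R" "r \<in> coeffs_in R"
      "[:lead_coeff g ^ m:] * f = s * g + r" "r = 0 \<or> degree r < degree g"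
      using pseudo_division[of g f] f g g0 by blast
    have "poly ([:lead_coeff g ^ m:] * f) x = poly (s * g + r) x" by (simp only: sr(3))
    then have e: "poly r x = - poly s x * poly g x" using f(3) by (simp add: eq_neg_iff_add_eq_0 add.commute)
    \<comment> \<open>By \<open>e\<close> the value of \<open>r\<close> at \<open>x\<close> is a
      multiple of \<open>b\<close>. A nonzero remainder would contradict the minimality of
      \<open>g\<close>, or that of \<open>f\<close> if its value vanished.\<close>
    have r0: "r = 0"
    proof (rule ccontr)
      assume "r \<noteq> 0"
      then have lt: "degree r < degree g" using sr(4) by simp
      then have "poly r x \<noteq> 0" using f_min[OF sr(2) \<open>r \<noteq> 0\<close>] dgf by auto
      moreover obtain v where v: "v \<in> coeffs_in R" "poly g x = poly v x * b" using g by blast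
      have "poly r x = poly (0 - s * v) x * b" using e v by (simp add: mult.assoc)
      moreover have "0 - s * v \<in> coeffs_in R" by (intro coeffs_in_diff coeffs_in_mult coeffs_in_0 sr(1) v(1))
      ultimately have "degree g \<le> degree r" using g_min sr(2) by blast
      then show False using lt by simp
    qed
    have s0: "s \<noteq> 0" using sr(3) r0 f(2) g0 by auto
    \<comment> \<open>Now \<open>s\<close> is a nonzero relation of \<open>x\<close> whose degree
      falls short of that of \<open>f\<close> by the degree of \<open>g\<close>, against the choice
      of \<open>f\<close>.\<close>
    have "poly s x = 0" using e r0 g by simp
    then have "degree f \<le> degree s" using f_min[OF sr(1) s0] by simp
    moreover have "degree f = degree s + degree g"
    proof -
      have "smult (lead_coeff g ^ m) f = s * g" using sr(3) r0 by simp
      then have "degree (smult (lead_coeff g ^ m) f) = degree (s * g)" by (rule arg_cong)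
      then show ?thesis using g0 degree_mult_eq[OF s0 g0] by simp
    qed
    ultimately show False using dg by simp
  qed
  then obtain c where c: "g = [:c:]" using degree_eq_zeroE by blast
  obtain v where v: "v \<in> coeffs_in R" "c = poly v x * b" using g c by auto
  have c0: "c \<noteq> 0" "c \<in> R" using g c lgR by auto
  \<comment> \<open>A nonzero image of \<open>c\<close> keeps \<open>b\<close> alive. A nonzero
    image of the leading coefficient of \<open>f\<close> keeps the image of \<open>f\<close>
    nonconstant, so that it has a root, and lets every relation of \<open>x\<close> be divided by
    \<open>f\<close>.\<close>
  have "c * lead_coeff f \<noteq> 0" "c * lead_coeff f \<in> R" using c0 f(2) lfR R_mult by auto
  then obtain \<chi> where \<chi>: "point_on R \<chi>" "\<chi> (c * lead_coeff f) \<noteq> 0" using good by blast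
  have \<chi>c: "\<chi> c \<noteq> 0" "\<chi> (lead_coeff f) \<noteq> 0"
    using \<chi> point_simps(2)[OF \<chi>(1) c0(2) lfR] by auto
  have "coeff (map_poly \<chi> f) (degree f) \<noteq> 0"
    using \<chi>c(2) coeff_map_poly[of \<chi> f "degree f"] point_0[OF \<chi>(1)] by simp
  then have "degree (map_poly \<chi> f) > 0" using le_degree df by fastforce
  then obtain \<xi> where \<xi>: "poly (map_poly \<chi> f) \<xi> = 0"
    using alg_closed_imp_poly_has_root[of "map_poly \<chi> f"] df by auto
  have "poly (map_poly \<chi> q) \<xi> = 0" if q: "q \<in> coeffs_in R" "poly q x = 0" for q
  proof -
    obtain m s r where sr: "s \<in> coeffs_in R" "r \<in> coeffs_in R"
      "[:lead_coeff f ^ m:] * q = s * f + r" "r = 0 \<or> degree r < degree f"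
      using pseudo_division[of f q] f q by blast
    have "poly ([:lead_coeff f ^ m:] * q) x = poly (s * f + r) x" by (simp only: sr(3))
    then have "poly r x = 0" using f(3) q(2) by simp
    then have "r = 0" using f_min[OF sr(2)] sr(4) by fastforce
    have lm: "[:lead_coeff f ^ m:] \<in> coeffs_in R" by (intro coeffs_in_const R_power lfR)
    have pw: "\<chi> (lead_coeff f ^ m) = \<chi> (lead_coeff f) ^ m"
      by (induction m) (auto simp: point_1[OF \<chi>(1)] point_simps(2)[OF \<chi>(1)] lfR R_power)
    have "map_poly \<chi> ([:lead_coeff f ^ m:] * q) = map_poly \<chi> (s * f)" using sr(3) \<open>r = 0\<close> by simp
    then have "[:\<chi> (lead_coeff f) ^ m:] * map_poly \<chi> q = map_poly \<chi> s * map_poly \<chi> f"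
      unfolding map_poly_mult[OF \<chi>(1) lm q(1)] map_poly_mult[OF \<chi>(1) sr(1) f(1)]
        map_poly_const[OF \<chi>(1)] pw .
    then have "poly ([:\<chi> (lead_coeff f) ^ m:] * map_poly \<chi> q) \<xi> = poly (map_poly \<chi> s * map_poly \<chi> f) \<xi>"
      by (simp only:)
    then show ?thesis using \<xi> \<chi>c by simp
  qed
  then obtain \<psi> where \<psi>: "point_on {poly p x |p. p \<in> coeffs_in R} \<psi>"
    "\<And>p. p \<in> coeffs_in R \<Longrightarrow> \<psi> (poly p x) = poly (map_poly \<chi> p) \<xi>"
    using point_extend[OF \<chi>(1), of x \<xi>] by blast
  have "\<psi> c = \<chi> c" using \<psi>(2)[OF coeffs_in_const[OF c0(2)]] by (simp add: map_poly_const[OF \<chi>(1)])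
  moreover have "\<psi> c = \<psi> (poly v x) * \<psi> b"
    using \<psi>(1) v b(1) unfolding point_on_def by blast
  ultimately have "\<psi> b \<noteq> 0" using \<chi>c by auto
  then show ?thesis using \<psi>(1) by blast
qed

end

lemma alg_subring_generated: "alg_subring (subring_generated (base_field \<union> S) :: 'a::k_domain set)"
  by (auto simp: alg_subring_def intro: subring_generated.intros)

lemma subring_generated_insert:
  fixes R :: "'a::k_domain set"
  assumes R: "R = subring_generated (base_field \<union> S)"
  shows "subring_generated (base_field \<union> insert x S) = {poly p x |p. p \<in> coeffs_in R}" (is "?A = ?B")
proof
  note R' = alg_subring_generated[of S, folded R]
  show "?A \<subseteq> ?B"
  proof
    fix y assume "y \<in> ?A"
    then show "y \<in> ?B"
    proof (induction rule: subring_generated.induct)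
      case (incl y)
      show ?case
      proof (cases "y = x")
        case True
        then have "y = poly (monom 1 1) x" by (simp add: poly_monom)
        then show ?thesis using coeffs_in_monom[OF R' R_1[OF R']] by blast
      next
        case False
        then have "y \<in> R" using incl R by (auto intro: subring_generated.incl)
        then have "[:y:] \<in> coeffs_in R" by (rule coeffs_in_const[OF R'])
        moreover have "y = poly [:y:] x" by simp
        ultimately show ?thesis by blast
      qed
    next
      case one
      have "[:1:] \<in> coeffs_in R" by (rule coeffs_in_const[OF R' R_1[OF R']])
      moreover have "1 = poly [:1:] x" by simp
      ultimately show ?case by blast
    next
      case (diff y z)
      then obtain p q where "p \<in> coeffs_in R" "q \<in> coeffs_in R" "y = poly p x" "z = poly q x" by blast
      moreover have "poly p x - poly q x = poly (p - q) x" by simp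
      ultimately show ?case using coeffs_in_diff[OF R', of p q] by blast
    next
      case (mult y z)
      then obtain p q where "p \<in> coeffs_in R" "q \<in> coeffs_in R" "y = poly p x" "z = poly q x" by blast
      moreover have "poly p x * poly q x = poly (p * q) x" by simp
      ultimately show ?case using coeffs_in_mult[OF R', of p q] by blast
    qed
  qed
  show "?B \<subseteq> ?A"
  proof
    fix y assume "y \<in> ?B"
    then obtain p where p: "p \<in> coeffs_in R" "y = poly p x" by blast
    note A' = alg_subring_generated[of "insert x S"]
    have sub: "R \<subseteq> ?A"
    proof
      fix z assume "z \<in> R" then show "z \<in> ?A" unfolding R
        by induction (auto intro: subring_generated.intros)
    qed
    have "x \<in> ?A" by (auto intro: subring_generated.incl)
    then show "y \<in> ?A" unfolding p(2) poly_altdef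
      using p(1) sub by (intro R_sum[OF A'] R_mult[OF A'] R_power[OF A']) (auto simp: coeffs_in_def)
  qed
qed

theorem points_separate:
  fixes b :: "'a::k_domain"
  assumes fg: "finite S" and b: "b \<in> subring_generated (base_field \<union> S)" "b \<noteq> 0"
  shows "\<exists>\<chi>. point_on (subring_generated (base_field \<union> S)) \<chi> \<and> \<chi> b \<noteq> 0"
  using fg b
proof (induction S arbitrary: b rule: finite_induct)
  case empty
  have eq: "subring_generated (base_field \<union> {}) = (base_field :: 'a set)"
  proof (intro subset_antisym subsetI)
    fix y :: 'a assume "y \<in> subring_generated (base_field \<union> {})"
    then show "y \<in> base_field"
      by induction (auto intro: base_field_1 base_field_diff base_field_mult)
  qed (auto intro: subring_generated.incl)
  have "point_on base_field (to_base :: 'a \<Rightarrow> _)"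
    by (auto simp: point_on_def of_base_inverse base_field_add base_field_mult plus_base_def times_base_def
        to_base_inverse to_base_inject)
  moreover have "to_base b \<noteq> 0"
    using empty eq by (metis of_base_simps(1) to_base_inverse)
  ultimately show ?case unfolding eq by blast
next
  case (insert x S)
  show ?case
    using points_adjoin[OF alg_subring_generated insert.IH, of b x] insert.prems
    unfolding subring_generated_insert[OF refl] by blast
qed

section \<open>Evaluation of tensors\<close>

text \<open>The formula of \<open>derange\<close> with values in an arbitrary ring: derangements,
  evaluations at points and partial specializations are all instances of it.\<close>

definition teval :: "(int \<Rightarrow> 'a::k_domain \<Rightarrow> 'r::comm_ring_1) \<Rightarrow> 'a tensor_power \<Rightarrow> 'r"
  where "teval h x = formal_eval h (rep_tensor_power x)"

lemma derange_eq_teval: "derange \<sigma> = teval (\<lambda>l. slot (\<sigma> l))"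
  by (simp add: derange_def teval_def fun_eq_iff)

lemma teval_abs: "alg_hom_family h \<Longrightarrow> teval h (abs_tensor_power p) = formal_eval h p"
  unfolding teval_def
  by (rule formal_eval_rel, assumption)
    (rule Quotient_rep_abs[OF Quotient_tensor_power equivp_reflp[OF equivp_tensor_rel]])

lemma tensor_power_abs: obtains p where "x = abs_tensor_power p"
  by (induction x) blast

lemma tensor_scalar_eq_slot: "tensor_scalar c = slot l (of_base c)"
  by (simp add: slot_simps)

text \<open>The slots generate the tensor power as a ring, since scalars are slots of elements of
  \<open>k\<close>. Identities between homomorphisms therefore need to be checked on slots
  only.\<close>

lemma tensor_power_induct [case_names slot diff mult]:
  fixes x :: "'a::k_domain tensor_power"
  assumes slot: "\<And>l a. P (slot l a)" and diff: "\<And>x y. P x \<Longrightarrow> P y \<Longrightarrow> P (x - y)"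
    and mult: "\<And>x y. P x \<Longrightarrow> P y \<Longrightarrow> P (x * y)"
  shows "P x"
proof -
  have one: "P 1" using slot[of 0 1] by (simp add: slot_simps)
  have zero: "P 0" using diff[OF one one] by simp
  have add: "P (x + y)" if "P x" "P y" for x y using diff[OF that(1) diff[OF zero that(2)]] by simp
  have "P (\<Prod>i\<in>S. slot i (f i))" for S and f :: "int \<Rightarrow> 'a"
    by (induction S rule: infinite_finite_induct) (simp_all add: one mult slot)
  then have single: "P (abs_tensor_power (Poly_Mapping.single f c))" for f :: "'a family" and c
    unfolding abs_tensor_power_single by (intro mult) (simp_all add: tensor_scalar_eq_slot[of _ 0] slot)
  have "P (abs_tensor_power p)" for p
  proof (induction p rule: update_induct)
    case const
    then show ?case using zero by (simp add: zero_tensor_power.abs_eq)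
  next
    case (update f a b)
    have "Poly_Mapping.update a b f = f + Poly_Mapping.single a b"
      using update(1) by (intro poly_mapping_eqI)
        (auto simp: lookup_update lookup_add lookup_single in_keys_iff when_def)
    then have "abs_tensor_power (Poly_Mapping.update a b f) =
        abs_tensor_power f + abs_tensor_power (Poly_Mapping.single a b)"
      by (simp add: plus_tensor_power.abs_eq)
    then show ?case using add[OF update(3) single] by simp
  qed
  then show ?thesis by (metis tensor_power_abs)
qed

context
  fixes h :: "int \<Rightarrow> 'a::k_domain \<Rightarrow> 'r::comm_ring_1"
  assumes h: "alg_hom_family h"
begin

lemma teval_add: "teval h (x + y) = teval h x + teval h y"
  by (rule tensor_power_abs[of x], rule tensor_power_abs[of y])
    (simp add: plus_tensor_power.abs_eq teval_abs h formal_eval_add)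

lemma teval_mult: "teval h (x * y) = teval h x * teval h y"
  by (rule tensor_power_abs[of x], rule tensor_power_abs[of y])
    (simp add: times_tensor_power.abs_eq teval_abs h formal_eval_mult)

lemma teval_0: "teval h 0 = 0"
  using teval_add[of 0 0] by simp

lemma teval_uminus: "teval h (- x) = - teval h x"
  using teval_add[of x "- x"] by (simp add: teval_0 add_eq_0_iff)

lemma teval_diff: "teval h (x - y) = teval h x - teval h y"
  using teval_add[of x "- y"] by (simp add: teval_uminus)

lemma teval_slot: "teval h (slot l a) = h l a"
  unfolding slot.abs_eq
  by (simp only: teval_abs[OF h] formal_eval_single[OF h], subst family_eval_upd[OF h])
    (simp add: family_eval_0[OF h] h_simps[OF h])

lemma teval_scalar: "teval h (tensor_scalar c) = h 0 (of_base c)"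
  by (simp add: tensor_scalar_eq_slot[of _ 0] teval_slot)

lemma teval_1: "teval h 1 = 1"
  using teval_slot[of 0 1] by (simp add: slot_simps h_simps[OF h])

lemma teval_sum: "teval h (sum f S) = (\<Sum>x\<in>S. teval h (f x))"
  by (induction S rule: infinite_finite_induct) (simp_all add: teval_0 teval_add)

lemma teval_prod: "teval h (prod f S) = (\<Prod>x\<in>S. teval h (f x))"
  by (induction S rule: infinite_finite_induct) (simp_all add: teval_1 teval_mult)

lemma teval_power: "teval h (x ^ m) = teval h x ^ m"
  by (induction m) (simp_all add: teval_1 teval_mult)

lemma alg_hom_family_comp: "alg_hom_family (\<lambda>l. h (\<sigma> l))"
  using h by (auto simp: alg_hom_family_def)

end

lemmas teval_hom = teval_add teval_mult teval_0 teval_uminus teval_diff teval_1 teval_sum teval_prod teval_power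

lemma derange_hom:
  "derange \<sigma> (x + y) = derange \<sigma> x + derange \<sigma> y" "derange \<sigma> (x * y) = derange \<sigma> x * derange \<sigma> y"
  "derange \<sigma> 0 = 0" "derange \<sigma> (- x) = - derange \<sigma> x" "derange \<sigma> (x - y) = derange \<sigma> x - derange \<sigma> y"
  "derange \<sigma> 1 = 1" "derange \<sigma> (sum f S) = (\<Sum>x\<in>S. derange \<sigma> (f x))"
  "derange \<sigma> (prod g T) = (\<Prod>x\<in>T. derange \<sigma> (g x))" "derange \<sigma> (x ^ m) = derange \<sigma> x ^ m"
  "derange \<sigma> (tensor_scalar c) = tensor_scalar c"
  unfolding derange_eq_teval
  by (simp_all add: teval_hom[OF alg_hom_family_slot] teval_scalar[OF alg_hom_family_slot] slot_simps)

lemma teval_derange: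
  assumes h: "alg_hom_family h"
  shows "teval h (derange \<sigma> x) = teval (\<lambda>l. h (\<sigma> l)) x"
  by (induction x rule: tensor_power_induct)
    (simp_all add: derange_slot derange_hom teval_hom[OF h] teval_slot[OF h]
      teval_hom[OF alg_hom_family_comp[OF h]] teval_slot[OF alg_hom_family_comp[OF h]])

lemma derange_comp: "derange \<sigma> (derange \<tau> x) = derange (\<sigma> \<circ> \<tau>) x"
  unfolding derange_eq_teval[of \<sigma>] derange_eq_teval[of "\<sigma> \<circ> \<tau>"]
    teval_derange[OF alg_hom_family_slot] by (simp add: derange_eq_teval)

lemma derange_id: "derange id x = x" "derange (\<lambda>l. l) x = x"
  using fun_cong[OF derange_unique[of "\<lambda>x. x" "\<lambda>l. l"], of x] by (auto simp: is_alg_endo_def id_def)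

lemma tensor_sub_mono: "I \<subseteq> J \<Longrightarrow> tensor_sub I \<subseteq> tensor_sub J"
  unfolding tensor_sub_def
  by (rule subsetI, erule subring_generated.induct) (auto intro: subring_generated.intros)

lemma tensor_sub_diff: "x \<in> tensor_sub I \<Longrightarrow> y \<in> tensor_sub I \<Longrightarrow> x - y \<in> tensor_sub I"
  and tensor_sub_mult: "x \<in> tensor_sub I \<Longrightarrow> y \<in> tensor_sub I \<Longrightarrow> x * y \<in> tensor_sub I"
  and tensor_sub_1: "1 \<in> tensor_sub I"
  and tensor_sub_scalar: "tensor_scalar c \<in> tensor_sub I"
  and tensor_sub_slot: "l \<in> I \<Longrightarrow> slot l a \<in> tensor_sub I"
  by (auto simp: tensor_sub_def intro: subring_generated.intros)

lemma tensor_sub_0: "0 \<in> tensor_sub I" using tensor_sub_diff[OF tensor_sub_1 tensor_sub_1] by simp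
lemma tensor_sub_uminus: "x \<in> tensor_sub I \<Longrightarrow> - x \<in> tensor_sub I"
  using tensor_sub_diff[OF tensor_sub_0, of x] by simp
lemma tensor_sub_add: "x \<in> tensor_sub I \<Longrightarrow> y \<in> tensor_sub I \<Longrightarrow> x + y \<in> tensor_sub I"
  using tensor_sub_diff[of x I "- y"] tensor_sub_uminus[of y I] by simp
lemma tensor_sub_sum: "(\<And>i. i \<in> S \<Longrightarrow> f i \<in> tensor_sub I) \<Longrightarrow> sum f S \<in> tensor_sub I"
  by (induction S rule: infinite_finite_induct) (auto intro: tensor_sub_add tensor_sub_0)
lemma tensor_sub_prod: "(\<And>i. i \<in> S \<Longrightarrow> f i \<in> tensor_sub I) \<Longrightarrow> prod f S \<in> tensor_sub I"
  by (induction S rule: infinite_finite_induct) (auto intro: tensor_sub_mult tensor_sub_1)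

lemma finite_support: "\<exists>I. finite I \<and> x \<in> tensor_sub I"
proof (induction x rule: tensor_power_induct)
  case (slot l a)
  then show ?case using tensor_sub_slot[of l "{l}" a] by (intro exI[of _ "{l}"]) simp
next
  case (diff x y)
  then obtain I J where "finite I" "x \<in> tensor_sub I" "finite J" "y \<in> tensor_sub J" by (elim exE conjE)
  then have "finite (I \<union> J) \<and> x - y \<in> tensor_sub (I \<union> J)"
    using tensor_sub_mono[of I "I \<union> J"] tensor_sub_mono[of J "I \<union> J"] by (auto intro!: tensor_sub_diff)
  then show ?case by (rule exI)
next
  case (mult x y)
  then obtain I J where "finite I" "x \<in> tensor_sub I" "finite J" "y \<in> tensor_sub J" by (elim exE conjE)
  then have "finite (I \<union> J) \<and> x * y \<in> tensor_sub (I \<union> J)"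
    using tensor_sub_mono[of I "I \<union> J"] tensor_sub_mono[of J "I \<union> J"] by (auto intro!: tensor_sub_mult)
  then show ?case by (rule exI)
qed

lemma teval_cong_sub:
  assumes "alg_hom_family h" "alg_hom_family h'" "x \<in> tensor_sub I"
    and "\<And>l a. l \<in> I \<Longrightarrow> h l a = h' l a" "\<And>c. h 0 (of_base c) = h' 0 (of_base c)"
  shows "teval h x = teval h' x"
  using assms(3) unfolding tensor_sub_def
proof (induction rule: subring_generated.induct)
  case (incl x)
  then show ?case
    using assms by (auto simp: teval_scalar teval_slot)
qed (simp_all add: assms(1,2) teval_hom)

lemma derange_cong_sub:
  assumes "x \<in> tensor_sub I" "\<And>l. l \<in> I \<Longrightarrow> \<sigma> l = \<tau> l"
  shows "derange \<sigma> x = derange \<tau> x"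
  unfolding derange_eq_teval
  by (rule teval_cong_sub[OF alg_hom_family_slot alg_hom_family_slot assms(1)])
    (simp_all add: assms(2) slot_simps)

lemma derange_sub:
  assumes "x \<in> tensor_sub I" "\<sigma> ` I \<subseteq> J"
  shows "derange \<sigma> x \<in> tensor_sub J"
  using assms(1) unfolding tensor_sub_def[of I]
proof (induction rule: subring_generated.induct)
  case (incl x)
  then show ?case using assms(2) by (auto simp: derange_hom derange_slot tensor_sub_scalar intro!: tensor_sub_slot)
qed (auto simp: derange_hom tensor_sub_1 intro: tensor_sub_diff tensor_sub_mult)

section \<open>Points of \<open>A\<close> and specialization of single positions\<close>

definition points :: "('a::k_domain \<Rightarrow> 'a base) set"
  where "points = {\<chi>. point_on UNIV \<chi>}"

lemma points_simps:
  assumes "\<chi> \<in> points"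
  shows "\<chi> (x + y) = \<chi> x + \<chi> y" "\<chi> (x * y) = \<chi> x * \<chi> y" "\<chi> (of_base c) = c" "\<chi> 0 = 0" "\<chi> 1 = 1"
    "\<chi> (x - y) = \<chi> x - \<chi> y"
proof -
  show *: "\<chi> (x + y) = \<chi> x + \<chi> y" "\<chi> (x * y) = \<chi> x * \<chi> y" "\<chi> (of_base c) = c" for x y c
    using assms by (auto simp: points_def point_on_def)
  show "\<chi> 0 = 0" "\<chi> 1 = 1" using *(3)[of 0] *(3)[of 1] by simp_all
  show "\<chi> (x - y) = \<chi> x - \<chi> y" using *(1)[of "x - y" y] by simp
qed

lemma points_sum: "\<chi> \<in> points \<Longrightarrow> \<chi> (sum f S) = (\<Sum>x\<in>S. \<chi> (f x))"
  by (induction S rule: infinite_finite_induct) (simp_all add: points_simps)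

lemma alg_hom_family_points: "(\<And>l. \<Phi> l \<in> points) \<Longrightarrow> alg_hom_family \<Phi>"
  by (simp add: alg_hom_family_def points_simps)

text \<open>Position \<open>l\<close> is evaluated at \<chi> and all others are kept; iteration over
  the support of a tensor evaluates it at a point.\<close>

definition slot_eval :: "int \<Rightarrow> ('a::k_domain \<Rightarrow> 'a base) \<Rightarrow> 'a tensor_power \<Rightarrow> 'a tensor_power"
  where "slot_eval l \<chi> = teval (\<lambda>m. if m = l then \<lambda>a. tensor_scalar (\<chi> a) else slot m)"

lemma slot_eval_family:
  "\<chi> \<in> points \<Longrightarrow> alg_hom_family (\<lambda>m. if m = l then \<lambda>a. tensor_scalar (\<chi> a) else slot m)"
  by (auto simp: alg_hom_family_def points_simps tensor_scalar_simps slot_simps)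

lemma slot_eval_in_sub:
  assumes "\<chi> \<in> points" "x \<in> tensor_sub (insert l I)"
  shows "slot_eval l \<chi> x \<in> tensor_sub I"
  using assms(2) unfolding tensor_sub_def[of "insert l I"]
proof (induction rule: subring_generated.induct)
  case (incl x)
  then show ?case
    by (auto simp: slot_eval_def teval_scalar[OF slot_eval_family[OF assms(1)]]
        teval_slot[OF slot_eval_family[OF assms(1)]] points_simps[OF assms(1)] slot_simps
        intro: tensor_sub_scalar tensor_sub_slot)
qed (auto simp: slot_eval_def teval_hom[OF slot_eval_family[OF assms(1)]]
    intro: tensor_sub_1 tensor_sub_diff tensor_sub_mult)

lemma slot_eval_fix:
  assumes "\<chi> \<in> points" "x \<in> tensor_sub I" "l \<notin> I"
  shows "slot_eval l \<chi> x = x"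
proof -
  have "slot_eval l \<chi> x = teval slot x"
    unfolding slot_eval_def
    by (rule teval_cong_sub[OF slot_eval_family[OF assms(1)] _ assms(2)])
      (use assms alg_hom_family_slot[of "\<lambda>l. l"] in \<open>auto simp: points_simps slot_simps\<close>)
  also have "\<dots> = x" using derange_id(2)[of x] by (simp add: derange_eq_teval)
  finally show ?thesis .
qed

lemma teval_slot_eval:
  assumes "\<chi> \<in> points" "\<And>l. \<Phi> l \<in> points"
  shows "teval \<Phi> (slot_eval l \<chi> x) = teval (\<Phi>(l := \<chi>)) x"
proof -
  have 1: "alg_hom_family (\<Phi>(l := \<chi>))" by (rule alg_hom_family_points) (use assms in auto)
  note 2 = alg_hom_family_points[OF assms(2)] and 3 = slot_eval_family[OF assms(1), of l]
  show ?thesis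
  proof (induction x rule: tensor_power_induct)
    case (slot m a)
    then show ?case
      unfolding slot_eval_def teval_slot[OF 1] teval_slot[OF 3]
      by (simp add: teval_slot[OF 2] teval_scalar[OF 2] points_simps[OF assms(2)])
  qed (simp_all add: slot_eval_def teval_hom[OF 1] teval_hom[OF 2] teval_hom[OF 3] del: fun_upd_apply)
qed

text \<open>Tensors of this form include the generators and are closed under differences and
  products.\<close>

lemma slot_expansion:
  fixes x :: "'a::k_domain tensor_power"
  assumes "x \<in> tensor_sub (insert l I)"
  shows "\<exists>m::nat. \<exists>a b. x = (\<Sum>i<m. slot l (a i) * b i) \<and> (\<forall>i. b i \<in> tensor_sub I)"
proof -
  define SP :: "'a tensor_power set" where "SP = {x. \<exists>m::nat. \<exists>a b. x = (\<Sum>i<m. slot l (a i) * b i) \<and> (\<forall>i. b i \<in> tensor_sub I)}"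
  have zero: "0 \<in> SP"
    unfolding SP_def by (auto intro!: exI[of _ "0::nat"] exI[of _ "\<lambda>_. 0"] simp: tensor_sub_0)
  have add1: "x + slot l a * b \<in> SP" if x: "x \<in> SP" and b: "b \<in> tensor_sub I" for x b :: "'a tensor_power" and a
  proof -
    obtain m :: nat and a' b' where *: "x = (\<Sum>i<m. slot l (a' i) * b' i)" "\<forall>i. b' i \<in> tensor_sub I"
      using x by (auto simp: SP_def)
    have "x + slot l a * b = (\<Sum>i<Suc m. slot l ((a'(m := a)) i) * (b'(m := b)) i)"
      by (simp add: *(1))
    moreover have "\<forall>i. (b'(m := b)) i \<in> tensor_sub I" using *(2) b by simp
    ultimately show ?thesis unfolding SP_def by blast
  qed
  have sums: "x + (\<Sum>i\<in>S. slot l (a i) * b i) \<in> SP"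
    if "x \<in> SP" "\<And>i. i \<in> S \<Longrightarrow> b i \<in> tensor_sub I" for x and S :: "'i set" and a b
    using that
    by (induction S arbitrary: x rule: infinite_finite_induct)
      (auto simp flip: add.assoc intro: add1)
  have diff: "x - y \<in> SP" if x: "x \<in> SP" and y: "y \<in> SP" for x y
  proof -
    obtain m :: nat and a b where *: "y = (\<Sum>i<m. slot l (a i) * b i)" "\<forall>i. b i \<in> tensor_sub I"
      using y by (auto simp: SP_def)
    have eq: "x - y = x + (\<Sum>i<m. slot l (a i) * (- b i))" by (simp add: * sum_negf)
    show ?thesis unfolding eq by (rule sums[OF x]) (use * tensor_sub_uminus in auto)
  qed
  have mult: "x * y \<in> SP" if xS: "x \<in> SP" and yS: "y \<in> SP" for x y
  proof -
    obtain m :: nat and a b where x: "x = (\<Sum>i<m. slot l (a i) * b i)" "\<forall>i. b i \<in> tensor_sub I"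
      using xS by (auto simp: SP_def)
    obtain m' :: nat and a' b' where y: "y = (\<Sum>i<m'. slot l (a' i) * b' i)" "\<forall>i. b' i \<in> tensor_sub I"
      using yS by (auto simp: SP_def)
    have "x * y = 0 + (\<Sum>z\<in>{..<m} \<times> {..<m'}. slot l (a (fst z) * a' (snd z)) * (b (fst z) * b' (snd z)))"
      unfolding x(1) y(1) sum_product sum.cartesian_product by (simp add: slot_simps mult_ac split_def)
    also have "\<dots> \<in> SP" by (rule sums[OF zero]) (simp add: tensor_sub_mult x(2) y(2))
    finally show ?thesis .
  qed
  have one: "1 \<in> SP" using add1[OF zero tensor_sub_1, of 1] by (simp add: slot_simps)
  have "x \<in> SP" using assms unfolding tensor_sub_def[of "insert l I"]
  proof (induction rule: subring_generated.induct)
    case (incl x)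
    then consider c where "x = tensor_scalar c" | a where "x = slot l a" | m a where "m \<in> I" "x = slot m a" by auto
    then show ?case
    proof cases
      case 1
      then show ?thesis using add1[OF zero tensor_sub_1, of "of_base c"] by (simp add: slot_simps)
    next
      case 2
      then show ?thesis using add1[OF zero tensor_sub_1, of a] by simp
    next
      case 3
      then show ?thesis using add1[OF zero tensor_sub_slot[OF 3(1), of a], of 1] by (simp add: slot_simps)
    qed
  qed (auto intro: one diff mult)
  then show ?thesis by (simp add: SP_def)
qed

lemma tensor_scalar_inverse: "c \<noteq> 0 \<Longrightarrow> tensor_scalar c * tensor_scalar (inverse c) = 1"
  by (simp add: tensor_scalar_simps(2,3) flip: tensor_scalar_simps(2))

lemma tensor_scalar_0: "tensor_scalar 0 = 0"
  using tensor_scalar_simps(1)[of 0 0] by simp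

lemma tensor_scalar_uminus: "tensor_scalar (- c :: 'a::k_domain base) = - tensor_scalar c"
  and tensor_scalar_diff: "tensor_scalar (c - d :: 'a::k_domain base) = tensor_scalar c - tensor_scalar d"
proof -
  show u: "tensor_scalar (- c) = - tensor_scalar c" for c :: "'a base"
  proof -
    have "tensor_scalar c + tensor_scalar (- c) = 0"
      using tensor_scalar_simps(1)[of c "- c"] by (simp add: tensor_scalar_0)
    then show ?thesis by (rule minus_unique[symmetric])
  qed
  show "tensor_scalar (c - d) = tensor_scalar c - tensor_scalar d"
    using tensor_scalar_simps(1)[of c "- d"] u by simp
qed

text \<open>A representation of \<open>x\<close> of minimal length has linearly independent second factors.\<close>

lemma slot_eval_nonzero:
  fixes x :: "'a::k_domain tensor_power" and J :: "nat set"
  assumes "finite J" "x = (\<Sum>i\<in>J. slot l (a i) * b i)" "\<forall>i. b i \<in> tensor_sub I" "l \<notin> I" "x \<noteq> 0"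
  shows "\<exists>a. a \<noteq> 0 \<and> (\<forall>\<chi>\<in>points. \<chi> a \<noteq> 0 \<longrightarrow> slot_eval l \<chi> x \<noteq> 0)"
  using assms(1-3)
proof (induction J arbitrary: a rule: finite_psubset_induct)
  case (psubset J)
  show ?case
  proof (cases "\<exists>c. (\<Sum>i\<in>J. tensor_scalar (c i) * b i) = 0 \<and> (\<exists>j\<in>J. c j \<noteq> 0)")
    case True
    then obtain c j where c: "(\<Sum>i\<in>J. tensor_scalar (c i) * b i) = 0" "j \<in> J" "c j \<noteq> 0" by blast
    define d where "d i = inverse (c j) * c i" for i
    have "0 = tensor_scalar (inverse (c j)) * (\<Sum>i\<in>J. tensor_scalar (c i) * b i)" using c by simp
    also have "\<dots> = (\<Sum>i\<in>J. tensor_scalar (d i) * b i)"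
      by (simp add: d_def sum_distrib_left tensor_scalar_simps mult_ac)
    also have "\<dots> = b j + (\<Sum>i\<in>J - {j}. tensor_scalar (d i) * b i)"
      using c psubset.hyps(1) by (subst sum.remove[of _ j]) (auto simp: d_def tensor_scalar_simps)
    finally have bj: "b j = - (\<Sum>i\<in>J - {j}. tensor_scalar (d i) * b i)" by (metis add.commute add_eq_0_iff)
    have "x = slot l (a j) * b j + (\<Sum>i\<in>J - {j}. slot l (a i) * b i)"
      using c psubset.hyps(1) unfolding psubset.prems(1) by (subst sum.remove[of _ j]) auto
    also have "\<dots> = (\<Sum>i\<in>J - {j}. slot l (a i - of_base (d i) * a j) * b i)"
    proof -
      have sl: "slot l (a i - of_base (d i) * a j) = slot l (a i) - tensor_scalar (d i) * slot l (a j)" for i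
        using slot_simps(1)[of l "a i - of_base (d i) * a j" "of_base (d i) * a j"] by (simp add: slot_simps)
      have "slot l (a j) * b j + (\<Sum>i\<in>J - {j}. slot l (a i) * b i) =
          (\<Sum>i\<in>J - {j}. slot l (a i) * b i) - slot l (a j) * (\<Sum>i\<in>J - {j}. tensor_scalar (d i) * b i)"
        unfolding bj by (simp only: mult_minus_right) simp
      also have "\<dots> = (\<Sum>i\<in>J - {j}. slot l (a i) * b i - slot l (a j) * (tensor_scalar (d i) * b i))"
        by (simp only: sum_subtractf sum_distrib_left)
      also have "\<dots> = (\<Sum>i\<in>J - {j}. slot l (a i - of_base (d i) * a j) * b i)"
        unfolding sl by (intro sum.cong refl) (simp add: left_diff_distrib right_diff_distrib mult_ac)
      finally show ?thesis .
    qed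
    finally have "x = (\<Sum>i\<in>J - {j}. slot l (a i - of_base (d i) * a j) * b i)" .
    moreover have "J - {j} \<subset> J" using c(2) by auto
    ultimately show ?thesis using psubset.IH[of "J - {j}" "\<lambda>i. a i - of_base (d i) * a j"] psubset.prems(2) by simp
  next
    case False
    have "\<exists>i\<in>J. a i \<noteq> 0"
    proof (rule ccontr)
      assume "\<not> ?thesis"
      then have "x = (\<Sum>i\<in>J. slot l (of_base 0) * b i)" unfolding psubset.prems(1) by (intro sum.cong) auto
      then show False using assms(5) by (simp only: slot_simps tensor_scalar_0) simp
    qed
    then obtain i where i: "i \<in> J" "a i \<noteq> 0" by blast
    \<comment> \<open>The specialized tensor is a linear combination of the independent
      \<open>b i\<close>, and its coefficient at \<open>i\<close> does not vanish.\<close>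
    have "slot_eval l \<chi> x \<noteq> 0" if \<chi>: "\<chi> \<in> points" "\<chi> (a i) \<noteq> 0" for \<chi>
    proof -
      have "slot_eval l \<chi> x = (\<Sum>i\<in>J. tensor_scalar (\<chi> (a i)) * slot_eval l \<chi> (b i))"
        unfolding psubset.prems(1) slot_eval_def
        by (simp add: teval_hom[OF slot_eval_family[OF \<chi>(1)]] teval_slot[OF slot_eval_family[OF \<chi>(1)]])
      also have "\<dots> = (\<Sum>i\<in>J. tensor_scalar (\<chi> (a i)) * b i)"
        using slot_eval_fix[OF \<chi>(1) _ assms(4)] psubset.prems(2) by simp
      finally show ?thesis using False i(1) \<chi>(2) by metis
    qed
    then show ?thesis using i(2) by blast
  qed
qed

locale fg_domain =
  fixes type_of_A :: "'a::k_domain itself"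
  assumes fg: "\<exists>S::'a set. finite S \<and> subring_generated (base_field \<union> S) = UNIV"
begin

lemma point_nonzero: "(a::'a) \<noteq> 0 \<Longrightarrow> \<exists>\<chi>\<in>points. \<chi> a \<noteq> 0"
  using fg points_separate[of _ a] unfolding points_def by (metis (mono_tags, lifting) UNIV_I mem_Collect_eq)

text \<open>Two tensors are treated at once because this is what makes the tensor power a domain. In
  the induction step each tensor supplies a nonzero element of \<open>A\<close> that the point must
  not kill; the product of the two elements is nonzero, so one point serves both.\<close>

lemma common_point:
  fixes x y :: "'a tensor_power"
  assumes "finite I" "x \<in> tensor_sub I" "y \<in> tensor_sub I" "x \<noteq> 0" "y \<noteq> 0"
  shows "\<exists>\<Phi>. (\<forall>l. \<Phi> l \<in> points) \<and> teval \<Phi> x \<noteq> 0 \<and> teval \<Phi> y \<noteq> 0"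
  using assms
proof (induction I arbitrary: x y rule: finite_induct)
  case empty
  have "\<exists>c. x = tensor_scalar c" if "x \<in> tensor_sub {}" for x :: "'a tensor_power"
    using that unfolding tensor_sub_def
  proof (induction rule: subring_generated.induct)
    case one
    then show ?case by (metis tensor_scalar_simps(3))
  qed (auto simp flip: tensor_scalar_simps(2) tensor_scalar_diff)
  then obtain c d where cd: "x = tensor_scalar c" "y = tensor_scalar d" using empty by metis
  then have nz: "c \<noteq> 0" "d \<noteq> 0" using empty tensor_scalar_0 by auto
  obtain \<chi> :: "'a \<Rightarrow> 'a base" where \<chi>: "\<chi> \<in> points" using point_nonzero[OF one_neq_zero] by blast
  have "alg_hom_family (\<lambda>_::int. \<chi>)" by (rule alg_hom_family_points) (rule \<chi>)
  then show ?case using \<chi> cd nz by (intro exI[of _ "\<lambda>_. \<chi>"]) (simp add: teval_scalar points_simps)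
next
  case (insert l I)
  have "\<exists>a. a \<noteq> 0 \<and> (\<forall>\<chi>\<in>points. \<chi> a \<noteq> 0 \<longrightarrow> slot_eval l \<chi> x \<noteq> 0)"
    if x: "x \<in> tensor_sub (insert l I)" "x \<noteq> 0" for x :: "'a tensor_power"
  proof -
    obtain m :: nat and a b where "x = (\<Sum>i<m. slot l (a i) * b i)" "\<forall>i. b i \<in> tensor_sub I"
      using slot_expansion[OF x(1)] by blast
    then show ?thesis using slot_eval_nonzero[of "{..<m}" x l a b I] insert.hyps(2) x(2) by simp
  qed
  then obtain a b where a: "a \<noteq> 0" "\<And>\<chi>. \<chi> \<in> points \<Longrightarrow> \<chi> a \<noteq> 0 \<Longrightarrow> slot_eval l \<chi> x \<noteq> 0"
    and b: "b \<noteq> 0" "\<And>\<chi>. \<chi> \<in> points \<Longrightarrow> \<chi> b \<noteq> 0 \<Longrightarrow> slot_eval l \<chi> y \<noteq> 0"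
    using insert.prems by metis
  obtain \<chi> where \<chi>: "\<chi> \<in> points" "\<chi> (a * b) \<noteq> 0" using point_nonzero[of "a * b"] a b by auto
  then have nz: "slot_eval l \<chi> x \<noteq> 0" "slot_eval l \<chi> y \<noteq> 0" using a(2) b(2) by (auto simp: points_simps)
  obtain \<Phi> where \<Phi>: "\<forall>l. \<Phi> l \<in> points" "teval \<Phi> (slot_eval l \<chi> x) \<noteq> 0" "teval \<Phi> (slot_eval l \<chi> y) \<noteq> 0"
    using insert.IH[OF slot_eval_in_sub[OF \<chi>(1) insert.prems(1)] slot_eval_in_sub[OF \<chi>(1) insert.prems(2)] nz] by blast
  then have "teval (\<Phi>(l := \<chi>)) x \<noteq> 0" "teval (\<Phi>(l := \<chi>)) y \<noteq> 0"
    using teval_slot_eval[OF \<chi>(1), of \<Phi>] by simp_all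
  moreover have "\<forall>m. (\<Phi>(l := \<chi>)) m \<in> points" using \<Phi>(1) \<chi>(1) by auto
  ultimately show ?case by blast
qed

lemma tensor_nonzero:
  fixes x :: "'a tensor_power"
  assumes "x \<noteq> 0"
  obtains \<Phi> where "\<And>l. \<Phi> l \<in> points" "teval \<Phi> x \<noteq> 0"
proof -
  obtain I where "finite I" "x \<in> tensor_sub I" using finite_support by blast
  then show ?thesis using common_point[of I x x] assms that by blast
qed

lemma tensor_eqI:
  fixes x y :: "'a tensor_power"
  assumes "\<And>\<Phi>. (\<And>l. \<Phi> l \<in> points) \<Longrightarrow> teval \<Phi> x = teval \<Phi> y"
  shows "x = y"
proof (rule ccontr)
  assume "x \<noteq> y"
  then obtain \<Phi> where "\<And>l. \<Phi> l \<in> points" "teval \<Phi> (x - y) \<noteq> 0" using tensor_nonzero[of "x - y"] by auto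
  then show False using assms[of \<Phi>] by (simp add: teval_diff alg_hom_family_points)
qed

lemma tensor_mult_eq_0:
  fixes x y :: "'a tensor_power"
  shows "x * y = 0 \<longleftrightarrow> x = 0 \<or> y = 0"
proof
  assume xy: "x * y = 0"
  show "x = 0 \<or> y = 0"
  proof (rule ccontr)
    assume nz: "\<not> (x = 0 \<or> y = 0)"
    obtain I J where "finite I" "x \<in> tensor_sub I" "finite J" "y \<in> tensor_sub J" using finite_support by metis
    then have "finite (I \<union> J)" "x \<in> tensor_sub (I \<union> J)" "y \<in> tensor_sub (I \<union> J)"
      using tensor_sub_mono[of I "I \<union> J"] tensor_sub_mono[of J "I \<union> J"] by auto
    then obtain \<Phi> where \<Phi>: "\<And>l. \<Phi> l \<in> points" "teval \<Phi> x \<noteq> 0" "teval \<Phi> y \<noteq> 0"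
      using common_point nz by metis
    then have "teval \<Phi> (x * y) \<noteq> 0" by (simp add: teval_mult alg_hom_family_points)
    then show False using xy \<Phi>(1) by (simp add: teval_0 alg_hom_family_points)
  qed
qed auto

lemma tensor_mult_cancel:
  fixes x y z :: "'a tensor_power"
  shows "x \<noteq> 0 \<Longrightarrow> x * y = x * z \<Longrightarrow> y = z"
  using tensor_mult_eq_0[of x "y - z"] by (simp add: algebra_simps)

lemma tensor_power_eq_0: "(x::'a tensor_power) ^ m = 0 \<Longrightarrow> x = 0"
  by (induction m) (auto simp: tensor_mult_eq_0)

lemma tensor_prod_eq_0: "finite S \<Longrightarrow> (\<Prod>i\<in>S. f i) = (0::'a tensor_power) \<longleftrightarrow> (\<exists>i\<in>S. f i = 0)"
  by (induction S rule: finite_induct) (auto simp: tensor_mult_eq_0)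

end

section \<open>Jacobi matrices have rank one\<close>

lemma comm_ring_hom_derange: "comm_ring_hom (derange \<sigma>)"
  by unfold_locales (simp_all add: derange_hom)

lemma comm_ring_hom_teval: "alg_hom_family h \<Longrightarrow> comm_ring_hom (teval h)"
  by unfold_locales (simp_all add: teval_hom)

context comm_ring_hom
begin

lemma hom_dt: "hom (dt n w) = dt n (\<lambda>b c. hom (w b c))"
  by (simp add: dt_Leibniz hom_distribs)

lemma hom_mixed_det: "hom (mixed_det n Y) = mixed_det n (\<lambda>b r c. hom (Y b r c))"
  by (simp add: mixed_det_def hom_distribs)

lemma hom_abelf: "hom (abelf n Y P Q i j) =
    abelf n (\<lambda>b r c. hom (Y b r c)) (\<lambda>r c. hom (P r c)) (\<lambda>r c. hom (Q r c)) i j"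
proof -
  have "(\<lambda>b p c. hom ((Y(j := unit_row r \<rho>)) b p c)) =
      (\<lambda>b p c. hom (Y b p c))(j := unit_row r (\<lambda>c. hom (\<rho> c)))" for j r \<rho>
    by (auto simp: fun_eq_iff unit_row_def)
  then show ?thesis by (simp add: abelf_def hom_distribs hom_mixed_det)
qed

end

lemma abelf_cong:
  assumes "\<And>b r c. b < n \<Longrightarrow> r < n \<Longrightarrow> c < n \<Longrightarrow> Y b r c = Y' b r c"
    "\<And>r c. r < n \<Longrightarrow> c < n \<Longrightarrow> P r c = P' r c" "\<And>r c. r < n \<Longrightarrow> c < n \<Longrightarrow> Q r c = Q' r c"
  shows "abelf n Y P Q i j = abelf n Y' P' Q' i j"
  unfolding abelf_def
  by (intro sum.cong refl arg_cong2[where f = "(*)"] mixed_det_cong) (auto simp: assms unit_row_def)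

section \<open>Abeliants of special families of matrices\<close>

lemma dt_repeat: "l < n \<Longrightarrow> j < n \<Longrightarrow> l \<noteq> j \<Longrightarrow> dt n (w(j := w l)) = 0"
  by (rule dt_equal[of l n j]) auto

text \<open>The outer matrix \<open>P\<close> repeats the inner matrix numbered \<open>l\<close>.
  Summation over \<open>a\<close> produces \<open>dt n (u(i := u l))\<close> next to
  \<open>dt n (v(j := v l))\<close>, and one of the two has a repeated row.\<close>

lemma abelf_repeated:
  assumes ij: "i < n" "j < n" "l < n" and ne: "i \<noteq> l \<or> j \<noteq> l"
  shows "abelf n (\<lambda>b p c. u b p * v b c) (\<lambda>p c. u l p * v l c) Q i j = 0"
proof -
  define c where "c r = dt n (u(j := \<lambda>p. if p = r then 1 else 0)) * dt n (v(i := Q r))" for r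
  have "abelf n (\<lambda>b p c. u b p * v b c) (\<lambda>p c. u l p * v l c) Q i j =
      (\<Sum>a<n. \<Sum>r<n. dt n (v(j := v l)) * (u l a * dt n (u(i := \<lambda>p. if p = a then 1 else 0))) * c r)"
    unfolding abelf_rank_one_inner[OF ij(1,2)] dt_scale[OF ij(2)] c_def by (simp add: mult_ac)
  also have "\<dots> = dt n (v(j := v l)) * (\<Sum>a<n. u l a * dt n (u(i := \<lambda>p. if p = a then 1 else 0))) * (\<Sum>r<n. c r)"
    by (simp add: sum_distrib_left sum_distrib_right mult_ac)
  also have "(\<Sum>a<n. u l a * dt n (u(i := \<lambda>p. if p = a then 1 else 0))) = dt n (u(i := u l))"
    by (rule dt_unit_expand[OF ij(1), symmetric])
  finally have eq: "abelf n (\<lambda>b p c. u b p * v b c) (\<lambda>p c. u l p * v l c) Q i j =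
      dt n (v(j := v l)) * dt n (u(i := u l)) * (\<Sum>r<n. c r)" .
  from ne show ?thesis
  proof
    assume "i \<noteq> l"
    then show ?thesis unfolding eq using dt_repeat[OF ij(3,1), of u] by (simp del: fun_upd_apply)
  next
    assume "j \<noteq> l"
    then show ?thesis unfolding eq using dt_repeat[OF ij(3,2), of v] by (simp del: fun_upd_apply)
  qed
qed

lemma permutes_pair:
  assumes \<tau>: "\<tau> permutes {0..<n}" and fixed: "\<And>r. r < n \<Longrightarrow> r \<noteq> a \<Longrightarrow> r \<noteq> b \<Longrightarrow> \<tau> r = r"
  shows "\<tau> = id \<or> \<tau> = transpose a b"
proof -
  have fx: "\<tau> r = r" if "r \<noteq> a" "r \<noteq> b" for r
    using fixed[of r] permutes_not_in[OF \<tau>, of r] that by (cases "r < n") auto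
  have inj: "\<tau> p = \<tau> q \<longleftrightarrow> p = q" for p q by (rule inj_eq[OF permutes_inj[OF \<tau>]])
  have ab: "\<tau> r = a \<or> \<tau> r = b" if "r = a \<or> r = b" for r
    using fx[of "\<tau> r"] inj[of "\<tau> r" r] that by metis
  show ?thesis
  proof (cases "\<tau> a = a")
    case True
    then have "\<tau> b = b" using ab[of b] inj[of a b] by auto
    then have "\<tau> r = r" for r using True fx[of r] by metis
    then show ?thesis by (auto simp: fun_eq_iff)
  next
    case False
    then have "\<tau> a = b" using ab[of a] by auto
    moreover from this have "\<tau> b = a" using ab[of b] inj[of a b] False by metis
    ultimately have "\<tau> r = transpose a b r" for r using fx[of r] by (auto simp: Transposition.transpose_def)
    then show ?thesis by (auto simp: fun_eq_iff)
  qed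
qed

text \<open>The matrices other than those numbered 0 and \<open>j\<close> are multiples of diagonal
  matrix units and use up all rows and columns but 0 and \<open>j\<close>. What is left is the mixed
  discriminant of two 2 by 2 blocks.\<close>

lemma mixed_det_corner:
  fixes A R :: "nat \<Rightarrow> nat \<Rightarrow> 'r::comm_ring_1"
  assumes n: "0 < n" and j: "j < n" "j \<noteq> 0"
    and Y0: "Y 0 = A" and Yb: "\<And>b. b < n \<Longrightarrow> b \<noteq> 0 \<Longrightarrow> Y b = (\<lambda>p c. if p = b \<and> c = b then g b else 0)"
  shows "mixed_det n (Y(j := R)) = (\<Prod>l\<in>{0..<n} - {0, j}. g l) *
    (A 0 0 * R j j + A j j * R 0 0 - A 0 j * R j 0 - A j 0 * R 0 j)"
proof -
  let ?P = "{\<tau>. \<tau> permutes {0..<n}}" and ?t = "transpose 0 j" and ?Y = "Y(j := R)"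
  let ?g = "\<Prod>l\<in>{0..<n} - {0, j}. g l"
  let ?f = "\<lambda>\<tau> \<sigma>. signof \<sigma> * (\<Prod>r = 0..<n. ?Y (\<tau> r) r (\<sigma> r))"
  have tp: "?t \<in> ?P" "id \<in> ?P" using n j by (auto simp: permutes_id intro!: permutes_swap_id)
  have ne: "id \<noteq> ?t" using j by (auto simp: fun_eq_iff Transposition.transpose_def intro!: exI[of _ 0])
  have entry: "?Y b r c = (if r = b \<and> c = b then g b else 0)" if "b < n" "b \<noteq> 0" "b \<noteq> j" for b r c
    using that by (simp add: Yb)
  have zt: "?f \<tau> \<sigma> = 0" if "\<tau> \<in> ?P" "\<tau> \<notin> {id, ?t}" for \<tau> \<sigma>
  proof -
    have t: "\<tau> permutes {0..<n}" using that by simp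
    have "\<exists>b<n. b \<noteq> 0 \<and> b \<noteq> j \<and> \<tau> b \<noteq> b"
      using permutes_pair[OF t, of 0 j] that(2) by blast
    then obtain b where b: "b < n" "b \<noteq> 0" "b \<noteq> j" "\<tau> b \<noteq> b" by blast
    obtain r where r: "r < n" "\<tau> r = b" using permutes_ex[OF t b(1)] by blast
    then have "?Y (\<tau> r) r (\<sigma> r) = 0" using entry[of b r] b by auto
    then have "(\<Prod>r = 0..<n. ?Y (\<tau> r) r (\<sigma> r)) = 0" using r(1) by (intro prod_zero bexI[of _ r]) (simp_all del: fun_upd_apply)
    then show ?thesis by (simp only: mult_zero_right)
  qed
  have zs: "?f \<tau> \<sigma> = 0" if "\<tau> \<in> {id, ?t}" "\<sigma> \<in> ?P" "\<sigma> \<notin> {id, ?t}" for \<tau> \<sigma>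
  proof -
    have s: "\<sigma> permutes {0..<n}" using that by simp
    have "\<exists>b<n. b \<noteq> 0 \<and> b \<noteq> j \<and> \<sigma> b \<noteq> b"
      using permutes_pair[OF s, of 0 j] that(3) by blast
    then obtain b where b: "b < n" "b \<noteq> 0" "b \<noteq> j" "\<sigma> b \<noteq> b" by blast
    then have "\<tau> b = b" using that(1) by (auto simp: Transposition.transpose_def)
    then have "?Y (\<tau> b) b (\<sigma> b) = 0" using entry[of b b] b by auto
    then have "(\<Prod>r = 0..<n. ?Y (\<tau> r) r (\<sigma> r)) = 0" using b(1) by (intro prod_zero bexI[of _ b]) (simp_all del: fun_upd_apply)
    then show ?thesis by (simp only: mult_zero_right)
  qed
  have val: "(\<Prod>r = 0..<n. ?Y (\<tau> r) r (\<sigma> r)) = ?Y (\<tau> 0) 0 (\<sigma> 0) * ?Y (\<tau> j) j (\<sigma> j) * ?g"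
    if "\<tau> \<in> {id, ?t}" "\<sigma> \<in> {id, ?t}" for \<tau> \<sigma>
  proof -
    have "(\<Prod>r = 0..<n. ?Y (\<tau> r) r (\<sigma> r)) =
        (\<Prod>r\<in>{0, j}. ?Y (\<tau> r) r (\<sigma> r)) * (\<Prod>r\<in>{0..<n} - {0, j}. ?Y (\<tau> r) r (\<sigma> r))"
      using n j by (subst prod.subset_diff[of "{0, j}"]) (auto simp: mult.commute)
    also have "(\<Prod>r\<in>{0..<n} - {0, j}. ?Y (\<tau> r) r (\<sigma> r)) = ?g"
    proof (rule prod.cong[OF refl])
      fix r assume r: "r \<in> {0..<n} - {0, j}"
      then have "\<tau> r = r" "\<sigma> r = r" using that by (auto simp: Transposition.transpose_def)
      then show "?Y (\<tau> r) r (\<sigma> r) = g r" using entry[of r r r] r by simp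
    qed
    finally show ?thesis using j by simp
  qed
  have sg: "signof ?t = (- 1 :: 'r)" using j by (simp add: sign_swap_id)
  have "mixed_det n ?Y = (\<Sum>\<tau>\<in>?P. \<Sum>\<sigma>\<in>?P. ?f \<tau> \<sigma>)" by (simp add: mixed_det_def)
  also have "\<dots> = (\<Sum>\<tau>\<in>{id, ?t}. \<Sum>\<sigma>\<in>?P. ?f \<tau> \<sigma>)"
    by (rule sum.mono_neutral_right) (use tp zt in \<open>auto simp: finite_permutations intro!: sum.neutral\<close>)
  also have "\<dots> = (\<Sum>\<tau>\<in>{id, ?t}. \<Sum>\<sigma>\<in>{id, ?t}. ?f \<tau> \<sigma>)"
    by (rule sum.cong[OF refl], rule sum.mono_neutral_right) (use tp zs in \<open>auto simp: finite_permutations\<close>)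
  also have "\<dots> = (\<Sum>\<tau>\<in>{id, ?t}. \<Sum>\<sigma>\<in>{id, ?t}. signof \<sigma> * (?Y (\<tau> 0) 0 (\<sigma> 0) * ?Y (\<tau> j) j (\<sigma> j) * ?g))"
    by (intro sum.cong refl) (simp only: val)
  also have "\<dots> = ?g * (A 0 0 * R j j + A j j * R 0 0 - A 0 j * R j 0 - A j 0 * R 0 j)"
    using ne j sg Y0 by (simp add: algebra_simps)
  finally show ?thesis .
qed

text \<open>With \<open>Q\<close> a multiple of the matrix unit at (0, 0), only \<open>r = 0\<close>
  and \<open>a\<close> in \<open>{0, i}\<close> survive. The bracket, quadratic in \<open>A\<close>
  and linear in \<open>P\<close>, is what remains of the Abel identity after suitable
  mergers.\<close>

lemma abelf_corner:
  fixes A P :: "nat \<Rightarrow> nat \<Rightarrow> 'r::comm_ring_1"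
  assumes ij: "i < n" "i \<noteq> 0" "j < n" "j \<noteq> 0"
    and Y0: "Y 0 = A" and Yb: "\<And>b. b < n \<Longrightarrow> b \<noteq> 0 \<Longrightarrow> Y b = (\<lambda>p c. if p = b \<and> c = b then g b else 0)"
    and Q: "Q = (\<lambda>p c. if p = 0 \<and> c = 0 then g0 else 0)"
  shows "abelf n Y P Q i j = (\<Prod>l\<in>{0..<n} - {0, j}. g l) * (\<Prod>l\<in>{0..<n} - {0, i}. g l) * g0 *
    (A i i * A j j * P 0 0 - A i i * A j 0 * P 0 j - A 0 i * A j j * P i 0 + A 0 i * A j 0 * P i j)"
proof -
  have n: "0 < n" using ij by simp
  let ?K = "\<lambda>j. \<Prod>l\<in>{0..<n} - {0, j}. g l"
  have corner: "mixed_det n (Y(j := R)) = ?K j * (A 0 0 * R j j + A j j * R 0 0 - A 0 j * R j 0 - A j 0 * R 0 j)"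
    if "j < n" "j \<noteq> 0" for j R
    by (rule mixed_det_corner) (use n that Y0 Yb in auto)
  have 1: "mixed_det n (Y(j := unit_row 0 (P a))) = ?K j * (A j j * P a 0 - A j 0 * P a j)" for a
    unfolding corner[OF ij(3,4)] using ij by (simp add: unit_row_def)
  have 2: "mixed_det n (Y(i := unit_row a (Q 0))) = ?K i * g0 * (if a = 0 then A i i else if a = i then - A 0 i else 0)" for a
    unfolding corner[OF ij(1,2)] using ij by (auto simp: unit_row_def Q)
  have 3: "mixed_det n (Y(i := unit_row a (Q r))) = 0" if "r \<noteq> 0" for a r
    unfolding corner[OF ij(1,2)] using ij that by (auto simp: unit_row_def Q)
  have "abelf n Y P Q i j = (\<Sum>a<n. mixed_det n (Y(j := unit_row 0 (P a))) * mixed_det n (Y(i := unit_row a (Q 0))))"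
  proof -
    have "(\<Sum>r<n. mixed_det n (Y(j := unit_row r (P a))) * mixed_det n (Y(i := unit_row a (Q r)))) =
        (\<Sum>r\<in>{0}. mixed_det n (Y(j := unit_row r (P a))) * mixed_det n (Y(i := unit_row a (Q r))))" for a
      by (rule sum.mono_neutral_right) (use n 3 in auto)
    then show ?thesis by (simp add: abelf_def)
  qed
  also have "\<dots> = (\<Sum>a\<in>{0, i}. mixed_det n (Y(j := unit_row 0 (P a))) * mixed_det n (Y(i := unit_row a (Q 0))))"
    by (rule sum.mono_neutral_right) (use n ij 2 in auto)
  also have "\<dots> = ?K j * ?K i * g0 *
    (A i i * A j j * P 0 0 - A i i * A j 0 * P 0 j - A 0 i * A j j * P i 0 + A 0 i * A j 0 * P i j)"
    using ij by (simp add: 1 2 algebra_simps)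
  finally show ?thesis .
qed

section \<open>Permutations of matrix indices acting on positions, where index \<open>a\<close>
  belongs to position \<open>a + 1\<close>\<close>

definition lift_perm :: "nat \<Rightarrow> (nat \<Rightarrow> nat) \<Rightarrow> int \<Rightarrow> int"
  where "lift_perm n \<pi> l = (if l \<in> {1..int n} then int (\<pi> (nat (l - 1))) + 1 else l)"

lemma lift_perm_simps:
  "a < n \<Longrightarrow> lift_perm n \<pi> (int a + 1) = int (\<pi> a) + 1"
  "a < n \<Longrightarrow> lift_perm n \<pi> (1 + int a) = int (\<pi> a) + 1"
  "l \<le> 0 \<Longrightarrow> lift_perm n \<pi> l = l" "l > int n \<Longrightarrow> lift_perm n \<pi> l = l"
  by (auto simp: lift_perm_def)

lemma lift_perm_permutes:
  assumes \<pi>: "\<pi> permutes {0..<n}"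
  shows "lift_perm n \<pi> permutes {1..int n}"
proof (rule bij_imp_permutes)
  have im: "lift_perm n \<pi> l \<in> {1..int n}" if "l \<in> {1..int n}" for l
  proof -
    have "nat (l - 1) < n" using that by auto
    then show ?thesis using permutes_lt[OF \<pi>, of "nat (l - 1)"] that by (simp add: lift_perm_def)
  qed
  have "inj_on (lift_perm n \<pi>) {1..int n}"
  proof (rule inj_onI)
    fix x y assume "x \<in> {1..int n}" "y \<in> {1..int n}" "lift_perm n \<pi> x = lift_perm n \<pi> y"
    then have "nat (x - 1) = nat (y - 1)" "x \<ge> 1" "y \<ge> 1"
      using inj_eq[OF permutes_inj[OF \<pi>]] by (auto simp: lift_perm_def)
    then show "x = y" by simp
  qed
  then show "bij_betw (lift_perm n \<pi>) {1..int n} {1..int n}"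
    unfolding bij_betw_def using endo_inj_surj[of "{1..int n}" "lift_perm n \<pi>"] im by blast
qed (auto simp: lift_perm_def)

lemma lift_perm_transpose:
  "a < n \<Longrightarrow> b < n \<Longrightarrow> lift_perm n (transpose a b) = transpose (int a + 1) (int b + 1)"
  by (auto simp: fun_eq_iff lift_perm_def Transposition.transpose_def)

lemma permutes_three:
  assumes "distinct [i, j, l]" "i < n" "j < n" "l < n"
  obtains \<pi> where "\<pi> permutes {0..<n}" "\<pi> 0 = i" "\<pi> (Suc 0) = j" "\<pi> 2 = l"
proof -
  define t1 where "t1 = transpose 0 i"
  define t2 where "t2 = transpose (t1 1) j"
  define t3 where "t3 = transpose (t2 (t1 2)) l"
  have n: "3 \<le> n"
  proof -
    have "card {i, j, l} \<le> card {0..<n}" by (rule card_mono) (use assms in auto)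
    then show ?thesis using assms(1) by simp
  qed
  have 1: "t1 permutes {0..<n}" unfolding t1_def by (rule permutes_swap_id) (use assms in auto)
  have 2: "t2 permutes {0..<n}" unfolding t2_def
    by (rule permutes_swap_id) (use assms n permutes_lt[OF 1, of 1] in auto)
  have 3: "t3 permutes {0..<n}" unfolding t3_def
    by (rule permutes_swap_id) (use assms n permutes_lt[OF 2] permutes_lt[OF 1, of 2] in auto)
  have e1: "t1 p = t1 q \<longleftrightarrow> p = q" for p q by (rule inj_eq[OF permutes_inj[OF 1]])
  have e2: "t2 p = t2 q \<longleftrightarrow> p = q" for p q by (rule inj_eq[OF permutes_inj[OF 2]])
  have a: "t1 0 = i" by (simp add: t1_def)
  have b: "t2 i = i" using e1[of 0 1] a assms(1) by (auto simp: t2_def Transposition.transpose_def)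
  have c: "t2 (t1 1) = j" by (simp add: t2_def)
  have d: "t3 i = i" using e2[of "t1 0" "t1 2"] e1[of 0 2] a b assms(1)
    by (auto simp: t3_def Transposition.transpose_def)
  have e: "t3 j = j" using e2[of "t1 1" "t1 2"] e1[of 1 2] c assms(1)
    by (auto simp: t3_def Transposition.transpose_def)
  show ?thesis
    by (rule that[of "t3 \<circ> (t2 \<circ> t1)"])
      (use 1 2 3 a b c d e in \<open>auto simp: t3_def intro!: permutes_compose\<close>)
qed

lemma permutes_two:
  assumes "i \<noteq> j" "i < n" "j < n"
  obtains \<pi> where "\<pi> permutes {0..<n}" "\<pi> 0 = i" "\<pi> (Suc 0) = j"
proof -
  define t1 where "t1 = transpose 0 i"
  define t2 where "t2 = transpose (t1 1) j"
  have 1: "t1 permutes {0..<n}" unfolding t1_def by (rule permutes_swap_id) (use assms in auto)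
  have 2: "t2 permutes {0..<n}" unfolding t2_def
    by (rule permutes_swap_id) (use assms permutes_lt[OF 1, of 1] in auto)
  have e1: "t1 p = t1 q \<longleftrightarrow> p = q" for p q by (rule inj_eq[OF permutes_inj[OF 1]])
  have a: "t1 0 = i" by (simp add: t1_def)
  have b: "t2 i = i" using e1[of 0 1] a assms(1) by (auto simp: t2_def Transposition.transpose_def)
  have c: "t2 (t1 1) = j" by (simp add: t2_def)
  show ?thesis
    by (rule that[of "t2 \<circ> t1"]) (use 1 2 a b c in \<open>auto intro!: permutes_compose\<close>)
qed

lemma slot_cases:
  assumes "m \<in> {0..int n + 1}"
  obtains "m = 0" | "m = int n + 1" | a where "a < n" "m = int a + 1"
proof (cases "m = 0 \<or> m = int n + 1")
  case False
  then have "nat (m - 1) < n" "m = int (nat (m - 1)) + 1" using assms by auto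
  then show ?thesis using that(3) by blast
qed (use that in auto)

lemma Jacobi_factor_eq:
  "Jacobi_factor n Z = derange (transpose 2 (int n + 1)) (derange (transpose 0 1) (Z $$ (0, 0))) *
    derange (transpose 0 1) (Z $$ (0, 0)) * derange (transpose 0 2) (Z $$ (1, 1)) *
    (\<Prod>l = 2..<n. (derange (transpose 0 (int l + 1)) (Z $$ (l, l)))\<^sup>2)"
proof -
  have "(\<Prod>l = 3..int n. (derange (transpose 0 l) (ent Z l l))\<^sup>2) =
      (\<Prod>l = 2..<n. (derange (transpose 0 (int l + 1)) (Z $$ (l, l)))\<^sup>2)"
    by (rule prod.reindex_bij_witness[where i = "\<lambda>l. int l + 1" and j = "\<lambda>l. nat (l - 1)"])
      (auto simp: ent_def)
  then show ?thesis by (simp add: Jacobi_factor_def ent_def)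
qed

section \<open>Symmetries and supports of the entries of a Jacobi matrix\<close>

locale jacobi = fg_domain type_of_A for type_of_A :: "'a::k_domain itself" +
  fixes n :: nat and L :: "'a set" and Z :: "'a tensor_power mat"
  assumes n2: "n \<ge> 2" and Z: "Z \<in> Jacobi_matrices n L"
begin

definition z :: "nat \<Rightarrow> nat \<Rightarrow> 'a tensor_power"
  where "z i j = Z $$ (i, j)"

abbreviation \<Delta> :: "'a tensor_power" where "\<Delta> \<equiv> Jacobi_factor n Z"

lemma ent_z: "ent Z (int i + 1) (int j + 1) = z i j" "ent Z (1 + int i) (1 + int j) = z i j"
  by (simp_all add: ent_def z_def)

lemma ent_z_const: "ent Z 1 1 = z 0 0" "ent Z 1 2 = z 0 1" "ent Z 2 1 = z 1 0" "ent Z 2 2 = z 1 1"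
  by (simp_all add: ent_def z_def)

lemma z_sub: "i < n \<Longrightarrow> j < n \<Longrightarrow> z i j \<in> tensor_sub {0..int n + 1}"
proof -
  assume ij: "i < n" "j < n"
  have "\<forall>i\<in>{1..int n}. \<forall>j\<in>{1..int n}. ent Z i j \<in> tensor_sub {0..int n + 1}"
    using Z by (simp add: Jacobi_matrices_def)
  then have "ent Z (int i + 1) (int j + 1) \<in> tensor_sub {0..int n + 1}" using ij by simp
  then show ?thesis by (simp only: ent_z)
qed

lemma z_cong:
  assumes "i < n" "j < n" "\<And>l. l \<in> {0..int n + 1} \<Longrightarrow> \<sigma> l = \<tau> l"
  shows "derange \<sigma> (z i j) = derange \<tau> (z i j)"
  by (rule derange_cong_sub[OF z_sub[OF assms(1,2)] assms(3)])

lemma z_perm: "\<pi> permutes {0..<n} \<Longrightarrow> i < n \<Longrightarrow> j < n \<Longrightarrow> derange (lift_perm n \<pi>) (z i j) = z (\<pi> i) (\<pi> j)"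
proof -
  assume \<pi>: "\<pi> permutes {0..<n}" and ij: "i < n" "j < n"
  have "derange (lift_perm n \<pi>) (ent Z (int i + 1) (int j + 1)) =
      ent Z (lift_perm n \<pi> (int i + 1)) (lift_perm n \<pi> (int j + 1))"
  proof -
    have "\<forall>\<pi>. \<pi> permutes {1..int n} \<longrightarrow>
        (\<forall>i\<in>{1..int n}. \<forall>j\<in>{1..int n}. derange \<pi> (ent Z i j) = ent Z (\<pi> i) (\<pi> j))"
      using Z by (simp add: Jacobi_matrices_def)
    then have "lift_perm n \<pi> permutes {1..int n} \<longrightarrow>
        (\<forall>i\<in>{1..int n}. \<forall>j\<in>{1..int n}. derange (lift_perm n \<pi>) (ent Z i j) =
          ent Z (lift_perm n \<pi> i) (lift_perm n \<pi> j))"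
      by (rule spec)
    then have "\<forall>i\<in>{1..int n}. \<forall>j\<in>{1..int n}. derange (lift_perm n \<pi>) (ent Z i j) =
        ent Z (lift_perm n \<pi> i) (lift_perm n \<pi> j)"
      using lift_perm_permutes[OF \<pi>] by (rule mp)
    then show ?thesis using ij by simp
  qed
  then show ?thesis using ij by (simp only: lift_perm_simps ent_z)
qed

lemma z_transpose:
  "a < n \<Longrightarrow> b < n \<Longrightarrow> i < n \<Longrightarrow> j < n \<Longrightarrow>
    derange (transpose (int a + 1) (int b + 1)) (z i j) = z (transpose a b i) (transpose a b j)"
  using z_perm[of "transpose a b" i j] permutes_swap_id[of a "{0..<n}" b] by (simp add: lift_perm_transpose)

text \<open>Moves a permutation of indices past another derangement. Only positions 0 to n+1 occur
  in the entries, so the composites are compared there.\<close>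

lemma z_conj:
  assumes \<pi>: "\<pi> permutes {0..<n}" and ij: "i < n" "j < n"
    and eq: "\<And>l. l \<in> {0..int n + 1} \<Longrightarrow> \<sigma> (\<tau> l) = \<tau>' (lift_perm n \<pi> l)"
  shows "derange \<sigma> (derange \<tau> (z i j)) = derange \<tau>' (z (\<pi> i) (\<pi> j))"
  unfolding z_perm[OF \<pi> ij, symmetric] derange_comp
  by (rule z_cong[OF ij]) (simp add: eq)

lemma z00: "z 0 0 = derange (id(1 := 2)) (z 0 1)"
  using Z by (simp add: Jacobi_matrices_def ent_z_const)

lemma z_minor01: "z 0 0 * z 1 1 = z 0 1 * z 1 0"
proof -
  have "ent Z 1 1 * ent Z 2 2 - ent Z 1 2 * ent Z 2 1 = 0"
    using Z unfolding Jacobi_matrices_def mem_Collect_eq by (elim conjE)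
  then show ?thesis by (simp only: ent_z_const right_minus_eq)
qed

text \<open>The definition prescribes a single minor; the permutations of indices carry it to all
  principal ones.\<close>

lemma z_minor: "i < n \<Longrightarrow> j < n \<Longrightarrow> z i i * z j j = z i j * z j i"
proof (cases "i = j")
  case False
  assume ij: "i < n" "j < n"
  obtain \<pi> where \<pi>: "\<pi> permutes {0..<n}" "\<pi> 0 = i" "\<pi> (Suc 0) = j" using permutes_two[OF False ij] .
  have "derange (lift_perm n \<pi>) (z 0 0 * z 1 1) = derange (lift_perm n \<pi>) (z 0 1 * z 1 0)"
    by (simp only: z_minor01)
  then show ?thesis using n2 by (simp add: derange_hom z_perm[OF \<pi>(1)] \<pi>)
qed simp

text \<open>\<open>z 0 0\<close> arises by moving position 1 into position 2, so position 1 does not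
  occur in it; by symmetry \<open>z i i\<close> omits position \<open>i + 1\<close>.\<close>

lemma zii_sub: "i < n \<Longrightarrow> z i i \<in> tensor_sub ({0..int n + 1} - {int i + 1})"
proof -
  assume i: "i < n"
  have 0: "z 0 0 \<in> tensor_sub ({0..int n + 1} - {1})"
    unfolding z00 by (rule derange_sub[OF z_sub]) (use n2 in auto)
  have "z i i = derange (transpose (int 0 + 1) (int i + 1)) (z 0 0)"
    using i n2 by (subst z_transpose) auto
  also have "\<dots> \<in> tensor_sub ({0..int n + 1} - {int i + 1})"
    by (rule derange_sub[OF 0]) (use i in \<open>auto simp: Transposition.transpose_def\<close>)
  finally show ?thesis .
qed

lemma zii_cong:
  assumes "i < n" "\<And>l. l \<in> {0..int n + 1} \<Longrightarrow> l \<noteq> int i + 1 \<Longrightarrow> \<sigma> l = \<tau> l"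
  shows "derange \<sigma> (z i i) = derange \<tau> (z i i)"
  by (rule derange_cong_sub[OF zii_sub[OF assms(1)]]) (use assms(2) in auto)

lemma abel_identity:
  assumes "i < n" "j < n"
  shows "abelf n (\<lambda>b p c. derange (id(0 := - (int b + 1))) (z p c)) (\<lambda>p c. z p c)
    (\<lambda>p c. derange (id(0 := - (int n + 1))) (z p c)) i j = \<Delta> * derange uminus (z i j)"
proof -
  have Zc: "Z \<in> carrier_mat n n" using Z by (simp add: Jacobi_matrices_def)
  have "abel n (\<lambda>l. map_mat (derange (id(0 := - int l))) Z) $$ (i, j) = (\<Delta> \<cdot>\<^sub>m bar_mat Z) $$ (i, j)"
    using Z by (simp add: Jacobi_matrices_def)
  also have "\<dots> = \<Delta> * derange uminus (z i j)" using Zc assms by (simp add: bar_mat_def z_def)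
  also have "abel n (\<lambda>l. map_mat (derange (id(0 := - int l))) Z) $$ (i, j) =
      abelf n (\<lambda>b p c. derange (id(0 := - (int b + 1))) (z p c)) (\<lambda>p c. z p c)
        (\<lambda>p c. derange (id(0 := - (int n + 1))) (z p c)) i j"
  proof -
    have "id(0 := 0) = (id :: int \<Rightarrow> int)" by auto
    then show ?thesis using Zc assms
      by (subst abel_entry) (auto intro!: abelf_cong simp: z_def derange_id algebra_simps)
  qed
  finally show ?thesis .
qed

text \<open>Every derangement \<kappa> specializes the Abel identity. The inner matrices carry
  distinct negative positions, so a suitable \<kappa> can merge each of them separately.\<close>

lemma abel_identity_derange:
  assumes "i < n" "j < n"
  shows "abelf n (\<lambda>b p c. derange (\<kappa> \<circ> id(0 := - (int b + 1))) (z p c)) (\<lambda>p c. derange \<kappa> (z p c))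
    (\<lambda>p c. derange (\<kappa> \<circ> id(0 := - (int n + 1))) (z p c)) i j = derange \<kappa> \<Delta> * derange (\<kappa> \<circ> uminus) (z i j)"
proof -
  have "derange \<kappa> (abelf n (\<lambda>b p c. derange (id(0 := - (int b + 1))) (z p c)) (\<lambda>p c. z p c)
    (\<lambda>p c. derange (id(0 := - (int n + 1))) (z p c)) i j) = derange \<kappa> (\<Delta> * derange uminus (z i j))"
    by (simp only: abel_identity[OF assms])
  then show ?thesis
    by (simp only: comm_ring_hom.hom_abelf[OF comm_ring_hom_derange] derange_hom derange_comp)
qed

lemma derange_eq_0_iff: "bij \<sigma> \<Longrightarrow> derange \<sigma> x = 0 \<longleftrightarrow> x = (0 :: 'a tensor_power)"
proof
  assume "bij \<sigma>" "derange \<sigma> x = 0"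
  then have "derange (inv_into UNIV \<sigma>) (derange \<sigma> x) = 0" by (simp add: derange_hom)
  then show "x = 0" using \<open>bij \<sigma>\<close> by (simp add: derange_comp bij_is_inj derange_id)
qed (simp add: derange_hom)

lemma bij_transpose: "bij (transpose a b)"
  by (rule bij_swap_iff[THEN iffD2, of id, simplified comp_id id_comp]) simp

lemma bij_lift_perm: "\<pi> permutes {0..<n} \<Longrightarrow> bij (lift_perm n \<pi>)"
  by (rule permutes_bij[OF lift_perm_permutes])

text \<open>All diagonal entries are renamings of \<open>z 0 0\<close> and all others of
  \<open>z 0 1\<close>. The minor condition ties the two together in a domain, so one nonzero entry
  forces all to be nonzero.\<close>

lemma z_nonzero: "i < n \<Longrightarrow> j < n \<Longrightarrow> z i j \<noteq> 0"
proof -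
  assume ij: "i < n" "j < n"
  have to00: "z l l = 0 \<longleftrightarrow> z 0 0 = 0" if "l < n" for l
  proof -
    have "z l l = derange (transpose (int 0 + 1) (int l + 1)) (z 0 0)" using that n2 by (subst z_transpose) auto
    then show ?thesis by (simp only: derange_eq_0_iff[OF bij_transpose])
  qed
  have to01: "z a b = 0 \<longleftrightarrow> z 0 1 = 0" if ab: "a \<noteq> b" "a < n" "b < n" for a b
  proof -
    obtain \<pi> where \<pi>: "\<pi> permutes {0..<n}" "\<pi> 0 = a" "\<pi> (Suc 0) = b" using permutes_two[OF ab] .
    have "z a b = derange (lift_perm n \<pi>) (z 0 1)" using n2 by (subst z_perm[OF \<pi>(1)]) (auto simp: \<pi>)
    then show ?thesis by (simp only: derange_eq_0_iff[OF bij_lift_perm[OF \<pi>(1)]])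
  qed
  have "z 0 0 = 0 \<longleftrightarrow> z 0 1 = 0"
  proof -
    have "z 1 1 = 0 \<longleftrightarrow> z 0 0 = 0" "z 1 0 = 0 \<longleftrightarrow> z 0 1 = 0" using to00[of 1] to01[of 1 0] n2 by auto
    then show ?thesis using z_minor01 tensor_mult_eq_0 by metis
  qed
  moreover have "\<exists>a<n. \<exists>b<n. z a b \<noteq> 0"
  proof (rule ccontr)
    assume "\<not> ?thesis"
    then have "Z = 0\<^sub>m n n" using Z by (intro eq_matI) (auto simp: Jacobi_matrices_def z_def)
    then show False using Z by (simp add: Jacobi_matrices_def)
  qed
  ultimately show ?thesis using to00 to01 ij by metis
qed

text \<open>The factor of \<Delta> attached to \<open>l\<close>. Position \<open>l + 1\<close> is
  absent from \<open>z l l\<close>, so after the exchange position 0 is absent from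
  \<open>G l\<close>.\<close>

definition G :: "nat \<Rightarrow> 'a tensor_power"
  where "G l = derange (transpose 0 (int l + 1)) (z l l)"

lemma G_nonzero: "l < n \<Longrightarrow> G l \<noteq> 0"
  unfolding G_def by (simp only: derange_eq_0_iff[OF bij_transpose] z_nonzero not_False_eq_True)

lemma G_perm: "\<pi> permutes {0..<n} \<Longrightarrow> l < n \<Longrightarrow> derange (lift_perm n \<pi>) (G l) = G (\<pi> l)"
proof -
  assume \<pi>: "\<pi> permutes {0..<n}" and l: "l < n"
  have inj: "\<pi> a = \<pi> l \<longleftrightarrow> a = l" for a by (rule inj_eq[OF permutes_inj[OF \<pi>]])
  show ?thesis unfolding G_def
  proof (rule z_conj[OF \<pi> l l])
    fix m assume "m \<in> {0..int n + 1}"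
    then show "lift_perm n \<pi> (transpose 0 (int l + 1) m) = transpose 0 (int (\<pi> l) + 1) (lift_perm n \<pi> m)"
    proof (cases rule: slot_cases)
      case (3 a)
      then show ?thesis using l inj[of a] by (cases "a = l") (simp_all add: lift_perm_simps Transposition.transpose_def)
    qed (use l permutes_lt[OF \<pi> l] in \<open>auto simp: lift_perm_simps Transposition.transpose_def\<close>)
  qed
qed

lemma G_transpose: "a < n \<Longrightarrow> b < n \<Longrightarrow> l < n \<Longrightarrow>
    derange (transpose (int a + 1) (int b + 1)) (G l) = G (transpose a b l)"
  using G_perm[of "transpose a b" l] permutes_swap_id[of a "{0..<n}" b] by (simp add: lift_perm_transpose)

lemma G_sub: "l < n \<Longrightarrow> G l \<in> tensor_sub {1..int n + 1}"
  unfolding G_def by (rule derange_sub[OF zii_sub]) (auto simp: Transposition.transpose_def)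

lemma \<Delta>_eq: "\<Delta> = derange (transpose 2 (int n + 1)) (G 0) * G 0 * G 1 * (\<Prod>l = 2..<n. (G l)\<^sup>2)"
  unfolding Jacobi_factor_eq G_def z_def by (simp add: add.commute)

lemma \<Delta>_nonzero: "\<Delta> \<noteq> 0"
  unfolding \<Delta>_eq using n2 G_nonzero
  by (auto simp: tensor_mult_eq_0 tensor_prod_eq_0 derange_eq_0_iff[OF bij_transpose] dest: tensor_power_eq_0)

lemma \<Delta>_sub: "\<Delta> \<in> tensor_sub {1..int n + 1}"
  unfolding \<Delta>_eq power2_eq_square using n2
  by (intro tensor_sub_mult tensor_sub_prod G_sub derange_sub[OF G_sub])
    (auto simp: Transposition.transpose_def)

lemma bij_uminus: "bij (uminus :: int \<Rightarrow> int)"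
  by (rule o_bij[of uminus]) (auto simp: fun_eq_iff)

text \<open>Merging positions 1 and 2 makes columns 0 and 1 of the inner matrices and of
  \<open>P\<close> equal, which kills the abeliant. The other side of the Abel identity is the
  merged \<Delta> times the barred \<open>z 0 0\<close>, which lives in nonpositive positions and
  stays nonzero.\<close>

lemma merge_\<Delta>: "derange (id(1 := 2)) \<Delta> = 0"
proof -
  let ?\<kappa> = "id(1 := 2) :: int \<Rightarrow> int"
  have tr: "derange ?\<kappa> (derange (transpose 1 2) x) = derange ?\<kappa> x" for x :: "'a tensor_power"
    unfolding derange_comp by (rule arg_cong[of _ _ "\<lambda>\<sigma>. derange \<sigma> x"]) (auto simp: fun_eq_iff Transposition.transpose_def)
  have kk: "derange ?\<kappa> (derange ?\<kappa> x) = derange ?\<kappa> x" for x :: "'a tensor_power"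
    unfolding derange_comp by (rule arg_cong[of _ _ "\<lambda>\<sigma>. derange \<sigma> x"]) (auto simp: fun_eq_iff)
  have t: "derange (transpose 1 2) (z p c) = z (transpose 0 1 p) (transpose 0 1 c)" if "p < n" "c < n" for p c
    using z_transpose[of 0 1 p c] that n2 by simp
  \<comment> \<open>The cases rest on three facts: \<kappa> is idempotent, \<open>z 0 0\<close> is
    the merger of \<open>z 0 1\<close>, and the merger does not see the exchange of positions 1 and
    2.\<close>
  have col: "derange ?\<kappa> (z p 0) = derange ?\<kappa> (z p 1)" if p: "p < n" for p
  proof -
    consider "p = 0" | "p = 1" | "p \<ge> 2" by linarith
    then show ?thesis
    proof cases
      case 1
      have "derange ?\<kappa> (z 0 0) = derange ?\<kappa> (derange ?\<kappa> (z 0 1))" by (simp only: z00)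
      then show ?thesis using kk 1 by simp
    next
      case 2
      have "derange ?\<kappa> (z 1 0) = derange ?\<kappa> (derange (transpose 1 2) (z 0 1))" using n2 by (subst t) auto
      also have "\<dots> = z 0 0" by (simp only: tr z00)
      finally have 1: "derange ?\<kappa> (z 1 0) = z 0 0" .
      have "derange ?\<kappa> (z 1 1) = derange ?\<kappa> (derange (transpose 1 2) (z 0 0))" using n2 by (subst t) auto
      also have "\<dots> = derange ?\<kappa> (derange ?\<kappa> (z 0 1))" by (simp only: tr z00)
      also have "\<dots> = z 0 0" by (simp only: kk z00)
      finally show ?thesis using 1 2 by simp
    next
      case 3
      have "derange ?\<kappa> (z p 1) = derange ?\<kappa> (derange (transpose 1 2) (z p 0))"
        using 3 p n2 by (subst t) (auto simp: Transposition.transpose_def)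
      then show ?thesis by (simp only: tr)
    qed
  qed
  have col': "derange (?\<kappa> \<circ> id(0 := m)) (z p 0) = derange (?\<kappa> \<circ> id(0 := m)) (z p 1)" if "p < n" "m \<le> 0" for p m
  proof -
    have "?\<kappa> \<circ> id(0 := m) = id(0 := m) \<circ> ?\<kappa>" using that by (auto simp: fun_eq_iff)
    then show ?thesis using col[OF that(1)] by (simp only: flip: derange_comp)
  qed
  have "derange ?\<kappa> \<Delta> * derange (?\<kappa> \<circ> uminus) (z 0 0) = 0"
    unfolding abel_identity_derange[symmetric, OF less_le_trans[OF zero_less_numeral n2] less_le_trans[OF zero_less_numeral n2]]
    by (rule abelf_equal_columns[of 0 n 1]) (use n2 col col' in auto)
  moreover have "derange (?\<kappa> \<circ> uminus) (z 0 0) = derange uminus (z 0 0)"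
    by (rule z_cong) (use n2 in auto)
  ultimately show ?thesis
    using n2 z_nonzero[of 0 0] by (auto simp: tensor_mult_eq_0 derange_eq_0_iff[OF bij_uminus])
qed

text \<open>Exchanging positions 2 and 3 permutes rows and columns of all matrices simultaneously,
  which the abeliant ignores, and leaves the barred entry untouched. Hence \<Delta> is invariant
  although its formula treats the two positions differently.\<close>

lemma bar_transpose_\<Delta>:
  assumes "n \<ge> 3"
  shows "derange (transpose 2 3) \<Delta> = \<Delta>"
proof -
  let ?t = "transpose 2 3 :: int \<Rightarrow> int" and ?s = "transpose 1 2 :: nat \<Rightarrow> nat"
  have s: "?s permutes {0..<n}" by (rule permutes_swap_id) (use assms in auto)
  have t: "derange (?t \<circ> id(0 := m)) (z p c) = derange (id(0 := m)) (z (?s p) (?s c))"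
    if "p < n" "c < n" "m \<le> 0" for p c m
  proof -
    have "?t \<circ> id(0 := m) = id(0 := m) \<circ> ?t" using that by (auto simp: fun_eq_iff Transposition.transpose_def)
    moreover have "derange ?t (z p c) = z (?s p) (?s c)"
      using z_transpose[of 1 2 p c] that assms by (simp add: add.commute)
    ultimately show ?thesis by (simp only: flip: derange_comp)
  qed
  have t0: "derange ?t (z p c) = z (?s p) (?s c)" if "p < n" "c < n" for p c
    using z_transpose[of 1 2 p c] that assms by (simp add: add.commute)
  have n0: "0 < n" using assms by simp
  have "derange ?t \<Delta> * derange (?t \<circ> uminus) (z 0 0) =
      abelf n (\<lambda>b p c. derange (id(0 := - (int b + 1))) (z (?s p) (?s c))) (\<lambda>p c. z (?s p) (?s c))
        (\<lambda>p c. derange (id(0 := - (int n + 1))) (z (?s p) (?s c))) 0 0"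
    unfolding abel_identity_derange[symmetric, OF n0 n0] by (rule abelf_cong) (use t t0 in auto)
  also have "\<dots> = \<Delta> * derange uminus (z 0 0)"
    unfolding abel_identity[symmetric, OF n0 n0]
    by (rule abelf_conj[OF s, of "\<lambda>b p c. derange (id(0 := - (int b + 1))) (z p c)"])
  also have "derange uminus (z 0 0) = derange (?t \<circ> uminus) (z 0 0)"
    by (rule z_cong) (use assms in \<open>auto simp: Transposition.transpose_def\<close>)
  finally have "derange ?t \<Delta> * derange (?t \<circ> uminus) (z 0 0) = \<Delta> * derange (?t \<circ> uminus) (z 0 0)" .
  moreover have "derange (?t \<circ> uminus) (z 0 0) \<noteq> 0"
    using z_nonzero[OF n0 n0] by (simp add: derange_eq_0_iff[OF bij_comp[OF bij_uminus bij_transpose]])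
  ultimately show ?thesis using tensor_mult_cancel mult.commute by metis
qed
end

section \<open>Mergers of position 0 and the rank one property\<close>

context jacobi
begin

text \<open>For the image of a Segre matrix this merger puts a repeated row into a determinant. Here
  it follows from the invariance of \<Delta> under \<open>transpose 2 3\<close> and its vanishing
  under the merger of positions 1 and 2. That merger sends both \<open>G 0\<close> and
  \<open>G 1\<close> to \<open>ii\<close>, the element to be shown zero.\<close>

lemma alternating:
  assumes n3: "n \<ge> 3"
  shows "derange (id(0 := 2)) (z 0 0) = 0"
proof -
  let ?\<kappa> = "id(1 := 2) :: int \<Rightarrow> int" and ?t = "transpose 2 3 :: int \<Rightarrow> int"
  define ii where "ii = derange (id(0 := 2)) (z 0 0)"
  define \<Gamma> where "\<Gamma> = derange (transpose 2 (int n + 1)) (G 0)"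
  define R where "R = (\<Prod>l = 3..<n. (G l)\<^sup>2)"
  have split: "(\<Prod>l = 2..<n. f l) = f 2 * (\<Prod>l = 3..<n. f l)" for f :: "nat \<Rightarrow> 'a tensor_power"
    using n3 prod.atLeast_Suc_lessThan[of 2 n f] by (simp add: numeral_3_eq_3 numeral_2_eq_2)
  have \<Delta>1: "\<Delta> = \<Gamma> * G 0 * G 1 * (G 2)\<^sup>2 * R" by (simp add: \<Delta>_eq \<Gamma>_def R_def split mult_ac)
  have tG: "derange ?t (G l) = G (transpose 1 2 l)" if "l < n" for l
    using G_transpose[of 1 2 l] that n3 by (simp add: add.commute)
  have tR: "derange ?t R = R" unfolding R_def derange_hom
    by (rule prod.cong[OF refl]) (simp add: tG Transposition.transpose_def)
  have "derange ?t \<Delta> = derange ?t \<Gamma> * G 0 * G 2 * (G 1)\<^sup>2 * R"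
    unfolding \<Delta>1 using n3 by (simp add: derange_hom tR tG Transposition.transpose_def)
  then have eq: "\<Gamma> * G 0 * G 1 * (G 2)\<^sup>2 * R = derange ?t \<Gamma> * G 0 * G 2 * (G 1)\<^sup>2 * R"
    using bar_transpose_\<Delta>[OF n3] \<Delta>1 by simp
  have R0: "R \<noteq> 0" using G_nonzero by (auto simp: R_def tensor_prod_eq_0 dest: tensor_power_eq_0)
  have "(G 0 * G 1 * G 2 * R) * (\<Gamma> * G 2) = (G 0 * G 1 * G 2 * R) * (derange ?t \<Gamma> * G 1)"
    using eq by (simp add: power2_eq_square mult_ac)
  \<comment> \<open>\<open>G 1\<close> and \<open>G 2\<close> occur in \<Delta> with exponents 1 and
    2, so after cancellation one of them is left on each side.\<close>
  then have rel: "\<Gamma> * G 2 = derange ?t \<Gamma> * G 1"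
    by (rule tensor_mult_cancel[rotated]) (use n3 G_nonzero R0 in \<open>simp add: tensor_mult_eq_0\<close>)
  have k0: "derange ?\<kappa> (G 0) = ii"
    unfolding G_def ii_def derange_comp by (rule zii_cong) (use n3 in \<open>auto simp: Transposition.transpose_def\<close>)
  have z11: "z 1 1 = derange (transpose 1 2) (z 0 0)" using z_transpose[of 0 1 0 0] n3 by simp
  have k1: "derange ?\<kappa> (G 1) = ii"
    unfolding G_def ii_def z11 derange_comp by (rule zii_cong) (use n3 in \<open>auto simp: Transposition.transpose_def\<close>)
  \<comment> \<open>The symmetry of \<open>z 0 0\<close> in positions 2 and 3 identifies the merged
    image of \<Gamma> with a renaming of \<open>ii\<close>.\<close>
  have z0t: "z 0 0 = derange ?t (z 0 0)" using z_transpose[of 1 2 0 0] n3 by (simp add: Transposition.transpose_def)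
  have k\<Gamma>: "derange ?\<kappa> (derange ?t \<Gamma>) = derange (transpose 3 (int n + 1)) ii"
    unfolding \<Gamma>_def G_def ii_def
  proof (subst (2) z0t, unfold derange_comp, rule zii_cong)
    fix l assume "l \<in> {0..int n + 1}" "l \<noteq> int 0 + 1"
    then consider "l = 0" | "l = 2" | "l = 3" | "l = int n + 1" | "l > 3" "l < int n + 1" by force
    then show "(?\<kappa> \<circ> (?t \<circ> (transpose 2 (int n + 1) \<circ> transpose 0 (int 0 + 1)))) l =
        (transpose 3 (int n + 1) \<circ> (id(0 := 2) \<circ> ?t)) l"
      using n3 by cases (simp_all add: Transposition.transpose_def)
  qed (use n3 in simp)
  have "derange ?\<kappa> (\<Gamma> * G 2) = derange ?\<kappa> (derange ?t \<Gamma> * G 1)" by (simp only: rel)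
  then have prod: "derange ?\<kappa> \<Gamma> * derange ?\<kappa> (G 2) = derange (transpose 3 (int n + 1)) ii * ii"
    by (simp only: derange_hom k\<Gamma> k1)
  have kG: "derange ?\<kappa> (G l) = 0 \<longleftrightarrow> derange ?\<kappa> (G 2) = 0" if "2 \<le> l" "l < n" for l
  proof -
    have "derange (transpose 3 (int l + 1)) (derange ?\<kappa> (G l)) = derange ?\<kappa> (derange (transpose 3 (int l + 1)) (G l))"
      unfolding derange_comp by (rule arg_cong[of _ _ "\<lambda>\<sigma>. derange \<sigma> (G l)"])
        (use that in \<open>auto simp: fun_eq_iff Transposition.transpose_def\<close>)
    also have "derange (transpose 3 (int l + 1)) (G l) = G 2"
      using G_transpose[of 2 l l] that n3 by (simp add: add.commute)
    finally show ?thesis using derange_eq_0_iff[OF bij_transpose] by metis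
  qed
  have "derange ?\<kappa> \<Gamma> * ii * ii * (\<Prod>l = 2..<n. (derange ?\<kappa> (G l))\<^sup>2) = 0"
    using merge_\<Delta> unfolding \<Delta>_eq \<Gamma>_def[symmetric] by (simp add: derange_hom k0 k1[unfolded One_nat_def])
  \<comment> \<open>By \<open>prod\<close>, if \<Gamma> or \<open>G 2\<close> merges to zero, then
    the product of \<open>ii\<close> with a renaming of itself vanishes.\<close>
  then have "derange ?\<kappa> \<Gamma> = 0 \<or> ii = 0 \<or> derange ?\<kappa> (G 2) = 0"
    using kG by (auto simp: tensor_mult_eq_0 tensor_prod_eq_0 dest!: tensor_power_eq_0)
  then have "derange (transpose 3 (int n + 1)) ii * ii = 0 \<or> ii = 0"
    using prod by (metis mult_zero_left mult_zero_right)
  then show ?thesis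
    unfolding ii_def[symmetric] tensor_mult_eq_0 by (simp only: derange_eq_0_iff[OF bij_transpose] disj_absorb)
qed

definition N :: "nat \<Rightarrow> nat \<Rightarrow> nat \<Rightarrow> 'a tensor_power"
  where "N l i j = derange (id(0 := int l + 1)) (z i j)"

lemma N_perm:
  assumes \<pi>: "\<pi> permutes {0..<n}" and ij: "i < n" "j < n" "l < n"
  shows "derange (lift_perm n \<pi>) (N l i j) = N (\<pi> l) (\<pi> i) (\<pi> j)"
  unfolding N_def
proof (rule z_conj[OF \<pi> ij(1,2)])
  fix m assume "m \<in> {0..int n + 1}"
  then show "lift_perm n \<pi> ((id(0 := int l + 1)) m) = (id(0 := int (\<pi> l) + 1)) (lift_perm n \<pi> m)"
    by (cases rule: slot_cases) (use ij in \<open>auto simp: lift_perm_simps\<close>)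
qed

lemma N_zero_perm:
  assumes "\<pi> permutes {0..<n}" "i < n" "j < n" "l < n"
  shows "N (\<pi> l) (\<pi> i) (\<pi> j) = 0 \<longleftrightarrow> N l i j = 0"
  unfolding N_perm[OF assms, symmetric] by (rule derange_eq_0_iff[OF bij_lift_perm[OF assms(1)]])

lemma N_minor: "i < n \<Longrightarrow> j < n \<Longrightarrow> N l i j * N l j i = N l i i * N l j j"
  unfolding N_def derange_hom(2)[symmetric] by (rule arg_cong[OF z_minor[symmetric]])

lemma N_diag_nonzero: "l < n \<Longrightarrow> N l l l = G l"
  unfolding N_def G_def by (rule zii_cong) (auto simp: Transposition.transpose_def)

text \<open>Diagonal entries vanish by alternation, and entries with three distinct indices by the
  principal minors and the symmetry in \<open>i\<close> and \<open>j\<close>. For the other entries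
  in row or column \<open>l\<close> the minors give only one of two alternatives. Either one makes
  every \<open>N b\<close> a matrix of rank one, and the Abel identity with \<open>P\<close>
  specialized to \<open>N l\<close> then has an abeliant with a repeated matrix.\<close>

lemma N_zero:
  assumes n3: "n \<ge> 3" and ijl: "i < n" "j < n" "l < n" and ne: "i \<noteq> l \<or> j \<noteq> l"
  shows "N l i j = 0"
proof -
  have diag: "N l i i = 0" if il: "i \<noteq> l" "i < n" "l < n" for i l
  proof -
    obtain \<pi> where \<pi>: "\<pi> permutes {0..<n}" "\<pi> 0 = i" "\<pi> (Suc 0) = l" using permutes_two[OF il] .
    have "N (Suc 0) 0 0 = 0" using alternating[OF n3] by (simp add: N_def)
    then show ?thesis using N_zero_perm[OF \<pi>(1), of 0 0 "Suc 0"] n3 \<pi> by simp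
  qed
  have off: "N l i j = 0" if h: "i \<noteq> j" "i \<noteq> l" "j \<noteq> l" "i < n" "j < n" "l < n" for i j l
  proof -
    have "N l i j * N l j i = 0" using N_minor[of i j l] diag h by simp
    moreover have "N l j i = 0 \<longleftrightarrow> N l i j = 0"
      using N_zero_perm[OF permutes_swap_id[of i "{0..<n}" j], of i j l] h
      by (simp add: Transposition.transpose_def)
    ultimately show ?thesis by (simp add: tensor_mult_eq_0)
  qed
  have 01: "N 0 (Suc 0) 0 = 0 \<or> N 0 0 (Suc 0) = 0"
    using N_minor[of "Suc 0" 0 0] diag[of "Suc 0" 0] n3 by (simp add: tensor_mult_eq_0)
  \<comment> \<open>Signs are removed from positions -1 to -n and 0 is merged into
    \<open>l + 1\<close>: the inner matrices become the \<open>N b\<close>, the first outer one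
    becomes \<open>N l\<close>, and -(n+1) alone stays negative. \<Delta> is unaffected, since only
    positions 1 to n+1 occur in it.\<close>
  define \<kappa> where "\<kappa> m = (if m = 0 then int l + 1 else if - int n \<le> m \<and> m \<le> -1 then - m else m)" for m :: int
  have Yb: "derange (\<kappa> \<circ> id(0 := - (int b + 1))) (z p c) = N b p c" if "b < n" "p < n" "c < n" for b p c
    unfolding N_def by (rule z_cong) (use that in \<open>auto simp: \<kappa>_def\<close>)
  have P: "derange \<kappa> (z p c) = N l p c" if "p < n" "c < n" for p c
    unfolding N_def by (rule z_cong) (use that in \<open>auto simp: \<kappa>_def\<close>)
  define Q where "Q p c = derange (\<kappa> \<circ> id(0 := - (int n + 1))) (z p c)" for p c
  have \<kappa>\<Delta>: "derange \<kappa> \<Delta> = \<Delta>"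
    using derange_cong_sub[OF \<Delta>_sub, of \<kappa> id] by (simp add: \<kappa>_def derange_id)
  have main: "abelf n N (N l) Q i j = \<Delta> * derange (\<kappa> \<circ> uminus) (z i j)"
    unfolding abel_identity_derange[OF ijl(1,2), of \<kappa>, symmetric, unfolded \<kappa>\<Delta>]
    by (rule abelf_cong) (simp_all only: Yb P Q_def)
  have "abelf n N (N l) Q i j = 0"
    using 01
  proof
    assume 0: "N 0 (Suc 0) 0 = 0"
    have row: "N b p b = 0" if h: "p \<noteq> b" "p < n" "b < n" for p b
    proof -
      obtain \<pi> where \<pi>: "\<pi> permutes {0..<n}" "\<pi> 0 = b" "\<pi> (Suc 0) = p" using permutes_two[OF h(1)[symmetric] h(3,2)] .
      show ?thesis using N_zero_perm[OF \<pi>(1), of "Suc 0" 0 0] n3 \<pi> 0 by simp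
    qed
    have form: "N b p c = (if p = b then 1 else 0) * N b b c" if "b < n" "p < n" "c < n" for b p c
      using row[of p b] off[of p c b] diag[of p b] that by (cases "p = b"; cases "c = b"; cases "p = c") auto
    have "abelf n N (N l) Q i j = abelf n (\<lambda>b p c. (if p = b then 1 else 0) * N b b c)
        (\<lambda>p c. (if p = l then 1 else 0) * N l l c) Q i j"
      by (rule abelf_cong) (use form ijl in blast)+
    also have "\<dots> = 0" by (rule abelf_repeated[OF ijl ne])
    finally show ?thesis .
  next
    assume 0: "N 0 0 (Suc 0) = 0"
    have col: "N b b p = 0" if h: "p \<noteq> b" "p < n" "b < n" for p b
    proof -
      obtain \<pi> where \<pi>: "\<pi> permutes {0..<n}" "\<pi> 0 = b" "\<pi> (Suc 0) = p" using permutes_two[OF h(1)[symmetric] h(3,2)] .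
      show ?thesis using N_zero_perm[OF \<pi>(1), of 0 "Suc 0" 0] n3 \<pi> 0 by simp
    qed
    have form: "N b p c = N b p b * (if c = b then 1 else 0)" if "b < n" "p < n" "c < n" for b p c
      using col[of c b] off[of p c b] diag[of c b] that by (cases "p = b"; cases "c = b"; cases "p = c") auto
    have "abelf n N (N l) Q i j = abelf n (\<lambda>b p c. N b p b * (if c = b then 1 else 0))
        (\<lambda>p c. N l p l * (if c = l then 1 else 0)) Q i j"
      by (rule abelf_cong) (use form ijl in blast)+
    also have "\<dots> = 0" by (rule abelf_repeated[OF ijl ne])
    finally show ?thesis .
  qed
  then have "derange (\<kappa> \<circ> uminus) (z i j) = 0" using main \<Delta>_nonzero by (simp add: tensor_mult_eq_0)
  \<comment> \<open>Renaming the remaining negative position turns the barred entry into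
    \<open>N l i j\<close>.\<close>
  then have "derange (id(- (int n + 1) := int n + 1)) (derange (\<kappa> \<circ> uminus) (z i j)) = 0" by (simp add: derange_hom)
  moreover have "derange (id(- (int n + 1) := int n + 1)) (derange (\<kappa> \<circ> uminus) (z i j)) = N l i j"
    unfolding N_def derange_comp by (rule z_cong) (use ijl in \<open>auto simp: \<kappa>_def\<close>)
  ultimately show ?thesis by simp
qed

text \<open>The identity behind the rank one property: with \<open>W = P\<^sub>1\<^sub>2 P\<^sub>0\<^sub>0 - P\<^sub>1\<^sub>0 P\<^sub>0\<^sub>2\<close>, the second factor
  becomes a nonzero multiple of \<open>W\<close> when \<open>A\<close> is specialized to \<open>P\<close>.\<close>

lemma corner_algebra:
  fixes A P :: "nat \<Rightarrow> nat \<Rightarrow> 'r::comm_ring_1"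
  defines "E \<equiv> \<lambda>i j. A i i * A j j * P 0 0 - A i i * A j 0 * P 0 j - A 0 i * A j j * P i 0 + A 0 i * A j 0 * P i j"
  assumes P1: "P 0 0 * P 1 1 = P 0 1 * P 1 0" and P2: "P 0 0 * P 2 2 = P 0 2 * P 2 0"
    and P12: "P 1 1 * P 2 2 = P 1 2 * P 2 1" and E: "E 1 2 * E 2 1 = E 1 1 * E 2 2"
  shows "(P 1 2 * P 0 0 - P 1 0 * P 0 2) *
    ((A 2 2 * P 0 0 - A 0 2 * P 2 0) * (A 1 1 * P 0 0 - A 1 0 * P 0 1) * A 0 1 * A 2 0 * P 1 2 * P 0 0
      - (A 1 1 * P 0 0 - A 0 1 * P 1 0) * (A 2 2 * P 0 0 - A 2 0 * P 0 2) * A 0 2 * A 1 0 * P 2 0 * P 0 1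
      - A 0 1 * A 2 0 * A 0 2 * A 1 0 * P 2 0 * P 0 1 * (P 1 2 * P 0 0 - P 1 0 * P 0 2)) = 0"
proof -
  define \<alpha> where "\<alpha> = A 1 1 * P 0 0 - A 0 1 * P 1 0"
  define \<beta> where "\<beta> = A 2 2 * P 0 0 - A 2 0 * P 0 2"
  define \<gamma> where "\<gamma> = A 2 2 * P 0 0 - A 0 2 * P 2 0"
  define \<delta> where "\<delta> = A 1 1 * P 0 0 - A 1 0 * P 0 1"
  define W where "W = P 1 2 * P 0 0 - P 1 0 * P 0 2"
  define W' where "W' = P 2 1 * P 0 0 - P 2 0 * P 0 1"
  have "P 0 0 * E 1 2 = \<alpha> * \<beta> + A 0 1 * A 2 0 * W"
    by (simp add: E_def \<alpha>_def \<beta>_def W_def algebra_simps)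
  moreover have "P 0 0 * E 2 1 = \<gamma> * \<delta> + A 0 2 * A 1 0 * W'"
    by (simp add: E_def \<gamma>_def \<delta>_def W'_def algebra_simps)
  moreover have "P 0 0 * E 1 1 = \<alpha> * \<delta>"
  proof -
    have "P 0 0 * E 1 1 - \<alpha> * \<delta> = A 0 1 * A 1 0 * (P 0 0 * P 1 1 - P 0 1 * P 1 0)"
      by (simp add: E_def \<alpha>_def \<delta>_def algebra_simps)
    then show ?thesis using P1 by simp
  qed
  moreover have "P 0 0 * E 2 2 = \<beta> * \<gamma>"
  proof -
    have "P 0 0 * E 2 2 - \<beta> * \<gamma> = A 0 2 * A 2 0 * (P 0 0 * P 2 2 - P 0 2 * P 2 0)"
      by (simp add: E_def \<beta>_def \<gamma>_def algebra_simps)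
    then show ?thesis using P2 by simp
  qed
  moreover have "(P 0 0 * E 1 2) * (P 0 0 * E 2 1) = (P 0 0 * E 1 1) * (P 0 0 * E 2 2)"
    using E by (simp add: mult_ac)
  ultimately have 1: "(\<alpha> * \<beta> + A 0 1 * A 2 0 * W) * (\<gamma> * \<delta> + A 0 2 * A 1 0 * W') = \<alpha> * \<delta> * (\<beta> * \<gamma>)"
    by (simp only:)
  \<comment> \<open>The principal minors make the two defects \<open>W\<close> and \<open>W'\<close>
    proportional, which leaves \<open>W\<close> as the only unknown in relation
    \<open>1\<close>.\<close>
  have 2: "P 1 2 * P 0 0 * W' = - (P 2 0 * P 0 1 * W)"
  proof -
    have "P 1 2 * P 0 0 * W' + P 2 0 * P 0 1 * W = P 0 0 * P 0 0 * (P 1 2 * P 2 1) - (P 0 2 * P 2 0) * (P 0 1 * P 1 0)"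
      by (simp add: W_def W'_def algebra_simps)
    also have "\<dots> = P 0 0 * P 0 0 * (P 1 1 * P 2 2) - (P 0 0 * P 2 2) * (P 0 0 * P 1 1)"
      by (simp only: P1 P2 P12)
    also have "\<dots> = 0" by (simp add: mult_ac)
    finally show ?thesis by (simp add: eq_neg_iff_add_eq_0)
  qed
  have "W * (\<gamma> * \<delta> * A 0 1 * A 2 0 * P 1 2 * P 0 0 - \<alpha> * \<beta> * A 0 2 * A 1 0 * P 2 0 * P 0 1
      - A 0 1 * A 2 0 * A 0 2 * A 1 0 * P 2 0 * P 0 1 * W) =
    P 1 2 * P 0 0 * (\<gamma> * \<delta> * A 0 1 * A 2 0 * W) + (\<alpha> * \<beta> * A 0 2 * A 1 0 + A 0 1 * A 2 0 * A 0 2 * A 1 0 * W) * (- (P 2 0 * P 0 1 * W))"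
    by (simp add: algebra_simps)
  also have "\<dots> = P 1 2 * P 0 0 * ((\<alpha> * \<beta> + A 0 1 * A 2 0 * W) * (\<gamma> * \<delta> + A 0 2 * A 1 0 * W') - \<alpha> * \<delta> * (\<beta> * \<gamma>))"
    unfolding 2[symmetric] by (simp add: algebra_simps)
  also have "\<dots> = 0" by (simp only: 1) simp
  finally show ?thesis by (simp only: \<alpha>_def \<beta>_def \<gamma>_def \<delta>_def W_def)
qed

text \<open>The Abel identity is specialized so that, by \<open>N_zero\<close>, the outer matrix
  \<open>Q\<close> and every inner matrix except the one of index 0 become multiples of diagonal
  matrix units. Its right side has a vanishing minor, hence so does the collapsed left side
  \<open>E\<close>. In \<open>A\<close> position 0 has been moved to the separate position -1, so
  \<open>A\<close> may afterwards be set equal to \<open>z\<close>.\<close>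

lemma z_triple_012:
  assumes n3: "n \<ge> 3"
  shows "z 0 0 * z 1 2 = z 0 2 * z 1 0"
proof -
  define A where "A p c = derange (id(0 := -1)) (z p c)" for p c
  \<comment> \<open>Position -1 is kept, so the inner matrix of index 0 is \<open>Z\<close> with a
    free position in place of 0. Positions -2 to -n become 2 to n, and -(n+1) becomes 1.\<close>
  define \<kappa> where "\<kappa> m = (if m = - (int n + 1) then 1 else if - int n \<le> m \<and> m \<le> -2 then - m else m)" for m :: int
  define \<zeta> where "\<zeta> i j = derange (\<kappa> \<circ> uminus) (z i j)" for i j
  define Y where "Y b = (if b = 0 then A else (\<lambda>p c. if p = b \<and> c = b then G b else 0))" for b
  define Q where "Q = (\<lambda>p c. if p = (0::nat) \<and> c = (0::nat) then G 0 else 0)"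
  define K where "K j = (\<Prod>l\<in>{0..<n} - {0, j}. G l)" for j
  define E where "E i j = A i i * A j j * z 0 0 - A i i * A j 0 * z 0 j - A 0 i * A j j * z i 0 + A 0 i * A j 0 * z i j" for i j
  have Nv: "N l p c = (if p = l \<and> c = l then G l else 0)" if "l < n" "p < n" "c < n" for l p c
    using N_zero[OF n3, of p c l] N_diag_nonzero[of l] that by auto
  have Y: "derange (\<kappa> \<circ> id(0 := - (int b + 1))) (z p c) = Y b p c" if "b < n" "p < n" "c < n" for b p c
  proof (cases "b = 0")
    case True
    have "derange (\<kappa> \<circ> id(0 := - (int b + 1))) (z p c) = A p c"
      unfolding A_def by (rule z_cong) (use that True in \<open>auto simp: \<kappa>_def\<close>)
    then show ?thesis by (simp add: Y_def True)
  next
    case False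
    have "derange (\<kappa> \<circ> id(0 := - (int b + 1))) (z p c) = N b p c"
      unfolding N_def by (rule z_cong) (use that False in \<open>auto simp: \<kappa>_def\<close>)
    then show ?thesis using Nv[OF that] False by (simp add: Y_def)
  qed
  have P: "derange \<kappa> (z p c) = z p c" if "p < n" "c < n" for p c
    using z_cong[OF that, of \<kappa> id] by (simp add: \<kappa>_def derange_id)
  have Q: "derange (\<kappa> \<circ> id(0 := - (int n + 1))) (z p c) = Q p c" if "p < n" "c < n" for p c
  proof -
    have "derange (\<kappa> \<circ> id(0 := - (int n + 1))) (z p c) = N 0 p c"
      unfolding N_def by (rule z_cong) (use that in \<open>auto simp: \<kappa>_def\<close>)
    then show ?thesis using Nv[of 0 p c] that n3 by (simp add: Q_def)
  qed
  have main: "K j * K i * G 0 * E i j = derange \<kappa> \<Delta> * \<zeta> i j" if "i < n" "j < n" "i \<noteq> 0" "j \<noteq> 0" for i j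
  proof -
    have "derange \<kappa> \<Delta> * \<zeta> i j = abelf n Y z Q i j"
      unfolding \<zeta>_def abel_identity_derange[OF that(1,2), symmetric]
      by (rule abelf_cong) (use Y P Q in auto)
    also have "\<dots> = K j * K i * G 0 * E i j"
      unfolding K_def E_def by (rule abelf_corner) (use that in \<open>auto simp: Y_def Q_def\<close>)
    finally show ?thesis by (rule sym)
  qed
  have \<zeta>: "\<zeta> 1 2 * \<zeta> 2 1 = \<zeta> 1 1 * \<zeta> 2 2"
    unfolding \<zeta>_def derange_hom(2)[symmetric] using z_minor[of 1 2] n3 by simp
  have "(K 2 * K 1 * G 0 * E 1 2) * (K 1 * K 2 * G 0 * E 2 1) = (K 1 * K 1 * G 0 * E 1 1) * (K 2 * K 2 * G 0 * E 2 2)"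
  proof -
    have lt: "(1::nat) < n" "2 < n" and ne: "(1::nat) \<noteq> 0" "(2::nat) \<noteq> 0" using n3 by auto
    note m = main[OF lt(1,2) ne(1,2)] main[OF lt(2,1) ne(2,1)] main[OF lt(1,1) ne(1,1)] main[OF lt(2,2) ne(2,2)]
    have "(K 2 * K 1 * G 0 * E 1 2) * (K 1 * K 2 * G 0 * E 2 1) = derange \<kappa> \<Delta> * derange \<kappa> \<Delta> * (\<zeta> 1 2 * \<zeta> 2 1)"
      unfolding m by (simp only: mult_ac)
    also have "\<dots> = derange \<kappa> \<Delta> * derange \<kappa> \<Delta> * (\<zeta> 1 1 * \<zeta> 2 2)" by (simp only: \<zeta>)
    also have "\<dots> = (K 1 * K 1 * G 0 * E 1 1) * (K 2 * K 2 * G 0 * E 2 2)"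
      unfolding m by (simp only: mult_ac)
    finally show ?thesis .
  qed
  then have "(K 1 * K 1 * K 2 * K 2 * G 0 * G 0) * (E 1 2 * E 2 1) = (K 1 * K 1 * K 2 * K 2 * G 0 * G 0) * (E 1 1 * E 2 2)"
    by (simp add: mult_ac)
  moreover have "K j \<noteq> 0" for j unfolding K_def using G_nonzero by (auto simp: tensor_prod_eq_0)
  then have "K 1 * K 1 * K 2 * K 2 * G 0 * G 0 \<noteq> 0" using G_nonzero[of 0] n3 by (auto simp: tensor_mult_eq_0)
  ultimately have EE: "E 1 2 * E 2 1 = E 1 1 * E 2 2" using tensor_mult_cancel by blast
  define W where "W = z 1 2 * z 0 0 - z 1 0 * z 0 2"
  define B where "B = (A 2 2 * z 0 0 - A 0 2 * z 2 0) * (A 1 1 * z 0 0 - A 1 0 * z 0 1) * A 0 1 * A 2 0 * z 1 2 * z 0 0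
      - (A 1 1 * z 0 0 - A 0 1 * z 1 0) * (A 2 2 * z 0 0 - A 2 0 * z 0 2) * A 0 2 * A 1 0 * z 2 0 * z 0 1
      - A 0 1 * A 2 0 * A 0 2 * A 1 0 * z 2 0 * z 0 1 * W"
  have WB: "W * B = 0"
    unfolding W_def B_def
    by (rule corner_algebra) (use n3 z_minor[of 0 1] z_minor[of 0 2] z_minor[of 1 2] EE in \<open>auto simp: E_def\<close>)
  have "W = 0"
  proof (rule ccontr)
    assume W0: "W \<noteq> 0"
    then have "B = 0" using WB by (simp add: tensor_mult_eq_0)
    \<comment> \<open>Returning -1 to 0 turns \<open>A\<close> into \<open>z\<close>. The first two
      terms of \<open>B\<close> then contain principal minors and vanish; the third is a product of
      nonzero entries with \<open>W\<close>.\<close>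
    let ?\<mu> = "id(-1 := 0) :: int \<Rightarrow> int"
    have \<mu>z: "derange ?\<mu> (z p c) = z p c" if "p < n" "c < n" for p c
      using z_cong[OF that, of ?\<mu> id] by (simp add: derange_id)
    have \<mu>A: "derange ?\<mu> (A p c) = z p c" if "p < n" "c < n" for p c
      using z_cong[OF that, of "?\<mu> \<circ> id(0 := -1)" id] by (simp add: A_def derange_comp derange_id)
    have "derange ?\<mu> B = 0" using \<open>B = 0\<close> by (simp add: derange_hom)
    then have "(z 2 2 * z 0 0 - z 0 2 * z 2 0) * (z 1 1 * z 0 0 - z 1 0 * z 0 1) * z 0 1 * z 2 0 * z 1 2 * z 0 0
      - (z 1 1 * z 0 0 - z 0 1 * z 1 0) * (z 2 2 * z 0 0 - z 2 0 * z 0 2) * z 0 2 * z 1 0 * z 2 0 * z 0 1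
      - z 0 1 * z 2 0 * z 0 2 * z 1 0 * z 2 0 * z 0 1 * W = 0"
      using n3 unfolding B_def W_def by (simp only: derange_hom) (simp add: \<mu>z \<mu>A)
    moreover have "z 2 2 * z 0 0 - z 0 2 * z 2 0 = 0" "z 1 1 * z 0 0 - z 0 1 * z 1 0 = 0"
      using z_minor[of 0 2] z_minor[of 0 1] n3 by (simp_all add: mult.commute)
    ultimately have "z 0 1 * z 2 0 * z 0 2 * z 1 0 * z 2 0 * z 0 1 * W = 0" by simp
    then show False using W0 z_nonzero n3 by (auto simp: tensor_mult_eq_0)
  qed
  then show ?thesis by (simp add: W_def mult.commute)
qed

text \<open>All minors follow from those with the nonzero pivot \<open>z 0 0\<close>. Three distinct
  indices are available only for n at least 3; otherwise the principal minors suffice.\<close>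

lemma z_rank_one:
  assumes "i < n" "j < n" "p < n" "q < n"
  shows "z i j * z p q = z i q * z p j"
proof -
  have tri: "z i i * z j l = z i l * z j i" if h: "i < n" "j < n" "l < n" for i j l
  proof (cases "distinct [i, j, l]")
    case True
    have n3: "n \<ge> 3"
    proof -
      have "card {i, j, l} \<le> card {0..<n}" by (rule card_mono) (use h in auto)
      then show ?thesis using True by simp
    qed
    obtain \<pi> where \<pi>: "\<pi> permutes {0..<n}" "\<pi> 0 = i" "\<pi> (Suc 0) = j" "\<pi> 2 = l" using permutes_three[OF True h] .
    have "derange (lift_perm n \<pi>) (z 0 0 * z 1 2) = derange (lift_perm n \<pi>) (z 0 2 * z 1 0)"
      by (simp only: z_triple_012[OF n3])
    then show ?thesis using n3 \<pi> by (simp add: derange_hom z_perm[OF \<pi>(1)])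
  next
    case False
    then show ?thesis using z_minor[of i j] h by (auto simp: mult.commute)
  qed
  have n0: "0 < n" using assms by simp
  have "z 0 0 * z 0 0 * (z i j * z p q) = (z 0 0 * z i j) * (z 0 0 * z p q)" by (simp add: mult_ac)
  also have "\<dots> = (z 0 0 * z i q) * (z 0 0 * z p j)"
    using tri[OF n0, of i j] tri[OF n0, of p q] tri[OF n0, of i q] tri[OF n0, of p j] assms by (simp add: mult_ac)
  also have "\<dots> = z 0 0 * z 0 0 * (z i q * z p j)" by (simp add: mult_ac)
  finally have "(z 0 0 * z 0 0) * (z i j * z p q) = (z 0 0 * z 0 0) * (z i q * z p j)" .
  then show ?thesis by (rule tensor_mult_cancel[rotated]) (use z_nonzero[OF n0 n0] in \<open>simp add: tensor_mult_eq_0\<close>)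
qed
end

section \<open>The Abel map of a Segre matrix\<close>

lemma rank_le_1_minor:
  assumes "rank_le_1 X" "i < dim_row X" "i' < dim_row X" "j < dim_col X" "j' < dim_col X"
  shows "X $$ (i, j) * X $$ (i', j') = X $$ (i, j') * X $$ (i', j)"
proof -
  have *: "X $$ (i, j) * X $$ (i', j') - X $$ (i, j') * X $$ (i', j) = 0"
    if "i < i'" "j < j'" "i' < dim_row X" "j' < dim_col X" for i i' j j'
    using assms(1) that unfolding rank_le_1_def by blast
  consider "i = i' \<or> j = j'" | "i < i'" "j < j'" | "i < i'" "j' < j" | "i' < i" "j < j'" | "i' < i" "j' < j"
    by linarith
  then show ?thesis
  proof cases
    case 1
    then show ?thesis by (auto simp: mult.commute)
  next
    case 2
    then show ?thesis using *[of i i' j j'] assms by simp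
  next
    case 3
    then show ?thesis using *[of i i' j' j] assms by simp
  next
    case 4
    then show ?thesis using *[of i' i j j'] assms by (simp add: mult.commute)
  next
    case 5
    then show ?thesis using *[of i' i j' j] assms by (simp add: mult.commute)
  qed
qed

lemma rank_one_factor:
  fixes M :: "nat \<Rightarrow> nat \<Rightarrow> 'k::field"
  assumes "\<And>i i' j j'. i < n \<Longrightarrow> i' < n \<Longrightarrow> j < n \<Longrightarrow> j' < n \<Longrightarrow> M i j * M i' j' = M i j' * M i' j"
  shows "\<exists>u v. \<forall>i<n. \<forall>j<n. M i j = u i * v j"
proof (cases "\<exists>i<n. \<exists>j<n. M i j \<noteq> 0")
  case True
  then obtain a b where ab: "a < n" "b < n" "M a b \<noteq> 0" by blast
  have "M i j = M i b * (M a j / M a b)" if "i < n" "j < n" for i j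
    using assms[of i a j b] that ab by (simp add: field_simps)
  then show ?thesis by (intro exI[of _ "\<lambda>i. M i b"] exI[of _ "\<lambda>j. M a j / M a b"]) auto
next
  case False
  then show ?thesis by (intro exI[of _ "\<lambda>_. 0"]) auto
qed

lemma dt_mult:
  fixes y m :: "nat \<Rightarrow> nat \<Rightarrow> 'r::comm_ring_1"
  shows "dt n (\<lambda>b p. \<Sum>c<n. y b c * m c p) = dt n y * dt n m"
proof -
  let ?Y = "mat n n (\<lambda>(b, c). y b c)" and ?M = "mat n n (\<lambda>(c, p). m c p)"
  have "?Y * ?M = mat n n (\<lambda>(b, p). \<Sum>c<n. y b c * m c p)"
    by (rule eq_matI) (auto simp: scalar_prod_def atLeast0LessThan)
  then show ?thesis unfolding dt_def by (metis det_mult mat_carrier)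
qed

text \<open>Cramer's rule: the coordinates of \<open>y b\<close> in terms of the vectors \<open>x p\<close>, up to the factor
  \<open>dt n x\<close>.\<close>

lemma dt_cramer:
  fixes x y :: "nat \<Rightarrow> nat \<Rightarrow> 'r::comm_ring_1"
  shows "dt n (\<lambda>b p. dt n (x(p := y b))) * dt n x = dt n y * dt n x ^ n"
proof -
  define m where "m c p = dt n (x(p := \<lambda>q. if q = c then 1 else 0))" for c p
  have 1: "dt n (\<lambda>b p. dt n (x(p := y b))) = dt n (\<lambda>b p. \<Sum>c<n. y b c * m c p)"
    by (rule dt_cong) (simp add: m_def dt_unit_expand[symmetric])
  have 2: "(\<Sum>c<n. x b c * m c p) = (if p = b then dt n x else 0)" if "p < n" "b < n" for p b
    unfolding m_def dt_unit_expand[OF that(1), symmetric]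
    using dt_repeat[OF that(2,1), of x] by (auto simp: fun_upd_idem)
  have "dt n m * dt n x = dt n (\<lambda>b p. \<Sum>c<n. x b c * m c p)" unfolding dt_mult by (rule mult.commute)
  also have "\<dots> = dt n (\<lambda>b p. if p = b then dt n x else 0)" by (rule dt_cong) (simp add: 2)
  also have "\<dots> = det (dt n x \<cdot>\<^sub>m 1\<^sub>m n)"
    unfolding dt_def by (rule arg_cong[of _ _ det], rule eq_matI) auto
  also have "\<dots> = dt n x ^ n" by simp
  finally have "dt n m * dt n x = dt n x ^ n" .
  then show ?thesis unfolding 1 dt_mult mult.assoc by (simp only:)
qed

lemma dt_col_scale: "dt n (\<lambda>b p. k p * w b p) = (\<Prod>p<n. k p) * dt n w"
proof -
  have "(\<Prod>b = 0..<n. k (\<sigma> b)) = (\<Prod>p<n. k p)" if "\<sigma> permutes {0..<n}" for \<sigma>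
    using prod.permute[OF that, of k] by (simp add: o_def atLeast0LessThan)
  then show ?thesis unfolding dt_Leibniz sum_distrib_left
    by (intro sum.cong refl) (simp add: prod.distrib mult_ac)
qed

lemma dt_row_scale: "dt n (\<lambda>b p. k b * w b p) = (\<Prod>b<n. k b) * dt n w"
  unfolding dt_Leibniz by (simp add: prod.distrib sum_distrib_left mult_ac atLeast0LessThan)

context fg_domain
begin

lemma base_combination_point:
  assumes "k_independent m a" "i < m" "c i \<noteq> 0"
  shows "\<exists>\<chi>\<in>points. (\<Sum>j<m. c j * \<chi> (a j :: 'a)) \<noteq> 0"
proof -
  have "(\<Sum>j<m. of_base (c j) * a j) \<noteq> 0" using assms unfolding k_independent_def by blast
  then obtain \<chi> where \<chi>: "\<chi> \<in> points" "\<chi> (\<Sum>j<m. of_base (c j) * a j) \<noteq> 0" using point_nonzero by blast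
  then have "(\<Sum>j<m. c j * \<chi> (a j)) \<noteq> 0" by (simp add: points_sum points_simps)
  then show ?thesis using \<chi>(1) by blast
qed

text \<open>Induction on \<open>m\<close>: expanded along its last row, the determinant is a
  combination of the values of the \<open>a j\<close> at the new point, with the cofactors as
  coefficients. The last cofactor is the previous determinant, so the same combination of the
  \<open>a j\<close> is nonzero and some point detects it.\<close>

lemma independent_points:
  assumes "k_independent m a"
  shows "\<exists>\<chi>. (\<forall>b. \<chi> b \<in> points) \<and> dt m (\<lambda>b c. \<chi> b (a c :: 'a)) \<noteq> 0"
  using assms
proof (induction m)
  case 0
  obtain \<chi> :: "'a \<Rightarrow> 'a base" where "\<chi> \<in> points" using point_nonzero[OF one_neq_zero] by blast
  then show ?case by (intro exI[of _ "\<lambda>_. \<chi>"]) (simp add: dt_def)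
next
  case (Suc m)
  have "k_independent m a"
    unfolding k_independent_def
  proof (intro allI impI)
    fix c i assume c: "(\<Sum>j<m. of_base (c j) * a j) = 0" and i: "i < m"
    have "(\<Sum>j<Suc m. of_base ((c(m := 0)) j) * a j) = 0" using c by simp
    then have "\<forall>i<Suc m. (c(m := 0)) i = 0" using Suc.prems unfolding k_independent_def by blast
    then have "(c(m := 0)) i = 0" using i less_SucI by blast
    then show "c i = 0" using i by simp
  qed
  then obtain \<chi> where \<chi>: "\<forall>b. \<chi> b \<in> points" "dt m (\<lambda>b c. \<chi> b (a c)) \<noteq> 0" using Suc.IH by blast
  let ?A = "\<lambda>\<chi>. mat (Suc m) (Suc m) (\<lambda>(b, c). \<chi> b (a c))"
  define cf where "cf j = cofactor (?A \<chi>) m j" for j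
  have "mat_delete (?A \<chi>) m m = mat m m (\<lambda>(b, c). \<chi> b (a c))"
    by (rule eq_matI) (auto simp: mat_delete_def)
  then have "cf m \<noteq> 0" using \<chi>(2) by (simp add: cf_def cofactor_def dt_def)
  then obtain \<psi> where \<psi>: "\<psi> \<in> points" "(\<Sum>j<Suc m. cf j * \<psi> (a j)) \<noteq> 0"
    using base_combination_point[OF Suc.prems, of m cf] by blast
  have cf': "cofactor (?A (\<chi>(m := \<psi>))) m j = cf j" for j
  proof -
    have "mat_delete (?A (\<chi>(m := \<psi>))) m j = mat_delete (?A \<chi>) m j"
      by (rule eq_matI) (auto simp: mat_delete_def)
    then show ?thesis by (simp add: cf_def cofactor_def)
  qed
  have "dt (Suc m) (\<lambda>b c. (\<chi>(m := \<psi>)) b (a c)) =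
      (\<Sum>j<Suc m. ?A (\<chi>(m := \<psi>)) $$ (m, j) * cofactor (?A (\<chi>(m := \<psi>))) m j)"
    unfolding dt_def by (rule laplace_expansion_row) auto
  also have "\<dots> = (\<Sum>j<Suc m. cf j * \<psi> (a j))"
    unfolding cf' by (intro sum.cong refl) (simp add: mult.commute)
  finally have "dt (Suc m) (\<lambda>b c. (\<chi>(m := \<psi>)) b (a c)) = (\<Sum>j<Suc m. cf j * \<psi> (a j))" .
  moreover have "\<forall>b. (\<chi>(m := \<psi>)) b \<in> points" using \<chi>(1) \<psi>(1) by auto
  ultimately show ?case using \<psi>(2) by metis
qed

end

lemma mixed_det_in_sub:
  assumes "\<And>b p c. b < n \<Longrightarrow> p < n \<Longrightarrow> c < n \<Longrightarrow> Y b p c \<in> tensor_sub I"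
  shows "mixed_det n Y \<in> tensor_sub I"
  unfolding mixed_det_def
  by (intro tensor_sub_sum tensor_sub_mult tensor_sub_prod assms)
    (auto simp: sign_def permutes_lt tensor_sub_1 intro: tensor_sub_uminus)

lemma abelf_in_sub:
  assumes "\<And>b p c. b < n \<Longrightarrow> p < n \<Longrightarrow> c < n \<Longrightarrow> Y b p c \<in> tensor_sub I"
    "\<And>p c. p < n \<Longrightarrow> c < n \<Longrightarrow> P p c \<in> tensor_sub I" "\<And>p c. p < n \<Longrightarrow> c < n \<Longrightarrow> Q p c \<in> tensor_sub I"
  shows "abelf n Y P Q i j \<in> tensor_sub I"
  unfolding abelf_def
  by (intro tensor_sub_sum tensor_sub_mult mixed_det_in_sub) (auto simp: unit_row_def tensor_sub_0 assms)

interpretation tensor_vs: vector_space "tensor_scale :: 'a::k_domain base \<Rightarrow> 'a tensor_power \<Rightarrow> 'a tensor_power"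
  by (rule vector_space_tensor_scale)

interpretation base_vs: vector_space "base_scale :: 'a::k_domain base \<Rightarrow> 'a \<Rightarrow> 'a"
  by (rule vector_space_base_scale)

lemma span_mult:
  assumes x: "x \<in> tensor_vs.span S" and y: "y \<in> tensor_vs.span T"
  shows "x * y \<in> tensor_vs.span (S * T)"
proof -
  have 1: "s * y \<in> tensor_vs.span (S * T)" if s: "s \<in> S" for s
    using y
  proof (induction rule: tensor_vs.span_induct)
    case base
    show ?case
    proof (rule tensor_vs.subspaceI; unfold mem_Collect_eq)
      show "s * (tensor_scale c x) \<in> tensor_vs.span (S * T)" if "s * x \<in> tensor_vs.span (S * T)" for c x
        unfolding mult.left_commute[of s] by (rule tensor_vs.span_scale[OF that])
    qed (simp_all add: tensor_vs.span_zero distrib_left tensor_vs.span_add)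
  next
    case (step t)
    then show ?case using s by (auto intro: tensor_vs.span_base set_times_intro)
  qed
  show ?thesis using x
  proof (induction rule: tensor_vs.span_induct)
    case base
    show ?case
    proof (rule tensor_vs.subspaceI; unfold mem_Collect_eq)
      show "tensor_scale c x * y \<in> tensor_vs.span (S * T)" if "x * y \<in> tensor_vs.span (S * T)" for c x
        unfolding mult.assoc by (rule tensor_vs.span_scale[OF that])
    qed (simp_all add: tensor_vs.span_zero distrib_right tensor_vs.span_add)
  next
    case (step s)
    then show ?case by (rule 1)
  qed
qed

lemma prod_mem: "finite I \<Longrightarrow> (\<And>i. i \<in> I \<Longrightarrow> x i \<in> S i) \<Longrightarrow> prod x I \<in> (prod S I :: 'b::comm_monoid_mult set)"
  by (induction I rule: finite_induct) (auto intro: set_times_intro)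

text \<open>Each term of the expansion contains one entry of \<rho> and exactly one entry of each
  inner matrix except the \<open>j\<close>-th; the space prescribed for the entry
  \<open>Z_12\<close> records this multidegree.\<close>

lemma mixed_det_unit_row_span:
  fixes Y :: "nat \<Rightarrow> nat \<Rightarrow> nat \<Rightarrow> 'a::k_domain tensor_power"
  assumes Y: "\<And>b p c. b < n \<Longrightarrow> p < n \<Longrightarrow> c < n \<Longrightarrow> Y b p c \<in> S b"
    and \<rho>: "\<And>c. c < n \<Longrightarrow> \<rho> c \<in> T" and j: "j < n" and r: "r < n"
  shows "mixed_det n (Y(j := unit_row r \<rho>)) \<in> tensor_vs.span (T * (\<Prod>b\<in>{..<n} - {j}. S b))"
proof -
  have "mixed_cof n Y j r c \<in> tensor_vs.span (\<Prod>b\<in>{..<n} - {j}. S b)" for c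
    unfolding mixed_cof_def
  proof (intro tensor_vs.span_sum)
    fix \<tau> \<sigma> assume "\<tau> \<in> {\<tau>. \<tau> permutes {0..<n} \<and> \<tau> r = j}" "\<sigma> \<in> {\<sigma>. \<sigma> permutes {0..<n} \<and> \<sigma> r = c}"
    then have t: "\<tau> permutes {0..<n}" "\<tau> r = j" and s: "\<sigma> permutes {0..<n}" by auto
    have "(\<Prod>p\<in>{0..<n} - {r}. Y (\<tau> p) p (\<sigma> p)) \<in> (\<Prod>p\<in>{0..<n} - {r}. S (\<tau> p))"
      by (rule prod_mem) (use Y permutes_lt[OF t(1)] permutes_lt[OF s] in auto)
    also have "(\<Prod>p\<in>{0..<n} - {r}. S (\<tau> p)) = (\<Prod>b\<in>{..<n} - {j}. S b)"
    proof (rule prod.reindex_bij_betw)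
      have "bij_betw \<tau> ({0..<n} - {r}) (\<tau> ` ({0..<n} - {r}))"
        by (rule inj_on_imp_bij_betw) (use permutes_inj[OF t(1)] in \<open>auto simp: inj_on_def\<close>)
      moreover have "\<tau> ` ({0..<n} - {r}) = {..<n} - {j}"
        using image_set_diff[OF permutes_inj[OF t(1)], of "{0..<n}" "{r}"] permutes_image[OF t(1)] t(2)
        by (simp add: atLeast0LessThan)
      ultimately show "bij_betw \<tau> ({0..<n} - {r}) ({..<n} - {j})" by simp
    qed
    finally have "(\<Prod>p\<in>{0..<n} - {r}. Y (\<tau> p) p (\<sigma> p)) \<in> tensor_vs.span (\<Prod>b\<in>{..<n} - {j}. S b)"
      by (rule tensor_vs.span_base)
    then show "signof \<sigma> * (\<Prod>p\<in>{0..<n} - {r}. Y (\<tau> p) p (\<sigma> p)) \<in> tensor_vs.span (\<Prod>b\<in>{..<n} - {j}. S b)"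
      by (auto simp: sign_def intro: tensor_vs.span_neg)
  qed
  then show ?thesis
    unfolding mixed_det_unit_row[OF j r]
    by (intro tensor_vs.span_sum span_mult) (auto intro: tensor_vs.span_base \<rho>)
qed

text \<open>The pair is not unique. Fixing one pair for each \<chi> makes the vectors at a position
  depend only on the point placed there, so that renaming positions acts on them by
  renaming.\<close>

definition factors :: "nat \<Rightarrow> 'a::k_domain mat \<Rightarrow> ('a \<Rightarrow> 'a base) \<Rightarrow> (nat \<Rightarrow> 'a base) \<times> (nat \<Rightarrow> 'a base)"
  where "factors n X \<chi> = (SOME uv. \<forall>p<n. \<forall>c<n. \<chi> (X $$ (p, c)) = fst uv p * snd uv c)"

lemma factors:
  assumes "X \<in> carrier_mat n n" "rank_le_1 X" "\<chi> \<in> points" "p < n" "c < n"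
  shows "\<chi> (X $$ (p, c)) = fst (factors n X \<chi>) p * snd (factors n X \<chi>) c"
proof -
  have "\<exists>u v. \<forall>p<n. \<forall>c<n. \<chi> (X $$ (p, c)) = u p * v c"
  proof (rule rank_one_factor)
    fix i i' j j' assume "i < n" "i' < n" "j < n" "j' < n"
    then have "\<chi> (X $$ (i, j) * X $$ (i', j')) = \<chi> (X $$ (i, j') * X $$ (i', j))"
      using assms(1) by (subst rank_le_1_minor[OF assms(2)]) auto
    then show "\<chi> (X $$ (i, j)) * \<chi> (X $$ (i', j')) = \<chi> (X $$ (i, j')) * \<chi> (X $$ (i', j))"
      by (simp add: points_simps[OF assms(3)])
  qed
  then obtain u v where "\<forall>p<n. \<forall>c<n. \<chi> (X $$ (p, c)) = u p * v c" by blast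
  then have "\<forall>p<n. \<forall>c<n. \<chi> (X $$ (p, c)) = fst (u, v) p * snd (u, v) c" by simp
  then have "\<forall>p<n. \<forall>c<n. \<chi> (X $$ (p, c)) = fst (factors n X \<chi>) p * snd (factors n X \<chi>) c"
    unfolding factors_def by (rule someI)
  then show ?thesis using assms(4,5) by blast
qed

lemma abel_map_entry:
  assumes X: "X \<in> carrier_mat n n" and ij: "i < n" "j < n"
  shows "abel_map n X $$ (i, j) = abelf n (\<lambda>b p c. slot (int b + 1) (X $$ (p, c))) (\<lambda>p c. slot 0 (X $$ (p, c)))
    (\<lambda>p c. slot (int n + 1) (X $$ (p, c))) i j"
  unfolding abel_map_def
  by (subst abel_entry[OF _ ij]) (use X in \<open>auto intro!: abelf_cong simp: add.commute\<close>)

text \<open>\<open>abelf_rank_one\<close> at a point, with the row replacements moved into the map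
  from rows to positions; a derangement then acts by composition with that map.\<close>

lemma eval_abel_map:
  assumes X: "X \<in> carrier_mat n n" and ij: "i < n" "j < n" and \<Phi>: "\<And>l. \<Phi> l \<in> points"
    and uv: "\<And>l p c. p < n \<Longrightarrow> c < n \<Longrightarrow> \<Phi> l (X $$ (p, c)) = u l p * v l c"
  shows "teval \<Phi> (abel_map n X $$ (i, j)) =
    dt n (\<lambda>b. u (((\<lambda>b. int b + 1)(i := 0)) b)) * dt n (\<lambda>b. v (((\<lambda>b. int b + 1)(i := int n + 1)) b)) *
    dt n (\<lambda>b. u (((\<lambda>b. int b + 1)(j := int n + 1)) b)) * dt n (\<lambda>b. v (((\<lambda>b. int b + 1)(j := 0)) b))"
proof -
  note h = alg_hom_family_points[of \<Phi>, OF \<Phi>]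
  have "teval \<Phi> (abel_map n X $$ (i, j)) = abelf n (\<lambda>b p c. u (int b + 1) p * v (int b + 1) c)
      (\<lambda>p c. u 0 p * v 0 c) (\<lambda>p c. u (int n + 1) p * v (int n + 1) c) i j"
    unfolding abel_map_entry[OF X ij] comm_ring_hom.hom_abelf[OF comm_ring_hom_teval[OF h]]
    by (rule abelf_cong) (simp_all add: teval_slot[OF h] uv)
  also have "\<dots> = dt n ((\<lambda>b. u (int b + 1))(i := u 0)) * dt n ((\<lambda>b. v (int b + 1))(i := v (int n + 1))) *
      dt n ((\<lambda>b. u (int b + 1))(j := u (int n + 1))) * dt n ((\<lambda>b. v (int b + 1))(j := v 0))"
    by (rule abelf_rank_one[OF ij])
  moreover have "(\<lambda>b. u (int b + 1))(i := u m) = (\<lambda>b. u (((\<lambda>b. int b + 1)(i := m)) b))"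
    "(\<lambda>b. v (int b + 1))(i := v m) = (\<lambda>b. v (((\<lambda>b. int b + 1)(i := m)) b))" for i m by auto
  ultimately show ?thesis by (simp only:)
qed

section \<open>Determinants of a Segre matrix at points and the Jacobi conditions\<close>

locale segre = fg_domain type_of_A for type_of_A :: "'a::k_domain itself" +
  fixes n :: nat and L :: "'a set" and X :: "'a mat"
  assumes n2: "n \<ge> 2" and L0: "0 \<in> L" and X: "X \<in> Segre_matrices n L"
begin

lemma XC: "X \<in> carrier_mat n n" and XL: "p < n \<Longrightarrow> c < n \<Longrightarrow> X $$ (p, c) \<in> L"
  and Xr: "rank_le_1 X" and Xk: "k_general X"
  using X by (auto simp: Segre_matrices_def)

definition F :: "(int \<Rightarrow> 'a \<Rightarrow> 'a base) \<Rightarrow> (nat \<Rightarrow> int) \<Rightarrow> 'a base"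
  where "F \<Phi> \<psi> = dt n (\<lambda>b. fst (factors n X (\<Phi> (\<psi> b))))"
definition H :: "(int \<Rightarrow> 'a \<Rightarrow> 'a base) \<Rightarrow> (nat \<Rightarrow> int) \<Rightarrow> 'a base"
  where "H \<Phi> \<psi> = dt n (\<lambda>b. snd (factors n X (\<Phi> (\<psi> b))))"

abbreviation \<iota> :: "nat \<Rightarrow> int" where "\<iota> \<equiv> \<lambda>b. int b + 1"
abbreviation W :: "nat \<Rightarrow> nat \<Rightarrow> 'a tensor_power" where "W i j \<equiv> abel_map n X $$ (i, j)"

lemma F_cong: "(\<And>b. b < n \<Longrightarrow> \<psi> b = \<psi>' b) \<Longrightarrow> F \<Phi> \<psi> = F \<Phi> \<psi>'"
  and H_cong: "(\<And>b. b < n \<Longrightarrow> \<psi> b = \<psi>' b) \<Longrightarrow> H \<Phi> \<psi> = H \<Phi> \<psi>'"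
  unfolding F_def H_def by (rule dt_cong; simp)+

lemma F_comp: "F (\<lambda>l. \<Phi> (\<sigma> l)) \<psi> = F \<Phi> (\<lambda>b. \<sigma> (\<psi> b))"
  and H_comp: "H (\<lambda>l. \<Phi> (\<sigma> l)) \<psi> = H \<Phi> (\<lambda>b. \<sigma> (\<psi> b))"
  by (simp_all add: F_def H_def)

lemma F_perm: "\<tau> permutes {0..<n} \<Longrightarrow> F \<Phi> (\<lambda>b. \<psi> (\<tau> b)) = signof \<tau> * F \<Phi> \<psi>"
  and H_perm: "\<tau> permutes {0..<n} \<Longrightarrow> H \<Phi> (\<lambda>b. \<psi> (\<tau> b)) = signof \<tau> * H \<Phi> \<psi>"
  unfolding F_def H_def
  by (rule dt_permute[of \<tau> n "\<lambda>b. fst (factors n X (\<Phi> (\<psi> b)))"]; assumption)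
    (rule dt_permute[of \<tau> n "\<lambda>b. snd (factors n X (\<Phi> (\<psi> b)))"]; assumption)

lemmas W_entry = abel_map_entry[OF XC]

lemma abel_map_carrier: "abel_map n X \<in> carrier_mat n n"
  by (simp add: abel_map_def abel_def)

context
  fixes \<Phi> :: "int \<Rightarrow> 'a \<Rightarrow> 'a base"
  assumes \<Phi>: "\<And>l. \<Phi> l \<in> points"
begin

lemma h\<Phi>: "alg_hom_family \<Phi>" by (rule alg_hom_family_points[OF \<Phi>])

lemma eval_slot_X: "p < n \<Longrightarrow> c < n \<Longrightarrow>
    teval \<Phi> (slot l (X $$ (p, c))) = fst (factors n X (\<Phi> l)) p * snd (factors n X (\<Phi> l)) c"
  by (simp only: teval_slot[OF h\<Phi>] factors[OF XC Xr \<Phi>])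

lemma eval_W:
  assumes "i < n" "j < n"
  shows "teval \<Phi> (W i j) = F \<Phi> (\<iota>(i := 0)) * H \<Phi> (\<iota>(i := int n + 1)) *
    F \<Phi> (\<iota>(j := int n + 1)) * H \<Phi> (\<iota>(j := 0))"
  unfolding F_def H_def by (rule eval_abel_map[OF XC assms \<Phi>]) (simp only: factors[OF XC Xr \<Phi>])

end

lemma eval_W_derange:
  assumes "\<And>l. \<Phi> l \<in> points" "i < n" "j < n"
  shows "teval \<Phi> (derange \<sigma> (W i j)) = F \<Phi> (\<lambda>b. \<sigma> ((\<iota>(i := 0)) b)) * H \<Phi> (\<lambda>b. \<sigma> ((\<iota>(i := int n + 1)) b)) *
    F \<Phi> (\<lambda>b. \<sigma> ((\<iota>(j := int n + 1)) b)) * H \<Phi> (\<lambda>b. \<sigma> ((\<iota>(j := 0)) b))"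
  using eval_W[of "\<lambda>l. \<Phi> (\<sigma> l)", OF assms(1) assms(2,3)]
  by (simp only: teval_derange[OF alg_hom_family_points[OF assms(1)]] F_comp H_comp)

text \<open>\<open>F\<close> and \<open>H\<close> depend on the chosen factorizations. Determinants
  formed from an independent row and an independent column of \<open>X\<close>, however, are
  tensors, and at a point they are \<open>H\<close> and \<open>F\<close> times products of
  coordinates; so one tensor controls both.\<close>

lemma nonvanishing_tensor:
  assumes inj: "inj_on \<psi> {..<n}"
  shows "\<exists>T. T \<noteq> 0 \<and> (\<forall>\<Phi>. (\<forall>l. \<Phi> l \<in> points) \<longrightarrow> teval \<Phi> T \<noteq> 0 \<longrightarrow> F \<Phi> \<psi> \<noteq> 0 \<and> H \<Phi> \<psi> \<noteq> 0)"
proof -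
  obtain i0 where i0: "i0 < n" "k_independent n (\<lambda>j. X $$ (i0, j))" using Xk XC by (auto simp: k_general_def)
  obtain j0 where j0: "j0 < n" "k_independent n (\<lambda>i. X $$ (i, j0))" using Xk XC by (auto simp: k_general_def)
  define T1 where "T1 = dt n (\<lambda>b c. slot (\<psi> b) (X $$ (i0, c)))"
  define T2 where "T2 = dt n (\<lambda>b p. slot (\<psi> b) (X $$ (p, j0)))"
  have nz: "dt n (\<lambda>b c. slot (\<psi> b) (a c)) \<noteq> 0" if ind: "k_independent n a" for a :: "nat \<Rightarrow> 'a"
  proof -
    obtain \<chi> where \<chi>: "\<And>b. \<chi> b \<in> points" "dt n (\<lambda>b c. \<chi> b (a c)) \<noteq> 0" using independent_points[OF ind] by blast
    define \<Phi> where "\<Phi> l = \<chi> (inv_into {..<n} \<psi> l)" for l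
    have \<Phi>: "\<Phi> l \<in> points" for l by (simp add: \<Phi>_def \<chi>)
    note h = alg_hom_family_points[of \<Phi>, OF \<Phi>]
    have "teval \<Phi> (dt n (\<lambda>b c. slot (\<psi> b) (a c))) = dt n (\<lambda>b c. \<chi> b (a c))"
      unfolding comm_ring_hom.hom_dt[OF comm_ring_hom_teval[OF h]]
      by (rule dt_cong) (simp add: teval_slot[OF h] \<Phi>_def inv_into_f_f[OF inj])
    then show ?thesis using \<chi>(2) teval_0[OF h] by metis
  qed
  have "T1 * T2 \<noteq> 0" using nz[OF i0(2)] nz[OF j0(2)] by (simp add: T1_def T2_def tensor_mult_eq_0)
  moreover have "F \<Phi> \<psi> \<noteq> 0 \<and> H \<Phi> \<psi> \<noteq> 0" if \<Phi>: "\<forall>l. \<Phi> l \<in> points" and T: "teval \<Phi> (T1 * T2) \<noteq> 0" for \<Phi>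
  proof -
    let ?u = "\<lambda>l. fst (factors n X (\<Phi> l))" and ?v = "\<lambda>l. snd (factors n X (\<Phi> l))"
    have P: "\<And>l. \<Phi> l \<in> points" using \<Phi> by blast
    note h = comm_ring_hom_teval[OF alg_hom_family_points[of \<Phi>, OF P]]
    have "teval \<Phi> T1 = dt n (\<lambda>b c. ?u (\<psi> b) i0 * ?v (\<psi> b) c)"
      unfolding T1_def comm_ring_hom.hom_dt[OF h] by (rule dt_cong) (simp add: eval_slot_X[OF P] i0)
    also have "\<dots> = (\<Prod>b<n. ?u (\<psi> b) i0) * H \<Phi> \<psi>" unfolding H_def by (rule dt_row_scale)
    finally have 1: "teval \<Phi> T1 = (\<Prod>b<n. ?u (\<psi> b) i0) * H \<Phi> \<psi>" .
    have "teval \<Phi> T2 = dt n (\<lambda>b p. ?v (\<psi> b) j0 * ?u (\<psi> b) p)"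
      unfolding T2_def comm_ring_hom.hom_dt[OF h] by (rule dt_cong) (simp add: eval_slot_X[OF P] j0 mult.commute)
    also have "\<dots> = (\<Prod>b<n. ?v (\<psi> b) j0) * F \<Phi> \<psi>" unfolding F_def by (rule dt_row_scale)
    finally show ?thesis using 1 T by (auto simp: teval_mult[OF alg_hom_family_points[of \<Phi>, OF P]])
  qed
  ultimately show ?thesis by blast
qed

lemma common_nonvanishing:
  assumes "inj_on \<psi> {..<n}" "inj_on \<psi>' {..<n}"
  shows "\<exists>\<Phi>. (\<forall>l. \<Phi> l \<in> points) \<and> F \<Phi> \<psi> \<noteq> 0 \<and> H \<Phi> \<psi> \<noteq> 0 \<and> F \<Phi> \<psi>' \<noteq> 0 \<and> H \<Phi> \<psi>' \<noteq> 0"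
proof -
  obtain T where T: "T \<noteq> 0" "\<And>\<Phi>. (\<forall>l. \<Phi> l \<in> points) \<Longrightarrow> teval \<Phi> T \<noteq> 0 \<Longrightarrow> F \<Phi> \<psi> \<noteq> 0 \<and> H \<Phi> \<psi> \<noteq> 0"
    using nonvanishing_tensor[OF assms(1)] by blast
  obtain T' where T': "T' \<noteq> 0" "\<And>\<Phi>. (\<forall>l. \<Phi> l \<in> points) \<Longrightarrow> teval \<Phi> T' \<noteq> 0 \<Longrightarrow> F \<Phi> \<psi>' \<noteq> 0 \<and> H \<Phi> \<psi>' \<noteq> 0"
    using nonvanishing_tensor[OF assms(2)] by blast
  have "T * T' \<noteq> 0" using T T' by (simp add: tensor_mult_eq_0)
  then obtain \<Phi> where \<Phi>: "\<And>l. \<Phi> l \<in> points" "teval \<Phi> (T * T') \<noteq> 0" using tensor_nonzero by blast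
  then have "teval \<Phi> T \<noteq> 0" "teval \<Phi> T' \<noteq> 0" by (auto simp: teval_mult alg_hom_family_points)
  then show ?thesis using T(2)[of \<Phi>] T'(2)[of \<Phi>] \<Phi>(1) by blast
qed

lemma W00_nonzero: "W 0 0 \<noteq> 0"
proof -
  have "inj_on (\<iota>(0 := 0)) {..<n}" "inj_on (\<iota>(0 := int n + 1)) {..<n}" by (auto simp: inj_on_def)
  then obtain \<Phi> where \<Phi>: "\<And>l. \<Phi> l \<in> points" "F \<Phi> (\<iota>(0 := 0)) \<noteq> 0" "H \<Phi> (\<iota>(0 := 0)) \<noteq> 0"
    "F \<Phi> (\<iota>(0 := int n + 1)) \<noteq> 0" "H \<Phi> (\<iota>(0 := int n + 1)) \<noteq> 0"
    using common_nonvanishing by metis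
  then have "teval \<Phi> (W 0 0) \<noteq> 0" using n2 by (subst eval_W) auto
  then show ?thesis using \<Phi>(1) teval_0 alg_hom_family_points by metis
qed

lemma W_sub: "i < n \<Longrightarrow> j < n \<Longrightarrow> W i j \<in> tensor_sub {0..int n + 1}"
  by (subst W_entry) (auto intro!: abelf_in_sub tensor_sub_slot)

text \<open>After the merger, two of the four determinants have the positions of
  \<open>W 0 0\<close> with rows 0 and 1 exchanged; the two signs cancel.\<close>

lemma W_merge: "W 0 0 = derange (id(1 := 2)) (W 0 1)"
proof (rule tensor_eqI)
  fix \<Phi> :: "int \<Rightarrow> 'a \<Rightarrow> 'a base" assume \<Phi>: "\<And>l. \<Phi> l \<in> points"
  let ?t = "transpose 0 1 :: nat \<Rightarrow> nat"
  have t: "?t permutes {0..<n}" "signof ?t = (- 1 :: 'a base)"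
    using n2 by (auto intro: permutes_swap_id simp: sign_swap_id)
  have 1: "F \<Phi> (\<lambda>b. (id(1 := 2)) ((\<iota>(1 := int n + 1)) b)) = F \<Phi> (\<lambda>b. (\<iota>(0 := int n + 1)) (?t b))"
    by (rule F_cong) (auto simp: Transposition.transpose_def)
  have 2: "H \<Phi> (\<lambda>b. (id(1 := 2)) ((\<iota>(1 := 0)) b)) = H \<Phi> (\<lambda>b. (\<iota>(0 := 0)) (?t b))"
    by (rule H_cong) (auto simp: Transposition.transpose_def)
  have 3: "F \<Phi> (\<lambda>b. (id(1 := 2)) ((\<iota>(0 := 0)) b)) = F \<Phi> (\<iota>(0 := 0))"
    by (rule F_cong) auto
  have 4: "H \<Phi> (\<lambda>b. (id(1 := 2)) ((\<iota>(0 := int n + 1)) b)) = H \<Phi> (\<iota>(0 := int n + 1))"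
    using n2 by (intro H_cong) auto
  show "teval \<Phi> (W 0 0) = teval \<Phi> (derange (id(1 := 2)) (W 0 1))"
    using n2 by (simp only: eval_W_derange[OF \<Phi>] eval_W[OF \<Phi>] 1 2 3 4 F_perm[OF t(1)] H_perm[OF t(1)] t(2)) simp
qed

text \<open>Each of the four determinants contributes the sign of \<pi>.\<close>

lemma W_perm:
  assumes \<pi>: "\<pi> permutes {0..<n}" and ij: "i < n" "j < n"
  shows "derange (lift_perm n \<pi>) (W i j) = W (\<pi> i) (\<pi> j)"
proof (rule tensor_eqI)
  fix \<Phi> :: "int \<Rightarrow> 'a \<Rightarrow> 'a base" assume \<Phi>: "\<And>l. \<Phi> l \<in> points"
  have inj: "\<pi> a = \<pi> b \<longleftrightarrow> a = b" for a b by (rule inj_eq[OF permutes_inj[OF \<pi>]])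
  have f: "lift_perm n \<pi> ((\<iota>(i := m)) b) = (\<iota>(\<pi> i := m)) (\<pi> b)" if "b < n" "m = 0 \<or> m = int n + 1" for b i m
    using that inj[of b i] by (auto simp: lift_perm_simps)
  have 1: "F \<Phi> (\<lambda>b. lift_perm n \<pi> ((\<iota>(i := m)) b)) = signof \<pi> * F \<Phi> (\<iota>(\<pi> i := m))" if "m = 0 \<or> m = int n + 1" for i m
    unfolding F_perm[OF \<pi>, symmetric] by (rule F_cong) (rule f[OF _ that])
  have 2: "H \<Phi> (\<lambda>b. lift_perm n \<pi> ((\<iota>(i := m)) b)) = signof \<pi> * H \<Phi> (\<iota>(\<pi> i := m))" if "m = 0 \<or> m = int n + 1" for i m
    unfolding H_perm[OF \<pi>, symmetric] by (rule H_cong) (rule f[OF _ that])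
  have s: "signof \<pi> * a * (signof \<pi> * b) * (signof \<pi> * c) * (signof \<pi> * d) = a * b * c * d" for a b c d :: "'a base"
    by (simp add: sign_def)
  show "teval \<Phi> (derange (lift_perm n \<pi>) (W i j)) = teval \<Phi> (W (\<pi> i) (\<pi> j))"
    unfolding eval_W_derange[OF \<Phi> ij] eval_W[OF \<Phi> permutes_lt[OF \<pi> ij(1)] permutes_lt[OF \<pi> ij(2)]]
    by (simp only: 1 2 s simp_thms)
qed

lemma W_minor:
  assumes "i < n" "j < n" "p < n" "q < n"
  shows "W i j * W p q = W i q * W p j"
proof (rule tensor_eqI)
  fix \<Phi> :: "int \<Rightarrow> 'a \<Rightarrow> 'a base" assume \<Phi>: "\<And>l. \<Phi> l \<in> points"
  show "teval \<Phi> (W i j * W p q) = teval \<Phi> (W i q * W p j)"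
    using assms by (simp add: teval_mult[OF alg_hom_family_points[of \<Phi>, OF \<Phi>]] eval_W[OF \<Phi>] mult_ac)
qed

interpretation tensor_vs: vector_space "tensor_scale :: 'a base \<Rightarrow> 'a tensor_power \<Rightarrow> 'a tensor_power"
  by (rule vector_space_tensor_scale)

text \<open>In \<open>W 0 1\<close> the first mixed determinant replaces position 2 by 0 and the
  second replaces position 1 by n+1. Positions 1 and 2 therefore occur once and positions 3 to n
  twice.\<close>

lemma W_space: "W 0 1 \<in> Jacobi_space n L"
proof -
  define S where "S l = slot l ` L" for l :: int
  define R where "R = (\<Prod>b = 2..<n. S (int b + 1))"
  have set: "(S 0 * (\<Prod>b\<in>{..<n} - {1}. S (int b + 1))) * (S (int n + 1) * (\<Prod>b\<in>{..<n} - {0}. S (int b + 1))) =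
      S 0 * S 1 * S 2 * (\<Prod>l = 3..int n. (S l)\<^sup>2) * S (int n + 1)"
  proof -
    have "{..<n} - {1} = insert 0 {2..<n}" "{..<n} - {0} = insert 1 {2..<n}" using n2 by auto
    then have "(\<Prod>b\<in>{..<n} - {1}. S (int b + 1)) = S 1 * R" "(\<Prod>b\<in>{..<n} - {0}. S (int b + 1)) = S 2 * R"
      by (simp_all add: R_def)
    moreover have "(\<Prod>l = 3..int n. (S l)\<^sup>2) = (\<Prod>b = 2..<n. (S (int b + 1))\<^sup>2)"
      by (rule prod.reindex_bij_witness[where i = "\<lambda>l. int l + 1" and j = "\<lambda>l. nat (l - 1)"]) auto
    then have "(\<Prod>l = 3..int n. (S l)\<^sup>2) = R * R"
      by (simp add: power2_eq_square prod.distrib R_def)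
    ultimately show ?thesis by (simp only: mult_ac)
  qed
  have lt: "0 < n" "1 < n" using n2 by auto
  have "W 0 1 \<in> tensor_vs.span ((S 0 * (\<Prod>b\<in>{..<n} - {1}. S (int b + 1))) * (S (int n + 1) * (\<Prod>b\<in>{..<n} - {0}. S (int b + 1))))"
    unfolding W_entry[OF lt] abelf_def
    by (intro tensor_vs.span_sum span_mult mixed_det_unit_row_span) (use n2 XL in \<open>auto simp: S_def\<close>)
  then show ?thesis unfolding set by (simp add: Jacobi_space_def S_def)
qed

text \<open>The exchange of 0 with \<open>l + 1\<close> restores the positions 1 to n in the two
  determinants that had 0 in row \<open>l\<close>.\<close>

lemma eval_G:
  assumes \<Phi>: "\<And>l. \<Phi> l \<in> points" and l: "l < n"
  shows "teval \<Phi> (derange (transpose 0 (int l + 1)) (W l l)) =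
    F \<Phi> \<iota> * H \<Phi> \<iota> * F \<Phi> (\<iota>(l := int n + 1)) * H \<Phi> (\<iota>(l := int n + 1))"
proof -
  have "(\<lambda>b. transpose 0 (int l + 1) ((\<iota>(l := 0)) b)) = \<iota>"
    "(\<lambda>b. transpose 0 (int l + 1) ((\<iota>(l := int n + 1)) b)) = \<iota>(l := int n + 1)"
    using l by (auto simp: Transposition.transpose_def)
  then show ?thesis by (simp only: eval_W_derange[OF \<Phi> l l] mult_ac)
qed

text \<open>At a point, the matrix with position 0 moved to \<open>m\<close> is the product of
  vectors \<open>U m\<close> and \<open>V m\<close>. Up to the weights \<open>hl\<close> and
  \<open>fl\<close>, their entries are the Cramer coordinates of the vectors at \<open>m\<close>
  relative to those at positions 1 to n, so Cramer's rule evaluates the four determinants of the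
  outer abeliant.\<close>

lemma W_abel_identity:
  assumes ij: "i < n" "j < n"
  shows "abelf n (\<lambda>b p c. derange (id(0 := - (int b + 1))) (W p c)) W
    (\<lambda>p c. derange (id(0 := - (int n + 1))) (W p c)) i j = Jacobi_factor n (abel_map n X) * derange uminus (W i j)"
    (is "?lhs = ?rhs")
proof -
  \<comment> \<open>The value of \<open>D\<close> at a point is the product of the two determinants
    that Cramer's rule divides by. Multiplication by it makes the points where they vanish harmless,
    and as a nonzero tensor it can be cancelled.\<close>
  define D where "D = mixed_det n (\<lambda>b p c. slot (int b + 1) (X $$ (p, c)))"
  have D_eval: "teval \<Phi> D = F \<Phi> \<iota> * H \<Phi> \<iota>" if \<Phi>: "\<And>l. \<Phi> l \<in> points" for \<Phi>
  proof -
    note h = comm_ring_hom_teval[OF alg_hom_family_points[of \<Phi>, OF \<Phi>]]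
    have "teval \<Phi> D = mixed_det n (\<lambda>b p c. fst (factors n X (\<Phi> (\<iota> b))) p * snd (factors n X (\<Phi> (\<iota> b))) c)"
      unfolding D_def comm_ring_hom.hom_mixed_det[OF h] by (rule mixed_det_cong) (simp add: eval_slot_X[OF \<Phi>])
    then show ?thesis by (simp add: mixed_det_rank_one F_def H_def)
  qed
  have D0: "D \<noteq> 0"
  proof -
    have "inj_on \<iota> {..<n}" by (auto simp: inj_on_def)
    then obtain \<Phi> where \<Phi>: "\<And>l. \<Phi> l \<in> points" "F \<Phi> \<iota> \<noteq> 0" "H \<Phi> \<iota> \<noteq> 0"
      using common_nonvanishing by metis
    then have "teval \<Phi> D \<noteq> 0" using D_eval by simp
    then show ?thesis using \<Phi>(1) teval_0 alg_hom_family_points by metis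
  qed
  have "D * ?lhs = D * ?rhs"
  proof (rule tensor_eqI)
    fix \<Phi> :: "int \<Rightarrow> 'a \<Rightarrow> 'a base" assume \<Phi>: "\<And>l. \<Phi> l \<in> points"
    note hf = alg_hom_family_points[of \<Phi>, OF \<Phi>]
    note h = comm_ring_hom_teval[OF hf]
    have "teval \<Phi> ?lhs = teval \<Phi> ?rhs" if nz: "F \<Phi> \<iota> \<noteq> 0" "H \<Phi> \<iota> \<noteq> 0"
    proof -
      define f h where "f = F \<Phi> \<iota>" and "h = H \<Phi> \<iota>"
      define fl hl where "fl l = F \<Phi> (\<iota>(l := int n + 1))" and "hl l = H \<Phi> (\<iota>(l := int n + 1))" for l
      define U where "U m p = F \<Phi> (\<iota>(p := m)) * hl p" for m p
      define V where "V m c = fl c * H \<Phi> (\<iota>(c := m))" for m c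
      have w: "teval \<Phi> (derange (id(0 := - m)) (W p c)) = U (- m) p * V (- m) c" if "p < n" "c < n" "m \<ge> 0" for m p c
      proof -
        have "(\<lambda>b. (id(0 := - m)) ((\<iota>(p := 0)) b)) = \<iota>(p := - m)" for p by auto
        moreover have "(\<lambda>b. (id(0 := - m)) ((\<iota>(p := int n + 1)) b)) = \<iota>(p := int n + 1)" for p by auto
        ultimately show ?thesis
          by (simp only: eval_W_derange[OF \<Phi> that(1,2)] U_def V_def fl_def hl_def mult_ac)
      qed
      have w0: "teval \<Phi> (W p c) = U 0 p * V 0 c" if "p < n" "c < n" for p c
        by (simp only: eval_W[OF \<Phi> that] U_def V_def fl_def hl_def mult_ac)
      have "teval \<Phi> ?lhs = abelf n (\<lambda>b p c. U (- (int b + 1)) p * V (- (int b + 1)) c) (\<lambda>p c. U 0 p * V 0 c)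
          (\<lambda>p c. U (- (int n + 1)) p * V (- (int n + 1)) c) i j"
        unfolding comm_ring_hom.hom_abelf[OF h] by (rule abelf_cong) (simp_all only: w w0 of_nat_0_le_iff add_nonneg_nonneg zero_le_one)
      also have "\<dots> = dt n ((\<lambda>b. U (- (int b + 1)))(i := U 0)) * dt n ((\<lambda>b. V (- (int b + 1)))(i := V (- (int n + 1)))) *
          dt n ((\<lambda>b. U (- (int b + 1)))(j := U (- (int n + 1)))) * dt n ((\<lambda>b. V (- (int b + 1)))(j := V 0))"
        by (rule abelf_rank_one[OF ij])
      moreover have "(\<lambda>b. U (- (int b + 1)))(i := U m) = (\<lambda>b. U (((\<lambda>b. - (int b + 1))(i := m)) b))"
        "(\<lambda>b. V (- (int b + 1)))(i := V m) = (\<lambda>b. V (((\<lambda>b. - (int b + 1))(i := m)) b))" for i m by auto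
      ultimately have L: "teval \<Phi> ?lhs = dt n (\<lambda>b. U (((\<lambda>b. - (int b + 1))(i := 0)) b)) *
          dt n (\<lambda>b. V (((\<lambda>b. - (int b + 1))(i := - (int n + 1))) b)) *
          dt n (\<lambda>b. U (((\<lambda>b. - (int b + 1))(j := - (int n + 1))) b)) *
          dt n (\<lambda>b. V (((\<lambda>b. - (int b + 1))(j := 0)) b))" by (simp only:)
      \<comment> \<open>The factor \<open>f\<close> on the left is the one in
        \<open>dt_cramer\<close>; the weights come out as column factors.\<close>
      have dU: "f * dt n (\<lambda>b. U (\<nu> b)) = (\<Prod>p<n. hl p) * f ^ n * F \<Phi> \<nu>" for \<nu>
      proof -
        have "dt n (\<lambda>b. U (\<nu> b)) = dt n (\<lambda>b p. hl p * dt n ((\<lambda>b. fst (factors n X (\<Phi> (\<iota> b))))(p := fst (factors n X (\<Phi> (\<nu> b))))))"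
        proof (rule dt_cong)
          have "(\<lambda>b. fst (factors n X (\<Phi> (\<iota> b))))(p := fst (factors n X (\<Phi> m))) =
              (\<lambda>b. fst (factors n X (\<Phi> ((\<iota>(p := m)) b))))" for p m by auto
          then show "U (\<nu> b) p = hl p * dt n ((\<lambda>b. fst (factors n X (\<Phi> (\<iota> b))))(p := fst (factors n X (\<Phi> (\<nu> b)))))" for b p
            by (simp only: U_def F_def mult.commute)
        qed
        then show ?thesis
          using dt_cramer[of n "\<lambda>b. fst (factors n X (\<Phi> (\<iota> b)))" "\<lambda>b. fst (factors n X (\<Phi> (\<nu> b)))"]
          by (simp add: dt_col_scale f_def F_def mult_ac)
      qed
      have dV: "h * dt n (\<lambda>b. V (\<nu> b)) = (\<Prod>p<n. fl p) * h ^ n * H \<Phi> \<nu>" for \<nu>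
      proof -
        have "dt n (\<lambda>b. V (\<nu> b)) = dt n (\<lambda>b p. fl p * dt n ((\<lambda>b. snd (factors n X (\<Phi> (\<iota> b))))(p := snd (factors n X (\<Phi> (\<nu> b))))))"
        proof (rule dt_cong)
          have "(\<lambda>b. snd (factors n X (\<Phi> (\<iota> b))))(p := snd (factors n X (\<Phi> m))) =
              (\<lambda>b. snd (factors n X (\<Phi> ((\<iota>(p := m)) b))))" for p m by auto
          then show "V (\<nu> b) p = fl p * dt n ((\<lambda>b. snd (factors n X (\<Phi> (\<iota> b))))(p := snd (factors n X (\<Phi> (\<nu> b)))))" for b p
            by (simp only: V_def H_def mult.commute)
        qed
        then show ?thesis
          using dt_cramer[of n "\<lambda>b. snd (factors n X (\<Phi> (\<iota> b)))" "\<lambda>b. snd (factors n X (\<Phi> (\<nu> b)))"]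
          by (simp add: dt_col_scale h_def H_def mult_ac)
      qed
      have bar: "teval \<Phi> (derange uminus (W i j)) = F \<Phi> ((\<lambda>b. - (int b + 1))(i := 0)) *
          H \<Phi> ((\<lambda>b. - (int b + 1))(i := - (int n + 1))) * F \<Phi> ((\<lambda>b. - (int b + 1))(j := - (int n + 1))) *
          H \<Phi> ((\<lambda>b. - (int b + 1))(j := 0))"
        unfolding eval_W_derange[OF \<Phi> ij]
        by (intro arg_cong2[where f = "(*)"] F_cong H_cong) auto
      define G where "G l = derange (transpose 0 (int l + 1)) (W l l)" for l
      have G: "teval \<Phi> (G l) = f * h * fl l * hl l" if "l < n" for l
        unfolding G_def f_def h_def fl_def hl_def by (rule eval_G[OF \<Phi> that])
      \<comment> \<open>The twisted factor of \<Delta>: none of its determinants is taken at the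
        positions 1 to n alone, and the four belong to indices 0 and 1. Two of them change sign, and
        the signs cancel.\<close>
      have \<Gamma>: "teval \<Phi> (derange (transpose 2 (int n + 1)) (G 0)) = fl 0 * hl 0 * fl 1 * hl 1"
      proof -
        let ?t = "transpose 0 1 :: nat \<Rightarrow> nat" and ?s = "\<lambda>l. transpose 2 (int n + 1) (transpose 0 1 l) :: int"
        have t: "?t permutes {0..<n}" "signof ?t = (- 1 :: 'a base)"
          using n2 by (auto intro: permutes_swap_id simp: sign_swap_id)
        have 1: "?s ((\<iota>(0 := 0)) b) = (\<iota>(1 := int n + 1)) b" if "b < n" for b
          using that n2 by (auto simp: Transposition.transpose_def)
        have 2: "?s ((\<iota>(0 := int n + 1)) b) = (\<iota>(0 := int n + 1)) (?t b)" if "b < n" for b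
          using that n2 by (auto simp: Transposition.transpose_def)
        have "derange (transpose 2 (int n + 1)) (G 0) = derange ?s (W 0 0)"
          by (simp add: G_def derange_comp o_def)
        moreover have "F \<Phi> (\<lambda>b. ?s ((\<iota>(0 := 0)) b)) = fl 1" "H \<Phi> (\<lambda>b. ?s ((\<iota>(0 := 0)) b)) = hl 1"
          unfolding fl_def hl_def by (rule F_cong H_cong, rule 1, assumption)+
        moreover have "F \<Phi> (\<lambda>b. ?s ((\<iota>(0 := int n + 1)) b)) = - fl 0" "H \<Phi> (\<lambda>b. ?s ((\<iota>(0 := int n + 1)) b)) = - hl 0"
        proof -
          have "F \<Phi> (\<lambda>b. ?s ((\<iota>(0 := int n + 1)) b)) = F \<Phi> (\<lambda>b. (\<iota>(0 := int n + 1)) (?t b))"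
            by (rule F_cong) (rule 2)
          also have "\<dots> = - fl 0" unfolding F_perm[OF t(1)] t(2) fl_def by simp
          finally show "F \<Phi> (\<lambda>b. ?s ((\<iota>(0 := int n + 1)) b)) = - fl 0" .
          have "H \<Phi> (\<lambda>b. ?s ((\<iota>(0 := int n + 1)) b)) = H \<Phi> (\<lambda>b. (\<iota>(0 := int n + 1)) (?t b))"
            by (rule H_cong) (rule 2)
          also have "\<dots> = - hl 0" unfolding H_perm[OF t(1)] t(2) hl_def by simp
          finally show "H \<Phi> (\<lambda>b. ?s ((\<iota>(0 := int n + 1)) b)) = - hl 0" .
        qed
        moreover have "0 < n" using n2 by simp
        ultimately show ?thesis by (simp only: eval_W_derange[OF \<Phi>]) simp
      qed
      have splitP: "(\<Prod>p<n. g p) = g 0 * g 1 * (\<Prod>p = 2..<n. g p)" for g :: "nat \<Rightarrow> 'a base"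
      proof -
        have "{..<n} = insert 0 (insert 1 {2..<n})" using n2 by auto
        then show ?thesis by simp
      qed
      have "Jacobi_factor n (abel_map n X) = derange (transpose 2 (int n + 1)) (G 0) * G 0 * G 1 * (\<Prod>l = 2..<n. (G l)\<^sup>2)"
        unfolding Jacobi_factor_eq G_def by (simp add: add.commute)
      then have "teval \<Phi> (Jacobi_factor n (abel_map n X)) =
          fl 0 * hl 0 * fl 1 * hl 1 * (f * h * fl 0 * hl 0) * (f * h * fl 1 * hl 1) * (\<Prod>l = 2..<n. (f * h * fl l * hl l)\<^sup>2)"
        using n2 by (simp add: teval_hom[OF hf] \<Gamma> G)
      also have "(\<Prod>l = 2..<n. (f * h * fl l * hl l)\<^sup>2) = (f * h) ^ (2 * (n - 2)) * (\<Prod>l = 2..<n. fl l)\<^sup>2 * (\<Prod>l = 2..<n. hl l)\<^sup>2"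
        by (simp add: power_mult_distrib prod.distrib prod_power_distrib power_mult)
      finally have "teval \<Phi> (Jacobi_factor n (abel_map n X)) =
          (f * h) ^ 2 * (f * h) ^ (2 * (n - 2)) * (\<Prod>p<n. fl p)\<^sup>2 * (\<Prod>p<n. hl p)\<^sup>2"
        by (simp add: splitP power2_eq_square mult_ac)
      note \<Delta>_eval = this
      \<comment> \<open>The exponent of \<open>f h\<close> in \<Delta> is 2 + 2(n-2); the two powers
        that Cramer's rule divides out complete it to 2n.\<close>
      have pw: "(f * h) ^ 2 * (f * h) ^ (2 * (n - 2)) * (f * h) ^ 2 = (f ^ n * h ^ n)\<^sup>2"
      proof -
        have "(f * h) ^ 2 * (f * h) ^ (2 * (n - 2)) * (f * h) ^ 2 = (f * h) ^ (n * 2)"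
          using n2 by (simp only: flip: power_add) (rule arg_cong[of _ _ "\<lambda>m. (f * h) ^ m"], simp)
        then show ?thesis by (simp only: power_mult power_mult_distrib)
      qed
      have R: "(f * h)\<^sup>2 * teval \<Phi> (Jacobi_factor n (abel_map n X)) =
          (f ^ n * h ^ n)\<^sup>2 * (\<Prod>p<n. fl p)\<^sup>2 * (\<Prod>p<n. hl p)\<^sup>2"
        unfolding \<Delta>_eval pw[symmetric] by (simp only: mult_ac)
      have "(f * h)\<^sup>2 * teval \<Phi> ?lhs = (f ^ n * h ^ n)\<^sup>2 * (\<Prod>p<n. fl p)\<^sup>2 * (\<Prod>p<n. hl p)\<^sup>2 * teval \<Phi> (derange uminus (W i j))"
      proof -
        have reorder: "(f * h)\<^sup>2 * (a * b * c * d) = (f * a) * (h * b) * (f * c) * (h * d)" for a b c d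
          by (simp add: power2_eq_square mult_ac)
        show ?thesis unfolding L reorder dU dV bar by (simp only: power2_eq_square mult_ac)
      qed
      also have "\<dots> = (f * h)\<^sup>2 * teval \<Phi> ?rhs" unfolding R[symmetric] teval_mult[OF hf] by (simp only: mult_ac)
      finally show ?thesis using nz by (simp add: f_def h_def)
    qed
    then show "teval \<Phi> (D * ?lhs) = teval \<Phi> (D * ?rhs)"
      unfolding teval_mult[OF hf, of D] D_eval[OF \<Phi>] by (metis mult_eq_0_iff)
  qed
  then show ?thesis by (rule tensor_mult_cancel[OF D0])
qed

theorem abel_map_Jacobi: "abel_map n X \<in> Jacobi_matrices n L"
proof -
  let ?W = "abel_map n X"
  have ent: "ent ?W i j = W (nat (i - 1)) (nat (j - 1))" for i j by (simp add: ent_def)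
  have perm: "derange \<pi> (ent ?W i j) = ent ?W (\<pi> i) (\<pi> j)"
    if \<pi>: "\<pi> permutes {1..int n}" and ij: "i \<in> {1..int n}" "j \<in> {1..int n}" for \<pi> i j
  proof -
    \<comment> \<open>The Jacobi condition permutes positions counted from 1; \<open>\<pi>'\<close>
      is the corresponding permutation of indices counted from 0.\<close>
    define \<pi>' where "\<pi>' b = (if b < n then nat (\<pi> (int b + 1) - 1) else b)" for b
    have mem: "\<pi> m \<in> {1..int n}" if "m \<in> {1..int n}" for m using permutes_in_image[OF \<pi>, of m] that by blast
    have lift: "\<pi> m = lift_perm n \<pi>' m" for m
    proof (cases "m \<in> {1..int n}")
      case True
      then have "int (nat (\<pi> m - 1)) + 1 = \<pi> m" using mem[OF True] by auto
      moreover have "nat (m - 1) < n" "int (nat (m - 1)) + 1 = m" using True by auto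
      ultimately show ?thesis using True unfolding lift_perm_def \<pi>'_def by simp
    next
      case False
      then show ?thesis using permutes_not_in[OF \<pi>] by (auto simp: lift_perm_def)
    qed
    have "\<pi>' permutes {0..<n}"
    proof (rule bij_imp_permutes)
      have "inj_on \<pi>' {0..<n}"
      proof (rule inj_onI)
        fix x y assume xy: "x \<in> {0..<n}" "y \<in> {0..<n}" "\<pi>' x = \<pi>' y"
        then have "\<pi> (int x + 1) = \<pi> (int y + 1)"
          using mem[of "int x + 1"] mem[of "int y + 1"] by (auto simp: \<pi>'_def)
        then show "x = y" using inj_eq[OF permutes_inj[OF \<pi>]] by simp
      qed
      moreover have "\<pi>' ` {0..<n} \<subseteq> {0..<n}"
      proof
        fix y assume "y \<in> \<pi>' ` {0..<n}"
        then obtain x where "x < n" "y = nat (\<pi> (int x + 1) - 1)" by (auto simp: \<pi>'_def)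
        then show "y \<in> {0..<n}" using mem[of "int x + 1"] by auto
      qed
      ultimately show "bij_betw \<pi>' {0..<n} {0..<n}"
        unfolding bij_betw_def using endo_inj_surj[OF finite_atLeastLessThan] by blast
    qed (auto simp: \<pi>'_def)
    note p = this
    have lt: "nat (i - 1) < n" "nat (j - 1) < n" using ij by auto
    have "\<pi> = lift_perm n \<pi>'" using lift by (rule ext)
    then have "derange \<pi> (ent ?W i j) = W (\<pi>' (nat (i - 1))) (\<pi>' (nat (j - 1)))"
      using W_perm[OF p lt] by (simp only: ent)
    also have "\<dots> = ent ?W (\<pi> i) (\<pi> j)"
      using ij lt by (simp add: ent \<pi>'_def)
    finally show ?thesis .
  qed
  have abel: "abel n (\<lambda>l. map_mat (derange (id(0 := - int l))) ?W) = Jacobi_factor n ?W \<cdot>\<^sub>m bar_mat ?W"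
  proof (rule eq_matI)
    fix i j assume "i < dim_row (Jacobi_factor n ?W \<cdot>\<^sub>m bar_mat ?W)" "j < dim_col (Jacobi_factor n ?W \<cdot>\<^sub>m bar_mat ?W)"
    then have ij: "i < n" "j < n" using abel_map_carrier by (auto simp: bar_mat_def)
    have id0: "id(0 := 0) = (id :: int \<Rightarrow> int)" by auto
    have "abel n (\<lambda>l. map_mat (derange (id(0 := - int l))) ?W) $$ (i, j) =
        abelf n (\<lambda>b p c. derange (id(0 := - (int b + 1))) (W p c)) W
          (\<lambda>p c. derange (id(0 := - (int n + 1))) (W p c)) i j"
      by (subst abel_entry[OF _ ij]) (use abel_map_carrier in \<open>auto intro!: abelf_cong simp: id0 derange_id algebra_simps\<close>)
    also have "\<dots> = (Jacobi_factor n ?W \<cdot>\<^sub>m bar_mat ?W) $$ (i, j)"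
      unfolding W_abel_identity[OF ij] using ij abel_map_carrier by (simp add: bar_mat_def)
    finally show "abel n (\<lambda>l. map_mat (derange (id(0 := - int l))) ?W) $$ (i, j) = (Jacobi_factor n ?W \<cdot>\<^sub>m bar_mat ?W) $$ (i, j)" .
  qed (use abel_map_carrier in \<open>auto simp: bar_mat_def abel_def\<close>)
  have "?W \<noteq> 0\<^sub>m n n" using W00_nonzero n2 by auto
  moreover have "W 0 0 * W 1 1 - W 0 1 * W 1 0 = 0" using W_minor[of 0 0 1 1] n2 by simp
  moreover have "ent ?W i j \<in> tensor_sub {0..int n + 1}" if "i \<in> {1..int n}" "j \<in> {1..int n}" for i j
    using that W_sub by (auto simp: ent)
  moreover have "ent ?W 1 2 \<in> Jacobi_space n L" "ent ?W 1 1 = derange (id(1 := 2)) (ent ?W 1 2)"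
    using W_space W_merge by (simp_all add: ent)
  ultimately show ?thesis
    unfolding Jacobi_matrices_def using abel_map_carrier perm abel by (auto simp: ent_def)
qed

end

section \<open>The correspondence\<close>

text \<open>Every position but 0 is evaluated at its point, so that a tensor becomes an element of
  \<open>A\<close>. Applied to a Jacobi matrix this gives the candidate for a preimage under the
  Abel map.\<close>

definition spec0 :: "(int \<Rightarrow> 'a::k_domain \<Rightarrow> 'a base) \<Rightarrow> 'a tensor_power \<Rightarrow> 'a"
  where "spec0 \<Phi> = teval (\<lambda>m a. if m = 0 then a else of_base (\<Phi> m a))"

lemma spec0_family:
  "(\<And>l. \<Phi> l \<in> points) \<Longrightarrow> alg_hom_family (\<lambda>m a. if m = 0 then a else of_base (\<Phi> m a))"
  by (auto simp: alg_hom_family_def points_simps)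

lemma point_spec0:
  assumes \<Phi>: "\<And>l. \<Phi> l \<in> points" and \<chi>: "\<chi> \<in> points"
  shows "\<chi> (spec0 \<Phi> x) = teval (\<Phi>(0 := \<chi>)) x"
proof -
  have 1: "alg_hom_family (\<Phi>(0 := \<chi>))" by (rule alg_hom_family_points) (use \<Phi> \<chi> in auto)
  note 2 = spec0_family[of \<Phi>, OF \<Phi>]
  show ?thesis
  proof (induction x rule: tensor_power_induct)
    case (slot m a)
    then show ?case
      unfolding spec0_def teval_slot[OF 1] teval_slot[OF 2] using points_simps(3)[OF \<chi>] by simp
  qed (simp_all add: spec0_def teval_hom[OF 1] teval_hom[OF 2] points_simps[OF \<chi>] del: fun_upd_apply)
qed

lemma spec0_derange:
  assumes \<Phi>: "\<And>l. \<Phi> l \<in> points" and \<sigma>: "\<And>m. \<sigma> m = 0 \<longleftrightarrow> m = 0"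
  shows "spec0 \<Phi> (derange \<sigma> x) = spec0 (\<lambda>m. \<Phi> (\<sigma> m)) x"
  unfolding spec0_def teval_derange[OF spec0_family[of \<Phi>, OF \<Phi>]] by (simp add: \<sigma>)

interpretation of_base_hom: comm_ring_hom "of_base :: 'a::k_domain base \<Rightarrow> 'a"
  by unfold_locales simp_all

abbreviation of_base_mat :: "'a::k_domain base mat \<Rightarrow> 'a mat"
  where "of_base_mat \<equiv> map_mat of_base"

lemma k_equivalent_refl: "X \<in> carrier_mat n n \<Longrightarrow> k_equivalent n X X"
  unfolding k_equivalent_def
  by (intro bexI[of _ "1\<^sub>m n"]) (auto simp: of_base_hom.mat_hom_one)

lemma invertible_base_mat:
  fixes A :: "'a::k_domain base mat"
  assumes A: "A \<in> carrier_mat n n" "det A \<noteq> 0"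
  obtains B where "B \<in> carrier_mat n n" "det B \<noteq> 0" "A * B = 1\<^sub>m n" "B * A = 1\<^sub>m n"
proof -
  define B where "B = inverse (det A) \<cdot>\<^sub>m adj_mat A"
  have B: "B \<in> carrier_mat n n" using adj_mat(1)[OF A(1)] by (simp add: B_def)
  have AB: "A * B = 1\<^sub>m n"
    unfolding B_def using A adj_mat[OF A(1)] by (subst mult_smult_distrib[of _ n n _ n]) auto
  have BA: "B * A = 1\<^sub>m n"
    unfolding B_def using A adj_mat[OF A(1)] by (subst mult_smult_assoc_mat[of _ n n _ n]) auto
  have "det A * det B = 1" using det_mult[OF A(1) B] AB by simp
  then have "det B \<noteq> 0" by auto
  then show ?thesis using that B AB BA by blast
qed

lemma k_equivalent_sym:
  assumes "X \<in> carrier_mat n n" "k_equivalent n X Y"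
  shows "k_equivalent n Y X"
proof -
  obtain P Q where P: "P \<in> carrier_mat n n" "det P \<noteq> 0" and Q: "Q \<in> carrier_mat n n" "det Q \<noteq> 0"
    and Y: "Y = of_base_mat P * X * of_base_mat Q" using assms(2) by (auto simp: k_equivalent_def)
  obtain P' where P': "P' \<in> carrier_mat n n" "det P' \<noteq> 0" "P' * P = 1\<^sub>m n" using invertible_base_mat[OF P] by blast
  obtain Q' where Q': "Q' \<in> carrier_mat n n" "det Q' \<noteq> 0" "Q * Q' = 1\<^sub>m n" using invertible_base_mat[OF Q] by blast
  have c: "of_base_mat P \<in> carrier_mat n n" "of_base_mat Q \<in> carrier_mat n n"
    "of_base_mat P' \<in> carrier_mat n n" "of_base_mat Q' \<in> carrier_mat n n" using P Q P' Q' by auto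
  have 1: "of_base_mat P' * of_base_mat P = 1\<^sub>m n" "of_base_mat Q * of_base_mat Q' = 1\<^sub>m n"
    using of_base_hom.mat_hom_mult[OF P'(1) P(1)] of_base_hom.mat_hom_mult[OF Q(1) Q'(1)] P'(3) Q'(3)
    by (simp_all add: of_base_hom.mat_hom_one)
  have "of_base_mat P' * Y * of_base_mat Q' =
      of_base_mat P' * (of_base_mat P * X) * (of_base_mat Q * of_base_mat Q')"
    unfolding Y using c assms(1) by (simp add: assoc_mult_mat[of _ n n _ n _ n])
  also have "\<dots> = (of_base_mat P' * of_base_mat P) * X"
    unfolding 1(2) using c assms(1) by (simp add: assoc_mult_mat[of _ n n _ n _ n])
  also have "\<dots> = X" unfolding 1 using assms(1) by simp
  finally show ?thesis using P' Q' unfolding k_equivalent_def by metis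
qed

lemma k_equivalent_trans:
  assumes X: "X \<in> carrier_mat n n" and "k_equivalent n X Y" "k_equivalent n Y V"
  shows "k_equivalent n X V"
proof -
  obtain P Q where P: "P \<in> carrier_mat n n" "det P \<noteq> 0" and Q: "Q \<in> carrier_mat n n" "det Q \<noteq> 0"
    and Y: "Y = of_base_mat P * X * of_base_mat Q" using assms(2) by (auto simp: k_equivalent_def)
  obtain P' Q' where P': "P' \<in> carrier_mat n n" "det P' \<noteq> 0" and Q': "Q' \<in> carrier_mat n n" "det Q' \<noteq> 0"
    and V: "V = of_base_mat P' * Y * of_base_mat Q'" using assms(3) by (auto simp: k_equivalent_def)
  have c: "of_base_mat P \<in> carrier_mat n n" "of_base_mat Q \<in> carrier_mat n n"
    "of_base_mat P' \<in> carrier_mat n n" "of_base_mat Q' \<in> carrier_mat n n" using P Q P' Q' by auto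
  have "V = of_base_mat (P' * P) * X * of_base_mat (Q * Q')"
    unfolding V Y of_base_hom.mat_hom_mult[OF P'(1) P(1)] of_base_hom.mat_hom_mult[OF Q(1) Q'(1)]
    using c X by (simp add: assoc_mult_mat[of _ n n _ n _ n])
  moreover have "P' * P \<in> carrier_mat n n" "Q * Q' \<in> carrier_mat n n" "det (P' * P) \<noteq> 0" "det (Q * Q') \<noteq> 0"
    using P Q P' Q' by (auto simp: det_mult)
  ultimately show ?thesis unfolding k_equivalent_def by blast
qed

lemma k_equivalent_scale:
  assumes X: "X \<in> carrier_mat n n" and c: "c \<noteq> 0"
  shows "k_equivalent n X (of_base c \<cdot>\<^sub>m X)"
proof -
  have 1: "of_base_mat (c \<cdot>\<^sub>m 1\<^sub>m n) = of_base c \<cdot>\<^sub>m 1\<^sub>m n" by (rule eq_matI) auto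
  have "of_base_mat (c \<cdot>\<^sub>m 1\<^sub>m n) * X * of_base_mat (1\<^sub>m n) = of_base c \<cdot>\<^sub>m X"
    using X by (simp add: 1 of_base_hom.mat_hom_one mult_smult_assoc_mat[of _ n n _ n])
  then show ?thesis unfolding k_equivalent_def using c
    by (intro bexI[of _ "c \<cdot>\<^sub>m 1\<^sub>m n"] bexI[of _ "1\<^sub>m n"]) auto
qed

lemma triple_product_entry:
  assumes "A \<in> carrier_mat n n" "X \<in> carrier_mat n n" "B \<in> carrier_mat n n" "i < n" "j < n"
  shows "(A * X * B) $$ (i, j) = (\<Sum>c<n. \<Sum>p<n. A $$ (i, p) * X $$ (p, c) * B $$ (c, j))"
  using assms by (simp add: scalar_prod_def atLeast0LessThan sum_distrib_left) (subst sum.swap, simp add: mult_ac)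

context fg_domain
begin

lemma eq_by_points: "(\<And>\<chi>. \<chi> \<in> points \<Longrightarrow> \<chi> a = \<chi> b) \<Longrightarrow> a = (b :: 'a)"
  using point_nonzero[of "a - b"] by (force simp: points_simps)

text \<open>Left multiplication acts on the vectors \<open>u\<close> at all positions and right
  multiplication on the vectors \<open>v\<close>, so each of the four determinants is multiplied by
  \<open>det P\<close> or \<open>det Q\<close>.\<close>

lemma abel_map_k_equivalent:
  assumes X: "X \<in> carrier_mat n n" "rank_le_1 X" and Y: "k_equivalent n X (Y :: 'a mat)"
  shows "\<exists>c. c \<noteq> 0 \<and> abel_map n Y = tensor_scalar c \<cdot>\<^sub>m abel_map n X"
proof -
  obtain P Q where P: "P \<in> carrier_mat n n" "det P \<noteq> 0" and Q: "Q \<in> carrier_mat n n" "det Q \<noteq> 0"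
    and Yeq: "Y = of_base_mat P * X * of_base_mat Q" using Y by (auto simp: k_equivalent_def)
  have YC: "Y \<in> carrier_mat n n" unfolding Yeq using P Q X by simp
  define p where "p b q = P $$ (q, b)" for b q
  define q where "q b c = Q $$ (b, c)" for b c
  have detp: "dt n p = det P"
  proof -
    have "mat n n (\<lambda>(b, q). p b q) = P\<^sup>T" using P by (intro eq_matI) (auto simp: p_def)
    then show ?thesis using det_transpose[OF P(1)] by (simp add: dt_def)
  qed
  have detq: "dt n q = det Q"
    unfolding dt_def q_def by (rule arg_cong[of _ _ det], rule eq_matI) (use Q in auto)
  define c where "c = det P * det Q * det P * det Q"
  have "abel_map n Y $$ (i, j) = tensor_scalar c * abel_map n X $$ (i, j)" if ij: "i < n" "j < n" for i j
  proof (rule tensor_eqI)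
    fix \<Phi> :: "int \<Rightarrow> 'a \<Rightarrow> 'a base" assume \<Phi>: "\<And>l. \<Phi> l \<in> points"
    note h = alg_hom_family_points[of \<Phi>, OF \<Phi>]
    define u v where "u l = fst (factors n X (\<Phi> l))" and "v l = snd (factors n X (\<Phi> l))" for l
    have uv: "\<Phi> l (X $$ (a, b)) = u l a * v l b" if "a < n" "b < n" for l a b
      unfolding u_def v_def by (rule factors[OF X \<Phi> that])
    have uv': "\<Phi> l (Y $$ (a, b)) = (\<Sum>s<n. u l s * p s a) * (\<Sum>t<n. v l t * q t b)" if "a < n" "b < n" for l a b
    proof -
      have "\<Phi> l (Y $$ (a, b)) = (\<Sum>t<n. \<Sum>s<n. P $$ (a, s) * (u l s * v l t) * Q $$ (t, b))"
        unfolding Yeq using P Q X that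
        by (subst triple_product_entry[of _ n]) (auto simp: points_sum[OF \<Phi>] points_simps[OF \<Phi>] uv)
      also have "\<dots> = (\<Sum>s<n. u l s * p s a) * (\<Sum>t<n. v l t * q t b)"
        unfolding sum_product by (subst sum.swap) (simp add: p_def q_def mult_ac)
      finally show ?thesis .
    qed
    show "teval \<Phi> (abel_map n Y $$ (i, j)) = teval \<Phi> (tensor_scalar c * abel_map n X $$ (i, j))"
    proof -
      have 1: "teval \<Phi> (abel_map n X $$ (i, j)) =
          dt n (\<lambda>b. u (((\<lambda>b. int b + 1)(i := 0)) b)) * dt n (\<lambda>b. v (((\<lambda>b. int b + 1)(i := int n + 1)) b)) *
          dt n (\<lambda>b. u (((\<lambda>b. int b + 1)(j := int n + 1)) b)) * dt n (\<lambda>b. v (((\<lambda>b. int b + 1)(j := 0)) b))"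
        by (rule eval_abel_map[OF X(1) ij \<Phi> uv])
      have "teval \<Phi> (abel_map n Y $$ (i, j)) =
          dt n (\<lambda>b a. \<Sum>s<n. u (((\<lambda>b. int b + 1)(i := 0)) b) s * p s a) *
          dt n (\<lambda>b a. \<Sum>s<n. v (((\<lambda>b. int b + 1)(i := int n + 1)) b) s * q s a) *
          dt n (\<lambda>b a. \<Sum>s<n. u (((\<lambda>b. int b + 1)(j := int n + 1)) b) s * p s a) *
          dt n (\<lambda>b a. \<Sum>s<n. v (((\<lambda>b. int b + 1)(j := 0)) b) s * q s a)"
        by (rule eval_abel_map[OF YC ij \<Phi> uv'])
      then show ?thesis
        unfolding dt_mult detp detq teval_mult[OF h] teval_scalar[OF h] points_simps(3)[OF \<Phi>] 1 c_def
        by (simp only: mult_ac)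
    qed
  qed
  then have "abel_map n Y = tensor_scalar c \<cdot>\<^sub>m abel_map n X"
    by (intro eq_matI) (auto simp: abel_map_def abel_def)
  moreover have "c \<noteq> 0" using P Q by (simp add: c_def)
  ultimately show ?thesis by blast
qed

end

context segre
begin

lemma jacobi_abel_map: "jacobi n L (abel_map n X)"
  by unfold_locales (use n2 abel_map_Jacobi in auto)

text \<open>With all positions but 0 fixed, an entry of the Abel matrix is bilinear in the vectors
  \<open>u'\<close> and \<open>v'\<close> at position 0: two of its determinants are linear in them,
  and the other two are the constants \<open>hl i\<close> and \<open>fl j\<close>. The coefficient
  matrices \<open>P\<close> and \<open>Q\<close> are invertible because the determinants occurring
  in \<Delta> do not vanish.\<close>

lemma spec0_abel_map_equivalent:
  assumes \<Phi>: "\<And>l. \<Phi> l \<in> points" and nz: "teval \<Phi> (Jacobi_factor n (abel_map n X)) \<noteq> 0"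
  shows "k_equivalent n X (map_mat (spec0 \<Phi>) (abel_map n X))"
proof -
  note hf = alg_hom_family_points[of \<Phi>, OF \<Phi>]
  define u v where "u b = fst (factors n X (\<Phi> (\<iota> b)))" and "v b = snd (factors n X (\<Phi> (\<iota> b)))" for b
  define fl hl where "fl l = F \<Phi> (\<iota>(l := int n + 1))" and "hl l = H \<Phi> (\<iota>(l := int n + 1))" for l
  have Geval: "F \<Phi> \<iota> \<noteq> 0 \<and> H \<Phi> \<iota> \<noteq> 0 \<and> fl l \<noteq> 0 \<and> hl l \<noteq> 0" if l: "l < n" for l
  proof -
    define G where "G l = derange (transpose 0 (int l + 1)) (W l l)" for l
    have "Jacobi_factor n (abel_map n X) = derange (transpose 2 (int n + 1)) (G 0) * G 0 * G 1 * (\<Prod>l = 2..<n. (G l)\<^sup>2)"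
      unfolding Jacobi_factor_eq G_def by (simp add: add.commute)
    then have "teval \<Phi> (G 0) \<noteq> 0" "teval \<Phi> (G 1) \<noteq> 0" "(\<Prod>l = 2..<n. (teval \<Phi> (G l))\<^sup>2) \<noteq> 0"
      using nz by (auto simp: teval_hom[OF hf])
    moreover have "l = 0 \<or> l = 1 \<or> l \<in> {2..<n}" using l by auto
    ultimately have "teval \<Phi> (G l) \<noteq> 0" by auto
    then show ?thesis unfolding G_def eval_G[of \<Phi>, OF \<Phi> l] fl_def hl_def by auto
  qed
  define mu where "mu p i = dt n (u(i := \<lambda>q. if q = p then 1 else 0))" for p i
  define mv where "mv c j = dt n (v(j := \<lambda>q. if q = c then 1 else 0))" for c j
  define P where "P = mat n n (\<lambda>(i, p). hl i * mu p i)"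
  define Q where "Q = mat n n (\<lambda>(c, j). fl j * mv c j)"
  \<comment> \<open>\<open>dt_cramer\<close> for the unit vectors: the cofactor matrix of an
    invertible matrix is invertible.\<close>
  have detm: "dt n (\<lambda>c p. dt n (x(p := \<lambda>q. if q = c then 1 else 0))) \<noteq> 0" if "dt n x \<noteq> 0" for x :: "nat \<Rightarrow> nat \<Rightarrow> 'a base"
  proof -
    have "dt n (\<lambda>b q. if q = b then 1 else (0::'a base)) = det (1\<^sub>m n)"
      unfolding dt_def by (rule arg_cong[of _ _ det], rule eq_matI) auto
    then show ?thesis using dt_cramer[of n x "\<lambda>c q. if q = c then 1 else 0"] that by auto
  qed
  have n0: "0 < n" using n2 by simp
  have u0: "dt n u \<noteq> 0" "dt n v \<noteq> 0" using Geval[OF n0] by (simp_all add: F_def H_def u_def[abs_def] v_def[abs_def])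
  have "det P = dt n (\<lambda>c p. hl p * mu c p)"
  proof -
    have "P\<^sup>T = mat n n (\<lambda>(b, c). hl c * mu b c)" unfolding P_def by (rule eq_matI) auto
    then show ?thesis using det_transpose[of P n] by (simp add: dt_def P_def)
  qed
  then have "det P \<noteq> 0" using Geval detm[OF u0(1)] by (simp add: dt_col_scale mu_def)
  moreover have "det Q \<noteq> 0" using Geval detm[OF u0(2)]
    unfolding Q_def dt_def[symmetric] dt_col_scale by (simp add: mv_def)
  moreover have "map_mat (spec0 \<Phi>) (abel_map n X) = of_base_mat P * X * of_base_mat Q"
  proof (rule eq_matI)
    fix i j assume "i < dim_row (of_base_mat P * X * of_base_mat Q)" "j < dim_col (of_base_mat P * X * of_base_mat Q)"
    then have ij: "i < n" "j < n" by (auto simp: P_def Q_def)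
    show "map_mat (spec0 \<Phi>) (abel_map n X) $$ (i, j) = (of_base_mat P * X * of_base_mat Q) $$ (i, j)"
    proof (rule eq_by_points)
      fix \<chi> :: "'a \<Rightarrow> 'a base" assume \<chi>: "\<chi> \<in> points"
      define u' v' where "u' = fst (factors n X \<chi>)" and "v' = snd (factors n X \<chi>)"
      have \<Psi>: "(\<Phi>(0 := \<chi>)) l \<in> points" for l using \<Phi> \<chi> by simp
      have "\<chi> (map_mat (spec0 \<Phi>) (abel_map n X) $$ (i, j)) = teval (\<Phi>(0 := \<chi>)) (W i j)"
        using ij abel_map_carrier point_spec0[of \<Phi>, OF \<Phi> \<chi>] by simp
      also have "\<dots> = F (\<Phi>(0 := \<chi>)) (\<iota>(i := 0)) * H (\<Phi>(0 := \<chi>)) (\<iota>(i := int n + 1)) *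
          F (\<Phi>(0 := \<chi>)) (\<iota>(j := int n + 1)) * H (\<Phi>(0 := \<chi>)) (\<iota>(j := 0))"
        by (rule eval_W[of "\<Phi>(0 := \<chi>)", OF \<Psi> ij])
      also have "F (\<Phi>(0 := \<chi>)) (\<iota>(i := 0)) = dt n (u(i := u'))"
        unfolding F_def u_def u'_def by (rule dt_cong) auto
      also have "H (\<Phi>(0 := \<chi>)) (\<iota>(j := 0)) = dt n (v(j := v'))"
        unfolding H_def v_def v'_def by (rule dt_cong) auto
      also have "H (\<Phi>(0 := \<chi>)) (\<iota>(i := int n + 1)) = hl i"
        unfolding H_def hl_def by (rule dt_cong) auto
      also have "F (\<Phi>(0 := \<chi>)) (\<iota>(j := int n + 1)) = fl j"
        unfolding F_def fl_def by (rule dt_cong) auto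
      also have "dt n (u(i := u')) = (\<Sum>p<n. u' p * mu p i)" unfolding mu_def by (rule dt_unit_expand[OF ij(1)])
      also have "dt n (v(j := v')) = (\<Sum>c<n. v' c * mv c j)" unfolding mv_def by (rule dt_unit_expand[OF ij(2)])
      finally have 1: "\<chi> (map_mat (spec0 \<Phi>) (abel_map n X) $$ (i, j)) =
          (\<Sum>p<n. u' p * mu p i) * hl i * fl j * (\<Sum>c<n. v' c * mv c j)" .
      have "\<chi> ((of_base_mat P * X * of_base_mat Q) $$ (i, j)) =
          (\<Sum>c<n. \<Sum>p<n. (hl i * mu p i) * (u' p * v' c) * (fl j * mv c j))"
        using ij XC by (subst triple_product_entry[of _ n])
          (auto simp: P_def Q_def points_sum[OF \<chi>] points_simps[OF \<chi>] factors[OF XC Xr \<chi>] u'_def v'_def)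
      also have "\<dots> = (\<Sum>p<n. \<Sum>c<n. (u' p * mu p i) * (v' c * mv c j) * (hl i * fl j))"
        by (subst sum.swap) (simp add: mult_ac)
      also have "\<dots> = (\<Sum>p<n. u' p * mu p i) * (\<Sum>c<n. v' c * mv c j) * (hl i * fl j)"
        unfolding sum_product by (simp only: sum_distrib_right)
      finally show "\<chi> (map_mat (spec0 \<Phi>) (abel_map n X) $$ (i, j)) = \<chi> ((of_base_mat P * X * of_base_mat Q) $$ (i, j))"
        unfolding 1 by (simp only: mult_ac)
    qed
  qed (use abel_map_carrier in \<open>auto simp: P_def Q_def\<close>)
  ultimately show ?thesis unfolding k_equivalent_def
    by (intro bexI[of _ P] bexI[of _ Q] conjI) (auto simp: P_def Q_def)
qed

end

section \<open>Generality of preimages and injectivity\<close>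

lemma dt_row_nonzero:
  assumes "dt n w \<noteq> 0" "b < n"
  shows "\<exists>c<n. w b c \<noteq> 0"
  using dt_unit_expand[OF assms(2), of w "w b"] assms by (auto simp: intro: sum.neutral)

lemma dt_kernel:
  fixes w :: "nat \<Rightarrow> nat \<Rightarrow> 'k::field"
  assumes "dt n w \<noteq> 0" "\<And>b. b < n \<Longrightarrow> (\<Sum>c<n. w b c * k c) = 0" "c < n"
  shows "k c = 0"
proof -
  let ?M = "mat n n (\<lambda>(b, c). w b c)"
  have "?M *\<^sub>v vec n k = 0\<^sub>v n"
    by (rule eq_vecI) (use assms(2) in \<open>auto simp: scalar_prod_def atLeast0LessThan\<close>)
  then have "vec n k = 0\<^sub>v n"
    using det_0_iff_vec_prod_zero_field[of ?M n] assms(1) vec_carrier[of n k] unfolding dt_def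
    by (metis mat_carrier)
  then have "vec n k $ c = 0\<^sub>v n $ c" by simp
  then show ?thesis using assms(3) by simp
qed

text \<open>A kernel vector of one nonzero row of a matrix of rank one is a kernel vector of all rows.\<close>

lemma rank_le_1_independent_row:
  fixes X :: "'a::k_domain mat"
  assumes X: "X \<in> carrier_mat n n" "rank_le_1 X" and nz: "p < n" "q < n" "X $$ (p, q) \<noteq> 0"
    and ker: "\<And>k. (\<And>i. i < n \<Longrightarrow> (\<Sum>j<n. of_base (k j) * X $$ (i, j)) = 0) \<Longrightarrow> \<forall>j<n. k j = 0"
  shows "k_independent n (\<lambda>j. X $$ (p, j))"
  unfolding k_independent_def
proof (intro allI impI)
  fix k j assume k: "(\<Sum>j<n. of_base (k j) * X $$ (p, j)) = 0" and j: "j < n"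
  have "(\<Sum>j<n. of_base (k j) * X $$ (i, j)) = 0" if i: "i < n" for i
  proof -
    have "X $$ (p, q) * (\<Sum>j<n. of_base (k j) * X $$ (i, j)) = X $$ (i, q) * (\<Sum>j<n. of_base (k j) * X $$ (p, j))"
      unfolding sum_distrib_left
    proof (rule sum.cong[OF refl])
      fix j assume "j \<in> {..<n}"
      then have "X $$ (p, q) * X $$ (i, j) = X $$ (p, j) * X $$ (i, q)"
        using X nz i by (intro rank_le_1_minor) auto
      then show "X $$ (p, q) * (of_base (k j) * X $$ (i, j)) = X $$ (i, q) * (of_base (k j) * X $$ (p, j))"
        by (simp add: mult_ac)
    qed
    then show ?thesis using k nz by simp
  qed
  then show "k j = 0" using ker j by blast
qed

context fg_domain
begin

text \<open>At a point where some entry does not vanish, four determinants are nonzero. A kernel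
  vector of all rows of \<open>X\<close> annihilates the vectors \<open>v\<close> at the positions
  of one of these determinants, once the vectors \<open>u\<close> at the same positions are known to
  be nonzero; hence it vanishes. Columns are treated in the same way.\<close>

lemma abel_map_nonzero_k_general:
  assumes X: "X \<in> carrier_mat n n" "rank_le_1 X" and nz: "abel_map n X \<noteq> 0\<^sub>m n n"
  shows "k_general (X :: 'a mat)"
proof -
  have "\<exists>i<n. \<exists>j<n. abel_map n X $$ (i, j) \<noteq> 0"
  proof (rule ccontr)
    assume "\<not> ?thesis"
    then have "abel_map n X = 0\<^sub>m n n" by (intro eq_matI) (auto simp: abel_map_def abel_def)
    then show False using nz by simp
  qed
  then obtain i j where ij: "i < n" "j < n" "abel_map n X $$ (i, j) \<noteq> 0" by blast
  obtain \<Phi> where \<Phi>: "\<And>l. \<Phi> l \<in> points" and ne: "teval \<Phi> (abel_map n X $$ (i, j)) \<noteq> 0"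
    using tensor_nonzero[OF ij(3)] by metis
  define u v where "u l = fst (factors n X (\<Phi> l))" and "v l = snd (factors n X (\<Phi> l))" for l
  have uv: "\<Phi> l (X $$ (a, b)) = u l a * v l b" if "a < n" "b < n" for l a b
    unfolding u_def v_def by (rule factors[OF X \<Phi> that])
  define \<alpha> \<beta> where "\<alpha> i = (\<lambda>b. int b + 1)(i := 0)" and "\<beta> i = (\<lambda>b. int b + 1)(i := int n + 1)" for i
  have "teval \<Phi> (abel_map n X $$ (i, j)) = dt n (\<lambda>b. u (\<alpha> i b)) * dt n (\<lambda>b. v (\<beta> i b)) *
      dt n (\<lambda>b. u (\<beta> j b)) * dt n (\<lambda>b. v (\<alpha> j b))"
    unfolding \<alpha>_def \<beta>_def by (rule eval_abel_map[OF X(1) ij(1,2) \<Phi> uv])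
  then have d: "dt n (\<lambda>b. u (\<alpha> i b)) \<noteq> 0" "dt n (\<lambda>b. v (\<beta> i b)) \<noteq> 0" "dt n (\<lambda>b. u (\<beta> j b)) \<noteq> 0" "dt n (\<lambda>b. v (\<alpha> j b)) \<noteq> 0"
    using ne by auto
  \<comment> \<open>Position 0, reached for \<open>b = j\<close>, occurs in the first determinant;
    the remaining positions of \<open>\<alpha> j\<close> occur in the third.\<close>
  have unz: "\<exists>p<n. u (\<alpha> j b) p \<noteq> 0" if b: "b < n" for b
    using dt_row_nonzero[OF d(1) ij(1)] dt_row_nonzero[OF d(3) b] by (cases "b = j") (auto simp: \<alpha>_def \<beta>_def)
  have vnz: "\<exists>p<n. v (\<alpha> i b) p \<noteq> 0" if b: "b < n" for b
    using dt_row_nonzero[OF d(4) ij(2)] dt_row_nonzero[OF d(2) b] by (cases "b = i") (auto simp: \<alpha>_def \<beta>_def)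
  have XT: "X\<^sup>T \<in> carrier_mat n n" "rank_le_1 X\<^sup>T"
  proof -
    show "X\<^sup>T \<in> carrier_mat n n" using X(1) by simp
    show "rank_le_1 X\<^sup>T" unfolding rank_le_1_def
    proof (intro allI impI)
      fix a a' b b' assume "a < a'" "a' < dim_row X\<^sup>T" "b < b'" "b' < dim_col X\<^sup>T"
      then show "X\<^sup>T $$ (a, b) * X\<^sup>T $$ (a', b') - X\<^sup>T $$ (a, b') * X\<^sup>T $$ (a', b) = 0"
        using rank_le_1_minor[OF X(2), of b b' a a'] by (simp add: mult.commute)
    qed
  qed
  have row: "k c = 0" if k: "\<And>p. p < n \<Longrightarrow> (\<Sum>q<n. of_base (k q) * X $$ (p, q)) = 0" and c: "c < n" for k c
  proof (rule dt_kernel[OF d(4) _ c])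
    fix b assume "b < n"
    then obtain p where p: "p < n" "u (\<alpha> j b) p \<noteq> 0" using unz by blast
    have "0 = \<Phi> (\<alpha> j b) (\<Sum>q<n. of_base (k q) * X $$ (p, q))" using k[OF p(1)] points_simps(4)[OF \<Phi>] by simp
    also have "\<dots> = u (\<alpha> j b) p * (\<Sum>q<n. v (\<alpha> j b) q * k q)"
      unfolding sum_distrib_left points_sum[OF \<Phi>]
      by (intro sum.cong refl) (simp add: points_simps[OF \<Phi>] uv p mult_ac)
    finally show "(\<Sum>q<n. v (\<alpha> j b) q * k q) = 0" using p(2) by simp
  qed
  have col: "k c = 0" if k: "\<And>q. q < n \<Longrightarrow> (\<Sum>p<n. of_base (k p) * X $$ (p, q)) = 0" and c: "c < n" for k c
  proof (rule dt_kernel[OF d(1) _ c])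
    fix b assume "b < n"
    then obtain q where q: "q < n" "v (\<alpha> i b) q \<noteq> 0" using vnz by blast
    have "0 = \<Phi> (\<alpha> i b) (\<Sum>p<n. of_base (k p) * X $$ (p, q))" using k[OF q(1)] points_simps(4)[OF \<Phi>] by simp
    also have "\<dots> = v (\<alpha> i b) q * (\<Sum>p<n. u (\<alpha> i b) p * k p)"
      unfolding sum_distrib_left points_sum[OF \<Phi>]
      by (intro sum.cong refl) (simp add: points_simps[OF \<Phi>] uv q mult_ac)
    finally show "(\<Sum>p<n. u (\<alpha> i b) p * k p) = 0" using q(2) by simp
  qed
  have "\<exists>p<n. \<exists>q<n. X $$ (p, q) \<noteq> 0"
  proof (rule ccontr)
    assume "\<not> ?thesis"
    then have "(1 :: 'a base) = 0" using row[of "\<lambda>_. 1" i] ij(1) by simp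
    then show False by simp
  qed
  then obtain p q where pq: "p < n" "q < n" "X $$ (p, q) \<noteq> 0" by blast
  have "k_independent n (\<lambda>j. X $$ (p, j))"
    by (rule rank_le_1_independent_row[OF X pq]) (use row in blast)
  moreover have "k_independent n (\<lambda>j. X\<^sup>T $$ (q, j))"
    by (rule rank_le_1_independent_row[OF XT pq(2,1)]) (use X(1) pq col in auto)
  then have "k_independent n (\<lambda>j. X $$ (j, q))"
    using X(1) pq by (simp add: k_independent_def)
  ultimately show ?thesis using X(1) pq unfolding k_general_def by auto
qed

text \<open>Both matrices are recovered at a common point where neither factor \<Delta> vanishes;
  the recovered matrices are proportional because the Abel matrices are.\<close>

lemma abel_map_injective:
  assumes n2: "n \<ge> 2" and L0: "(0::'a) \<in> L" and X: "X \<in> Segre_matrices n L" "X' \<in> Segre_matrices n L"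
    and eq: "abel_map n X' = tensor_scalar c \<cdot>\<^sub>m abel_map n X" and c: "c \<noteq> 0"
  shows "k_equivalent n X X'"
proof -
  interpret s: segre type_of_A n L X by unfold_locales (use n2 L0 X in auto)
  interpret s': segre type_of_A n L X' by unfold_locales (use n2 L0 X in auto)
  have "Jacobi_factor n (abel_map n X) * Jacobi_factor n (abel_map n X') \<noteq> 0"
    using jacobi.\<Delta>_nonzero[OF s.jacobi_abel_map] jacobi.\<Delta>_nonzero[OF s'.jacobi_abel_map]
    by (simp add: tensor_mult_eq_0)
  then obtain \<Phi> where \<Phi>: "\<And>l. \<Phi> l \<in> points"
    and "teval \<Phi> (Jacobi_factor n (abel_map n X) * Jacobi_factor n (abel_map n X')) \<noteq> 0"
    using tensor_nonzero by metis
  then have nz: "teval \<Phi> (Jacobi_factor n (abel_map n X)) \<noteq> 0" "teval \<Phi> (Jacobi_factor n (abel_map n X')) \<noteq> 0"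
    by (auto simp: teval_mult[OF alg_hom_family_points[of \<Phi>, OF \<Phi>]])
  let ?M = "map_mat (spec0 \<Phi>) (abel_map n X)"
  have M: "?M \<in> carrier_mat n n" using s.abel_map_carrier by simp
  have "map_mat (spec0 \<Phi>) (abel_map n X') = of_base c \<cdot>\<^sub>m ?M"
    unfolding eq using s.abel_map_carrier
    by (intro eq_matI) (auto simp: spec0_def teval_mult[OF spec0_family[of \<Phi>, OF \<Phi>]] teval_scalar[OF spec0_family[of \<Phi>, OF \<Phi>]])
  then have 1: "k_equivalent n ?M (map_mat (spec0 \<Phi>) (abel_map n X'))"
    using k_equivalent_scale[OF M c] by simp
  have 2: "k_equivalent n X ?M" by (rule s.spec0_abel_map_equivalent[OF \<Phi> nz(1)])
  have "k_equivalent n X' (map_mat (spec0 \<Phi>) (abel_map n X'))" by (rule s'.spec0_abel_map_equivalent[OF \<Phi> nz(2)])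
  then have 3: "k_equivalent n (map_mat (spec0 \<Phi>) (abel_map n X')) X'" by (rule k_equivalent_sym[OF s'.XC])
  show ?thesis
    using k_equivalent_trans[OF s.XC k_equivalent_trans[OF s.XC 2 1] 3] .
qed

end

text \<open>Position 0 carries exactly one factor from \<open>L\<close>. Specialization makes all
  other factors scalars, which \<open>K\<close> expresses, and \<open>L\<close> is a
  subspace.\<close>

lemma spec0_Jacobi_space:
  fixes L :: "'a::k_domain set"
  assumes \<Phi>: "\<And>l. \<Phi> l \<in> points" and L: "module.subspace base_scale L" and x: "x \<in> Jacobi_space n L"
  shows "spec0 \<Phi> x \<in> L"
proof -
  note h = spec0_family[of \<Phi>, OF \<Phi>]
  define K where "K = {y. \<exists>c. spec0 \<Phi> y = of_base c}"
  have Kmult: "S * T \<subseteq> K" if ST: "S \<subseteq> K" "T \<subseteq> K" for S T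
  proof
    fix y assume "y \<in> S * T"
    then obtain s t where st: "y = s * t" "s \<in> S" "t \<in> T" by (rule set_times_elim)
    then obtain c d where "spec0 \<Phi> s = of_base c" "spec0 \<Phi> t = of_base d" using ST unfolding K_def by blast
    then have "spec0 \<Phi> y = of_base (c * d)" by (simp add: st spec0_def teval_mult[OF h])
    then show "y \<in> K" unfolding K_def by blast
  qed
  have K1: "1 \<subseteq> K"
  proof -
    have "spec0 \<Phi> 1 = of_base 1" by (simp add: spec0_def teval_1[OF h])
    then show ?thesis unfolding K_def set_one by blast
  qed
  have Kslot: "slot l ` L \<subseteq> K" if "l \<noteq> 0" for l
    using that by (auto simp: K_def spec0_def teval_slot[OF h])
  have Kprod: "(\<Prod>l\<in>I. S l) \<subseteq> K" if "\<And>l. l \<in> I \<Longrightarrow> S l \<subseteq> K" for I :: "int set" and S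
    using that by (induction I rule: infinite_finite_induct) (use K1 Kmult in auto)
  have "x \<in> tensor_vs.span
    (slot 0 ` L * slot 1 ` L * slot 2 ` L * (\<Prod>l = 3..int n. (slot l ` L)\<^sup>2) * slot (int n + 1) ` L)"
    using x unfolding Jacobi_space_def .
  then show ?thesis
  proof (induction rule: tensor_vs.span_induct)
    case base
    show ?case
    proof (rule tensor_vs.subspaceI; unfold mem_Collect_eq)
      show "spec0 \<Phi> 0 \<in> L" using base_vs.subspace_0[OF L] by (simp add: spec0_def teval_0[OF h])
      show "spec0 \<Phi> (x + y) \<in> L" if "spec0 \<Phi> x \<in> L" "spec0 \<Phi> y \<in> L" for x y
        using base_vs.subspace_add[OF L that] by (simp add: spec0_def teval_add[OF h])
      show "spec0 \<Phi> (tensor_scale c x) \<in> L" if "spec0 \<Phi> x \<in> L" for c x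
        using base_vs.subspace_scale[OF L that] by (simp add: spec0_def teval_mult[OF h] teval_scalar[OF h])
    qed
  next
    case (step y)
    then have "y \<in> slot 0 ` L * (slot 1 ` L * slot 2 ` L * (\<Prod>l = 3..int n. (slot l ` L)\<^sup>2) * slot (int n + 1) ` L)"
      by (simp only: mult.assoc)
    then obtain s t where st: "y = s * t" "s \<in> slot 0 ` L"
      "t \<in> slot 1 ` L * slot 2 ` L * (\<Prod>l = 3..int n. (slot l ` L)\<^sup>2) * slot (int n + 1) ` L"
      by (rule set_times_elim)
    have "slot 1 ` L * slot 2 ` L * (\<Prod>l = 3..int n. (slot l ` L)\<^sup>2) * slot (int n + 1) ` L \<subseteq> K"
      by (intro Kmult Kprod Kslot; (unfold power2_eq_square)?; (intro Kmult Kslot)?) auto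
    then obtain c where "spec0 \<Phi> t = of_base c" using st(3) unfolding K_def by blast
    moreover obtain a where "a \<in> L" "s = slot 0 a" using st(2) by blast
    ultimately show ?case
      using base_vs.subspace_scale[OF L, of a c] by (simp add: st(1) spec0_def teval_mult[OF h] teval_slot[OF h] mult.commute)
  qed
qed

context jacobi
begin

text \<open>Every entry is a renaming of \<open>z 0 1\<close> that keeps position 0 in place, and
  such a renaming only rearranges or merges the points put at the other positions.\<close>

lemma spec0_z:
  assumes \<Phi>: "\<And>l. \<Phi> l \<in> points" and L: "module.subspace base_scale L" and ij: "i < n" "j < n"
  shows "spec0 \<Phi> (z i j) \<in> L"
proof -
  have z01: "spec0 \<Phi> (z 0 1) \<in> L" if "\<And>l. \<Phi> l \<in> points" for \<Phi>
    by (rule spec0_Jacobi_space[OF that L, where n = n])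
      (use Z in \<open>auto simp: Jacobi_matrices_def ent_z_const\<close>)
  have lp: "lift_perm n \<pi> m = 0 \<longleftrightarrow> m = 0" for \<pi> m by (auto simp: lift_perm_def)
  have z00': "spec0 \<Phi> (z 0 0) \<in> L" if "\<And>l. \<Phi> l \<in> points" for \<Phi>
    unfolding z00 by (subst spec0_derange) (use that z01 in auto)
  have n0: "0 < n" "1 < n" using n2 by auto
  show ?thesis
  proof (cases "i = j")
    case True
    define \<pi> where "\<pi> = transpose 0 i"
    have \<pi>: "\<pi> permutes {0..<n}" "\<pi> 0 = i" unfolding \<pi>_def using ij n0 by (auto intro: permutes_swap_id)
    have "z i j = derange (lift_perm n \<pi>) (z 0 0)" unfolding z_perm[OF \<pi>(1) n0(1) n0(1)] using \<pi> True by simp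
    then show ?thesis by (simp only:) (subst spec0_derange, use \<Phi> lp z00' in auto)
  next
    case False
    obtain \<pi> where \<pi>: "\<pi> permutes {0..<n}" "\<pi> 0 = i" "\<pi> (Suc 0) = j" using permutes_two[OF False ij] .
    have "z i j = derange (lift_perm n \<pi>) (z 0 1)" unfolding z_perm[OF \<pi>(1) n0] using \<pi> by simp
    then show ?thesis by (simp only:) (subst spec0_derange, use \<Phi> lp z01 in auto)
  qed
qed

text \<open>The Abel identity is read at a mixed point \<Theta>. The positive positions, which
  \<Delta> sees, get the fixed \<Phi> and yield a constant; the nonpositive ones, which the barred
  matrix sees, get the reflected variable \<Psi>. At \<Theta> the matrix with position 0 moved to
  \<open>-l\<close> has the value of the specialized matrix at position \<open>l\<close>.\<close>

lemma abel_map_spec0: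
  assumes \<Phi>: "\<And>l. \<Phi> l \<in> points"
  shows "abel_map n (map_mat (spec0 \<Phi>) Z) = tensor_scalar (teval \<Phi> \<Delta>) \<cdot>\<^sub>m Z"
proof -
  have ZC: "Z \<in> carrier_mat n n" using Z by (simp add: Jacobi_matrices_def)
  then have XC: "map_mat (spec0 \<Phi>) Z \<in> carrier_mat n n" by simp
  have Xz: "map_mat (spec0 \<Phi>) Z $$ (p, c) = spec0 \<Phi> (z p c)" if "p < n" "c < n" for p c
    using ZC that by (simp add: z_def)
  have "abel_map n (map_mat (spec0 \<Phi>) Z) $$ (i, j) = tensor_scalar (teval \<Phi> \<Delta>) * z i j" if ij: "i < n" "j < n" for i j
  proof (rule tensor_eqI)
    fix \<Psi> :: "int \<Rightarrow> 'a \<Rightarrow> 'a base" assume \<Psi>: "\<And>l. \<Psi> l \<in> points"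
    note h = alg_hom_family_points[of \<Psi>, OF \<Psi>]
    define \<Theta> where "\<Theta> m = (if m \<ge> 1 then \<Phi> m else \<Psi> (- m))" for m
    have \<Theta>: "\<Theta> m \<in> points" for m using \<Phi> \<Psi> by (simp add: \<Theta>_def)
    note h\<Theta> = alg_hom_family_points[of \<Theta>, OF \<Theta>]
    have cong: "teval P x = teval P' x" if "\<And>l. P l \<in> points" "\<And>l. P' l \<in> points" "x \<in> tensor_sub I" "\<And>l. l \<in> I \<Longrightarrow> P l = P' l" for P P' I x
      by (rule teval_cong_sub[OF alg_hom_family_points[of P, OF that(1)] alg_hom_family_points[of P', OF that(2)] that(3)])
        (simp_all add: that(4) points_simps(3)[OF that(1)] points_simps(3)[OF that(2)])
    have slots: "teval \<Psi> (slot l (map_mat (spec0 \<Phi>) Z $$ (p, c))) = teval \<Theta> (derange (id(0 := - l)) (z p c))"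
      if "l \<ge> 0" "p < n" "c < n" for l p c
    proof -
      have "teval \<Psi> (slot l (map_mat (spec0 \<Phi>) Z $$ (p, c))) = teval (\<Phi>(0 := \<Psi> l)) (z p c)"
        unfolding Xz[OF that(2,3)] teval_slot[OF h] by (rule point_spec0[OF \<Phi> \<Psi>])
      also have "\<dots> = teval (\<lambda>m. \<Theta> ((id(0 := - l)) m)) (z p c)"
        by (rule cong[OF _ _ z_sub[OF that(2,3)]]) (use \<Phi> \<Psi> \<Theta> that(1) in \<open>auto simp: \<Theta>_def\<close>)
      also have "\<dots> = teval \<Theta> (derange (id(0 := - l)) (z p c))" by (rule teval_derange[OF h\<Theta>, symmetric])
      finally show ?thesis .
    qed
    have "teval \<Psi> (abel_map n (map_mat (spec0 \<Phi>) Z) $$ (i, j)) =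
        teval \<Theta> (abelf n (\<lambda>b p c. derange (id(0 := - (int b + 1))) (z p c)) (\<lambda>p c. z p c)
          (\<lambda>p c. derange (id(0 := - (int n + 1))) (z p c)) i j)"
      unfolding abel_map_entry[OF XC ij] comm_ring_hom.hom_abelf[OF comm_ring_hom_teval[OF h]]
        comm_ring_hom.hom_abelf[OF comm_ring_hom_teval[OF h\<Theta>]]
    proof (rule abelf_cong)
      have id0: "id(0 := - 0) = (id :: int \<Rightarrow> int)" by auto
      show "teval \<Psi> (slot 0 (map_mat (spec0 \<Phi>) Z $$ (p, c))) = teval \<Theta> (z p c)" if "p < n" "c < n" for p c
        using slots[of 0 p c] that by (simp only: id0 derange_id order_refl)
    qed (rule slots; simp)+
    also have "\<dots> = teval \<Theta> \<Delta> * teval \<Theta> (derange uminus (z i j))"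
      unfolding abel_identity[OF ij] by (rule teval_mult[OF h\<Theta>])
    also have "teval \<Theta> \<Delta> = teval \<Phi> \<Delta>"
      by (rule cong[OF \<Theta> \<Phi> \<Delta>_sub]) (simp add: \<Theta>_def)
    also have "teval \<Theta> (derange uminus (z i j)) = teval (\<lambda>m. \<Theta> (- m)) (z i j)" by (rule teval_derange[OF h\<Theta>])
    also have "\<dots> = teval \<Psi> (z i j)"
      by (rule cong[OF \<Theta> \<Psi> z_sub[OF ij]]) (auto simp: \<Theta>_def)
    finally show "teval \<Psi> (abel_map n (map_mat (spec0 \<Phi>) Z) $$ (i, j)) = teval \<Psi> (tensor_scalar (teval \<Phi> \<Delta>) * z i j)"
      by (simp only: teval_mult[OF h] teval_scalar[OF h] points_simps(3)[OF \<Psi>])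
  qed
  then show ?thesis
    using ZC by (intro eq_matI) (auto simp: abel_map_def abel_def z_def)
qed

lemma abel_map_surjective:
  assumes L: "module.subspace base_scale L"
  shows "\<exists>X\<in>Segre_matrices n L. \<exists>c. c \<noteq> 0 \<and> abel_map n X = tensor_scalar c \<cdot>\<^sub>m Z"
proof -
  obtain \<Phi> where \<Phi>: "\<And>l. \<Phi> l \<in> points" and nz: "teval \<Phi> \<Delta> \<noteq> 0" using tensor_nonzero[OF \<Delta>_nonzero] by metis
  note h = spec0_family[of \<Phi>, OF \<Phi>]
  let ?X = "map_mat (spec0 \<Phi>) Z"
  have ZC: "Z \<in> carrier_mat n n" using Z by (simp add: Jacobi_matrices_def)
  then have XC: "?X \<in> carrier_mat n n" by simp
  have Xz: "?X $$ (p, c) = spec0 \<Phi> (z p c)" if "p < n" "c < n" for p c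
    using ZC that by (simp add: z_def)
  have r: "rank_le_1 ?X" unfolding rank_le_1_def
  proof (intro allI impI)
    fix i i' j j' assume "i < i'" "i' < dim_row ?X" "j < j'" "j' < dim_col ?X"
    then have lt: "i < n" "i' < n" "j < n" "j' < n" using ZC by auto
    have "spec0 \<Phi> (z i j * z i' j') = spec0 \<Phi> (z i j' * z i' j)" by (simp only: z_rank_one[OF lt(1,3,2,4)])
    then show "?X $$ (i, j) * ?X $$ (i', j') - ?X $$ (i, j') * ?X $$ (i', j) = 0"
      using lt by (simp only: Xz) (simp add: spec0_def teval_mult[OF h])
  qed
  have eq: "abel_map n ?X = tensor_scalar (teval \<Phi> \<Delta>) \<cdot>\<^sub>m Z" by (rule abel_map_spec0[OF \<Phi>])
  have "abel_map n ?X \<noteq> 0\<^sub>m n n"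
  proof
    assume "abel_map n ?X = 0\<^sub>m n n"
    then have "(tensor_scalar (teval \<Phi> \<Delta>) \<cdot>\<^sub>m Z) $$ (0, 0) = 0" using n2 by (simp add: eq[symmetric])
    then have "tensor_scalar (teval \<Phi> \<Delta>) * z 0 0 = 0" using ZC n2 by (simp add: z_def)
    then have "tensor_scalar (teval \<Phi> \<Delta>) = 0" using z_nonzero[of 0 0] n2 by (simp add: tensor_mult_eq_0)
    then show False using tensor_scalar_inverse[OF nz] by simp
  qed
  then have "k_general ?X" by (rule abel_map_nonzero_k_general[OF XC r])
  moreover have "?X $$ (i, j) \<in> L" if "i < n" "j < n" for i j
    unfolding Xz[OF that] by (rule spec0_z[OF \<Phi> L that])
  ultimately have "?X \<in> Segre_matrices n L" using XC r by (simp add: Segre_matrices_def)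
  then show ?thesis using eq nz by blast
qed

end

section \<open>Passage to equivalence classes\<close>

lemma equiv_k_proportionality:
  "equiv (carrier_mat n n :: 'a::k_domain tensor_power mat set) (k_proportionality n)"
proof (rule equivI)
  show "k_proportionality n \<subseteq> carrier_mat n n \<times> carrier_mat n n" by (auto simp: k_proportionality_def)
  show "refl_on (carrier_mat n n) (k_proportionality n :: ('a tensor_power mat \<times> _) set)"
    by (rule refl_onI) (auto simp: k_proportionality_def tensor_scalar_simps intro!: exI[of _ 1])
  show "sym (k_proportionality n :: ('a tensor_power mat \<times> _) set)"
  proof (rule symI)
    fix X Y :: "'a tensor_power mat" assume "(X, Y) \<in> k_proportionality n"
    then obtain c where c: "X \<in> carrier_mat n n" "Y \<in> carrier_mat n n" "c \<noteq> 0" "Y = tensor_scalar c \<cdot>\<^sub>m X"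
      by (auto simp: k_proportionality_def)
    have "X = tensor_scalar (inverse c) \<cdot>\<^sub>m Y"
      unfolding c(4) using c(1) tensor_scalar_inverse[OF c(3)]
      by (intro eq_matI) (auto simp flip: mult.assoc simp: mult.commute[of "tensor_scalar (inverse c)"])
    moreover have "inverse c \<noteq> 0" using c(3) by simp
    ultimately show "(Y, X) \<in> k_proportionality n" using c(1,2) unfolding k_proportionality_def by blast
  qed
  show "trans (k_proportionality n :: ('a tensor_power mat \<times> _) set)"
  proof (rule transI)
    fix X Y V :: "'a tensor_power mat" assume "(X, Y) \<in> k_proportionality n" "(Y, V) \<in> k_proportionality n"
    then obtain c d where c: "X \<in> carrier_mat n n" "V \<in> carrier_mat n n" "c \<noteq> 0" "d \<noteq> 0"
      "V = tensor_scalar d \<cdot>\<^sub>m (tensor_scalar c \<cdot>\<^sub>m X)" by (auto simp: k_proportionality_def)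
    have "V = tensor_scalar (d * c) \<cdot>\<^sub>m X"
      unfolding c(5) by (rule eq_matI) (simp_all only: index_smult_mat tensor_scalar_simps(2) mult.assoc)
    moreover have "d * c \<noteq> 0" using c by simp
    ultimately show "(X, V) \<in> k_proportionality n" using c(1,2) unfolding k_proportionality_def by blast
  qed
qed

lemma equiv_Segre: "equiv (Segre_matrices n L) (Segre_equivalence n L)"
proof (rule equivI)
  have C: "X \<in> carrier_mat n n" if "X \<in> Segre_matrices n L" for X using that by (simp add: Segre_matrices_def)
  show "Segre_equivalence n L \<subseteq> Segre_matrices n L \<times> Segre_matrices n L" by (auto simp: Segre_equivalence_def)
  show "refl_on (Segre_matrices n L) (Segre_equivalence n L)"
    by (rule refl_onI) (auto simp: Segre_equivalence_def intro: k_equivalent_refl C)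
  show "sym (Segre_equivalence n L)"
    by (rule symI) (auto simp: Segre_equivalence_def intro: k_equivalent_sym C)
  show "trans (Segre_equivalence n L)"
    by (rule transI) (auto simp: Segre_equivalence_def intro: k_equivalent_trans C)
qed

lemma (in fg_domain) abel_map_bij_betw:
  assumes n2: "n \<ge> 2" and L: "module.subspace base_scale (L :: 'a set)"
  shows "bij_betw (\<lambda>C. k_proportionality n `` (abel_map n ` C))
    (Segre_matrices n L // Segre_equivalence n L) (Jacobi_matrices n L // k_proportionality n)"
proof -
  let ?f = "\<lambda>C. k_proportionality n `` (abel_map n ` C)"
  let ?P = "k_proportionality n :: ('a tensor_power mat \<times> _) set"
  note eP = equiv_k_proportionality[of n, where 'a = 'a] and eS = equiv_Segre[of n L]
  have L0: "0 \<in> L" by (rule base_vs.subspace_0[OF L])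
  have C: "abel_map n X \<in> carrier_mat n n" for X :: "'a mat" by (simp add: abel_map_def abel_def)
  have XC: "X \<in> carrier_mat n n" "rank_le_1 X" if "X \<in> Segre_matrices n L" for X using that by (auto simp: Segre_matrices_def)
  \<comment> \<open>The image of a class is formed from all its members; it is a single
    proportionality class because equivalent matrices have proportional images.\<close>
  have cls: "?f (Segre_equivalence n L `` {X}) = ?P `` {abel_map n X}" if X: "X \<in> Segre_matrices n L" for X
  proof -
    have "?P `` {abel_map n Y} = ?P `` {abel_map n X}" if "Y \<in> Segre_equivalence n L `` {X}" for Y
    proof -
      have "k_equivalent n X Y" using that by (auto simp: Segre_equivalence_def)
      then have "(abel_map n X, abel_map n Y) \<in> ?P"
        using abel_map_k_equivalent[OF XC[OF X]] C by (auto simp: k_proportionality_def)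
      then show ?thesis using equiv_class_eq[OF eP] by blast
    qed
    moreover have "X \<in> Segre_equivalence n L `` {X}" by (rule equiv_class_self[OF eS X])
    ultimately show ?thesis by blast
  qed
  show ?thesis
    unfolding bij_betw_def
  proof
    show "inj_on ?f (Segre_matrices n L // Segre_equivalence n L)"
    proof (rule inj_onI)
      fix A B assume A: "A \<in> Segre_matrices n L // Segre_equivalence n L" and B: "B \<in> Segre_matrices n L // Segre_equivalence n L"
        and eq: "?f A = ?f B"
      obtain X where X: "X \<in> Segre_matrices n L" "A = Segre_equivalence n L `` {X}" using A by (rule quotientE)
      obtain Y where Y: "Y \<in> Segre_matrices n L" "B = Segre_equivalence n L `` {Y}" using B by (rule quotientE)
      have "?P `` {abel_map n X} = ?P `` {abel_map n Y}" using eq cls X Y by simp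
      then have "(abel_map n X, abel_map n Y) \<in> ?P" using eq_equiv_class_iff[OF eP C C] by blast
      then obtain c where "c \<noteq> 0" "abel_map n Y = tensor_scalar c \<cdot>\<^sub>m abel_map n X" by (auto simp: k_proportionality_def)
      then have "k_equivalent n X Y" using abel_map_injective[OF n2 L0 X(1) Y(1)] by blast
      then have "(X, Y) \<in> Segre_equivalence n L" using X Y by (simp add: Segre_equivalence_def)
      then show "A = B" unfolding X(2) Y(2) by (rule equiv_class_eq[OF eS])
    qed
    show "?f ` (Segre_matrices n L // Segre_equivalence n L) = Jacobi_matrices n L // ?P"
    proof (intro equalityI subsetI)
      fix D assume "D \<in> ?f ` (Segre_matrices n L // Segre_equivalence n L)"
      then obtain X where X: "X \<in> Segre_matrices n L" and D: "D = ?P `` {abel_map n X}" using cls by (auto elim!: quotientE)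
      interpret segre type_of_A n L X by unfold_locales (use n2 L0 X in auto)
      show "D \<in> Jacobi_matrices n L // ?P" unfolding D by (rule quotientI[OF abel_map_Jacobi])
    next
      fix D assume "D \<in> Jacobi_matrices n L // ?P"
      then obtain Z where Z: "Z \<in> Jacobi_matrices n L" and D: "D = ?P `` {Z}" by (rule quotientE)
      interpret jacobi type_of_A n L Z by unfold_locales (use n2 Z in auto)
      obtain X c where X: "X \<in> Segre_matrices n L" and "c \<noteq> 0" "abel_map n X = tensor_scalar c \<cdot>\<^sub>m Z"
        using abel_map_surjective[OF L] by blast
      then have "(Z, abel_map n X) \<in> ?P" using C[of X] \<open>Z \<in> Jacobi_matrices n L\<close> by (auto simp: k_proportionality_def Jacobi_matrices_def)
      then have "D = ?f (Segre_equivalence n L `` {X})" unfolding D cls[OF X] by (rule equiv_class_eq[OF eP])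
      then show "D \<in> ?f ` (Segre_matrices n L // Segre_equivalence n L)" using quotientI[OF X] by blast
    qed
  qed
qed

section \<open>The projective variety\<close>

text \<open>Homogeneous polynomial maps of degree \<open>d\<close> from coordinates to tensors: sums
  of monomials times fixed tensors. The zero map belongs to every degree, as befits a sum without
  terms.\<close>

inductive hom_map :: "nat \<Rightarrow> nat \<Rightarrow> ((nat \<Rightarrow> 'a::k_domain base) \<Rightarrow> 'a tensor_power) \<Rightarrow> bool" for N where
  hom_map_0: "hom_map N d (\<lambda>_. 0)"
| hom_map_monomial: "Poly_Mapping.keys m \<subseteq> {..N} \<Longrightarrow> (\<Sum>i\<le>N. Poly_Mapping.lookup m i) = d \<Longrightarrow>
    hom_map N d (\<lambda>c. tensor_scale (\<Prod>i\<le>N. c i ^ Poly_Mapping.lookup m i) w)"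
| hom_map_add: "hom_map N d f \<Longrightarrow> hom_map N d g \<Longrightarrow> hom_map N d (\<lambda>c. f c + g c)"

lemma hom_map_mult_monomial:
  assumes m: "Poly_Mapping.keys m \<subseteq> {..N}" "(\<Sum>i\<le>N. Poly_Mapping.lookup m i) = d" and g: "hom_map N e g"
  shows "hom_map N (d + e) (\<lambda>c. tensor_scale (\<Prod>i\<le>N. c i ^ Poly_Mapping.lookup m i) w * g c)"
  using g
proof induction
  case (hom_map_monomial m' e w')
  have "hom_map N (d + e) (\<lambda>c. tensor_scale (\<Prod>i\<le>N. c i ^ Poly_Mapping.lookup (m + m') i) (w * w'))"
    by (rule hom_map.hom_map_monomial)
      (use m hom_map_monomial Poly_Mapping.keys_add[of m m'] in \<open>auto simp: lookup_add sum.distrib\<close>)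
  also have "(\<lambda>c. tensor_scale (\<Prod>i\<le>N. c i ^ Poly_Mapping.lookup (m + m') i) (w * w')) =
      (\<lambda>c. tensor_scale (\<Prod>i\<le>N. c i ^ Poly_Mapping.lookup m i) w *
        tensor_scale (\<Prod>i\<le>N. c i ^ Poly_Mapping.lookup m' i) w')"
    unfolding lookup_add power_add prod.distrib tensor_scalar_simps(2) by (simp only: mult_ac)
  finally show ?case .
qed (auto simp: distrib_left intro: hom_map_0 hom_map_add)

lemma hom_map_mult: "hom_map N d f \<Longrightarrow> hom_map N e g \<Longrightarrow> hom_map N (d + e) (\<lambda>c. f c * g c)"
  by (induction rule: hom_map.induct)
    (auto simp: distrib_right intro: hom_map_0 hom_map_add hom_map_mult_monomial)

lemma hom_map_const: "hom_map N 0 (\<lambda>_. w)"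
  using hom_map_monomial[of 0 N 0 w] by (simp add: tensor_scalar_simps)

lemma hom_map_cmult: "hom_map N d f \<Longrightarrow> hom_map N d (\<lambda>c. w * f c)"
  using hom_map_mult[OF hom_map_const] by (metis add_0)

lemma hom_map_diff: "hom_map N d f \<Longrightarrow> hom_map N d g \<Longrightarrow> hom_map N d (\<lambda>c. f c - g c)"
  using hom_map_add[OF _ hom_map_cmult[of N d g "- 1"], of f] by simp

lemma hom_map_sum: "(\<And>i. i \<in> S \<Longrightarrow> hom_map N d (f i)) \<Longrightarrow> hom_map N d (\<lambda>c. \<Sum>i\<in>S. f i c)"
  by (induction S rule: infinite_finite_induct) (auto intro: hom_map_0 hom_map_add)

lemma hom_map_prod: "finite S \<Longrightarrow> (\<And>i. i \<in> S \<Longrightarrow> hom_map N (d i) (f i)) \<Longrightarrow>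
    hom_map N (\<Sum>i\<in>S. d i) (\<lambda>c. \<Prod>i\<in>S. f i c)"
  by (induction S rule: finite_induct) (auto intro: hom_map_const hom_map_mult)

lemma derange_scale: "derange \<sigma> (tensor_scale c x) = tensor_scale c (derange \<sigma> x)"
  by (simp only: derange_hom is_alg_endoD(3)[OF is_alg_endo_derange])

lemma hom_map_derange: "hom_map N d f \<Longrightarrow> hom_map N d (\<lambda>c. derange \<sigma> (f c))"
  by (induction rule: hom_map.induct)
    (auto simp: derange_hom(1,3) derange_scale intro: hom_map_0 hom_map_add hom_map_monomial)

lemma hom_map_variable:
  assumes "l \<le> N"
  shows "hom_map N 1 (\<lambda>c. tensor_scale (c l) w)"
proof -
  have "(\<Prod>i\<le>N. c i ^ Poly_Mapping.lookup (Poly_Mapping.single l 1) i) = c l" for c :: "nat \<Rightarrow> 'a base"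
  proof -
    have "(\<Prod>i\<le>N. c i ^ Poly_Mapping.lookup (Poly_Mapping.single l 1) i) = (\<Prod>i\<le>N. if i = l then c l else 1)"
      by (rule prod.cong) (auto simp: lookup_single when_def)
    then show ?thesis using assms by simp
  qed
  moreover have "(\<Sum>i\<le>N. Poly_Mapping.lookup (Poly_Mapping.single l (1::nat)) i) = 1"
    using assms by (simp add: lookup_single when_def)
  ultimately show ?thesis using hom_map_monomial[of "Poly_Mapping.single l 1" N 1 w] assms by simp
qed

lemma mpoly_eval_superset:
  assumes "finite S" "Poly_Mapping.keys f \<subseteq> S"
  shows "mpoly_eval c f = (\<Sum>m\<in>S. Poly_Mapping.lookup f m *
    (\<Prod>i\<in>Poly_Mapping.keys m. c i ^ Poly_Mapping.lookup m i))"
  unfolding mpoly_eval_def by (rule sum.mono_neutral_left) (use assms in \<open>auto simp: in_keys_iff\<close>)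

lemma mpoly_eval_add: "mpoly_eval c (f + g) = mpoly_eval c f + mpoly_eval c g"
  using Poly_Mapping.keys_add[of f g]
  by (subst (1 2 3) mpoly_eval_superset[of "Poly_Mapping.keys f \<union> Poly_Mapping.keys g"])
    (auto simp: lookup_add algebra_simps sum.distrib)

text \<open>A point applied to the tensor coefficients leaves an ordinary homogeneous polynomial
  over \<open>k\<close>.\<close>

lemma hom_map_mpoly:
  assumes h: "alg_hom_family \<Phi>" and \<Phi>: "\<And>c. \<Phi> 0 (of_base c) = c" and f: "hom_map N d f"
  shows "\<exists>p. homogeneous_mpoly N p \<and> (\<forall>c. mpoly_eval c p = teval \<Phi> (f c))"
proof -
  have "\<exists>p. (\<forall>m\<in>Poly_Mapping.keys p. Poly_Mapping.keys m \<subseteq> {..N} \<and>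
      (\<Sum>i\<in>Poly_Mapping.keys m. Poly_Mapping.lookup m i) = d) \<and> (\<forall>c. mpoly_eval c p = teval \<Phi> (f c))"
    using f
  proof induction
    case (hom_map_0 d)
    show ?case by (rule exI[of _ 0]) (simp add: mpoly_eval_def teval_0[OF h])
  next
    case (hom_map_monomial m d w)
    have "(\<Sum>i\<in>Poly_Mapping.keys m. Poly_Mapping.lookup m i) = (\<Sum>i\<le>N. Poly_Mapping.lookup m i)"
      by (rule sum.mono_neutral_left) (use hom_map_monomial in \<open>auto simp: in_keys_iff\<close>)
    moreover have "(\<Prod>i\<in>Poly_Mapping.keys m. c i ^ Poly_Mapping.lookup m i) = (\<Prod>i\<le>N. c i ^ Poly_Mapping.lookup m i)"
      for c :: "nat \<Rightarrow> 'a base"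
      by (rule prod.mono_neutral_left) (use hom_map_monomial in \<open>auto simp: in_keys_iff\<close>)
    ultimately show ?case using hom_map_monomial
      by (intro exI[of _ "Poly_Mapping.single m (teval \<Phi> w)"])
        (auto simp: mpoly_eval_def teval_mult[OF h] teval_scalar[OF h] \<Phi> mult.commute)
  next
    case (hom_map_add d f g)
    then obtain p q where "\<forall>m\<in>Poly_Mapping.keys p. Poly_Mapping.keys m \<subseteq> {..N} \<and>
        (\<Sum>i\<in>Poly_Mapping.keys m. Poly_Mapping.lookup m i) = d" "\<forall>c. mpoly_eval c p = teval \<Phi> (f c)"
      and "\<forall>m\<in>Poly_Mapping.keys q. Poly_Mapping.keys m \<subseteq> {..N} \<and>
        (\<Sum>i\<in>Poly_Mapping.keys m. Poly_Mapping.lookup m i) = d" "\<forall>c. mpoly_eval c q = teval \<Phi> (g c)" by blast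
    moreover have "m \<in> Poly_Mapping.keys p \<or> m \<in> Poly_Mapping.keys q" if "m \<in> Poly_Mapping.keys (p + q)" for m
      using that Poly_Mapping.keys_add[of p q] by blast
    ultimately show ?case
      by (intro exI[of _ "p + q"]) (metis mpoly_eval_add teval_add[OF h])
  qed
  then show ?thesis unfolding homogeneous_mpoly_def by blast
qed

lemma hom_map_mixed_det:
  assumes "\<And>b r k. b < n \<Longrightarrow> r < n \<Longrightarrow> k < n \<Longrightarrow> hom_map N 1 (\<lambda>c. Y c b r k)"
  shows "hom_map N n (\<lambda>c. mixed_det n (Y c))"
proof -
  have "hom_map N (\<Sum>r = 0..<n. 1) (\<lambda>c. \<Prod>r = 0..<n. Y c (\<tau> r) r (\<sigma> r))"
    if "\<tau> permutes {0..<n}" "\<sigma> permutes {0..<n}" for \<tau> \<sigma>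
    by (rule hom_map_prod) (use assms permutes_lt[OF that(1)] permutes_lt[OF that(2)] in auto)
  then show ?thesis unfolding mixed_det_def by (intro hom_map_sum hom_map_cmult) simp
qed

lemma hom_map_abelf:
  assumes "\<And>b r k. b < n \<Longrightarrow> r < n \<Longrightarrow> k < n \<Longrightarrow> hom_map N 1 (\<lambda>c. Y c b r k)"
    "\<And>r k. r < n \<Longrightarrow> k < n \<Longrightarrow> hom_map N 1 (\<lambda>c. P c r k)" "\<And>r k. r < n \<Longrightarrow> k < n \<Longrightarrow> hom_map N 1 (\<lambda>c. Q c r k)"
  shows "hom_map N (n + n) (\<lambda>c. abelf n (Y c) (P c) (Q c) i j)"
proof -
  have row: "hom_map N 1 (\<lambda>c. ((Y c)(j := unit_row r (R c))) b s k)"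
    if "b < n" "s < n" "k < n" "\<And>k. k < n \<Longrightarrow> hom_map N 1 (\<lambda>c. R c k)" for j r R b s k
    using assms(1)[OF that(1-3)] that by (cases "b = j"; cases "s = r") (auto simp: unit_row_def intro: hom_map_0)
  show ?thesis unfolding abelf_def
    by (intro hom_map_sum hom_map_mult hom_map_mixed_det row assms(2,3)) auto
qed

text \<open>Three factors of degree 1 and n-2 squares. With the barred entry the degree becomes 2n,
  the same as that of the abeliant, so the Abel identity is homogeneous.\<close>

lemma hom_map_Jacobi_factor:
  assumes n2: "n \<ge> 2" and Z: "\<And>i. i < n \<Longrightarrow> hom_map N 1 (\<lambda>c. Z c $$ (i, i))"
  shows "hom_map N (n + n - 1) (\<lambda>c. Jacobi_factor n (Z c))"
proof -
  have "hom_map N (1 + 1 + 1 + (\<Sum>l = 2..<n. 1 + 1)) (\<lambda>c. Jacobi_factor n (Z c))"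
    unfolding Jacobi_factor_eq power2_eq_square
    by (intro hom_map_mult hom_map_prod hom_map_derange) (use n2 Z in auto)
  moreover have "1 + 1 + 1 + (\<Sum>l = 2..<n. 1 + 1) = n + n - 1" using n2 by simp
  ultimately show ?thesis by (simp only:)
qed

text \<open>By the linear conditions, a Jacobi matrix is determined by its entry \<open>Z\<^sub>1\<^sub>2\<close>: every other
  entry arises from it by a derangement.\<close>

definition spread :: "nat \<Rightarrow> nat \<Rightarrow> nat \<Rightarrow> int \<Rightarrow> int"
  where "spread n i j = (if i = j then lift_perm n (transpose 0 i) \<circ> id(1 := 2)
    else lift_perm n (SOME \<pi>. \<pi> permutes {0..<n} \<and> \<pi> 0 = i \<and> \<pi> (Suc 0) = j))"

definition spread_mat :: "nat \<Rightarrow> 'a::k_domain tensor_power \<Rightarrow> 'a tensor_power mat"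
  where "spread_mat n x = mat n n (\<lambda>(i, j). derange (spread n i j) x)"

text \<open>The conditions linear in \<open>Z\<close>, expressed for \<open>x = Z_12\<close>. Since
  \<open>spread\<close> involves a choice of permutation, consistency is demanded explicitly: the
  corresponding entry of the spread matrix is \<open>x\<close> itself, and permutations act as
  prescribed.\<close>

definition linear_Jacobi_space :: "nat \<Rightarrow> 'a::k_domain set \<Rightarrow> 'a tensor_power set"
  where "linear_Jacobi_space n L = {x \<in> Jacobi_space n L.
    (\<forall>i<n. \<forall>j<n. derange (spread n i j) x \<in> tensor_sub {0..int n + 1}) \<and>
    derange (spread n 0 1) x = x \<and> derange (spread n 0 0) x = derange (id(1 := 2)) x \<and>
    (\<forall>\<pi>. \<pi> permutes {1..int n} \<longrightarrow> (\<forall>i<n. \<forall>j<n. derange \<pi> (derange (spread n i j) x) =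
      derange (spread n (nat (\<pi> (int i + 1) - 1)) (nat (\<pi> (int j + 1) - 1))) x))}"

definition minor_defect :: "nat \<Rightarrow> 'a::k_domain tensor_power \<Rightarrow> 'a tensor_power"
  where "minor_defect n x = derange (spread n 0 0) x * derange (spread n 1 1) x -
    derange (spread n 0 1) x * derange (spread n 1 0) x"

definition abel_defect :: "nat \<Rightarrow> nat \<Rightarrow> nat \<Rightarrow> 'a::k_domain tensor_power \<Rightarrow> 'a tensor_power"
  where "abel_defect n i j x =
    abelf n (\<lambda>b p c. derange (id(0 := - (int b + 1))) (derange (spread n p c) x)) (\<lambda>p c. derange (spread n p c) x)
      (\<lambda>p c. derange (id(0 := - (int n + 1))) (derange (spread n p c) x)) i j -
    Jacobi_factor n (spread_mat n x) * derange uminus (derange (spread n i j) x)"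

lemma ent_spread_mat: "i \<in> {1..int n} \<Longrightarrow> j \<in> {1..int n} \<Longrightarrow>
    ent (spread_mat n x) i j = derange (spread n (nat (i - 1)) (nat (j - 1))) x"
  unfolding ent_def spread_mat_def by (subst index_mat) auto

lemma abel_identity_iff:
  "abel n (\<lambda>l. map_mat (derange (id(0 := - int l))) (spread_mat n x)) =
      Jacobi_factor n (spread_mat n x) \<cdot>\<^sub>m bar_mat (spread_mat n x) \<longleftrightarrow>
    (\<forall>i<n. \<forall>j<n. abel_defect n i j x = 0)" (is "?A = ?B \<longleftrightarrow> _")
proof -
  have C: "spread_mat n x \<in> carrier_mat n n" by (simp add: spread_mat_def)
  have A: "?A \<in> carrier_mat n n" by (simp add: abel_def)
  have B: "?B \<in> carrier_mat n n" using C by (simp add: bar_mat_def)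
  have "?A $$ (i, j) - ?B $$ (i, j) = abel_defect n i j x" if ij: "i < n" "j < n" for i j
  proof -
    have id0: "id(0 := 0) = (id :: int \<Rightarrow> int)" by auto
    have "?A $$ (i, j) = abelf n (\<lambda>b p c. derange (id(0 := - (int b + 1))) (derange (spread n p c) x))
        (\<lambda>p c. derange (spread n p c) x) (\<lambda>p c. derange (id(0 := - (int n + 1))) (derange (spread n p c) x)) i j"
      by (subst abel_entry[OF _ ij]) (use C in \<open>auto intro!: abelf_cong simp: spread_mat_def id0 derange_id algebra_simps\<close>)
    moreover have "?B $$ (i, j) = Jacobi_factor n (spread_mat n x) * derange uminus (derange (spread n i j) x)"
      using ij by (simp add: bar_mat_def spread_mat_def)
    ultimately show ?thesis by (simp only: abel_defect_def)
  qed
  then have "?A $$ (i, j) = ?B $$ (i, j) \<longleftrightarrow> abel_defect n i j x = 0" if "i < n" "j < n" for i j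
    using that by (metis right_minus_eq)
  moreover have "M = M' \<longleftrightarrow> (\<forall>i<n. \<forall>j<n. M $$ (i, j) = M' $$ (i, j))"
    if "M \<in> carrier_mat n n" "M' \<in> carrier_mat n n" for M M' :: "'a tensor_power mat"
    using that by (auto simp: mat_eq_iff)
  ultimately show ?thesis using A B by metis
qed

lemma (in jacobi) spread_mat_z: "Z = spread_mat n (z 0 1)"
proof (rule eq_matI)
  have n0: "0 < n" "Suc 0 < n" using n2 by auto
  fix i j assume "i < dim_row (spread_mat n (z 0 1))" "j < dim_col (spread_mat n (z 0 1))"
  then have ij: "i < n" "j < n" by (auto simp: spread_mat_def)
  have "z i j = derange (spread n i j) (z 0 1)"
  proof (cases "i = j")
    case True
    define \<pi> where "\<pi> = transpose 0 i"
    have \<pi>: "\<pi> permutes {0..<n}" "\<pi> 0 = i" unfolding \<pi>_def using ij n0 by (auto intro: permutes_swap_id)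
    have "derange (spread n i j) (z 0 1) = derange (lift_perm n \<pi>) (z 0 0)"
      unfolding z00 derange_comp by (simp add: spread_def True \<pi>_def)
    then show ?thesis unfolding z_perm[OF \<pi>(1) n0(1) n0(1)] using \<pi> True by simp
  next
    case False
    define \<pi> where "\<pi> = (SOME \<pi>. \<pi> permutes {0..<n} \<and> \<pi> 0 = i \<and> \<pi> (Suc 0) = j)"
    have "\<exists>\<pi>. \<pi> permutes {0..<n} \<and> \<pi> 0 = i \<and> \<pi> (Suc 0) = j" using permutes_two[OF False ij] by metis
    then have \<pi>: "\<pi> permutes {0..<n} \<and> \<pi> 0 = i \<and> \<pi> (Suc 0) = j" unfolding \<pi>_def by (rule someI_ex)
    have "derange (spread n i j) (z 0 1) = derange (lift_perm n \<pi>) (z 0 (Suc 0))"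
      using False by (simp add: spread_def \<pi>_def)
    then show ?thesis using z_perm[of \<pi> 0 "Suc 0"] \<pi> n0 by simp
  qed
  then show "Z $$ (i, j) = spread_mat n (z 0 1) $$ (i, j)" using ij by (simp add: spread_mat_def z_def)
qed (use Z in \<open>auto simp: spread_mat_def Jacobi_matrices_def\<close>)

context fg_domain
begin

text \<open>Separates the linear conditions, which determine the ambient projective space, from the
  two homogeneous ones, which become its equations.\<close>

lemma Jacobi_matrices_iff:
  fixes L :: "'a set"
  assumes n2: "n \<ge> 2"
  shows "Z \<in> Jacobi_matrices n L \<longleftrightarrow> (\<exists>x\<in>linear_Jacobi_space n L. x \<noteq> 0 \<and> Z = spread_mat n x \<and>
    minor_defect n x = 0 \<and> (\<forall>i<n. \<forall>j<n. abel_defect n i j x = 0))" (is "_ \<longleftrightarrow> ?R")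
proof
  assume Z: "Z \<in> Jacobi_matrices n L"
  interpret jacobi type_of_A n L Z by unfold_locales (use n2 Z in auto)
  define x where "x = z 0 1"
  have eq: "Z = spread_mat n x" unfolding x_def by (rule spread_mat_z)
  have e: "ent Z i j = derange (spread n (nat (i - 1)) (nat (j - 1))) x" if "i \<in> {1..int n}" "j \<in> {1..int n}" for i j
    unfolding eq by (rule ent_spread_mat[OF that])
  have e': "derange (spread n i j) x = ent Z (int i + 1) (int j + 1)" if "i < n" "j < n" for i j
    using e[of "int i + 1" "int j + 1"] that by simp
  have ec: "derange (spread n 0 0) x = ent Z 1 1" "derange (spread n 0 1) x = ent Z 1 2"
    "derange (spread n 1 0) x = ent Z 2 1" "derange (spread n 1 1) x = ent Z 2 2"
    using e'[of 0 0] e'[of 0 1] e'[of 1 0] e'[of 1 1] n2 by simp_all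
  have x12: "ent Z 1 2 = x" by (simp add: ent_z_const x_def)
  have J: "\<forall>i\<in>{1..int n}. \<forall>j\<in>{1..int n}. ent Z i j \<in> tensor_sub {0..int n + 1}"
    "ent Z 1 2 \<in> Jacobi_space n L" "ent Z 1 1 = derange (id(1 := 2)) (ent Z 1 2)"
    "\<forall>\<pi>. \<pi> permutes {1..int n} \<longrightarrow>
      (\<forall>i\<in>{1..int n}. \<forall>j\<in>{1..int n}. derange \<pi> (ent Z i j) = ent Z (\<pi> i) (\<pi> j))"
    "ent Z 1 1 * ent Z 2 2 - ent Z 1 2 * ent Z 2 1 = 0"
    "abel n (\<lambda>l. map_mat (derange (id(0 := - int l))) Z) = Jacobi_factor n Z \<cdot>\<^sub>m bar_mat Z"
    using Z unfolding Jacobi_matrices_def mem_Collect_eq by - (elim conjE, assumption)+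
  have "derange \<pi> (derange (spread n i j) x) =
      derange (spread n (nat (\<pi> (int i + 1) - 1)) (nat (\<pi> (int j + 1) - 1))) x"
    if \<pi>: "\<pi> permutes {1..int n}" and ij: "i < n" "j < n" for \<pi> i j
  proof -
    have mem: "int i + 1 \<in> {1..int n}" "int j + 1 \<in> {1..int n}" using ij by auto
    then have mem': "\<pi> (int i + 1) \<in> {1..int n}" "\<pi> (int j + 1) \<in> {1..int n}"
      unfolding permutes_in_image[OF \<pi>] .
    show ?thesis using J(4) \<pi> mem unfolding e'[OF ij] e[OF mem', symmetric] by blast
  qed
  moreover have "derange (spread n i j) x \<in> tensor_sub {0..int n + 1}" if "i < n" "j < n" for i j
    unfolding e'[OF that] using J(1) that by simp
  ultimately have "x \<in> linear_Jacobi_space n L"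
    unfolding linear_Jacobi_space_def mem_Collect_eq ec x12 using J(2,3) x12 by simp
  moreover have "x \<noteq> 0" unfolding x_def using z_nonzero[of 0 1] n2 by simp
  moreover have "minor_defect n x = 0" unfolding minor_defect_def ec by (rule J(5))
  moreover have "\<forall>i<n. \<forall>j<n. abel_defect n i j x = 0" using J(6) unfolding eq abel_identity_iff .
  ultimately show ?R using eq by blast
next
  assume ?R
  then obtain x where x: "x \<in> linear_Jacobi_space n L" "x \<noteq> 0" "Z = spread_mat n x"
    "minor_defect n x = 0" "\<forall>i<n. \<forall>j<n. abel_defect n i j x = 0" by blast
  have V: "x \<in> Jacobi_space n L" "\<forall>i<n. \<forall>j<n. derange (spread n i j) x \<in> tensor_sub {0..int n + 1}"
    "derange (spread n 0 1) x = x" "derange (spread n 0 0) x = derange (id(1 := 2)) x"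
    "\<forall>\<pi>. \<pi> permutes {1..int n} \<longrightarrow> (\<forall>i<n. \<forall>j<n. derange \<pi> (derange (spread n i j) x) =
      derange (spread n (nat (\<pi> (int i + 1) - 1)) (nat (\<pi> (int j + 1) - 1))) x)"
    using x(1) unfolding linear_Jacobi_space_def mem_Collect_eq by - (elim conjE, assumption)+
  have e: "ent Z i j = derange (spread n (nat (i - 1)) (nat (j - 1))) x" if "i \<in> {1..int n}" "j \<in> {1..int n}" for i j
    unfolding x(3) by (rule ent_spread_mat[OF that])
  have ec: "ent Z 1 1 = derange (spread n 0 0) x" "ent Z 1 2 = derange (spread n 0 1) x"
    "ent Z 2 1 = derange (spread n 1 0) x" "ent Z 2 2 = derange (spread n 1 1) x"
    using n2 by (simp_all add: e)
  have "Z \<noteq> 0\<^sub>m n n"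
  proof
    assume "Z = 0\<^sub>m n n"
    then have "ent Z 1 2 = 0" using n2 by (simp add: ent_def)
    then show False using ec(2) V(3) x(2) by simp
  qed
  moreover have "derange \<pi> (ent Z i j) = ent Z (\<pi> i) (\<pi> j)"
    if \<pi>: "\<pi> permutes {1..int n}" and ij: "i \<in> {1..int n}" "j \<in> {1..int n}" for \<pi> i j
  proof -
    have mem': "\<pi> i \<in> {1..int n}" "\<pi> j \<in> {1..int n}" using ij unfolding permutes_in_image[OF \<pi>] .
    have "nat (i - 1) < n" "nat (j - 1) < n" using ij by auto
    then have "derange \<pi> (derange (spread n (nat (i - 1)) (nat (j - 1))) x) =
        derange (spread n (nat (\<pi> (int (nat (i - 1)) + 1) - 1)) (nat (\<pi> (int (nat (j - 1)) + 1) - 1))) x"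
      using V(5) \<pi> by blast
    moreover have "int (nat (i - 1)) + 1 = i" "int (nat (j - 1)) + 1 = j" using ij by auto
    ultimately show ?thesis unfolding e[OF ij] e[OF mem'] by simp
  qed
  moreover have "ent Z i j \<in> tensor_sub {0..int n + 1}" if ij: "i \<in> {1..int n}" "j \<in> {1..int n}" for i j
  proof -
    have "nat (i - 1) < n" "nat (j - 1) < n" using ij by auto
    then show ?thesis unfolding e[OF ij] using V(2) by blast
  qed
  moreover have "ent Z 1 2 \<in> Jacobi_space n L" "ent Z 1 1 = derange (id(1 := 2)) (ent Z 1 2)"
    unfolding ec V(3) using V by simp_all
  moreover have "ent Z 1 1 * ent Z 2 2 - ent Z 1 2 * ent Z 2 1 = 0" using x(4) unfolding minor_defect_def ec .
  moreover have "abel n (\<lambda>l. map_mat (derange (id(0 := - int l))) Z) = Jacobi_factor n Z \<cdot>\<^sub>m bar_mat Z"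
    unfolding x(3) abel_identity_iff by (rule x(5))
  moreover have "Z \<in> carrier_mat n n" by (simp add: x(3) spread_mat_def)
  ultimately show "Z \<in> Jacobi_matrices n L" unfolding Jacobi_matrices_def by blast
qed

end

lemma tensor_sub_scale: "x \<in> tensor_sub I \<Longrightarrow> tensor_scale c x \<in> tensor_sub I"
  by (rule tensor_sub_mult) (auto simp: tensor_sub_def intro: subring_generated.incl)

lemma subspace_linear_Jacobi_space: "tensor_vs.subspace (linear_Jacobi_space n L)"
proof -
  have J: "tensor_vs.subspace (Jacobi_space n L)" unfolding Jacobi_space_def by (rule tensor_vs.subspace_span)
  show ?thesis
  proof (rule tensor_vs.subspaceI)
    show "0 \<in> linear_Jacobi_space n L"
      using tensor_vs.subspace_0[OF J] by (simp add: linear_Jacobi_space_def derange_hom tensor_sub_0)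
    show "x + y \<in> linear_Jacobi_space n L" if "x \<in> linear_Jacobi_space n L" "y \<in> linear_Jacobi_space n L" for x y
      using tensor_vs.subspace_add[OF J, of x y] that
      by (simp add: linear_Jacobi_space_def derange_hom(1) tensor_sub_add)
    show "tensor_scale c x \<in> linear_Jacobi_space n L" if "x \<in> linear_Jacobi_space n L" for c x
      using tensor_vs.subspace_scale[OF J, of x c] that
      by (simp add: linear_Jacobi_space_def derange_scale tensor_sub_scale)
  qed
qed

text \<open>Containment in the span of a finite set passes to elementwise products of sets, by
  \<open>span_mult\<close>.\<close>

lemma finite_span_Jacobi_space:
  assumes B: "finite B" "base_vs.span B = L"
  shows "\<exists>T. finite T \<and> Jacobi_space n L \<subseteq> tensor_vs.span T"
proof -
  define fd where "fd S \<longleftrightarrow> (\<exists>T. finite T \<and> S \<subseteq> tensor_vs.span T)" for S :: "'a tensor_power set"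
  have mult: "fd (S * S')" if "fd S" "fd S'" for S S'
  proof -
    obtain T T' where "finite T" "S \<subseteq> tensor_vs.span T" "finite T'" "S' \<subseteq> tensor_vs.span T'"
      using \<open>fd S\<close> \<open>fd S'\<close> unfolding fd_def by blast
    then have "finite (T * T')" "S * S' \<subseteq> tensor_vs.span (T * T')"
      by (auto simp: finite_set_times elim!: set_times_elim intro: span_mult)
    then show ?thesis unfolding fd_def by blast
  qed
  have slot: "fd (slot l ` L)" for l
  proof -
    have "slot l a \<in> tensor_vs.span (slot l ` B)" if "a \<in> L" for a
      using that unfolding B(2)[symmetric]
    proof (induction rule: base_vs.span_induct)
      case base
      show ?case
      proof (rule base_vs.subspaceI; unfold mem_Collect_eq)
        have "slot l 0 = tensor_scalar (0 :: 'a base)" using slot_simps(4)[of l "0 :: 'a base"] by simp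
        then show "slot l 0 \<in> tensor_vs.span (slot l ` B)" by (simp add: tensor_scalar_0 tensor_vs.span_zero)
      qed (simp_all add: slot_simps tensor_vs.span_add tensor_vs.span_scale)
    qed (auto intro: tensor_vs.span_base)
    then show ?thesis unfolding fd_def using B(1) by blast
  qed
  have one: "fd 1" unfolding fd_def by (intro exI[of _ "{1}"]) (auto intro: tensor_vs.span_base)
  have prod: "fd (\<Prod>l\<in>I. S l)" if "\<And>l. fd (S l)" for I :: "int set" and S
    by (induction I rule: infinite_finite_induct) (use one mult that in auto)
  have "fd (slot 0 ` L * slot 1 ` L * slot 2 ` L * (\<Prod>l = 3..int n. (slot l ` L)\<^sup>2) * slot (int n + 1) ` L)"
    unfolding power2_eq_square by (intro mult prod slot)
  then show ?thesis unfolding fd_def Jacobi_space_def using tensor_vs.span_minimal[OF _ tensor_vs.subspace_span] by blast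
qed

lemma tensor_scalar_eq_0: "tensor_scalar c = 0 \<longleftrightarrow> c = 0"
  using tensor_scalar_inverse[of c] tensor_scalar_0 by (metis mult_zero_left zero_neq_one)

lemma quotient_parametrized:
  assumes "\<And>x. x \<in> A \<longleftrightarrow> (\<exists>c. x = f c \<and> P c)"
  shows "A // r = {r `` {f c} |c. P c}"
proof -
  have "A = {f c |c. P c}" using assms by blast
  then show ?thesis unfolding quotient_def by blast
qed

text \<open>The ambient projective space has at least one coordinate, so a zero space of candidates
  needs its own model: a single point, with the coordinate itself as equation.\<close>

lemma is_projective_variety_empty:
  assumes "0 < n"
  shows "is_projective_variety n ({} :: 'a::k_domain tensor_power mat set set)"
proof -
  let ?B = "\<lambda>_::nat. mat n n (\<lambda>_. 1 :: 'a tensor_power)" and ?p = "Poly_Mapping.single (Poly_Mapping.single (0::nat) (1::nat)) (1 :: 'a base)"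
  have "c 0 = 0" if "mat_combination n 0 ?B c = 0\<^sub>m n n" for c
  proof -
    have "mat_combination n 0 ?B c $$ (0, 0) = 0" using that assms by simp
    then show ?thesis using assms by (simp add: mat_combination_def tensor_scalar_eq_0)
  qed
  moreover have "mpoly_eval c ?p = c 0" for c by (simp add: mpoly_eval_def)
  moreover have "homogeneous_mpoly 0 ?p" by (simp add: homogeneous_mpoly_def)
  ultimately show ?thesis unfolding is_projective_variety_def
    by (intro exI[of _ 0] exI[of _ ?B] exI[of _ "{?p}"]) auto
qed

context fg_domain
begin

lemma Jacobi_projective_variety:
  fixes L :: "'a set"
  assumes n2: "n \<ge> 2" and L: "finite B" "base_vs.span B = L"
  shows "is_projective_variety n (Jacobi_matrices n L // k_proportionality n)"
proof -
  let ?V = "linear_Jacobi_space n L"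
  obtain T where T: "finite T" "Jacobi_space n L \<subseteq> tensor_vs.span T" using finite_span_Jacobi_space[OF L] by blast
  obtain E where E: "E \<subseteq> ?V" "tensor_vs.independent E" "?V \<subseteq> tensor_vs.span E"
    using tensor_vs.maximal_independent_subset[of ?V] by blast
  have "E \<subseteq> tensor_vs.span T" using E(1) T(2) unfolding linear_Jacobi_space_def by blast
  then have finE: "finite E" using tensor_vs.independent_span_bound[OF T(1) E(2)] by blast
  show ?thesis
  proof (cases "E = {}")
    case True
    then have "x = 0" if "x \<in> ?V" for x using E(3) that by auto
    then have "Jacobi_matrices n L = {}" unfolding set_eq_iff Jacobi_matrices_iff[OF n2] by blast
    then show ?thesis using is_projective_variety_empty[of n] n2 by (simp add: quotient_def)
  next
    case False
    \<comment> \<open>Coordinates are numbered 0 to \<open>N\<close>, so \<open>N\<close> is one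
      less than the dimension.\<close>
    define N where "N = card E - 1"
    have "card E > 0" using False finE by (simp add: card_gt_0_iff)
    then have N: "{0..<card E} = {..N}" unfolding N_def by auto
    obtain b where b: "bij_betw b {..N} E" using ex_bij_betw_nat_finite[OF finE] unfolding N by blast
    define x where "x c = (\<Sum>l\<le>N. tensor_scale (c l) (b l))" for c
    have bV: "b l \<in> ?V" if "l \<le> N" for l using bij_betwE[OF b] that E(1) by auto
    have xV: "x c \<in> ?V" for c
      unfolding x_def
      by (intro tensor_vs.subspace_sum[OF subspace_linear_Jacobi_space] tensor_vs.subspace_scale[OF subspace_linear_Jacobi_space] bV) simp
    have x0: "\<forall>l\<le>N. c l = 0" if c: "x c = 0" for c
    proof -
      define u where "u v = c (inv_into {..N} b v)" for v
      have u: "u (b l) = c l" if "l \<le> N" for l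
        unfolding u_def using that bij_betw_inv_into_left[OF b, of l] by simp
      have "(\<Sum>v\<in>E. tensor_scale (u v) v) = (\<Sum>l\<le>N. tensor_scale (u (b l)) (b l))"
        by (rule sum.reindex_bij_betw[OF b, symmetric])
      also have "\<dots> = 0" using c unfolding x_def by (simp add: u)
      finally have "\<forall>v\<in>E. u v = 0" using E(2) tensor_vs.dependent_finite[OF finE] by blast
      then show ?thesis using u bij_betwE[OF b] by force
    qed
    have xsurj: "\<exists>c. y = x c" if "y \<in> ?V" for y
    proof -
      have "y \<in> range (\<lambda>u. \<Sum>v\<in>E. tensor_scale (u v) v)"
        using subsetD[OF E(3) that] unfolding tensor_vs.span_finite[OF finE] .
      then obtain u where "y = (\<Sum>v\<in>E. tensor_scale (u v) v)" by (rule rangeE)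
      also have "\<dots> = (\<Sum>l\<le>N. tensor_scale (u (b l)) (b l))" by (rule sum.reindex_bij_betw[OF b, symmetric])
      finally show ?thesis unfolding x_def by (intro exI[of _ "\<lambda>l. u (b l)"]) simp
    qed
    have mc: "mat_combination n N (\<lambda>l. spread_mat n (b l)) c = spread_mat n (x c)" for c
    proof (rule eq_matI)
      have "derange \<sigma> (x c) = (\<Sum>l\<le>N. tensor_scale (c l) (derange \<sigma> (b l)))" for \<sigma>
        by (simp only: x_def derange_hom(7) derange_scale)
      then show "mat_combination n N (\<lambda>l. spread_mat n (b l)) c $$ (i, j) = spread_mat n (x c) $$ (i, j)"
        if "i < dim_row (spread_mat n (x c))" "j < dim_col (spread_mat n (x c))" for i j
        using that by (simp add: mat_combination_def spread_mat_def)
    qed (simp_all add: mat_combination_def spread_mat_def)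
    have hx: "hom_map N 1 x" unfolding x_def[abs_def] by (intro hom_map_sum hom_map_variable) simp
    have hs: "hom_map N 1 (\<lambda>c. derange \<sigma> (x c))" for \<sigma> by (rule hom_map_derange[OF hx])
    have hm: "hom_map N (1 + 1) (\<lambda>c. minor_defect n (x c))"
      unfolding minor_defect_def by (intro hom_map_diff hom_map_mult hs)
    have ha: "hom_map N (n + n) (\<lambda>c. abel_defect n i j (x c))" if ij: "i < n" "j < n" for i j
    proof -
      have "hom_map N (n + n - 1) (\<lambda>c. Jacobi_factor n (spread_mat n (x c)))"
        by (rule hom_map_Jacobi_factor[OF n2]) (simp add: spread_mat_def hs[unfolded One_nat_def])
      from hom_map_mult[OF this hom_map_derange[OF hs]]
      have "hom_map N (n + n) (\<lambda>c. Jacobi_factor n (spread_mat n (x c)) * derange uminus (derange (spread n i j) (x c)))"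
        using n2 by simp
      then show ?thesis unfolding abel_defect_def
        by (intro hom_map_diff hom_map_abelf hs hom_map_derange[OF hs])
    qed
    define D where "D = insert (\<lambda>c. minor_defect n (x c)) {\<lambda>c. abel_defect n i j (x c) | i j. i < n \<and> j < n}"
    \<comment> \<open>A tensor vanishes exactly when all its values at points do, so every defect
      yields one scalar equation for each point.\<close>
    define F where "F = {p. homogeneous_mpoly N p \<and>
      (\<exists>\<Phi> f. (\<forall>l. \<Phi> l \<in> points) \<and> f \<in> D \<and> (\<forall>c. mpoly_eval c p = teval \<Phi> (f c)))}"
    have F: "(\<forall>p\<in>F. mpoly_eval c p = 0) \<longleftrightarrow> minor_defect n (x c) = 0 \<and> (\<forall>i<n. \<forall>j<n. abel_defect n i j (x c) = 0)" for c
    proof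
      assume a: "\<forall>p\<in>F. mpoly_eval c p = 0"
      have "f c = 0" if f: "f \<in> D" for f
      proof (rule tensor_eqI)
        fix \<Phi> :: "int \<Rightarrow> 'a \<Rightarrow> 'a base" assume \<Phi>: "\<And>l. \<Phi> l \<in> points"
        note h = alg_hom_family_points[of \<Phi>, OF \<Phi>]
        have "\<exists>d. hom_map N d f" using f hm ha unfolding D_def by blast
        then obtain d where "hom_map N d f" ..
        then obtain p where "homogeneous_mpoly N p" "\<forall>c. mpoly_eval c p = teval \<Phi> (f c)"
          using hom_map_mpoly[OF h points_simps(3)[OF \<Phi>]] by blast
        moreover from this have "p \<in> F" unfolding F_def using \<Phi> f by blast
        ultimately show "teval \<Phi> (f c) = teval \<Phi> 0" using a teval_0[OF h] by metis
      qed
      then show "minor_defect n (x c) = 0 \<and> (\<forall>i<n. \<forall>j<n. abel_defect n i j (x c) = 0)" unfolding D_def by blast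
    next
      assume "minor_defect n (x c) = 0 \<and> (\<forall>i<n. \<forall>j<n. abel_defect n i j (x c) = 0)"
      then have "f c = 0" if "f \<in> D" for f using that unfolding D_def by auto
      then show "\<forall>p\<in>F. mpoly_eval c p = 0"
        unfolding F_def using teval_0 alg_hom_family_points by force
    qed
    have nz: "x c \<noteq> 0 \<longleftrightarrow> (\<exists>l\<le>N. c l \<noteq> 0)" for c
    proof
      assume "x c \<noteq> 0"
      then show "\<exists>l\<le>N. c l \<noteq> 0" unfolding x_def by (metis (no_types, lifting) atMost_iff mult_zero_left sum.neutral tensor_scalar_0)
    qed (use x0 in blast)
    have Jac: "Z \<in> Jacobi_matrices n L \<longleftrightarrow> (\<exists>c. Z = mat_combination n N (\<lambda>l. spread_mat n (b l)) c \<and>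
        (\<exists>l\<le>N. c l \<noteq> 0) \<and> (\<forall>p\<in>F. mpoly_eval c p = 0))" for Z
      unfolding Jacobi_matrices_iff[OF n2] mc F nz[symmetric] using xsurj xV by metis
    have "Jacobi_matrices n L // k_proportionality n =
        {k_proportionality n `` {mat_combination n N (\<lambda>l. spread_mat n (b l)) c} |c.
          (\<exists>l\<le>N. c l \<noteq> 0) \<and> (\<forall>p\<in>F. mpoly_eval c p = 0)}"
      by (rule quotient_parametrized[OF Jac])
    \<comment> \<open>Independence of the basis matrices is read off the entry (0, 1), which is
      \<open>x c\<close> itself.\<close>
    moreover have "\<forall>l\<le>N. c l = 0" if "mat_combination n N (\<lambda>l. spread_mat n (b l)) c = 0\<^sub>m n n" for c
    proof (rule x0)
      have "spread_mat n (x c) $$ (0, 1) = 0" using that n2 unfolding mc by simp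
      then show "x c = 0" using xV[of c] n2 by (simp add: spread_mat_def linear_Jacobi_space_def)
    qed
    moreover have "\<forall>p\<in>F. homogeneous_mpoly N p" unfolding F_def by blast
    moreover have "\<forall>l\<le>N. spread_mat n (b l) \<in> carrier_mat n n" by (simp add: spread_mat_def)
    ultimately show ?thesis unfolding is_projective_variety_def
      by (intro exI[of _ N] exI[of _ "\<lambda>l. spread_mat n (b l)"] exI[of _ F] conjI allI[of "\<lambda>c. _ c \<longrightarrow> _ c"] impI) simp_all
  qed
qed

end

theorem theorem3p7p6:
  fixes n :: nat and L :: "'a::k_domain set"
  assumes "is_type n L"
  shows "is_projective_variety n (Jacobi_matrices n L // k_proportionality n) \<and>
    (\<forall>X \<in> Segre_matrices n L. abel_map n X \<in> Jacobi_matrices n L) \<and>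
    bij_betw (\<lambda>C. k_proportionality n `` (abel_map n ` C))
      (Segre_matrices n L // Segre_equivalence n L)
      (Jacobi_matrices n L // k_proportionality n)"
proof -
  have n2: "n \<ge> 2" and fg: "\<exists>S::'a set. finite S \<and> subring_generated (base_field \<union> S) = UNIV"
    and L: "base_vs.subspace L" using assms by (auto simp: is_type_def)
  obtain B where B: "finite B" "base_vs.span B = L" using assms by (auto simp: is_type_def)
  interpret fg_domain "TYPE('a)" by unfold_locales (rule fg)
  have "abel_map n X \<in> Jacobi_matrices n L" if "X \<in> Segre_matrices n L" for X
  proof -
    interpret segre "TYPE('a)" n L X by unfold_locales (use n2 base_vs.subspace_0[OF L] that in auto)
    show ?thesis by (rule abel_map_Jacobi)
  qed
  then show ?thesis using Jacobi_projective_variety[OF n2 B] abel_map_bij_betw[OF n2 L] by blast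
qed

end
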